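(* For each integer $k \geq 1$, there is a finite set $V_k$ of permutations such that a permutation $w$ is $k$-vexillary if and only if $w$ avoids all patterns in $V_k$.
   Context: Permutations are elements of $S_\infty=\bigcup_{n\ge 0} S_n$, written in one-line notation. For a sequence $x=x(1)\cdots x(m)$ of distinct integers, $\mathrm{fl}(x)$ is the unique $v\in S_m$ with $v(i)<v(j)$ iff $x(i)<x(j)$. A permutation $w$ contains $v\in S_m$ as a pattern if there are $i_1<\cdots<i_m$ with $\mathrm{fl}(w(i_1)\cdots w(i_m))=v$; otherwise $w$ avoids $v$. Let $s_i=(i\ i{+}1)$, and let $\mathrm{Red}(w)$ be the set of reduced words of $w$: minimal-length sequences $(a_1,\dots,a_{\ell})$ with $s_{a_1}\cdots s_{a_{\ell}}=w$ (right multiplication by $s_i$ swaps the entries in positions $i$ and $i+1$). $\mathcal{EG}(w)$ is the set of semistandard Young tableaux (English notation) whose column word, obtained by reading each column from bottom to top, starting with the leftmost column and moving right, is a reduced word of $w$. Put $EG(w)=|\mathcal{EG}(w)|$. A permutation $w$ is $k$-vexillary if $EG(w)\le k$. *)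

theory Defs
  imports "HOL-Combinatorics.Permutations"
begin

text \<open>
  \<open>S n\<close> consists of the permutations of \<open>\<nat>\<close> that fix everything outside \<open>{1..n}\<close>; in
  particular \<open>0\<close> is always fixed, and \<open>S n \<subseteq> S (Suc n)\<close>.
\<close>

definition S :: "nat \<Rightarrow> (nat \<Rightarrow> nat) set" where
  "S n = {w. w permutes {1..n}}"

definition S_infty :: "(nat \<Rightarrow> nat) set" where
  "S_infty = (\<Union>n. S n)"


section \<open>Patterns\<close>

text \<open>
  A sequence \<open>x(1) \<dots> x(m)\<close> is a function of which only the values on \<open>{1..m}\<close> matter.
  For distinct values the description is unique, see \<open>fl_eq_iff\<close> below.
\<close>

definition fl :: "nat \<Rightarrow> (nat \<Rightarrow> 'a::linorder) \<Rightarrow> nat \<Rightarrow> nat" where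
  "fl m x = (THE v. v \<in> S m \<and> (\<forall>i\<in>{1..m}. \<forall>j\<in>{1..m}. v i < v j \<longleftrightarrow> x i < x j))"

text \<open>
  An element of \<open>S_infty\<close> lies in \<open>S m\<close> for many \<open>m\<close>. The choice of \<open>m\<close> is irrelevant here:
  as \<open>w\<close> fixes all large positions, an occurrence of \<open>v \<in> S m\<close> in \<open>w\<close> can be extended by a
  large fixed point of \<open>w\<close> to an occurrence of \<open>v \<in> S (Suc m)\<close>, and conversely restricted.
\<close>

definition contains_pattern :: "(nat \<Rightarrow> nat) \<Rightarrow> (nat \<Rightarrow> nat) \<Rightarrow> bool" where
  "contains_pattern w v \<longleftrightarrow>
     (\<exists>m i. v \<in> S m \<and> strict_mono_on {1..m} i \<and> (\<forall>j\<in>{1..m}. 1 \<le> i j) \<and>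
        fl m (\<lambda>j. w (i j)) = v)"

definition avoids_pattern :: "(nat \<Rightarrow> nat) \<Rightarrow> (nat \<Rightarrow> nat) \<Rightarrow> bool" where
  "avoids_pattern w v \<longleftrightarrow> \<not> contains_pattern w v"


section \<open>Reduced words\<close>

definition simple_refl :: "nat \<Rightarrow> nat \<Rightarrow> nat" where
  "simple_refl i = Transposition.transpose i (i + 1)"

fun word_prod :: "nat list \<Rightarrow> nat \<Rightarrow> nat" where
  "word_prod [] = id"
| "word_prod (a # as) = simple_refl a \<circ> word_prod as"

definition words :: "(nat \<Rightarrow> nat) \<Rightarrow> nat list set" where
  "words w = {as. (\<forall>a\<in>set as. 1 \<le> a) \<and> word_prod as = w}"

definition Red :: "(nat \<Rightarrow> nat) \<Rightarrow> nat list set" where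
  "Red w = {as \<in> words w. \<forall>bs \<in> words w. length as \<le> length bs}"


section \<open>Tableaux\<close>

text \<open>
  A tableau in English notation is the list of its rows, from top to bottom. Empty rows are
  excluded, so that a tableau has exactly one representation; the empty tableau is \<open>[]\<close>.
\<close>

definition semistandard :: "nat list list \<Rightarrow> bool" where
  "semistandard T \<longleftrightarrow>
     (\<forall>r\<in>set T. r \<noteq> [] \<and> sorted r \<and> (\<forall>a\<in>set r. 1 \<le> a)) \<and>
     (\<forall>i. Suc i < length T \<longrightarrow>
        length (T ! Suc i) \<le> length (T ! i) \<and>
        (\<forall>j < length (T ! Suc i). T ! i ! j < T ! Suc i ! j))"

text \<open>
  For a tableau, \<open>List.transpose\<close> yields the list of its columns, from left to right, each
  read from top to bottom.
\<close>

definition column_word :: "nat list list \<Rightarrow> nat list" where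
  "column_word T = concat (map rev (List.transpose T))"

definition EG_tableaux :: "(nat \<Rightarrow> nat) \<Rightarrow> nat list list set" where
  "EG_tableaux w = {T. semistandard T \<and> column_word T \<in> Red w}"

text \<open>
  \<open>EG_tableaux w\<close> is finite for \<open>w \<in> S_infty\<close>, since reduced words of \<open>w \<in> S n\<close> have a fixed
  length and only use letters below \<open>n\<close>.
\<close>

definition EG :: "(nat \<Rightarrow> nat) \<Rightarrow> nat" where
  "EG w = card (EG_tableaux w)"

definition k_vexillary :: "nat \<Rightarrow> (nat \<Rightarrow> nat) \<Rightarrow> bool" where
  "k_vexillary k w \<longleftrightarrow> EG w \<le> k"


section \<open>Flattening is well defined\<close>

lemma order_pattern_unique:
  assumes v: "v \<in> S m" and u: "u \<in> S m"
    and eq: "\<forall>i\<in>{1..m}. \<forall>j\<in>{1..m}. v i < v j \<longleftrightarrow> u i < u j"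
  shows "v = u"
proof
  fix i
  have card: "card {j\<in>{1..m}. p j < p i} = p i - 1" if "p \<in> S m" "i \<in> {1..m}" for p
  proof -
    have p: "p permutes {1..m}" using that by (simp add: S_def)
    have "p ` {j\<in>{1..m}. p j < p i} = {a\<in>p ` {1..m}. a < p i}" by auto
    also have "\<dots> = {1..<p i}"
      using permutes_in_image[OF p, of i] that unfolding permutes_image[OF p] by auto
    finally have "card (p ` {j\<in>{1..m}. p j < p i}) = p i - 1" by simp
    moreover have "inj_on p {j\<in>{1..m}. p j < p i}"
      using permutes_inj_on[OF p] by blast
    ultimately show ?thesis by (simp add: card_image)
  qed
  show "v i = u i"
  proof (cases "i \<in> {1..m}")
    case True
    then have "{j\<in>{1..m}. v j < v i} = {j\<in>{1..m}. u j < u i}" using eq by blast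
    then have "v i - 1 = u i - 1" using card[OF v True] card[OF u True] by simp
    moreover have "v i \<in> {1..m}" "u i \<in> {1..m}"
      using True permutes_in_image[of v "{1..m}" i] permutes_in_image[of u "{1..m}" i] u v
      unfolding S_def by simp_all
    ultimately show ?thesis by auto
  next
    case False
    then show ?thesis using u v by (simp add: S_def permutes_def)
  qed
qed

lemma order_pattern_exists:
  fixes x :: "nat \<Rightarrow> 'a::linorder"
  assumes inj: "inj_on x {1..m}"
  shows "\<exists>v\<in>S m. \<forall>i\<in>{1..m}. \<forall>j\<in>{1..m}. v i < v j \<longleftrightarrow> x i < x j"
proof -
  define r where "r i = card {j\<in>{1..m}. x j \<le> x i}" for i
  define v where "v i = (if i \<in> {1..m} then r i else i)" for i
  have r_less: "r i < r j" if "i \<in> {1..m}" "j \<in> {1..m}" "x i < x j" for i j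
  proof -
    have "{k\<in>{1..m}. x k \<le> x i} \<subseteq> {k\<in>{1..m}. x k \<le> x j}"
      using that(3) by (auto intro: order.trans less_imp_le)
    moreover have "j \<in> {k\<in>{1..m}. x k \<le> x j}" "j \<notin> {k\<in>{1..m}. x k \<le> x i}"
      using that by simp_all
    ultimately have "{k\<in>{1..m}. x k \<le> x i} \<subset> {k\<in>{1..m}. x k \<le> x j}" by blast
    then show ?thesis unfolding r_def by (intro psubset_card_mono) simp_all
  qed
  have iff: "v i < v j \<longleftrightarrow> x i < x j" if "i \<in> {1..m}" "j \<in> {1..m}" for i j
  proof (cases "x i" "x j" rule: linorder_cases)
    case less
    then have "r i < r j" using r_less that by simp
    then show ?thesis using less that by (simp add: v_def)
  next
    case equal
    then have "i = j" using inj_onD[OF inj] that by blast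
    then show ?thesis by simp
  next
    case greater
    then have "r j < r i" using r_less that by simp
    then show ?thesis using greater that by (simp add: v_def)
  qed
  have "inj_on v {1..m}"
  proof (rule inj_onI)
    fix i j assume ij: "i \<in> {1..m}" "j \<in> {1..m}" "v i = v j"
    then have "\<not> x i < x j" "\<not> x j < x i" using iff[of i j] iff[of j i] by simp_all
    then have "x i = x j" by simp
    then show "i = j" using inj_onD[OF inj] ij by blast
  qed
  moreover have "v ` {1..m} \<subseteq> {1..m}"
  proof
    fix a assume "a \<in> v ` {1..m}"
    then obtain i where i: "i \<in> {1..m}" "a = r i" by (auto simp: v_def)
    have "r i \<le> card {1..m}" unfolding r_def by (rule card_mono) auto
    moreover have "r i > 0" unfolding r_def using i by (subst card_gt_0_iff) auto
    ultimately show "a \<in> {1..m}" using i by auto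
  qed
  ultimately have "bij_betw v {1..m} {1..m}"
    by (simp add: bij_betw_def endo_inj_surj)
  then have "v permutes {1..m}" by (rule bij_imp_permutes) (auto simp: v_def)
  then show ?thesis using iff by (auto simp: S_def)
qed

lemma fl_eq_iff:
  fixes x :: "nat \<Rightarrow> 'a::linorder"
  assumes "inj_on x {1..m}"
  shows "fl m x = v \<longleftrightarrow>
    v \<in> S m \<and> (\<forall>i\<in>{1..m}. \<forall>j\<in>{1..m}. v i < v j \<longleftrightarrow> x i < x j)"
proof -
  let ?P = "\<lambda>v. v \<in> S m \<and> (\<forall>i\<in>{1..m}. \<forall>j\<in>{1..m}. v i < v j \<longleftrightarrow> x i < x j)"
  obtain u where u: "?P u" using order_pattern_exists[OF assms] by blast
  have uniq: "v = u" if "?P v" for v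
    using that u order_pattern_unique[of v m u] by simp
  have "fl m x = u" unfolding fl_def by (rule the_equality) (fact u, rule uniq)
  then show ?thesis using u uniq by blast
qed

end

theory Submission
  imports Defs Complex_Main "HOL-Library.Extended_Nat"
begin

text \<open>
  To a finite diagram \<open>D\<close> (a set of boxes, given by row and column) belongs its Specht module: the
  span of the column-antisymmetrised fillings of the tensor positions by the boxes, as a module of
  the symmetric group that permutes the positions. Let \<open>len\<close> be its composition length. For the
  Rothe diagram of \<open>w\<close> the dimension is the number of reduced words of \<open>w\<close> and the length is
  \<open>EG w\<close>. Indeed, a Lascoux-Schuetzenberger transition from \<open>w\<close> to its children moves one column
  and then one row of the diagram, which exhibits the modules of the children as subquotients of
  the module of \<open>w\<close>. The transition formula for reduced words shows by dimension that they are all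
  of it, and the same formula holds for \<open>EG\<close>. At the leaves, the Grassmannian permutations, the
  diagram has nested columns, the module is simple, and \<open>EG\<close> is \<open>1\<close>.

  The lower bound on \<open>len\<close> works for any tree of such row and column moves in any diagram. It uses
  only boxes in the rows and columns involved, so it survives passing to permutations containing
  the corresponding pattern, and \<open>EG\<close> is monotone in patterns. Conversely, if \<open>EG w > k\<close>, the
  transition tree of \<open>w\<close> can be pruned to \<open>k + 1\<close> leaves. This tree involves at most \<open>3 k\<close> rows
  and \<open>3 k\<close> columns, so \<open>w\<close> contains a pattern \<open>v\<close> in \<open>S (6 k)\<close> with \<open>EG v > k\<close>.
\<close>

section \<open>Lengths of function modules\<close>

text \<open>Tensors are real functions on words whose letters are rows. A column move then yields an
  inclusion of modules, and a row move the image under a divided power of a matrix unit of gl.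
  \<open>len\<close> is relative to a set of operators and is the dimension for the empty set, so a
  dimension count that forces two subspaces to coincide also computes composition lengths.

  Neither a basis nor an insertion algorithm is used. The dimension is squeezed between two
  filtrations by the last letter of a word, and both transition formulas sum one signed identity for
  single words, over words or over tableaux.

  Permutations live on all integers because a transition moves a value to the left: with unlimited
  room there, every step has a child.

  Origin of \<open>3 * k\<close>: a tree with \<open>k + 1\<close> leaves and \<open>b\<close>
  branchings, each with at least two children, has \<open>b \<le> k\<close> and \<open>k + b\<close>
  nodes below the root. A branching costs one row and each such node one more, in total
  \<open>k + 2 * b\<close>; the same holds for columns. For \<open>inv w\<close> rows are values of
  \<open>w\<close> and columns are positions, which together single out at most \<open>6 * k\<close>
  positions.\<close>

definition subsp :: "('w \<Rightarrow> real) set \<Rightarrow> bool" where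
  "subsp V \<longleftrightarrow> (\<lambda>_. 0) \<in> V \<and> (\<forall>f\<in>V. \<forall>g\<in>V. \<forall>c. (\<lambda>x. f x + c * g x) \<in> V)"

definition submod :: "(('w \<Rightarrow> real) \<Rightarrow> ('w \<Rightarrow> real)) set \<Rightarrow> ('w \<Rightarrow> real) set \<Rightarrow> bool" where
  "submod G V \<longleftrightarrow> subsp V \<and> (\<forall>g\<in>G. g ` V \<subseteq> V)"

definition lin :: "(('w \<Rightarrow> real) \<Rightarrow> ('v \<Rightarrow> real)) \<Rightarrow> bool" where
  "lin L \<longleftrightarrow> (\<forall>f g c. L (\<lambda>x. f x + c * g x) = (\<lambda>x. L f x + c * L g x))"

lemma subspD:
  assumes "subsp V"
  shows "(\<lambda>_. 0) \<in> V" and "f \<in> V \<Longrightarrow> g \<in> V \<Longrightarrow> (\<lambda>x. f x + c * g x) \<in> V"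
  using assms by (auto simp: subsp_def)

lemma subsp_scale: "subsp V \<Longrightarrow> f \<in> V \<Longrightarrow> (\<lambda>x. c * f x) \<in> V"
  using subspD(2)[of V "\<lambda>_. 0" f c] subspD(1)[of V] by simp

lemma subsp_add: "subsp V \<Longrightarrow> f \<in> V \<Longrightarrow> g \<in> V \<Longrightarrow> (\<lambda>x. f x + g x) \<in> V"
  using subspD(2)[of V f g 1] by simp

lemma subsp_diff: "subsp V \<Longrightarrow> f \<in> V \<Longrightarrow> g \<in> V \<Longrightarrow> (\<lambda>x. f x - g x) \<in> V"
  using subspD(2)[of V f g "-1"] by simp

lemma subsp_sum:
  assumes "subsp V" "finite A" "\<And>a. a \<in> A \<Longrightarrow> h a \<in> V"
  shows "(\<lambda>x. \<Sum>a\<in>A. h a x) \<in> V"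
  using assms(2,3)
proof (induction A rule: finite_induct)
  case empty
  then show ?case using subspD(1)[OF assms(1)] by simp
next
  case (insert a A)
  then show ?case using subsp_add[OF assms(1), of "h a" "\<lambda>x. \<Sum>a\<in>A. h a x"] by simp
qed

lemma lin_comb: "lin L \<Longrightarrow> L (\<lambda>x. f x + c * g x) = (\<lambda>x. L f x + c * L g x)"
  by (simp add: lin_def)

lemma lin_zero: "lin L \<Longrightarrow> L (\<lambda>_. 0) = (\<lambda>_. 0)"
  using lin_comb[of L "\<lambda>_. 0" "-1" "\<lambda>_. 0"] by (simp add: fun_eq_iff)

lemma lin_scale: "lin L \<Longrightarrow> L (\<lambda>x. c * f x) = (\<lambda>x. c * L f x)"
  using lin_comb[of L "\<lambda>_. 0" c f] lin_zero[of L] by simp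

lemma lin_add: "lin L \<Longrightarrow> L (\<lambda>x. f x + g x) = (\<lambda>x. L f x + L g x)"
  using lin_comb[of L f 1 g] by simp

lemma lin_diff: "lin L \<Longrightarrow> L (\<lambda>x. f x - g x) = (\<lambda>x. L f x - L g x)"
  using lin_comb[of L f "-1" g] by simp

lemma lin_sum:
  assumes "lin L" "finite A"
  shows "L (\<lambda>x. \<Sum>a\<in>A. h a x) = (\<lambda>x. \<Sum>a\<in>A. L (h a) x)"
  using assms(2)
proof (induction A rule: finite_induct)
  case empty
  then show ?case using lin_zero[OF assms(1)] by simp
next
  case (insert a A)
  then show ?case using lin_add[OF assms(1), of "h a" "\<lambda>x. \<Sum>a\<in>A. h a x"] by simp
qed

lemma submodI: "subsp V \<Longrightarrow> (\<And>g f. g \<in> G \<Longrightarrow> f \<in> V \<Longrightarrow> g f \<in> V) \<Longrightarrow> submod G V"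
  by (auto simp: submod_def)

lemma submod_subsp: "submod G V \<Longrightarrow> subsp V"
  by (simp add: submod_def)

lemma submodD: "submod G V \<Longrightarrow> g \<in> G \<Longrightarrow> f \<in> V \<Longrightarrow> g f \<in> V"
  by (auto simp: submod_def)

lemma submod_empty_iff: "submod {} V \<longleftrightarrow> subsp V"
  by (simp add: submod_def)

lemma submod_zero: "(\<And>g. g \<in> G \<Longrightarrow> lin g) \<Longrightarrow> submod G {\<lambda>_. 0}"
  by (rule submodI) (auto simp: subsp_def lin_zero)

text \<open>A chain may start at any submodule, not only at zero, so it can be intersected with a
  kernel, mapped or pulled back without adjusting its lower end.\<close>

inductive chain_to :: "(('w \<Rightarrow> real) \<Rightarrow> ('w \<Rightarrow> real)) set \<Rightarrow> ('w \<Rightarrow> real) set \<Rightarrow> nat \<Rightarrow> bool"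
  for G where
  base: "submod G U \<Longrightarrow> chain_to G U 0"
| step: "chain_to G U n \<Longrightarrow> submod G V \<Longrightarrow> U \<subset> V \<Longrightarrow> chain_to G V (Suc n)"

text \<open>The supremum is taken in \<open>enat\<close>, so finiteness of the dimension need not be
  known beforehand. For \<open>G = {}\<close> submodules are subspaces and this is the
  dimension.\<close>

definition len :: "(('w \<Rightarrow> real) \<Rightarrow> ('w \<Rightarrow> real)) set \<Rightarrow> ('w \<Rightarrow> real) set \<Rightarrow> enat" where
  "len G M = (SUP n\<in>{n. \<exists>U\<subseteq>M. chain_to G U n}. enat n)"

lemma chain_to_submod: "chain_to G U n \<Longrightarrow> submod G U"
  by (induction rule: chain_to.induct) auto

lemma chain_to_SucD: "chain_to G U (Suc n) \<Longrightarrow> chain_to G U n"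
proof (induction n arbitrary: U)
  case 0
  then show ?case by (intro chain_to.base chain_to_submod)
next
  case (Suc n)
  from Suc.prems obtain W where "chain_to G W (Suc n)" "submod G U" "W \<subset> U"
    by (cases rule: chain_to.cases) auto
  then show ?case using Suc.IH chain_to.step by blast
qed

lemma chain_to_le: "chain_to G U n \<Longrightarrow> m \<le> n \<Longrightarrow> chain_to G U m"
  by (induction n) (auto simp: le_Suc_eq dest: chain_to_SucD)

lemma len_upper: "chain_to G U n \<Longrightarrow> U \<subseteq> M \<Longrightarrow> enat n \<le> len G M"
  unfolding len_def by (rule SUP_upper) auto

lemma len_least: "(\<And>U n. chain_to G U n \<Longrightarrow> U \<subseteq> M \<Longrightarrow> enat n \<le> b) \<Longrightarrow> len G M \<le> b"
  unfolding len_def by (rule SUP_least) auto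

lemma len_mono: "M \<subseteq> M' \<Longrightarrow> len G M \<le> len G M'"
  by (rule len_least) (blast intro: len_upper)

text \<open>Initial segments of chains are chains, so every finite number below the supremum is
  attained; the zero submodule provides the chain for \<open>n = 0\<close>.\<close>

lemma len_ge_chain:
  assumes "enat n \<le> len G M" "submod G {\<lambda>_. 0}" "(\<lambda>_. 0) \<in> M"
  shows "\<exists>U\<subseteq>M. chain_to G U n"
proof (rule ccontr)
  assume neg: "\<not> ?thesis"
  then have "n \<noteq> 0" using chain_to.base[OF assms(2)] assms(3) by (metis empty_subsetI insert_subset)
  moreover have "len G M \<le> enat (n - 1)"
  proof (rule len_least)
    fix U m assume U: "chain_to G U m" "U \<subseteq> M"
    then have "\<not> n \<le> m" using neg chain_to_le by blast
    then show "enat m \<le> enat (n - 1)" by simp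
  qed
  ultimately show False using assms(1) by (metis One_nat_def diff_less dual_order.trans
        enat_ord_simps(1) leD less_numeral_extra(1) neq0_conv)
qed

lemma len_strict:
  assumes "submod G M" "submod G M'" "M \<subset> M'"
  shows "len G M + 1 \<le> len G M'"
proof -
  have ge: "enat n + 1 \<le> len G M'" if "chain_to G U n" "U \<subseteq> M" for U n
  proof -
    have "chain_to G M' (Suc n)"
      using assms that by (meson chain_to.step subset_psubset_trans)
    then have "enat (Suc n) \<le> len G M'" by (rule len_upper) simp
    then show ?thesis by (simp add: one_enat_def)
  qed
  have one: "1 \<le> len G M'"
    using ge[of M 0] chain_to.base[OF assms(1)] by (simp add: zero_enat_def[symmetric])
  have "len G M \<le> len G M' - 1"
  proof (rule len_least)
    fix U n assume "chain_to G U n" "U \<subseteq> M"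
    then have "enat n + 1 \<le> len G M'" by (rule ge)
    then show "enat n \<le> len G M' - 1" by (cases "len G M'") (auto simp: one_enat_def)
  qed
  then show ?thesis using one
    by (cases "len G M'"; cases "len G M") (auto simp: one_enat_def)
qed

section \<open>Equivariant maps and additivity of length\<close>

definition equivar :: "(('w \<Rightarrow> real) \<Rightarrow> ('w \<Rightarrow> real)) set \<Rightarrow> (('w \<Rightarrow> real) \<Rightarrow> ('w \<Rightarrow> real)) \<Rightarrow> bool" where
  "equivar G L \<longleftrightarrow> lin L \<and> (\<forall>g\<in>G. \<forall>f. L (g f) = g (L f))"

lemma equivar_lin: "equivar G L \<Longrightarrow> lin L"
  by (simp add: equivar_def)

lemma equivar_empty: "lin L \<Longrightarrow> equivar {} L"
  by (simp add: equivar_def)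

abbreviation kernel :: "(('w \<Rightarrow> real) \<Rightarrow> ('v \<Rightarrow> real)) \<Rightarrow> ('w \<Rightarrow> real) set" where
  "kernel L \<equiv> {f. L f = (\<lambda>_. 0)}"

lemma submod_image:
  assumes "equivar G L" "submod G U"
  shows "submod G (L ` U)"
proof (rule submodI)
  have L: "lin L" using assms(1) by (rule equivar_lin)
  note U = submod_subsp[OF assms(2)]
  show "subsp (L ` U)"
    unfolding subsp_def
    using subspD[OF U] lin_zero[OF L] by (auto simp: lin_comb[OF L, symmetric] image_iff) metis+
  show "g f \<in> L ` U" if "g \<in> G" "f \<in> L ` U" for g f
  proof -
    obtain h where h: "h \<in> U" "f = L h" using \<open>f \<in> L ` U\<close> by blast
    have "g f = L (g h)" using assms(1) h(2) that(1) by (simp add: equivar_def)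
    then show ?thesis using submodD[OF assms(2) that(1) h(1)] by blast
  qed
qed

lemma submod_preimage:
  assumes "equivar G L" "submod G M" "submod G W"
  shows "submod G {f\<in>M. L f \<in> W}"
proof (rule submodI)
  have L: "lin L" using assms(1) by (rule equivar_lin)
  note M = subspD[OF submod_subsp[OF assms(2)]] and W = subspD[OF submod_subsp[OF assms(3)]]
  show "subsp {f\<in>M. L f \<in> W}"
    unfolding subsp_def using M W by (auto simp: lin_comb[OF L] lin_zero[OF L])
  show "g f \<in> {f\<in>M. L f \<in> W}" if "g \<in> G" "f \<in> {f\<in>M. L f \<in> W}" for g f
    using that submodD[OF assms(2) that(1)] submodD[OF assms(3) that(1)] assms(1)
    by (auto simp: equivar_def)
qed

lemma submod_kernel:
  assumes "equivar G L" "submod G M" "\<And>g. g \<in> G \<Longrightarrow> lin g"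
  shows "submod G (M \<inter> kernel L)"
proof -
  have "M \<inter> kernel L = {f\<in>M. L f \<in> {\<lambda>_. 0}}" by auto
  then show ?thesis using submod_preimage[OF assms(1,2) submod_zero[of G]] assms(3) by simp
qed

text \<open>Rank-nullity for lengths. A chain splits into its intersections with the kernel and its
  images, and a strict step stays strict in at least one of the two. Conversely, preimages of a
  chain in the image can be stacked on a chain in the kernel.\<close>

lemma len_exact:
  assumes eq: "equivar G L" and M: "submod G M" and G: "\<And>g. g \<in> G \<Longrightarrow> lin g"
  shows "len G M = len G (M \<inter> kernel L) + len G (L ` M)"
proof (rule antisym)
  have L: "lin L" using eq by (rule equivar_lin)
  have split: "\<exists>a b. n \<le> a + b \<and> chain_to G (U \<inter> kernel L) a \<and> chain_to G (L ` U) b"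
    if "chain_to G U n" for U n
    using that
  proof (induction rule: chain_to.induct)
    case (base U)
    then show ?case
      using submod_kernel[OF eq _ G] submod_image[OF eq] by (blast intro: chain_to.base)
  next
    case (step U n V)
    obtain a b where ab: "n \<le> a + b" "chain_to G (U \<inter> kernel L) a" "chain_to G (L ` U) b"
      using step.IH by blast
    note V = submod_subsp[OF \<open>submod G V\<close>] and U = submod_subsp[OF chain_to_submod[OF step.hyps(1)]]
    have sK: "submod G (V \<inter> kernel L)" and sI: "submod G (L ` V)"
      using step.hyps submod_kernel[OF eq _ G] submod_image[OF eq] by blast+
    show ?case
    proof (cases "U \<inter> kernel L = V \<inter> kernel L")
      case False
      then have "chain_to G (V \<inter> kernel L) (Suc a)"
        using ab(2) sK step.hyps(3) by (intro chain_to.step[of G "U \<inter> kernel L"]) auto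
      moreover have "chain_to G (L ` V) b"
      proof (cases "L ` U = L ` V")
        case True
        then show ?thesis using ab(3) by simp
      next
        case False
        then have "chain_to G (L ` V) (Suc b)"
          using ab(3) sI step.hyps(3) by (intro chain_to.step[of G "L ` U"]) auto
        then show ?thesis by (rule chain_to_SucD)
      qed
      ultimately show ?thesis using ab(1) by (intro exI[of _ "Suc a"] exI[of _ b]) auto
    next
      case True
      \<comment> \<open>If kernel parts and images both agreed, an element of \<open>V\<close> would
        differ from an element of \<open>U\<close> by a kernel element of \<open>V\<close>, which
        lies in \<open>U\<close>.\<close>
      have "L ` U \<noteq> L ` V"
      proof
        assume im: "L ` U = L ` V"
        have "V \<subseteq> U"
        proof
          fix f assume f: "f \<in> V"
          then obtain h where h: "h \<in> U" "L f = L h" using im by blast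
          then have "(\<lambda>x. f x - h x) \<in> V \<inter> kernel L"
            using subsp_diff[OF V f, of h] step.hyps(3) by (auto simp: lin_diff[OF L])
          then have "(\<lambda>x. f x - h x) \<in> U" using True by blast
          from subsp_add[OF U h(1) this] show "f \<in> U" by simp
        qed
        then show False using step.hyps(3) by blast
      qed
      then have "chain_to G (L ` V) (Suc b)"
        using ab(3) sI step.hyps(3) by (intro chain_to.step[of G "L ` U"]) auto
      then show ?thesis using ab True by (intro exI[of _ a] exI[of _ "Suc b"]) auto
    qed
  qed
  show "len G M \<le> len G (M \<inter> kernel L) + len G (L ` M)"
  proof (rule len_least)
    fix U n assume U: "chain_to G U n" "U \<subseteq> M"
    obtain a b where ab: "n \<le> a + b" "chain_to G (U \<inter> kernel L) a" "chain_to G (L ` U) b"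
      using split[OF U(1)] by blast
    have "enat a \<le> len G (M \<inter> kernel L)" "enat b \<le> len G (L ` M)"
      using U(2) by (auto intro!: len_upper[OF ab(2)] len_upper[OF ab(3)])
    then have "enat a + enat b \<le> len G (M \<inter> kernel L) + len G (L ` M)" by (rule add_mono)
    moreover have "enat n \<le> enat a + enat b" using ab(1) by simp
    ultimately show "enat n \<le> len G (M \<inter> kernel L) + len G (L ` M)" by (rule order.trans[rotated])
  qed
  \<comment> \<open>The preimage of the lowest member of \<open>B\<close> contains \<open>A\<close>.
    Whether or not the two coincide, a chain of length \<open>a\<close> ends at that
    preimage.\<close>
  have join: "\<exists>U\<subseteq>M. chain_to G U (a + b)" if A: "chain_to G A a" "A \<subseteq> M \<inter> kernel L"
    and B: "chain_to G B b" "B \<subseteq> L ` M" for A B a b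
  proof -
    have "B \<subseteq> L ` M \<Longrightarrow> chain_to G {f\<in>M. L f \<in> B} (a + b)"
      using B(1)
    proof (induction rule: chain_to.induct)
      case (base B)
      have s: "submod G {f\<in>M. L f \<in> B}" using submod_preimage[OF eq M] base by blast
      have "A \<subseteq> {f\<in>M. L f \<in> B}"
        using A(2) subspD(1)[OF submod_subsp[OF base(1)]] by auto
      then show ?case
        using A(1) s chain_to.step[OF A(1) s] chain_to_SucD by (cases "A = {f\<in>M. L f \<in> B}") auto
    next
      case (step B b B')
      have "chain_to G {f\<in>M. L f \<in> B} (a + b)" using step by blast
      moreover have "submod G {f\<in>M. L f \<in> B'}" using submod_preimage[OF eq M] step by blast
      moreover have "{f\<in>M. L f \<in> B} \<subset> {f\<in>M. L f \<in> B'}" using step.hyps(3) step.prems by blast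
      ultimately show ?case using chain_to.step by fastforce
    qed
    then show ?thesis using B(2) by (intro exI[of _ "{f\<in>M. L f \<in> B}"]) auto
  qed
  have z0: "submod G {\<lambda>_. 0}" using submod_zero[of G] G by blast
  have zK: "(\<lambda>_. 0) \<in> M \<inter> kernel L" and zI: "(\<lambda>_. 0) \<in> L ` M"
    using subspD(1)[OF submod_subsp[OF M]] lin_zero[OF L] imageI[of "\<lambda>_. 0" M L] by simp_all
  have "enat a + enat b \<le> len G M"
    if a: "enat a \<le> len G (M \<inter> kernel L)" and b: "enat b \<le> len G (L ` M)" for a b
  proof -
    obtain A where A: "A \<subseteq> M \<inter> kernel L" "chain_to G A a" using len_ge_chain[OF a z0 zK] by blast
    obtain B where B: "B \<subseteq> L ` M" "chain_to G B b" using len_ge_chain[OF b z0 zI] by blast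
    obtain U where "U \<subseteq> M" "chain_to G U (a + b)" using join[OF A(2,1) B(2,1)] by blast
    then show ?thesis using len_upper[of G U "a + b" M] by simp
  qed
  note ab = this
  show "len G (M \<inter> kernel L) + len G (L ` M) \<le> len G M"
  proof (cases "len G M")
    case (enat m)
    \<comment> \<open>A bound on all finite numbers below \<open>x\<close> also excludes that
      \<open>x\<close> is infinite.\<close>
    have fin: "x \<le> enat m" if "\<And>a. enat a \<le> x \<Longrightarrow> a \<le> m" for x
    proof (cases x)
      case infinity
      then show ?thesis using that[of "Suc m"] by simp
    qed (use that in simp)
    have "len G (M \<inter> kernel L) \<le> enat m" "len G (L ` M) \<le> enat m"
      using ab[of _ 0] ab[of 0] enat by (auto intro!: fin simp: zero_enat_def[symmetric])
    then obtain a b where "len G (M \<inter> kernel L) = enat a" "len G (L ` M) = enat b"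
      by (metis enat_ile)
    then show ?thesis using ab[of a b] by simp
  qed simp
qed

lemma len_zero: "len G {\<lambda>_. 0} = 0"
proof -
  have "len G {\<lambda>_. 0} \<le> 0"
  proof (rule len_least)
    fix U n assume "chain_to G U n" "U \<subseteq> {\<lambda>_. 0}"
    then show "enat n \<le> 0"
    proof (cases rule: chain_to.cases)
      case (step W m)
      then have "W = {}" using \<open>U \<subseteq> {\<lambda>_. 0}\<close> by blast
      then show ?thesis using chain_to_submod[OF step(2)] by (auto simp: submod_def subsp_def)
    qed (simp add: zero_enat_def)
  qed
  then show ?thesis by simp
qed

section \<open>Sums of submodules and filtrations\<close>

fun sum_space :: "('w \<Rightarrow> real) set list \<Rightarrow> ('w \<Rightarrow> real) set" where
  "sum_space [] = {\<lambda>_. 0}"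
| "sum_space (N # Ns) = {\<lambda>x. f x + g x |f g. f \<in> N \<and> g \<in> sum_space Ns}"

lemma sum_spaceI:
  "f \<in> N \<Longrightarrow> g \<in> sum_space Ns \<Longrightarrow> (\<lambda>x. f x + g x) \<in> sum_space (N # Ns)"
  by auto

lemma sum_space_submod:
  assumes "\<And>N. N \<in> set Ns \<Longrightarrow> submod G N" "\<And>g. g \<in> G \<Longrightarrow> lin g"
  shows "submod G (sum_space Ns)"
  using assms(1)
proof (induction Ns)
  case Nil
  then show ?case using submod_zero assms(2) by simp blast
next
  case (Cons N Ns)
  have N: "submod G N" and S: "submod G (sum_space Ns)" using Cons by auto
  note N' = subspD[OF submod_subsp[OF N]] and S' = subspD[OF submod_subsp[OF S]]
  show ?case
  proof (rule submodI)
    show "subsp (sum_space (N # Ns))"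
      unfolding subsp_def
    proof (intro conjI ballI allI)
      show "(\<lambda>_. 0) \<in> sum_space (N # Ns)" using N'(1) S'(1) by force
    next
      fix f g c assume "f \<in> sum_space (N # Ns)" "g \<in> sum_space (N # Ns)"
      then obtain f1 f2 g1 g2 where *: "f1 \<in> N" "f2 \<in> sum_space Ns" "g1 \<in> N" "g2 \<in> sum_space Ns"
        and fg: "f = (\<lambda>x. f1 x + f2 x)" "g = (\<lambda>x. g1 x + g2 x)" by auto
      have "(\<lambda>x. f x + c * g x) = (\<lambda>x. (f1 x + c * g1 x) + (f2 x + c * g2 x))"
        using fg by (simp add: algebra_simps)
      then show "(\<lambda>x. f x + c * g x) \<in> sum_space (N # Ns)"
        by (metis (no_types) sum_spaceI[OF N'(2)[OF *(1,3)] S'(2)[OF *(2,4)]])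
    qed
    fix g f assume g: "g \<in> G" "f \<in> sum_space (N # Ns)"
    then obtain f1 f2 where *: "f1 \<in> N" "f2 \<in> sum_space Ns" "f = (\<lambda>x. f1 x + f2 x)" by auto
    then have "g f = (\<lambda>x. g f1 x + g f2 x)" using lin_add assms(2) g(1) by blast
    then show "g f \<in> sum_space (N # Ns)"
      using submodD[OF N g(1) *(1)] submodD[OF S g(1) *(2)] by auto
  qed
qed

lemma sum_space_subset:
  assumes "subsp M" "\<And>N. N \<in> set Ns \<Longrightarrow> N \<subseteq> M"
  shows "sum_space Ns \<subseteq> M"
  using assms(2)
proof (induction Ns)
  case Nil
  then show ?case using subspD(1)[OF assms(1)] by simp
next
  case (Cons N Ns)
  have "N \<subseteq> M" "sum_space Ns \<subseteq> M" using Cons by simp_all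
  then show ?case using subsp_add[OF assms(1)] by auto
qed

text \<open>
  Filtrations are obtained from families of submodules and maps that are triangular with
  respect to each other.
\<close>

definition triangular :: "(('w \<Rightarrow> real) \<Rightarrow> ('w \<Rightarrow> real)) set \<Rightarrow>
    (('w \<Rightarrow> real) set \<times> (('w \<Rightarrow> real) \<Rightarrow> ('w \<Rightarrow> real)) \<times> ('w \<Rightarrow> real) set) list \<Rightarrow> bool" where
  "triangular G Ts \<longleftrightarrow>
     (\<forall>(N, L, Q)\<in>set Ts. submod G N \<and> equivar G L \<and> L ` N = Q) \<and>
     sorted_wrt (\<lambda>(_, L, _) (N, _, _). N \<subseteq> kernel L) Ts"

text \<open>The first map kills all later submodules, so on the whole sum it still has image
  \<open>Q\<close>, and its kernel contains the sum of the later ones. Additivity of length then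
  turns this into an induction step for both bounds.\<close>

lemma triangular_step:
  assumes T: "triangular G ((N, L, Q) # Ts)" and G: "\<And>g. g \<in> G \<Longrightarrow> lin g"
  defines "S1 \<equiv> sum_space (map fst ((N, L, Q) # Ts))" and "S2 \<equiv> sum_space (map fst Ts)"
  shows "len G S1 = len G (S1 \<inter> kernel L) + len G Q" and "S2 \<subseteq> S1 \<inter> kernel L"
    and "submod G S1" and "submod G S2" and "submod G (S1 \<inter> kernel L)"
proof -
  have L: "equivar G L" and N: "submod G N" and Q: "L ` N = Q"
    using T by (auto simp: triangular_def)
  show S1: "submod G S1" unfolding S1_def
    using T G by (intro sum_space_submod) (auto simp: triangular_def)
  show S2: "submod G S2" unfolding S2_def
    using T G by (intro sum_space_submod) (auto simp: triangular_def)
  show "submod G (S1 \<inter> kernel L)" by (rule submod_kernel[OF L S1 G])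
  have "subsp (kernel L)"
    by (auto simp: subsp_def lin_zero[OF equivar_lin[OF L]] lin_comb[OF equivar_lin[OF L]])
  moreover have "N' \<subseteq> kernel L" if "N' \<in> set (map fst Ts)" for N'
    using T that by (force simp: triangular_def)
  ultimately have K: "S2 \<subseteq> kernel L" unfolding S2_def by (rule sum_space_subset)
  have "L ` S1 = Q"
  proof
    show "L ` S1 \<subseteq> Q"
      using K Q by (auto simp: S1_def S2_def lin_add[OF equivar_lin[OF L]])
    show "Q \<subseteq> L ` S1"
    proof
      fix q assume "q \<in> Q"
      then obtain f where f: "f \<in> N" "q = L f" using Q by blast
      have "(\<lambda>x. f x + (\<lambda>_. 0) x) \<in> S1"
        unfolding S1_def list.map fst_conv
        using f(1) subspD(1)[OF submod_subsp[OF S2]] unfolding S2_def by (intro sum_spaceI)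
      then show "q \<in> L ` S1" using f(2) by auto
    qed
  qed
  then show "len G S1 = len G (S1 \<inter> kernel L) + len G Q" using len_exact[OF L S1 G] by simp
  have "S2 \<subseteq> S1"
  proof
    fix f assume "f \<in> S2"
    then have "(\<lambda>x. (\<lambda>_. 0) x + f x) \<in> S1"
      unfolding S1_def S2_def list.map fst_conv using subspD(1)[OF submod_subsp[OF N]]
      by (intro sum_spaceI)
    then show "f \<in> S1" by simp
  qed
  then show "S2 \<subseteq> S1 \<inter> kernel L" using K by blast
qed

lemma triangular_ConsD: "triangular G (T # Ts) \<Longrightarrow> triangular G Ts"
  by (auto simp: triangular_def)

lemma triangular_empty: "triangular G Ts \<Longrightarrow> triangular {} Ts"
  by (auto simp: triangular_def submod_def equivar_def)

lemma len_sum_space_ge: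
  assumes "triangular G Ts" and G: "\<And>g. g \<in> G \<Longrightarrow> lin g"
  shows "(\<Sum>(N, L, Q)\<leftarrow>Ts. len G Q) \<le> len G (sum_space (map fst Ts))"
  using assms(1)
proof (induction Ts)
  case (Cons T Ts)
  obtain N L Q where T: "T = (N, L, Q)" by (cases T)
  note * = triangular_step[OF Cons.prems[unfolded T] G]
  have "(\<Sum>(N, L, Q)\<leftarrow>Ts. len G Q) \<le> len G (sum_space (map fst Ts))"
    using Cons triangular_ConsD by blast
  also have "\<dots> \<le> len G (sum_space (map fst (T # Ts)) \<inter> kernel L)"
    using *(2) unfolding T by (rule len_mono)
  finally show ?case
    using *(1) unfolding T by (simp add: add.commute add_mono)
qed simp

lemma len_triangular_ge:
  assumes "triangular G Ts" "\<And>g. g \<in> G \<Longrightarrow> lin g" "submod G M"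
    "\<And>N. N \<in> fst ` set Ts \<Longrightarrow> N \<subseteq> M"
  shows "(\<Sum>(N, L, Q)\<leftarrow>Ts. len G Q) \<le> len G M"
  using len_sum_space_ge[OF assms(1,2)]
    len_mono[OF sum_space_subset[OF submod_subsp[OF assms(3)], of "map fst Ts"], of G] assms(4)
  by (metis (no_types, lifting) list.set_map order.trans)

lemma len_finite_eq:
  assumes "submod {} U" "submod {} V" "U \<subseteq> V" "len {} V \<le> len {} U" "len {} U \<noteq> \<infinity>"
  shows "U = V"
proof (rule ccontr)
  assume "U \<noteq> V"
  then have "len {} U + 1 \<le> len {} V" using assms by (intro len_strict) auto
  then show False using assms(4,5) by (cases "len {} U"; cases "len {} V") (auto simp: one_enat_def)
qed

text \<open>The lower bound for dimensions is tight only if at every step the sum of the later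
  submodules is all of the kernel. This is an equality of sets, so the length formula with respect
  to \<open>G\<close> follows from a hypothesis about dimensions alone.\<close>

lemma len_sum_space_eq:
  assumes "triangular G Ts" and G: "\<And>g. g \<in> G \<Longrightarrow> lin g"
    and "len {} (sum_space (map fst Ts)) \<le> (\<Sum>(N, L, Q)\<leftarrow>Ts. len {} Q)"
    and "(\<Sum>(N, L, Q)\<leftarrow>Ts. len {} Q) \<noteq> \<infinity>"
  shows "len G (sum_space (map fst Ts)) = (\<Sum>(N, L, Q)\<leftarrow>Ts. len G Q)"
  using assms(1,3,4)
proof (induction Ts)
  case Nil
  then show ?case by (simp add: len_zero)
next
  case (Cons T Ts)
  obtain N L Q where T: "T = (N, L, Q)" by (cases T)
  let ?S1 = "sum_space (map fst (T # Ts))" and ?S2 = "sum_space (map fst Ts)"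
  note * = triangular_step[OF Cons.prems(1)[unfolded T] G]
  note ** = triangular_step[OF triangular_empty[OF Cons.prems(1)[unfolded T]]]
  have fin: "(\<Sum>(N, L, Q)\<leftarrow>Ts. len {} Q) \<noteq> \<infinity>" "len {} Q \<noteq> \<infinity>"
    using Cons.prems(3) T by (simp_all add: plus_eq_infty_iff_enat del: not_infinity_eq)
  have e: "len {} ?S1 = len {} (?S1 \<inter> kernel L) + len {} Q" using **(1) T by simp
  have le1: "len {} (?S1 \<inter> kernel L) \<le> (\<Sum>(N, L, Q)\<leftarrow>Ts. len {} Q)"
    using Cons.prems(2) fin e T
    by (cases "len {} (?S1 \<inter> kernel L)"; cases "len {} Q"; cases "\<Sum>(N, L, Q)\<leftarrow>Ts. len {} Q") auto
  have le2: "(\<Sum>(N, L, Q)\<leftarrow>Ts. len {} Q) \<le> len {} ?S2"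
    using triangular_ConsD[OF triangular_empty[OF Cons.prems(1)]] by (rule len_sum_space_ge) auto
  have le3: "len {} ?S2 \<le> len {} (?S1 \<inter> kernel L)" using **(2) T by (auto intro!: len_mono)
  have eqS: "?S2 = ?S1 \<inter> kernel L"
  proof (rule len_finite_eq)
    have "len {} ?S2 \<le> (\<Sum>(N, L, Q)\<leftarrow>Ts. len {} Q)" using le3 le1 by (rule order.trans)
    then show "len {} ?S2 \<noteq> \<infinity>" using fin(1) by (cases "len {} ?S2") (simp_all del: not_infinity_eq)
    show "len {} (?S1 \<inter> kernel L) \<le> len {} ?S2" using le1 le2 by (rule order.trans)
    show "submod {} ?S2" "submod {} (?S1 \<inter> kernel L)" "?S2 \<subseteq> ?S1 \<inter> kernel L"
      using **(2,4,5) unfolding T by blast+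
  qed
  have "len G ?S2 = (\<Sum>(N, L, Q)\<leftarrow>Ts. len G Q)"
    using Cons.IH[OF triangular_ConsD[OF Cons.prems(1)] order.trans[OF le3 le1] fin(1)] .
  moreover have "len G ?S1 = len G (?S1 \<inter> kernel L) + len G Q" using *(1) unfolding T .
  ultimately have "len G ?S1 = (\<Sum>(N, L, Q)\<leftarrow>Ts. len G Q) + len G Q" by (simp only: eqS)
  then show ?case unfolding T by (simp only: list.map sum_list.Cons prod.case add.commute)
qed

text \<open>If the dimension of \<open>M\<close> does not exceed the sum of the dimensions of the
  quotients, the sum of the submodules already exhausts \<open>M\<close>. This converts a numerical
  identity between dimensions into additivity of composition length.\<close>

lemma len_triangular_eq:
  assumes T: "triangular G Ts" and G: "\<And>g. g \<in> G \<Longrightarrow> lin g" and M: "submod G M"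
    and sub: "\<And>N. N \<in> fst ` set Ts \<Longrightarrow> N \<subseteq> M"
    and le: "len {} M \<le> (\<Sum>(N, L, Q)\<leftarrow>Ts. len {} Q)"
    and fin: "(\<Sum>(N, L, Q)\<leftarrow>Ts. len {} Q) \<noteq> \<infinity>"
  shows "len G M = (\<Sum>(N, L, Q)\<leftarrow>Ts. len G Q)"
proof -
  let ?S = "sum_space (map fst Ts)"
  have S: "submod G ?S" using T G by (intro sum_space_submod) (auto simp: triangular_def)
  have SM: "?S \<subseteq> M" using sub by (intro sum_space_subset[OF submod_subsp[OF M]]) auto
  have ge: "(\<Sum>(N, L, Q)\<leftarrow>Ts. len {} Q) \<le> len {} ?S"
    using triangular_empty[OF T] by (rule len_sum_space_ge) auto
  have le': "len {} ?S \<le> (\<Sum>(N, L, Q)\<leftarrow>Ts. len {} Q)" using len_mono[OF SM] le by (rule order.trans)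
  have "?S = M"
  proof (rule len_finite_eq)
    show "len {} ?S \<noteq> \<infinity>" using le' fin by (metis enat_ord_simps(5))
    show "len {} M \<le> len {} ?S" using le ge by (rule order.trans)
  qed (use S M SM in \<open>auto simp: submod_def\<close>)
  then show ?thesis using len_sum_space_eq[OF T G le' fin] by simp
qed

section \<open>Linear spans\<close>

inductive_set lspan :: "('w \<Rightarrow> real) set \<Rightarrow> ('w \<Rightarrow> real) set" for A where
  zero: "(\<lambda>_. 0) \<in> lspan A"
| add: "f \<in> lspan A \<Longrightarrow> s \<in> A \<Longrightarrow> (\<lambda>x. f x + c * s x) \<in> lspan A"

lemma lspan_base: "s \<in> A \<Longrightarrow> s \<in> lspan A"
  using lspan.add[OF lspan.zero, of s A 1] by simp

lemma subsp_lspan: "subsp (lspan A)"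
  unfolding subsp_def
proof (intro conjI ballI allI)
  show "(\<lambda>_. 0) \<in> lspan A" by (rule lspan.zero)
  fix f g c assume f: "f \<in> lspan A" and "g \<in> lspan A"
  from this(2) show "(\<lambda>x. f x + c * g x) \<in> lspan A"
  proof (induction rule: lspan.induct)
    case zero
    then show ?case using f by simp
  next
    case (add g s a)
    from lspan.add[OF add.IH add.hyps(2), of "c * a"] show ?case
      by (simp add: algebra_simps)
  qed
qed

lemma lspan_least: "subsp V \<Longrightarrow> A \<subseteq> V \<Longrightarrow> lspan A \<subseteq> V"
proof
  fix f assume V: "subsp V" "A \<subseteq> V" and "f \<in> lspan A"
  from this(3) show "f \<in> V"
    by (induction rule: lspan.induct) (use V in \<open>auto intro: subspD\<close>)
qed

lemma lspan_image:
  fixes L :: "('w \<Rightarrow> real) \<Rightarrow> ('w \<Rightarrow> real)"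
  assumes "lin L" shows "L ` lspan A = lspan (L ` A)"
proof
  have "f \<in> lspan A \<Longrightarrow> L f \<in> lspan (L ` A)" for f
    by (induction rule: lspan.induct)
      (auto simp: lin_zero[OF assms] lin_comb[OF assms] intro: lspan.intros)
  then show "L ` lspan A \<subseteq> lspan (L ` A)" by blast
  have "submod {} (L ` lspan A)"
    using submod_image[of "{}" L "lspan A"] assms subsp_lspan[of A] by (simp add: equivar_def submod_def)
  then show "lspan (L ` A) \<subseteq> L ` lspan A"
    by (intro lspan_least) (auto simp: submod_def lspan_base)
qed

lemma submod_lspan:
  assumes "\<And>g. g \<in> G \<Longrightarrow> lin g" "\<And>g s. g \<in> G \<Longrightarrow> s \<in> A \<Longrightarrow> g s \<in> lspan A"
  shows "submod G (lspan A)"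
  unfolding submod_def
proof (intro conjI ballI subsp_lspan)
  fix g assume "g \<in> G"
  then have "g ` lspan A = lspan (g ` A)" "g ` A \<subseteq> lspan A" using assms by (auto simp: lspan_image)
  then show "g ` lspan A \<subseteq> lspan A" using lspan_least[OF subsp_lspan] by metis
qed

section \<open>Specht modules of diagrams\<close>

text \<open>The action of a matrix unit of gl on tensors: an indicator function of a word is sent to
  the sum of the words obtained by changing one letter \<open>a\<close> into
  \<open>b\<close>.\<close>

definition Fop :: "'r \<Rightarrow> 'r \<Rightarrow> ('r list \<Rightarrow> real) \<Rightarrow> 'r list \<Rightarrow> real" where
  "Fop a b f ys = (\<Sum>p | p < length ys \<and> ys ! p = b. f (ys[p := a]))"

definition colperms :: "nat \<Rightarrow> (nat \<Rightarrow> 'c) \<Rightarrow> (nat \<Rightarrow> nat) set" where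
  "colperms d \<kappa> = {\<sigma>. \<sigma> permutes {..<d} \<and> (\<forall>p<d. \<kappa> (\<sigma> p) = \<kappa> p)}"

text \<open>Position \<open>p\<close> of the tensor carries the box in row \<open>\<rho> p\<close>
  and column \<open>\<kappa> p\<close>. The value is the coefficient of \<open>xs\<close> in the
  signed sum of the words \<open>\<rho> \<circ> \<sigma>\<close> over the column group.\<close>

definition gn :: "nat \<Rightarrow> (nat \<Rightarrow> 'r) \<Rightarrow> (nat \<Rightarrow> 'c) \<Rightarrow> 'r list \<Rightarrow> real" where
  "gn d \<rho> \<kappa> xs = (\<Sum>\<sigma>\<in>colperms d \<kappa>. of_int (sign \<sigma>) *
      of_bool (length xs = d \<and> (\<forall>p<d. xs ! p = \<rho> (\<sigma> p))))"

definition act :: "nat \<Rightarrow> (nat \<Rightarrow> nat) \<Rightarrow> ('r list \<Rightarrow> real) \<Rightarrow> 'r list \<Rightarrow> real" where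
  "act d \<tau> f xs = (if length xs = d then f (map (\<lambda>p. xs ! \<tau> p) [0..<d]) else 0)"

definition PG :: "nat \<Rightarrow> (('r list \<Rightarrow> real) \<Rightarrow> 'r list \<Rightarrow> real) set" where
  "PG d = {act d \<tau> |\<tau>. \<tau> permutes {..<d}}"

lemma lin_Fop: "lin (Fop a b)"
  by (auto simp: lin_def Fop_def fun_eq_iff sum.distrib sum_distrib_left)

lemma lin_act: "lin (act d \<tau>)"
  by (auto simp: lin_def act_def fun_eq_iff)

lemma lin_PG: "g \<in> PG d \<Longrightarrow> lin g"
  by (auto simp: PG_def lin_act)

lemma lin_funpow:
  fixes L :: "('w \<Rightarrow> real) \<Rightarrow> ('w \<Rightarrow> real)"
  shows "lin L \<Longrightarrow> lin (L ^^ n)"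
proof (induction n)
  case (Suc n)
  then show ?case by (auto simp: lin_def funpow.simps)
qed (simp add: lin_def)

lemma finite_colperms: "finite (colperms d \<kappa>)"
  by (rule finite_subset[of _ "{\<sigma>. \<sigma> permutes {..<d}}"])
    (auto simp: colperms_def finite_permutations)

lemma colperms_less: "\<sigma> \<in> colperms d \<kappa> \<Longrightarrow> p < d \<Longrightarrow> \<sigma> p < d"
  using permutes_in_image[of \<sigma> "{..<d}" p] by (auto simp: colperms_def)

lemma permutes_less: "\<sigma> permutes {..<d} \<Longrightarrow> p < d \<Longrightarrow> \<sigma> p < (d::nat)"
  using permutes_in_image[of \<sigma> "{..<d}" p] by auto

lemma permutation_lessThan: "\<sigma> permutes {..<d::nat} \<Longrightarrow> permutation \<sigma>"
  by (auto simp: permutation_permutes)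

lemma colperms_comp: "\<sigma> \<in> colperms d \<kappa> \<Longrightarrow> \<tau> \<in> colperms d \<kappa> \<Longrightarrow> \<sigma> \<circ> \<tau> \<in> colperms d \<kappa>"
  by (auto simp: colperms_def permutes_compose permutes_less)

lemma colperms_inv: "\<sigma> \<in> colperms d \<kappa> \<Longrightarrow> inv \<sigma> \<in> colperms d \<kappa>"
proof -
  assume s: "\<sigma> \<in> colperms d \<kappa>"
  then have p: "\<sigma> permutes {..<d}" by (simp add: colperms_def)
  have "\<kappa> (inv \<sigma> q) = \<kappa> q" if "q < d" for q
  proof -
    have "inv \<sigma> q < d" using permutes_less[OF permutes_inv[OF p] that] .
    then have "\<kappa> (\<sigma> (inv \<sigma> q)) = \<kappa> (inv \<sigma> q)" using s by (simp add: colperms_def)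
    then show ?thesis by (simp add: permutes_inverses[OF p])
  qed
  then show ?thesis using permutes_inv[OF p] by (simp add: colperms_def)
qed

lemma colperms_id: "id \<in> colperms d \<kappa>"
  by (simp add: colperms_def permutes_id)

lemma sign_comp_lessThan:
  "\<sigma> permutes {..<d::nat} \<Longrightarrow> \<tau> permutes {..<d} \<Longrightarrow> sign (\<sigma> \<circ> \<tau>) = sign \<sigma> * sign \<tau>"
  by (simp add: sign_compose permutation_lessThan)

lemma gn_cong:
  assumes "\<And>p. p < d \<Longrightarrow> \<rho> p = \<rho>' p" "\<And>p. p < d \<Longrightarrow> \<kappa> p = \<kappa>' p"
  shows "gn d \<rho> \<kappa> = gn d \<rho>' \<kappa>'"
proof
  fix xs
  have C: "colperms d \<kappa> = colperms d \<kappa>'"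
    using assms(2) by (auto simp: colperms_def permutes_less)
  show "gn d \<rho> \<kappa> xs = gn d \<rho>' \<kappa>' xs"
    unfolding gn_def C by (rule sum.cong) (auto simp: assms(1) colperms_less)
qed

text \<open>Changing a letter commutes with antisymmetrising over positions. In the term of
  \<open>\<sigma>\<close> position \<open>q\<close> carries the letter of box
  \<open>\<sigma> q\<close>, so the sum over positions is reindexed as a sum over boxes.\<close>

lemma Fop_gn:
  "Fop a b (gn d \<rho> \<kappa>) = (\<lambda>ys. \<Sum>p | p < d \<and> \<rho> p = a. gn d (\<rho>(p := b)) \<kappa> ys)"
proof
  fix ys
  show "Fop a b (gn d \<rho> \<kappa>) ys = (\<Sum>p | p < d \<and> \<rho> p = a. gn d (\<rho>(p := b)) \<kappa> ys)"
  proof (cases "length ys = d")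
    case False
    then show ?thesis by (simp add: Fop_def gn_def)
  next
    case True
    let ?l = "\<lambda>\<sigma> q. of_int (sign \<sigma>) *
      of_bool (ys ! q = b \<and> (\<forall>p<d. ys[q := a] ! p = \<rho> (\<sigma> p))) :: real"
    let ?r = "\<lambda>\<sigma> p. of_int (sign \<sigma>) *
      of_bool (\<rho> p = a \<and> (\<forall>q<d. ys ! q = (\<rho>(p := b)) (\<sigma> q))) :: real"
    have "Fop a b (gn d \<rho> \<kappa>) ys = (\<Sum>q<d. \<Sum>\<sigma>\<in>colperms d \<kappa>. ?l \<sigma> q)"
      unfolding Fop_def gn_def using True
      by (intro sum.mono_neutral_cong_left) (auto intro!: sum.neutral simp: finite_colperms)
    also have "\<dots> = (\<Sum>\<sigma>\<in>colperms d \<kappa>. \<Sum>q<d. ?l \<sigma> q)" by (rule sum.swap)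
    also have "\<dots> = (\<Sum>\<sigma>\<in>colperms d \<kappa>. \<Sum>p<d. ?r \<sigma> p)"
    proof (rule sum.cong[OF refl])
      fix \<sigma> assume s: "\<sigma> \<in> colperms d \<kappa>"
      then have perm: "\<sigma> permutes {..<d}" by (simp add: colperms_def)
      have "?l \<sigma> q = ?r \<sigma> (\<sigma> q)" if q: "q < d" for q
      proof -
        have "(ys ! q = b \<and> (\<forall>p<d. ys[q := a] ! p = \<rho> (\<sigma> p))) \<longleftrightarrow>
          (\<rho> (\<sigma> q) = a \<and> (\<forall>p<d. ys ! p = (\<rho>(\<sigma> q := b)) (\<sigma> p)))" (is "?A \<longleftrightarrow> ?B")
        proof -
          have "ys[q := a] ! p = \<rho> (\<sigma> p) \<longleftrightarrow> (if p = q then a = \<rho> (\<sigma> q) else ys ! p = \<rho> (\<sigma> p))"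
            if "p < d" for p using True q that by (auto simp: nth_list_update)
          moreover have "ys ! p = (\<rho>(\<sigma> q := b)) (\<sigma> p) \<longleftrightarrow>
              (if p = q then ys ! q = b else ys ! p = \<rho> (\<sigma> p))" for p
            using permutes_inj[OF perm] by (auto dest: injD)
          ultimately show ?thesis using q by (metis (full_types))
        qed
        then show ?thesis by simp
      qed
      then have "(\<Sum>q<d. ?l \<sigma> q) = (\<Sum>q<d. ?r \<sigma> (\<sigma> q))" by (intro sum.cong) auto
      also have "\<dots> = (\<Sum>p<d. ?r \<sigma> p)"
        using sum.permute[OF perm, of "?r \<sigma>"] by (simp add: o_def)
      finally show "(\<Sum>q<d. ?l \<sigma> q) = (\<Sum>p<d. ?r \<sigma> p)" .
    qed
    also have "\<dots> = (\<Sum>p<d. \<Sum>\<sigma>\<in>colperms d \<kappa>. ?r \<sigma> p)" by (rule sum.swap)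
    also have "\<dots> = (\<Sum>p | p < d \<and> \<rho> p = a. gn d (\<rho>(p := b)) \<kappa> ys)"
      unfolding gn_def using True
      by (intro sum.mono_neutral_cong_right) (auto intro!: sum.neutral simp: finite_colperms)
    finally show ?thesis .
  qed
qed

lemma gn_comp:
  assumes "\<sigma> \<in> colperms d \<kappa>"
  shows "gn d (\<rho> \<circ> \<sigma>) \<kappa> xs = of_int (sign \<sigma>) * gn d \<rho> \<kappa> xs"
proof -
  have perm: "\<sigma> permutes {..<d}" using assms by (simp add: colperms_def)
  let ?h = "\<lambda>\<tau>. of_int (sign \<tau>) * of_bool (length xs = d \<and> (\<forall>p<d. xs ! p = \<rho> (\<tau> p))) :: real"
  have "gn d \<rho> \<kappa> xs = (\<Sum>\<tau>\<in>colperms d \<kappa>. ?h (\<sigma> \<circ> \<tau>))"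
    unfolding gn_def
    by (rule sum.reindex_bij_witness[of _ "\<lambda>\<tau>. \<sigma> \<circ> \<tau>" "\<lambda>\<tau>. inv \<sigma> \<circ> \<tau>"])
      (auto simp: colperms_comp colperms_inv assms o_assoc permutes_inv_o[OF perm])
  also have "\<dots> = (\<Sum>\<tau>\<in>colperms d \<kappa>. of_int (sign \<sigma>) * (of_int (sign \<tau>) *
      of_bool (length xs = d \<and> (\<forall>p<d. xs ! p = (\<rho> \<circ> \<sigma>) (\<tau> p)))))"
    by (rule sum.cong) (auto simp: colperms_def sign_comp_lessThan[OF perm])
  also have "\<dots> = of_int (sign \<sigma>) * gn d (\<rho> \<circ> \<sigma>) \<kappa> xs"
    by (simp add: gn_def sum_distrib_left)
  finally have "gn d \<rho> \<kappa> xs = of_int (sign \<sigma>) * gn d (\<rho> \<circ> \<sigma>) \<kappa> xs" .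
  moreover have "of_int (sign \<sigma>) * of_int (sign \<sigma>) = (1::real)"
    by (simp add: sign_def)
  ultimately show ?thesis by (metis mult.assoc mult_1)
qed

text \<open>The transposition of the two positions lies in the column group, leaves the filling
  unchanged and has sign -1.\<close>

lemma gn_zero:
  assumes "p < d" "q < d" "p \<noteq> q" "\<rho> p = \<rho> q" "\<kappa> p = \<kappa> q"
  shows "gn d \<rho> \<kappa> = (\<lambda>_. 0)"
proof
  fix xs
  let ?t = "Transposition.transpose p q"
  have "?t \<in> colperms d \<kappa>"
    using assms by (auto simp: colperms_def permutes_swap_id transpose_def)
  then have "gn d (\<rho> \<circ> ?t) \<kappa> xs = of_int (sign ?t) * gn d \<rho> \<kappa> xs" by (rule gn_comp)
  moreover have "\<rho> \<circ> ?t = \<rho>" using assms(4) by (auto simp: transpose_def)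
  ultimately show "gn d \<rho> \<kappa> xs = 0" using assms(3) by (simp add: sign_swap_id)
qed

lemma gn_supp: "length xs \<noteq> d \<Longrightarrow> gn d \<rho> \<kappa> xs = 0"
  by (simp add: gn_def)

text \<open>Within a column the row letters are distinct, so only the identity of the column group
  reproduces the word. This coefficient certifies that generators are nonzero.\<close>

lemma gn_self:
  assumes "inj_on (\<lambda>p. (\<rho> p, \<kappa> p)) {..<d}"
  shows "gn d \<rho> \<kappa> (map \<rho> [0..<d]) = 1"
proof -
  have "gn d \<rho> \<kappa> (map \<rho> [0..<d]) = (\<Sum>\<sigma>\<in>{id}. of_int (sign \<sigma>) *
      of_bool (length (map \<rho> [0..<d]) = d \<and> (\<forall>p<d. map \<rho> [0..<d] ! p = \<rho> (\<sigma> p))))"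
    unfolding gn_def
  proof (rule sum.mono_neutral_right)
    show "\<forall>\<sigma>\<in>colperms d \<kappa> - {id}. of_int (sign \<sigma>) *
      of_bool (length (map \<rho> [0..<d]) = d \<and> (\<forall>p<d. map \<rho> [0..<d] ! p = \<rho> (\<sigma> p))) = (0::real)"
    proof
      fix \<sigma> assume s: "\<sigma> \<in> colperms d \<kappa> - {id}"
      have "\<exists>p<d. \<rho> p \<noteq> \<rho> (\<sigma> p)"
      proof (rule ccontr)
        assume "\<not> ?thesis"
        then have "\<sigma> p = p" if "p < d" for p
          using inj_onD[OF assms, of "\<sigma> p" p] s that colperms_less[of \<sigma> d \<kappa> p]
          by (auto simp: colperms_def)
        moreover have "\<sigma> p = p" if "\<not> p < d" for p
          using s that permutes_not_in[of \<sigma> "{..<d}" p] by (auto simp: colperms_def)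
        ultimately have "\<sigma> = id" by (metis eq_id_iff)
        then show False using s by simp
      qed
      then show "of_int (sign \<sigma>) *
        of_bool (length (map \<rho> [0..<d]) = d \<and> (\<forall>p<d. map \<rho> [0..<d] ! p = \<rho> (\<sigma> p))) = (0::real)"
        by auto
    qed
  qed (auto simp: finite_colperms colperms_id)
  then show ?thesis by simp
qed

lemma act_gn_apply:
  assumes t: "\<tau> permutes {..<d}"
  shows "act d (inv \<tau>) (gn d \<rho> \<kappa>) xs = (\<Sum>\<sigma>\<in>colperms d \<kappa>. of_int (sign \<sigma>) *
      of_bool (length xs = d \<and> (\<forall>p<d. xs ! p = \<rho> (\<sigma> (\<tau> p)))))"
proof (cases "length xs = d")
  case False
  then show ?thesis by (simp add: act_def)
next
  case True
  have "(\<forall>p<d. map (\<lambda>p. xs ! inv \<tau> p) [0..<d] ! p = \<rho> (\<sigma> p)) \<longleftrightarrow>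
    (\<forall>p<d. xs ! p = \<rho> (\<sigma> (\<tau> p)))" for \<sigma>
  proof -
    have "(\<forall>p<d. xs ! inv \<tau> p = \<rho> (\<sigma> p)) \<longleftrightarrow> (\<forall>p<d. xs ! p = \<rho> (\<sigma> (\<tau> p)))"
    proof (intro iffI allI impI)
      fix p assume *: "\<forall>p<d. xs ! inv \<tau> p = \<rho> (\<sigma> p)" and "p < d"
      then have "\<tau> p < d" using permutes_less[OF t] by blast
      then show "xs ! p = \<rho> (\<sigma> (\<tau> p))" using *[rule_format, of "\<tau> p"] by (simp add: permutes_inverses[OF t])
    next
      fix p assume *: "\<forall>p<d. xs ! p = \<rho> (\<sigma> (\<tau> p))" and "p < d"
      then have "inv \<tau> p < d" using permutes_less[OF permutes_inv[OF t]] by blast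
      then show "xs ! inv \<tau> p = \<rho> (\<sigma> p)" using *[rule_format, of "inv \<tau> p"] by (simp add: permutes_inverses[OF t])
    qed
    then show ?thesis by simp
  qed
  then show ?thesis using True by (simp add: act_def gn_def)
qed

lemma act_gn:
  assumes t: "\<tau> permutes {..<d}"
  shows "act d \<tau> (gn d \<rho> \<kappa>) = gn d (\<rho> \<circ> inv \<tau>) (\<kappa> \<circ> inv \<tau>)"
proof
  fix xs
  let ?i = "inv \<tau>"
  have i: "?i permutes {..<d}" using t by (rule permutes_inv)
  have "act d (inv ?i) (gn d \<rho> \<kappa>) xs = gn d (\<rho> \<circ> ?i) (\<kappa> \<circ> ?i) xs"
    unfolding act_gn_apply[OF i] unfolding gn_def
  proof (rule sum.reindex_bij_witness[of _ "\<lambda>\<sigma>. ?i \<circ> \<sigma> \<circ> \<tau>" "\<lambda>\<sigma>. \<tau> \<circ> \<sigma> \<circ> ?i"])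
    fix \<sigma> assume s: "\<sigma> \<in> colperms d \<kappa>"
    then have sp: "\<sigma> permutes {..<d}" by (simp add: colperms_def)
    show "?i \<circ> (\<tau> \<circ> \<sigma> \<circ> ?i) \<circ> \<tau> = \<sigma>" by (auto simp: permutes_inverses[OF t])
    show "\<tau> \<circ> \<sigma> \<circ> ?i \<in> colperms d (\<kappa> \<circ> ?i)"
      using s sp t i permutes_less[OF i] by (auto simp: colperms_def permutes_inverses[OF t]
          intro!: permutes_compose)
    have "sign (\<tau> \<circ> \<sigma> \<circ> ?i) = sign \<sigma>"
    proof -
      have "sign (\<tau> \<circ> \<sigma> \<circ> ?i) = sign \<tau> * sign \<sigma> * sign ?i"
        using sign_comp_lessThan[OF permutes_compose[OF sp t] i] sign_comp_lessThan[OF t sp]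
        by (simp add: o_assoc)
      moreover have "sign ?i = sign \<tau>" by (rule sign_inverse[OF permutation_lessThan[OF t]])
      ultimately show ?thesis by (simp add: sign_def)
    qed
    then show "of_int (sign (\<tau> \<circ> \<sigma> \<circ> ?i)) * of_bool (length xs = d \<and>
          (\<forall>p<d. xs ! p = (\<rho> \<circ> ?i) ((\<tau> \<circ> \<sigma> \<circ> ?i) p))) = (of_int (sign \<sigma>) *
          of_bool (length xs = d \<and> (\<forall>p<d. xs ! p = \<rho> (\<sigma> (?i p)))) :: real)"
      by (simp add: permutes_inverses[OF t])
  next
    fix \<sigma> assume s: "\<sigma> \<in> colperms d (\<kappa> \<circ> ?i)"
    then have sp: "\<sigma> permutes {..<d}" by (simp add: colperms_def)
    show "\<tau> \<circ> (?i \<circ> \<sigma> \<circ> \<tau>) \<circ> ?i = \<sigma>" by (auto simp: permutes_inverses[OF t])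
    have "\<kappa> (?i (\<sigma> (\<tau> p))) = \<kappa> p" if "p < d" for p
      using s permutes_less[OF t that] by (auto simp: colperms_def permutes_inverses[OF t])
    then show "?i \<circ> \<sigma> \<circ> \<tau> \<in> colperms d \<kappa>"
      using sp t i by (auto simp: colperms_def intro!: permutes_compose)
  qed
  then show "act d \<tau> (gn d \<rho> \<kappa>) xs = gn d (\<rho> \<circ> inv \<tau>) (\<kappa> \<circ> inv \<tau>) xs"
    by (simp add: inv_inv_eq permutes_bij[OF t])
qed

lemma Fop_act:
  assumes t: "\<tau> permutes {..<d}"
  shows "Fop a b (act d \<tau> f) = act d \<tau> (Fop a b f)"
proof
  fix ys
  show "Fop a b (act d \<tau> f) ys = act d \<tau> (Fop a b f) ys"
  proof (cases "length ys = d")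
    case False
    then show ?thesis by (simp add: Fop_def act_def)
  next
    case True
    have "(map (\<lambda>p. ys ! \<tau> p) [0..<d])[p := a] = map (\<lambda>q. ys[\<tau> p := a] ! \<tau> q) [0..<d]" if "p < d" for p
      using that True permutes_less[OF t] permutes_inj[OF t]
      by (intro nth_equalityI) (auto simp: nth_list_update dest: injD)
    then have "act d \<tau> (Fop a b f) ys =
        (\<Sum>p | p < d \<and> ys ! \<tau> p = b. f (map (\<lambda>q. ys[\<tau> p := a] ! \<tau> q) [0..<d]))"
      using True by (auto simp: act_def Fop_def intro!: sum.cong)
    also have "\<dots> = (\<Sum>p | p < d \<and> ys ! p = b. f (map (\<lambda>q. ys[p := a] ! \<tau> q) [0..<d]))"
      by (rule sum.reindex_bij_witness[of _ "inv \<tau>" \<tau>])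
        (auto simp: permutes_inverses[OF t] permutes_less[OF t] permutes_less[OF permutes_inv[OF t]])
    finally show ?thesis using True by (simp add: Fop_def act_def)
  qed
qed

section \<open>Fillings and the module of a diagram\<close>

definition fill :: "('r \<times> 'c) set \<Rightarrow> (nat \<Rightarrow> 'r) \<Rightarrow> (nat \<Rightarrow> 'c) \<Rightarrow> bool" where
  "fill D \<rho> \<kappa> \<longleftrightarrow> bij_betw (\<lambda>p. (\<rho> p, \<kappa> p)) {..<card D} D"

definition gens :: "('r \<times> 'c) set \<Rightarrow> ('r list \<Rightarrow> real) set" where
  "gens D = {gn (card D) \<rho> \<kappa> |\<rho> \<kappa>. fill D \<rho> \<kappa>}"

definition Mod :: "('r \<times> 'c) set \<Rightarrow> ('r list \<Rightarrow> real) set" where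
  "Mod D = lspan (gens D)"

lemma fill_ex: "finite D \<Longrightarrow> \<exists>\<rho> \<kappa>. fill D \<rho> \<kappa>"
proof -
  assume "finite D"
  then obtain h where "bij_betw h {0..<card D} D" using ex_bij_betw_nat_finite by blast
  then have "fill D (fst \<circ> h) (snd \<circ> h)" by (simp add: fill_def atLeast0LessThan)
  then show ?thesis by blast
qed

lemma fill_act:
  assumes "fill D \<rho> \<kappa>" "\<tau> permutes {..<card D}"
  shows "fill D (\<rho> \<circ> \<tau>) (\<kappa> \<circ> \<tau>)"
proof -
  have "bij_betw ((\<lambda>p. (\<rho> p, \<kappa> p)) \<circ> \<tau>) {..<card D} D"
    using assms permutes_imp_bij by (auto simp: fill_def intro: bij_betw_trans)
  then show ?thesis by (simp add: fill_def o_def)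
qed

lemma fill_mem: "fill D \<rho> \<kappa> \<Longrightarrow> (x, c) \<in> D \<longleftrightarrow> (\<exists>q<card D. \<rho> q = x \<and> \<kappa> q = c)"
proof -
  assume "fill D \<rho> \<kappa>"
  then have "D = (\<lambda>p. (\<rho> p, \<kappa> p)) ` {..<card D}"
    unfolding fill_def by (rule bij_betw_imp_surj_on[symmetric])
  then have "(x, c) \<in> D \<longleftrightarrow> (x, c) \<in> (\<lambda>p. (\<rho> p, \<kappa> p)) ` {..<card D}" by simp
  then show ?thesis by auto
qed

lemma submod_Mod: "submod (PG (card D)) (Mod D)"
  unfolding Mod_def
proof (rule submod_lspan)
  fix g s :: "'a list \<Rightarrow> real" assume "s \<in> gens D"
  fix g :: "('a list \<Rightarrow> real) \<Rightarrow> 'a list \<Rightarrow> real" assume "g \<in> PG (card D)"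
  then obtain \<tau> where t: "\<tau> permutes {..<card D}" "g = act (card D) \<tau>" by (auto simp: PG_def)
  obtain \<rho> \<kappa> where "fill D \<rho> \<kappa>" "s = gn (card D) \<rho> \<kappa>" using \<open>s \<in> gens D\<close> by (auto simp: gens_def)
  then have "g s \<in> gens D"
    using t act_gn[OF t(1)] fill_act[OF _ permutes_inv[OF t(1)]] unfolding gens_def by blast
  then show "g s \<in> lspan (gens D)" by (rule lspan_base)
qed (rule lin_PG)

lemma Mod_supp: "f \<in> Mod D \<Longrightarrow> length xs \<noteq> card D \<Longrightarrow> f xs = 0"
  unfolding Mod_def
proof (induction rule: lspan.induct)
  case (add f s c)
  then show ?case by (auto simp: gens_def gn_supp)
qed simp

lemma gn_in_Mod: "fill D \<rho> \<kappa> \<Longrightarrow> gn (card D) \<rho> \<kappa> \<in> Mod D"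
  unfolding Mod_def gens_def by (rule lspan_base) blast

lemma gn_self_fill: "fill D \<rho> \<kappa> \<Longrightarrow> gn (card D) \<rho> \<kappa> (map \<rho> [0..<card D]) = 1"
  by (rule gn_self) (auto simp: fill_def bij_betw_def)

text \<open>\<open>Rm a b\<close> moves the boxes of row \<open>a\<close> to row \<open>b\<close> where possible, \<open>Cm\<close> does so for columns.\<close>

definition Rm :: "'r \<Rightarrow> 'r \<Rightarrow> ('r \<times> 'c) set \<Rightarrow> ('r \<times> 'c) set" where
  "Rm a b D = (\<lambda>(x, c). if x = a \<and> (b, c) \<notin> D then (b, c) else (x, c)) ` D"

definition Cm :: "'c \<Rightarrow> 'c \<Rightarrow> ('r \<times> 'c) set \<Rightarrow> ('r \<times> 'c) set" where
  "Cm a b D = (\<lambda>(x, c). if c = a \<and> (x, b) \<notin> D then (x, b) else (x, c)) ` D"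

text \<open>The columns in which \<open>Rm a b\<close> really moves a box. For finite
  \<open>D\<close> and \<open>a \<noteq> b\<close> their number is the highest power of
  \<open>Fop a b\<close> that is nonzero on the module.\<close>

definition elig :: "'r \<Rightarrow> 'r \<Rightarrow> ('r \<times> 'c) set \<Rightarrow> 'c set" where
  "elig a b D = {c. (a, c) \<in> D \<and> (b, c) \<notin> D}"

lemma finite_elig: "finite D \<Longrightarrow> finite (elig a b D)"
  by (rule finite_subset[of _ "snd ` D"]) (force simp: elig_def)+

lemma mem_Rm: "a \<noteq> b \<Longrightarrow> (x, c) \<in> Rm a b D \<longleftrightarrow>
    (if x = a then (a, c) \<in> D \<and> (b, c) \<in> D
     else if x = b then (a, c) \<in> D \<or> (b, c) \<in> D else (x, c) \<in> D)"
  unfolding Rm_def image_iff Bex_def split_paired_Ex prod.case by (auto split: if_splits)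

lemma mem_Cm: "a \<noteq> b \<Longrightarrow> (x, c) \<in> Cm a b D \<longleftrightarrow>
    (if c = a then (x, a) \<in> D \<and> (x, b) \<in> D
     else if c = b then (x, a) \<in> D \<or> (x, b) \<in> D else (x, c) \<in> D)"
  unfolding Cm_def image_iff Bex_def split_paired_Ex prod.case by (auto split: if_splits)

lemma inj_Rm: "inj_on (\<lambda>(x, c). if x = a \<and> (b, c) \<notin> D then (b, c) else (x, c)) D"
  by (rule inj_onI) (auto split: if_splits)

lemma inj_Cm: "inj_on (\<lambda>(x, c). if c = a \<and> (x, b) \<notin> D then (x, b) else (x, c)) D"
  by (rule inj_onI) (auto split: if_splits)

lemma card_Rm: "card (Rm a b D) = card D"
  unfolding Rm_def by (rule card_image[OF inj_Rm])

lemma card_Cm: "card (Cm a b D) = card D"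
  unfolding Cm_def by (rule card_image[OF inj_Cm])

lemma finite_Rm: "finite D \<Longrightarrow> finite (Rm a b D)"
  by (simp add: Rm_def)

lemma finite_Cm: "finite D \<Longrightarrow> finite (Cm a b D)"
  by (simp add: Cm_def)

text \<open>Enumerating an image diagram is the same as enumerating \<open>D\<close> and applying
  \<open>h\<close>. Row moves, column moves and renamings of rows all transport generators in this
  way.\<close>

lemma fill_image:
  assumes "inj_on h D"
  shows "fill (h ` D) \<rho>' \<kappa>' \<longleftrightarrow>
    (\<exists>\<rho> \<kappa>. fill D \<rho> \<kappa> \<and> (\<forall>p<card D. (\<rho>' p, \<kappa>' p) = h (\<rho> p, \<kappa> p)))"
proof -
  have c: "card (h ` D) = card D" by (rule card_image[OF assms])
  have hb: "bij_betw h D (h ` D)" using assms by (simp add: bij_betw_def)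
  show ?thesis
  proof
    assume "fill (h ` D) \<rho>' \<kappa>'"
    then have b: "bij_betw (\<lambda>p. (\<rho>' p, \<kappa>' p)) {..<card D} (h ` D)" by (simp add: fill_def c)
    let ?g = "\<lambda>p. inv_into D h (\<rho>' p, \<kappa>' p)"
    have "bij_betw (inv_into D h \<circ> (\<lambda>p. (\<rho>' p, \<kappa>' p))) {..<card D} D"
      using b bij_betw_inv_into[OF hb] by (rule bij_betw_trans)
    then have "fill D (fst \<circ> ?g) (snd \<circ> ?g)" by (simp add: fill_def o_def)
    moreover have "(\<rho>' p, \<kappa>' p) = h (?g p)" if "p < card D" for p
      using bij_betwE[OF b] that by (intro f_inv_into_f[symmetric]) auto
    ultimately show "\<exists>\<rho> \<kappa>. fill D \<rho> \<kappa> \<and> (\<forall>p<card D. (\<rho>' p, \<kappa>' p) = h (\<rho> p, \<kappa> p))"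
      by (intro exI[of _ "fst \<circ> ?g"] exI[of _ "snd \<circ> ?g"]) auto
  next
    assume "\<exists>\<rho> \<kappa>. fill D \<rho> \<kappa> \<and> (\<forall>p<card D. (\<rho>' p, \<kappa>' p) = h (\<rho> p, \<kappa> p))"
    then obtain \<rho> \<kappa> where f: "fill D \<rho> \<kappa>" and e: "\<And>p. p < card D \<Longrightarrow> (\<rho>' p, \<kappa>' p) = h (\<rho> p, \<kappa> p)"
      by blast
    have "bij_betw (h \<circ> (\<lambda>p. (\<rho> p, \<kappa> p))) {..<card D} (h ` D)"
      using f hb unfolding fill_def by (rule bij_betw_trans)
    then show "fill (h ` D) \<rho>' \<kappa>'"
      unfolding fill_def c using e by (subst bij_betw_cong[where g = "h \<circ> (\<lambda>p. (\<rho> p, \<kappa> p))"]) auto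
  qed
qed

text \<open>In a column that already has a box in row \<open>b\<close>, changing \<open>a\<close> to
  \<open>b\<close> repeats a pair and gives zero. Hence every application must use a box of
  \<open>E\<close>; after \<open>n\<close> applications all of them have moved, in any of
  \<open>n!\<close> orders, and nothing is left for one more.\<close>

lemma Fop_funpow_gn:
  assumes "inj_on (\<lambda>p. (\<rho> p, \<kappa> p)) {..<d}" "a \<noteq> b"
    and "E = {p. p < d \<and> \<rho> p = a \<and> \<not> (\<exists>q<d. \<rho> q = b \<and> \<kappa> q = \<kappa> p)}" "card E = n"
  shows "(Fop a b ^^ n) (gn d \<rho> \<kappa>) =
      (\<lambda>ys. fact n * gn d (\<lambda>p. if p \<in> E then b else \<rho> p) \<kappa> ys) \<and>
    (Fop a b ^^ Suc n) (gn d \<rho> \<kappa>) = (\<lambda>_. 0)"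
  using assms
proof (induction n arbitrary: \<rho> E)
  case (0 \<rho>)
  have fE: "finite E" using 0(3) by simp
  then have E: "E = {}" using 0(4) by simp
  have "gn d (\<rho>(p := b)) \<kappa> = (\<lambda>_. 0)" if p: "p < d" "\<rho> p = a" for p
  proof -
    have "p \<notin> E" using E by simp
    then obtain q where "q < d" "\<rho> q = b" "\<kappa> q = \<kappa> p" unfolding 0(3) using p by auto
    then show ?thesis using p 0(2) by (intro gn_zero[of p d q]) auto
  qed
  then have "Fop a b (gn d \<rho> \<kappa>) = (\<lambda>_. 0)" unfolding Fop_gn by (auto intro!: sum.neutral)
  then show ?case using E by simp
next
  case (Suc n \<rho>)
  have fE: "finite E" using Suc.prems(3) by simp
  have z: "gn d (\<rho>(p := b)) \<kappa> = (\<lambda>_. 0)" if p: "p < d" "\<rho> p = a" "p \<notin> E" for p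
  proof -
    obtain q where "q < d" "\<rho> q = b" "\<kappa> q = \<kappa> p" using p unfolding Suc.prems(3) by auto
    then show ?thesis using p Suc.prems(2) by (intro gn_zero[of p d q]) auto
  qed
  have F: "Fop a b (gn d \<rho> \<kappa>) = (\<lambda>ys. \<Sum>p\<in>E. gn d (\<rho>(p := b)) \<kappa> ys)"
    unfolding Fop_gn
  proof
    fix ys
    show "(\<Sum>p | p < d \<and> \<rho> p = a. gn d (\<rho>(p := b)) \<kappa> ys) = (\<Sum>p\<in>E. gn d (\<rho>(p := b)) \<kappa> ys)"
      by (rule sum.mono_neutral_right) (use Suc.prems(3) in \<open>auto simp: z\<close>)
  qed
  let ?m = "gn d (\<lambda>p. if p \<in> E then b else \<rho> p) \<kappa>"
  have step: "(Fop a b ^^ n) (gn d (\<rho>(p := b)) \<kappa>) = (\<lambda>ys. fact n * ?m ys) \<and>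
      (Fop a b ^^ Suc n) (gn d (\<rho>(p := b)) \<kappa>) = (\<lambda>_. 0)" if p: "p \<in> E" for p
  proof -
    have pd: "p < d" "\<rho> p = a" "\<And>q. q < d \<Longrightarrow> \<rho> q = b \<Longrightarrow> \<kappa> q \<noteq> \<kappa> p"
      using p Suc.prems(3) by auto
    have i: "inj_on (\<lambda>q. ((\<rho>(p := b)) q, \<kappa> q)) {..<d}"
    proof (rule inj_onI)
      fix x y assume "x \<in> {..<d}" "y \<in> {..<d}" "((\<rho>(p := b)) x, \<kappa> x) = ((\<rho>(p := b)) y, \<kappa> y)"
      then show "x = y"
        using pd(3)[of x] pd(3)[of y] inj_onD[OF Suc.prems(1), of x y]
        by (cases "x = p"; cases "y = p") (simp_all split: if_splits)
    qed
    have e: "E - {p} = {q. q < d \<and> (\<rho>(p := b)) q = a \<and>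
        \<not> (\<exists>q'<d. (\<rho>(p := b)) q' = b \<and> \<kappa> q' = \<kappa> q)}"
    proof -
      have "q \<in> E - {p} \<longleftrightarrow> q < d \<and> (\<rho>(p := b)) q = a \<and>
        \<not> (\<exists>q'<d. (\<rho>(p := b)) q' = b \<and> \<kappa> q' = \<kappa> q)" for q
      proof (cases "q < d \<and> \<rho> q = a \<and> q \<noteq> p")
        case True
        then have k: "\<kappa> p \<noteq> \<kappa> q"
          using inj_onD[OF Suc.prems(1), of p q] pd(1,2) by auto
        have "(\<rho>(p := b)) q' = b \<and> \<kappa> q' = \<kappa> q \<longleftrightarrow> \<rho> q' = b \<and> \<kappa> q' = \<kappa> q" for q'
          using k by (cases "q' = p") simp_all
        then show ?thesis unfolding Suc.prems(3) using True by simp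
      next
        case False
        then show ?thesis unfolding Suc.prems(3) using Suc.prems(2)
          by (cases "q = p"; cases "q < d"; cases "\<rho> q = a") simp_all
      qed
      then show ?thesis by blast
    qed
    have "card (E - {p}) = n" using Suc.prems(4) p fE by simp
    from Suc.IH[OF i Suc.prems(2) e this]
    have "(Fop a b ^^ n) (gn d (\<rho>(p := b)) \<kappa>) =
        (\<lambda>ys. fact n * gn d (\<lambda>q. if q \<in> E - {p} then b else (\<rho>(p := b)) q) \<kappa> ys)"
      "(Fop a b ^^ Suc n) (gn d (\<rho>(p := b)) \<kappa>) = (\<lambda>_. 0)" by blast+
    moreover have "(\<lambda>q. if q \<in> E - {p} then b else (\<rho>(p := b)) q) = (\<lambda>p. if p \<in> E then b else \<rho> p)"
      using p by auto
    ultimately show ?thesis by simp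
  qed
  have pw: "(Fop a b ^^ Suc k) (gn d \<rho> \<kappa>) = (\<lambda>ys. \<Sum>p\<in>E. (Fop a b ^^ k) (gn d (\<rho>(p := b)) \<kappa>) ys)" for k
    unfolding funpow_Suc_right o_apply F by (rule lin_sum[OF lin_funpow[OF lin_Fop] fE])
  have "(Fop a b ^^ Suc n) (gn d \<rho> \<kappa>) = (\<lambda>ys. \<Sum>p\<in>E. fact n * ?m ys)"
    unfolding pw using step by auto
  then have 1: "(Fop a b ^^ Suc n) (gn d \<rho> \<kappa>) = (\<lambda>ys. fact (Suc n) * ?m ys)"
    using Suc.prems(4) by (simp add: mult.assoc)
  have 2: "(Fop a b ^^ Suc (Suc n)) (gn d \<rho> \<kappa>) = (\<lambda>_. 0)"
    unfolding pw[of "Suc n"]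
  proof (intro ext sum.neutral ballI)
    fix ys p assume "p \<in> E"
    then have "(Fop a b ^^ Suc n) (gn d (\<rho>(p := b)) \<kappa>) = (\<lambda>_. 0)" using step by blast
    then show "(Fop a b ^^ Suc n) (gn d (\<rho>(p := b)) \<kappa>) ys = 0" by metis
  qed
  show ?case using 1 2 by blast
qed

lemma fill_elig:
  fixes a b
  assumes "fill D \<rho> \<kappa>" "finite D"
  defines "E \<equiv> {p. p < card D \<and> \<rho> p = a \<and> \<not> (\<exists>q<card D. \<rho> q = b \<and> \<kappa> q = \<kappa> p)}"
  shows "card E = card (elig a b D)" and "p < card D \<Longrightarrow> p \<in> E \<longleftrightarrow> \<rho> p = a \<and> (b, \<kappa> p) \<notin> D"
proof -
  have b: "bij_betw (\<lambda>p. (\<rho> p, \<kappa> p)) {..<card D} D" using assms(1) by (simp add: fill_def)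
  note mem = fill_mem[OF assms(1)]
  show *: "p < card D \<Longrightarrow> p \<in> E \<longleftrightarrow> \<rho> p = a \<and> (b, \<kappa> p) \<notin> D" for p
    unfolding E_def mem by auto
  have "\<kappa> ` E = elig a b D"
    unfolding E_def elig_def mem by (auto simp: image_iff)
  moreover have "inj_on \<kappa> E"
  proof (rule inj_onI)
    fix x y assume "x \<in> E" "y \<in> E" "\<kappa> x = \<kappa> y"
    then show "x = y" using inj_onD[OF bij_betw_imp_inj_on[OF b], of x y] by (auto simp: E_def)
  qed
  ultimately show "card E = card (elig a b D)" by (metis card_image)
qed

lemma Fop_funpow_fill:
  assumes "fill D \<rho> \<kappa>" "finite D" "a \<noteq> b"
  shows "(Fop a b ^^ card (elig a b D)) (gn (card D) \<rho> \<kappa>) =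
      (\<lambda>ys. fact (card (elig a b D)) *
        gn (card D) (\<lambda>p. if \<rho> p = a \<and> (b, \<kappa> p) \<notin> D then b else \<rho> p) \<kappa> ys)"
    and "(Fop a b ^^ Suc (card (elig a b D))) (gn (card D) \<rho> \<kappa>) = (\<lambda>_. 0)"
proof -
  let ?E = "{p. p < card D \<and> \<rho> p = a \<and> \<not> (\<exists>q<card D. \<rho> q = b \<and> \<kappa> q = \<kappa> p)}"
  note e = fill_elig[OF assms(1,2), where a = a and b = b]
  have inj: "inj_on (\<lambda>p. (\<rho> p, \<kappa> p)) {..<card D}" using assms(1) by (auto simp: fill_def bij_betw_def)
  have g: "gn (card D) (\<lambda>p. if p \<in> ?E then b else \<rho> p) \<kappa> =
      gn (card D) (\<lambda>p. if \<rho> p = a \<and> (b, \<kappa> p) \<notin> D then b else \<rho> p) \<kappa>"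
    by (rule gn_cong) (simp_all only: e(2))
  from Fop_funpow_gn[OF inj assms(3) refl e(1)]
  show "(Fop a b ^^ card (elig a b D)) (gn (card D) \<rho> \<kappa>) =
      (\<lambda>ys. fact (card (elig a b D)) *
        gn (card D) (\<lambda>p. if \<rho> p = a \<and> (b, \<kappa> p) \<notin> D then b else \<rho> p) \<kappa> ys)"
    and "(Fop a b ^^ Suc (card (elig a b D))) (gn (card D) \<rho> \<kappa>) = (\<lambda>_. 0)"
    unfolding g by blast+
qed

lemma funpow_lin_zero:
  fixes L :: "('w \<Rightarrow> real) \<Rightarrow> ('w \<Rightarrow> real)"
  shows "lin L \<Longrightarrow> (L ^^ m) f = (\<lambda>_. 0) \<Longrightarrow> m \<le> n \<Longrightarrow> (L ^^ n) f = (\<lambda>_. 0)"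
proof -
  assume L: "lin L" and z: "(L ^^ m) f = (\<lambda>_. 0)" and "m \<le> n"
  have "(L ^^ n) f = (L ^^ ((n - m) + m)) f" using \<open>m \<le> n\<close> by simp
  also have "\<dots> = (L ^^ (n - m)) ((L ^^ m) f)" by (simp only: funpow_add o_apply)
  finally have "(L ^^ n) f = (L ^^ (n - m)) ((L ^^ m) f)" .
  then show ?thesis using z lin_zero[OF lin_funpow[OF L]] by simp
qed

lemma Fop_funpow_Mod_zero:
  assumes "finite D" "a \<noteq> b" "card (elig a b D) < k" "f \<in> Mod D"
  shows "(Fop a b ^^ k) f = (\<lambda>_. 0)"
  using assms(4) unfolding Mod_def
proof (induction rule: lspan.induct)
  case zero
  then show ?case by (rule lin_zero[OF lin_funpow[OF lin_Fop]])
next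
  case (add f s c)
  then obtain \<rho> \<kappa> where s: "s = gn (card D) \<rho> \<kappa>" "fill D \<rho> \<kappa>" by (auto simp: gens_def)
  have "(Fop a b ^^ k) s = (\<lambda>_. 0)"
    unfolding s(1) by (rule funpow_lin_zero[OF lin_Fop Fop_funpow_fill(2)[OF s(2) assms(1,2)]])
      (use assms(3) in simp)
  then show ?case using add.IH by (simp add: lin_comb[OF lin_funpow[OF lin_Fop]])
qed

text \<open>The divided power: dividing by the factorial cancels the number of orders in which the
  boxes can move, so generators go to generators without a factor.\<close>

definition Rop :: "'r \<Rightarrow> 'r \<Rightarrow> nat \<Rightarrow> ('r list \<Rightarrow> real) \<Rightarrow> 'r list \<Rightarrow> real" where
  "Rop a b k f = (\<lambda>ys. (Fop a b ^^ k) f ys / fact k)"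

lemma lin_Rop: "lin (Rop a b k)"
  using lin_funpow[OF lin_Fop, of k a b] by (auto simp: lin_def Rop_def add_divide_distrib)

lemma Fop_funpow_act: "\<tau> permutes {..<d} \<Longrightarrow> (Fop a b ^^ k) (act d \<tau> f) = act d \<tau> ((Fop a b ^^ k) f)"
  by (induction k) (auto simp: Fop_act)

lemma equivar_Rop: "equivar (PG d) (Rop a b k)"
  unfolding equivar_def using lin_Rop
  by (auto simp: PG_def Rop_def Fop_funpow_act) (auto simp: act_def)

lemma Rop_Mod_zero:
  "finite D \<Longrightarrow> a \<noteq> b \<Longrightarrow> card (elig a b D) < k \<Longrightarrow> Mod D \<subseteq> kernel (Rop a b k)"
  by (auto simp: Rop_def Fop_funpow_Mod_zero)

text \<open>With the number of eligible boxes as exponent, each generator goes to the one whose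
  boxes have been moved, and every filling of the moved diagram arises in this way.\<close>

lemma Rop_Mod:
  assumes "finite D" "a \<noteq> b"
  shows "Rop a b (card (elig a b D)) ` Mod D = Mod (Rm a b D)"
proof -
  let ?k = "card (elig a b D)" and ?h = "\<lambda>(x, c). if x = a \<and> (b, c) \<notin> D then (b, c) else (x, c)"
  have g: "Rop a b ?k (gn (card D) \<rho> \<kappa>) =
      gn (card D) (\<lambda>p. if \<rho> p = a \<and> (b, \<kappa> p) \<notin> D then b else \<rho> p) \<kappa>" if "fill D \<rho> \<kappa>" for \<rho> \<kappa>
    unfolding Rop_def Fop_funpow_fill(1)[OF that assms] by simp
  have "Rop a b ?k ` gens D = gens (Rm a b D)"
  proof
    show "Rop a b ?k ` gens D \<subseteq> gens (Rm a b D)"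
    proof
      fix s assume "s \<in> Rop a b ?k ` gens D"
      then obtain \<rho> \<kappa> where f: "fill D \<rho> \<kappa>" "s = Rop a b ?k (gn (card D) \<rho> \<kappa>)"
        by (auto simp: gens_def)
      then have "s = gn (card (Rm a b D)) (\<lambda>p. if \<rho> p = a \<and> (b, \<kappa> p) \<notin> D then b else \<rho> p) \<kappa>"
        by (simp add: g card_Rm)
      moreover have "fill (Rm a b D) (\<lambda>p. if \<rho> p = a \<and> (b, \<kappa> p) \<notin> D then b else \<rho> p) \<kappa>"
        unfolding Rm_def fill_image[OF inj_Rm] using f(1) by (intro exI[of _ \<rho>] exI[of _ \<kappa>]) auto
      ultimately show "s \<in> gens (Rm a b D)" unfolding gens_def by blast
    qed
    show "gens (Rm a b D) \<subseteq> Rop a b ?k ` gens D"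
    proof
      fix s assume "s \<in> gens (Rm a b D)"
      then obtain \<rho>' \<kappa>' where f: "fill (Rm a b D) \<rho>' \<kappa>'" "s = gn (card D) \<rho>' \<kappa>'"
        by (auto simp: gens_def card_Rm)
      then obtain \<rho> \<kappa> where r: "fill D \<rho> \<kappa>" "\<And>p. p < card D \<Longrightarrow> (\<rho>' p, \<kappa>' p) = ?h (\<rho> p, \<kappa> p)"
        unfolding Rm_def fill_image[OF inj_Rm] by blast
      have "s = gn (card D) (\<lambda>p. if \<rho> p = a \<and> (b, \<kappa> p) \<notin> D then b else \<rho> p) \<kappa>"
        unfolding f(2) by (rule gn_cong; drule r(2)) (auto split: if_splits)
      then have "s = Rop a b ?k (gn (card D) \<rho> \<kappa>)" using g[OF r(1)] by simp
      then show "s \<in> Rop a b ?k ` gens D" using r(1) unfolding gens_def by blast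
    qed
  qed
  then show ?thesis unfolding Mod_def using lspan_image[OF lin_Rop] by metis
qed

section \<open>Antisymmetrisation and column moves\<close>

definition alt :: "nat \<Rightarrow> (nat \<Rightarrow> 'c) \<Rightarrow> ('r list \<Rightarrow> real) \<Rightarrow> 'r list \<Rightarrow> real" where
  "alt d \<kappa> f = (\<lambda>xs. \<Sum>\<tau>\<in>colperms d \<kappa>. of_int (sign \<tau>) * act d (inv \<tau>) f xs)"

lemma alt_submod:
  assumes "submod (PG d) V" "f \<in> V"
  shows "alt d \<kappa> f \<in> V"
  unfolding alt_def
proof (rule subsp_sum[OF submod_subsp[OF assms(1)] finite_colperms])
  fix \<tau> assume "\<tau> \<in> colperms d \<kappa>"
  then have "act d (inv \<tau>) \<in> PG d" by (auto simp: PG_def colperms_def permutes_inv)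
  then have "act d (inv \<tau>) f \<in> V" using submodD assms by blast
  then show "(\<lambda>xs. of_int (sign \<tau>) * act d (inv \<tau>) f xs) \<in> V"
    by (rule subsp_scale[OF submod_subsp[OF assms(1)]])
qed

lemma lin_alt: "lin (alt d \<kappa>)"
  by (simp add: lin_def alt_def lin_comb[OF lin_act] sum_distrib_left sum.distrib algebra_simps)

lemma alt_gn:
  "alt d \<kappa>' (gn d \<rho> \<kappa>) = (\<lambda>xs. \<Sum>\<sigma>\<in>colperms d \<kappa>. of_int (sign \<sigma>) * gn d (\<rho> \<circ> \<sigma>) \<kappa>' xs)"
proof
  fix xs
  have "alt d \<kappa>' (gn d \<rho> \<kappa>) xs = (\<Sum>\<tau>\<in>colperms d \<kappa>'. \<Sum>\<sigma>\<in>colperms d \<kappa>. of_int (sign \<tau>) * (of_int (sign \<sigma>) *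
      of_bool (length xs = d \<and> (\<forall>p<d. xs ! p = \<rho> (\<sigma> (\<tau> p))))))"
    unfolding alt_def by (rule sum.cong) (auto simp: act_gn_apply colperms_def sum_distrib_left)
  also have "\<dots> = (\<Sum>\<sigma>\<in>colperms d \<kappa>. of_int (sign \<sigma>) * gn d (\<rho> \<circ> \<sigma>) \<kappa>' xs)"
    by (subst sum.swap) (simp add: gn_def sum_distrib_left mult.left_commute)
  finally show "alt d \<kappa>' (gn d \<rho> \<kappa>) xs = (\<Sum>\<sigma>\<in>colperms d \<kappa>. of_int (sign \<sigma>) * gn d (\<rho> \<circ> \<sigma>) \<kappa>' xs)" .
qed

text \<open>A generator of \<open>D\<close> is antisymmetrised over the new columns. A term whose
  \<open>\<sigma>\<close> does not preserve the new columns takes a displaced box to a box of column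
  \<open>a\<close> whose row also meets column \<open>b\<close>; the two boxes of that row then
  collide in the new column \<open>b\<close> and the term vanishes. The remaining terms are equal,
  since their signs occur twice, so a positive multiple of the new generator lies in the
  module.\<close>

lemma Mod_Cm:
  assumes "finite D" "a \<noteq> b"
  shows "Mod (Cm a b D) \<subseteq> Mod D"
  unfolding Mod_def[of "Cm a b D"]
proof (rule lspan_least)
  let ?d = "card D"
  show "subsp (Mod D)" by (rule submod_subsp[OF submod_Mod])
  show "gens (Cm a b D) \<subseteq> Mod D"
  proof
    fix s assume "s \<in> gens (Cm a b D)"
    then obtain \<rho>' \<kappa>' where f: "fill (Cm a b D) \<rho>' \<kappa>'" "s = gn ?d \<rho>' \<kappa>'"
      by (auto simp: gens_def card_Cm)
    then obtain \<rho> \<kappa> where r: "fill D \<rho> \<kappa>" and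
      e: "\<And>p. p < ?d \<Longrightarrow> (\<rho>' p, \<kappa>' p) =
        (\<lambda>(x, c). if c = a \<and> (x, b) \<notin> D then (x, b) else (x, c)) (\<rho> p, \<kappa> p)"
      unfolding Cm_def fill_image[OF inj_Cm] by blast
    have rho: "\<rho>' p = \<rho> p" and kap: "\<kappa>' p = (if \<kappa> p = a \<and> (\<rho> p, b) \<notin> D then b else \<kappa> p)" if "p < ?d" for p
      using e[OF that] by (auto split: if_splits)
    have bij: "bij_betw (\<lambda>p. (\<rho> p, \<kappa> p)) {..<?d} D" using r by (simp add: fill_def)
    note mem = fill_mem[OF r]
    let ?H = "colperms ?d \<kappa> \<inter> colperms ?d \<kappa>'"
    have z: "gn ?d (\<rho> \<circ> \<sigma>) \<kappa>' = (\<lambda>_. 0)" if s: "\<sigma> \<in> colperms ?d \<kappa> - colperms ?d \<kappa>'" for \<sigma>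
    proof -
      have sp: "\<sigma> permutes {..<?d}" and sk: "\<And>p. p < ?d \<Longrightarrow> \<kappa> (\<sigma> p) = \<kappa> p"
        using s by (auto simp: colperms_def)
      \<comment> \<open>Positions of the displaced boxes. A column permutation that preserves this
        set preserves the new columns as well.\<close>
      define X where "X = {p. p < ?d \<and> \<kappa> p = a \<and> (\<rho> p, b) \<notin> D}"
      have fX: "finite X" by (simp add: X_def)
      have "\<exists>x\<in>X. \<sigma> x \<notin> X"
      proof (rule ccontr)
        assume "\<not> ?thesis"
        then have "\<sigma> ` X \<subseteq> X" by blast
        then have im: "\<sigma> ` X = X"
          using endo_inj_surj[OF fX] permutes_inj_on[OF sp] by blast
        have "\<kappa>' (\<sigma> p) = \<kappa>' p" if p: "p < ?d" for p
        proof -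
          have "\<sigma> p \<in> X \<longleftrightarrow> p \<in> X"
            using im permutes_inj[OF sp] by (metis (full_types) image_iff injD)
          then show ?thesis
            using kap[OF p] kap[OF permutes_less[OF sp p]] sk[OF p] p permutes_less[OF sp p]
            by (auto simp: X_def)
        qed
        then have "\<sigma> \<in> colperms ?d \<kappa>'" using sp by (simp add: colperms_def)
        then show False using s by blast
      qed
      then obtain x where x: "x \<in> X" "\<sigma> x \<notin> X" by blast
      have xd: "x < ?d" "\<kappa> x = a" using x(1) by (auto simp: X_def)
      then have "(\<rho> (\<sigma> x), b) \<in> D"
        using x(2) sk[of x] permutes_less[OF sp, of x] by (auto simp: X_def)
      then obtain q' where q': "q' < ?d" "\<rho> q' = \<rho> (\<sigma> x)" "\<kappa> q' = b" using mem by auto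
      define q where "q = inv \<sigma> q'"
      have q: "q < ?d" "\<sigma> q = q'"
        using permutes_less[OF permutes_inv[OF sp] q'(1)] by (auto simp: q_def permutes_inverses[OF sp])
      have kq: "\<kappa> q = b" using sk[OF q(1)] q(2) q'(3) by simp
      show ?thesis
      proof (rule gn_zero[of x ?d q])
        show "x \<noteq> q" using xd kq assms(2) by auto
        show "\<kappa>' x = \<kappa>' q" using kap[OF xd(1)] kap[OF q(1)] kq x(1) assms(2) by (auto simp: X_def)
      qed (use xd q q' in auto)
    qed
    have "alt ?d \<kappa>' (gn ?d \<rho> \<kappa>) = (\<lambda>xs. real (card ?H) * gn ?d \<rho> \<kappa>' xs)"
    proof
      fix xs
      have "alt ?d \<kappa>' (gn ?d \<rho> \<kappa>) xs = (\<Sum>\<sigma>\<in>?H. of_int (sign \<sigma>) * gn ?d (\<rho> \<circ> \<sigma>) \<kappa>' xs)"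
        unfolding alt_gn by (rule sum.mono_neutral_right) (auto simp: finite_colperms z)
      also have "\<dots> = (\<Sum>\<sigma>\<in>?H. gn ?d \<rho> \<kappa>' xs)"
        by (rule sum.cong) (auto simp: gn_comp sign_def)
      finally show "alt ?d \<kappa>' (gn ?d \<rho> \<kappa>) xs = real (card ?H) * gn ?d \<rho> \<kappa>' xs" by simp
    qed
    moreover have "alt ?d \<kappa>' (gn ?d \<rho> \<kappa>) \<in> Mod D"
      by (rule alt_submod[OF submod_Mod gn_in_Mod[OF r]])
    moreover have "card ?H \<noteq> 0"
      using colperms_id[of ?d \<kappa>] colperms_id[of ?d \<kappa>'] finite_colperms[of ?d \<kappa>]
      by (metis IntI card_0_eq empty_iff finite_Int)
    ultimately have "gn ?d \<rho> \<kappa>' \<in> Mod D"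
      using subsp_scale[OF submod_subsp[OF submod_Mod], of _ D "1 / real (card ?H)"] by force
    moreover have "gn ?d \<rho> \<kappa>' = s" unfolding f(2) by (rule gn_cong) (auto simp: rho)
    ultimately show "s \<in> Mod D" by simp
  qed
qed

section \<open>Reduced words of permutations of the integers\<close>

abbreviation tr :: "int \<Rightarrow> int \<Rightarrow> int \<Rightarrow> int" where
  "tr \<equiv> Transposition.transpose"

definition sr :: "int \<Rightarrow> int \<Rightarrow> int" where
  "sr a = tr a (a + 1)"

text \<open>The first letter of a word acts first.\<close>

fun wprod :: "int list \<Rightarrow> int \<Rightarrow> int" where
  "wprod [] = id"
| "wprod (a # c) = wprod c \<circ> sr a"

text \<open>Reducedness by stripping descents, which suits recursion on the first letter.
  \<open>red_iff\<close> identifies it with having the right product and as many letters as the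
  product has inversions.\<close>

fun red :: "int list \<Rightarrow> (int \<Rightarrow> int) \<Rightarrow> bool" where
  "red [] z \<longleftrightarrow> z = id"
| "red (a # c) z \<longleftrightarrow> z (a + 1) < z a \<and> red c (z \<circ> sr a)"

text \<open>The Rothe diagram, with rows indexed by positions and columns by values.\<close>

definition dg :: "(int \<Rightarrow> int) \<Rightarrow> (int \<times> int) set" where
  "dg z = {(x, c). x < inv z c \<and> c < z x}"

lemma sr_sr [simp]: "sr a (sr a x) = x"
  by (auto simp: sr_def transpose_def)

lemma sr_sr_comp [simp]: "sr a \<circ> sr a = id"
  by auto

lemma sr_simps [simp]: "sr a a = a + 1" "sr a (a + 1) = a" "x \<noteq> a \<Longrightarrow> x \<noteq> a + 1 \<Longrightarrow> sr a x = x"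
  by (auto simp: sr_def transpose_def)

lemma permutation_sr: "permutation (sr a)"
  by (simp add: sr_def permutation_swap_id)

lemma permutation_comp_sr: "permutation z \<Longrightarrow> permutation (z \<circ> sr a)"
  by (rule permutation_compose[OF _ permutation_sr])

lemma permutation_comp_tr: "permutation z \<Longrightarrow> permutation (z \<circ> tr p q)"
  by (rule permutation_compose[OF _ permutation_swap_id])

lemma permutation_inj_eq: "permutation z \<Longrightarrow> z x = z y \<longleftrightarrow> x = y"
  using permutation_bijective bij_is_inj inj_eq by metis

lemma permutation_inv_f: "permutation z \<Longrightarrow> inv z (z x) = x"
  by (simp add: permutation_bijective bij_is_inj)

lemma permutation_f_inv: "permutation z \<Longrightarrow> z (inv z x) = x"
  by (simp add: permutation_bijective bij_is_surj surj_f_inv_f)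

lemma mem_dg: "permutation z \<Longrightarrow> (x, z j) \<in> dg z \<longleftrightarrow> x < j \<and> z j < z x"
  by (simp add: dg_def permutation_inv_f)

lemma permutation_bound:
  assumes "permutation z"
  obtains m :: int where "0 < m" "\<And>x. m \<le> x \<Longrightarrow> z x = x" "\<And>x. x \<le> - m \<Longrightarrow> z x = x"
proof -
  have f: "finite {x. z x \<noteq> x}" using assms permutation by blast
  define m where "m = Max (insert 1 (abs ` {x. z x \<noteq> x})) + 1"
  have ge: "k < m" if "k \<in> insert 1 (abs ` {x. z x \<noteq> x})" for k
    using Max_ge[OF _ that] f by (auto simp: m_def)
  have "z x = x" if "m \<le> \<bar>x\<bar>" for x using ge[of "\<bar>x\<bar>"] that by (cases "z x = x") auto
  moreover have "0 < m" using ge[of 1] by simp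
  ultimately show ?thesis using that[of m] by (metis abs_ge_self abs_le_D2 abs_minus_cancel abs_of_nonneg
        abs_of_nonpos add.inverse_inverse dual_order.trans le_minus_iff minus_le_iff neg_0_le_iff_le order_less_imp_le)
qed

lemma bounded_between:
  fixes z :: "int \<Rightarrow> int"
  assumes z: "permutation z" and m: "\<And>x. m \<le> x \<Longrightarrow> z x = x" "\<And>x. x \<le> - m \<Longrightarrow> z x = x"
    and x: "- m < x" "x < m"
  shows "- m < z x" "z x < m"
proof -
  have fx: "z x = x" if "z (z x) = z x" using that permutation_inj_eq[OF z] by metis
  show "- m < z x"
  proof (rule ccontr)
    assume "\<not> - m < z x"
    then have "z x \<le> - m" by linarith
    with fx[OF m(2)[OF this]] x(1) show False by linarith
  qed
  show "z x < m"
  proof (rule ccontr)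
    assume "\<not> z x < m"
    then have "m \<le> z x" by linarith
    with fx[OF m(1)[OF this]] x(2) show False by linarith
  qed
qed

text \<open>The permutation preserves the open interval from \<open>- m\<close> to \<open>m\<close>
  and is the identity outside, so an inversion with one end outside is impossible.\<close>

lemma dg_bound:
  assumes z: "permutation z" and m: "\<And>x. m \<le> x \<Longrightarrow> z x = x" "\<And>x. x \<le> - m \<Longrightarrow> z x = x"
  shows "dg z \<subseteq> {- m<..<m} \<times> {- m<..<m}"
proof
  fix b assume "b \<in> dg z"
  then obtain x j where b: "b = (x, z j)" "x < j" "z j < z x"
    unfolding dg_def using permutation_f_inv[OF z] by (metis (mono_tags, lifting) case_prodE mem_Collect_eq)
  have xm: "x < m"
  proof (rule ccontr)
    assume "\<not> x < m"
    then show False using b m(1)[of x] m(1)[of j] by simp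
  qed
  have jm: "- m < j"
  proof (rule ccontr)
    assume "\<not> - m < j"
    then show False using b m(2)[of x] m(2)[of j] by simp
  qed
  have xm': "- m < x"
  proof (rule ccontr)
    assume "\<not> - m < x"
    then have zx: "z x = x" using m(2)[of x] by simp
    have "j < m" using b zx xm m(1)[of j] by linarith
    then have "- m < z j" using bounded_between(1)[OF z m] jm by blast
    then show False using b zx \<open>\<not> - m < x\<close> by simp
  qed
  have jm': "j < m"
  proof (rule ccontr)
    assume "\<not> j < m"
    then have "z j = j" using m(1)[of j] by simp
    moreover have "z x < m" using bounded_between(2)[OF z m] xm xm' by blast
    ultimately show False using b \<open>\<not> j < m\<close> by simp
  qed
  show "b \<in> {- m<..<m} \<times> {- m<..<m}"
    using b xm xm' bounded_between[OF z m jm jm'] by simp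
qed

lemma finite_dg: "permutation z \<Longrightarrow> finite (dg z)"
proof -
  assume z: "permutation z"
  obtain m where m0: "0 < m" and m: "\<And>x. m \<le> x \<Longrightarrow> z x = x" "\<And>x. x \<le> - m \<Longrightarrow> z x = x"
    by (rule permutation_bound[OF z]) (rule that)
  have "dg z \<subseteq> {- m<..<m} \<times> {- m<..<m}" using dg_bound[OF z m] .
  then show ?thesis by (rule finite_subset) (simp add: finite_cartesian_product)
qed

text \<open>At a descent only the inversion between the two adjacent positions is lost; all others
  survive with rows \<open>a\<close> and \<open>a + 1\<close> exchanged.\<close>

lemma dg_comp_sr:
  assumes z: "permutation z" and a: "z (a + 1) < z a"
  shows "dg (z \<circ> sr a) = (\<lambda>(x, c). (sr a x, c)) ` (dg z - {(a, z (a + 1))})"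
proof -
  have "(x, c) \<in> dg (z \<circ> sr a) \<longleftrightarrow> (sr a x, c) \<in> dg z \<and> (sr a x, c) \<noteq> (a, z (a + 1))" for x c
  proof -
    define j where "j = inv z c"
    have c: "c = z j" using permutation_f_inv[OF z] by (simp add: j_def)
    have e: "c = (z \<circ> sr a) (sr a j)" using c by simp
    have 1: "(x, c) \<in> dg (z \<circ> sr a) \<longleftrightarrow> x < sr a j \<and> z j < z (sr a x)"
      using mem_dg[OF permutation_comp_sr[OF z], of x a "sr a j"] e by simp
    have 2: "(sr a x, c) \<in> dg z \<longleftrightarrow> sr a x < j \<and> z j < z (sr a x)"
      unfolding c by (rule mem_dg[OF z])
    have 3: "(sr a x, c) = (a, z (a + 1)) \<longleftrightarrow> x = a + 1 \<and> j = a + 1"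
      unfolding c using permutation_inj_eq[OF z] by (metis prod.inject sr_simps(1) sr_simps(2) sr_sr)
    show ?thesis unfolding 1 2 3
      using a by (cases "x = a"; cases "x = a + 1"; cases "j = a"; cases "j = a + 1") auto
  qed
  then have m: "b \<in> dg (z \<circ> sr a) \<longleftrightarrow> (sr a (fst b), snd b) \<in> dg z - {(a, z (a + 1))}" for b
    by (cases b) simp
  show ?thesis
  proof (rule set_eqI)
    fix b
    show "b \<in> dg (z \<circ> sr a) \<longleftrightarrow> b \<in> (\<lambda>(x, c). (sr a x, c)) ` (dg z - {(a, z (a + 1))})"
    proof
      assume "b \<in> dg (z \<circ> sr a)"
      then show "b \<in> (\<lambda>(x, c). (sr a x, c)) ` (dg z - {(a, z (a + 1))})"
        unfolding m by (intro image_eqI[of _ _ "(sr a (fst b), snd b)"]) simp_all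
    qed (unfold m, clarsimp)
  qed
qed

lemma card_dg_comp_sr:
  assumes z: "permutation z" and a: "z (a + 1) < z a"
  shows "card (dg z) = Suc (card (dg (z \<circ> sr a)))"
proof -
  have "inj_on (\<lambda>(x, c). (sr a x, c)) A" for A :: "(int \<times> int) set"
    by (rule inj_onI) (auto dest: arg_cong[of _ _ "sr a"])
  then have "card (dg (z \<circ> sr a)) = card (dg z - {(a, z (a + 1))})"
    unfolding dg_comp_sr[OF assms] by (rule card_image)
  moreover have "(a, z (a + 1)) \<in> dg z" using mem_dg[OF z] a by simp
  ultimately show ?thesis using finite_dg[OF z] by (metis card.remove)
qed

lemma card_dg_comp_sr_ascent:
  assumes z: "permutation z" and a: "z a < z (a + 1)"
  shows "card (dg (z \<circ> sr a)) = Suc (card (dg z))"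
  using card_dg_comp_sr[OF permutation_comp_sr[OF z], of a a] a by (simp add: o_assoc[symmetric])

lemma permutation_wprod: "permutation (wprod c)"
  by (induction c) (auto simp: permutation_id permutation_comp_sr simp del: comp_apply id_apply)

lemma wprod_append: "wprod (c @ d) = wprod d \<circ> wprod c"
  by (induction c) auto

lemma dg_id: "dg id = {}"
  by (auto simp: dg_def)

lemma card_dg_wprod: "card (dg (wprod c)) \<le> length c"
proof (induction c)
  case (Cons a c)
  have "wprod c a < wprod c (a + 1) \<or> wprod c (a + 1) < wprod c a"
    using permutation_inj_eq[OF permutation_wprod, of c a "a + 1"] by linarith
  then show ?case
    using Cons card_dg_comp_sr[OF permutation_wprod, of c a]
      card_dg_comp_sr_ascent[OF permutation_wprod, of c a] by (auto simp del: comp_apply)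
qed (simp add: dg_id del: id_apply)

lemma red_imp: "permutation z \<Longrightarrow> red c z \<Longrightarrow> wprod c = z \<and> length c = card (dg z)"
proof (induction c arbitrary: z)
  case (Cons a c)
  have "wprod c = z \<circ> sr a \<and> length c = card (dg (z \<circ> sr a))"
    using Cons.IH[OF permutation_comp_sr[OF Cons.prems(1)], of a] Cons.prems(2)
    by (simp del: comp_apply)
  then show ?case using card_dg_comp_sr[OF Cons.prems(1), of a] Cons.prems(2)
    by (simp add: o_assoc[symmetric])
qed (simp add: dg_id)

text \<open>If the first letter were an ascent, the remaining word would be shorter than the number
  of inversions of its product, against \<open>card_dg_wprod\<close>.\<close>

lemma red_iff:
  assumes "permutation z"
  shows "red c z \<longleftrightarrow> wprod c = z \<and> length c = card (dg z)"
proof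
  show "wprod c = z \<and> length c = card (dg z) \<Longrightarrow> red c z"
    using assms
  proof (induction c arbitrary: z)
    case (Cons a c)
    have e: "z \<circ> sr a = wprod c" using Cons.prems(1) by (auto simp: o_assoc[symmetric])
    have "z (a + 1) < z a"
    proof (rule ccontr)
      assume "\<not> ?thesis"
      then have "z a < z (a + 1)" using permutation_inj_eq[OF Cons.prems(2), of a "a + 1"] by linarith
      then show False
        using card_dg_comp_sr_ascent[OF Cons.prems(2), of a] e card_dg_wprod[of c] Cons.prems(1)
        by (simp del: comp_apply)
    qed
    moreover from card_dg_comp_sr[OF Cons.prems(2) this]
    have "red c (z \<circ> sr a)"
      using Cons.IH[of "z \<circ> sr a"] Cons.prems e permutation_wprod[of c] by (simp del: comp_apply)
    ultimately show ?case by simp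
  qed simp
qed (use red_imp[OF assms] in blast)

lemma red_letters:
  assumes "permutation z" "red c z" "\<And>x. m \<le> x \<Longrightarrow> z x = x" "\<And>x. x \<le> n \<Longrightarrow> z x = x"
  shows "set c \<subseteq> {n<..<m}"
  using assms
proof (induction c arbitrary: z)
  case (Cons a c)
  have d: "z (a + 1) < z a" using Cons.prems(2) by simp
  have am: "a + 1 < m"
  proof (rule ccontr)
    assume "\<not> a + 1 < m"
    then have m1: "z (a + 1) = a + 1" using Cons.prems(3) by simp
    then have "a + 1 < z a" using d by simp
    then show False
      using m1 Cons.prems(3)[of "z a"] permutation_inj_eq[OF Cons.prems(1), of "z a" a] \<open>\<not> a + 1 < m\<close> by simp
  qed
  have an: "n < a"
  proof (rule ccontr)
    assume "\<not> n < a"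
    then have m1: "z a = a" using Cons.prems(4) by simp
    then have "z (a + 1) < a" using d by simp
    then show False
      using m1 Cons.prems(4)[of "z (a + 1)"] permutation_inj_eq[OF Cons.prems(1), of "z (a + 1)" "a + 1"] \<open>\<not> n < a\<close> by simp
  qed
  have "set c \<subseteq> {n<..<m}"
  proof (rule Cons.IH)
    show "red c (z \<circ> sr a)" using Cons.prems(2) by simp
    show "(z \<circ> sr a) x = x" if "m \<le> x" for x using Cons.prems(3)[OF that] that am by simp
    show "(z \<circ> sr a) x = x" if "x \<le> n" for x using Cons.prems(4)[OF that] that an by simp
  qed (rule permutation_comp_sr[OF Cons.prems(1)])
  then show ?case using am an by simp
qed simp

lemma finite_red:
  assumes "permutation z"
  shows "finite {c. red c z}"
proof -
  obtain m where m0: "0 < m" and m: "\<And>x. m \<le> x \<Longrightarrow> z x = x" "\<And>x. x \<le> - m \<Longrightarrow> z x = x"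
    by (rule permutation_bound[OF assms]) (rule that)
  have "{c. red c z} \<subseteq> {c. set c \<subseteq> {- m<..<m} \<and> length c = card (dg z)}"
    using red_letters[OF assms _ m] red_imp[OF assms] by blast
  then show ?thesis by (rule finite_subset) (simp add: finite_lists_length_eq)
qed

definition descents :: "(int \<Rightarrow> int) \<Rightarrow> int set" where
  "descents z = {a. z (a + 1) < z a}"

lemma finite_descents: assumes "permutation z" shows "finite (descents z)"
proof -
  have "descents z \<subseteq> fst ` dg z"
    using mem_dg[OF assms] by (force simp: descents_def)
  then show ?thesis using finite_dg[OF assms] finite_surj by blast
qed

lemma card_red_descents:
  assumes z: "permutation z" and "z \<noteq> id"
  shows "card {c. red c z} = (\<Sum>a\<in>descents z. card {c. red c (z \<circ> sr a)})"
proof -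
  have e: "{c. red c z} = (\<Union>a\<in>descents z. (#) a ` {c. red c (z \<circ> sr a)})"
  proof (rule set_eqI)
    fix c show "c \<in> {c. red c z} \<longleftrightarrow> c \<in> (\<Union>a\<in>descents z. (#) a ` {c. red c (z \<circ> sr a)})"
      using assms(2) by (cases c) (auto simp: descents_def)
  qed
  have "card (\<Union>a\<in>descents z. (#) a ` {c. red c (z \<circ> sr a)}) =
      (\<Sum>a\<in>descents z. card ((#) a ` {c. red c (z \<circ> sr a)}))"
    using finite_descents[OF z] finite_red[OF permutation_comp_sr[OF z]]
    by (intro card_UN_disjoint) auto
  also have "\<dots> = (\<Sum>a\<in>descents z. card {c. red c (z \<circ> sr a)})"
    by (intro sum.cong refl card_image) (auto simp: inj_on_def)
  finally show ?thesis unfolding e .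
qed

text \<open>Without inversions the permutation is strictly increasing; comparing consecutive values
  inwards from the two fixed ends gives both inequalities.\<close>

lemma dg_empty_iff: "permutation z \<Longrightarrow> dg z = {} \<longleftrightarrow> z = id"
proof
  assume z: "permutation z" and e: "dg z = {}"
  have "red [] z \<or> descents z = {}"
    using e mem_dg[OF z] by (force simp: descents_def)
  have mono: "z x < z y" if "x < y" for x y
    using mem_dg[OF z, of x y] e that permutation_inj_eq[OF z, of x y] by force
  obtain m where m: "0 < m" "\<And>x. m \<le> x \<Longrightarrow> z x = x" "\<And>x. x \<le> - m \<Longrightarrow> z x = x"
    by (rule permutation_bound[OF z]) (rule that)
  have le: "z x \<le> x" for x
  proof (induction "nat (m - x)" arbitrary: x)
    case 0
    then show ?case using m(2)[of x] by simp
  next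
    case (Suc n)
    have "z (x + 1) \<le> x + 1" using Suc by simp
    then show ?case using mono[of x "x + 1"] by simp
  qed
  have ge: "x \<le> z x" for x
  proof (induction "nat (x + m)" arbitrary: x)
    case 0
    then show ?case using m(3)[of x] by simp
  next
    case (Suc n)
    have "x - 1 \<le> z (x - 1)" using Suc by simp
    then show ?case using mono[of "x - 1" x] by simp
  qed
  show "z = id" using le ge by (auto intro!: ext order.antisym)
qed (simp add: dg_id)

section \<open>The transition formula\<close>

text \<open>The condition for \<open>v \<circ> tr p q\<close> to cover \<open>v\<close> in Bruhat
  order, that is, to have exactly one more inversion.\<close>

definition cov :: "(int \<Rightarrow> int) \<Rightarrow> int \<Rightarrow> int \<Rightarrow> bool" where
  "cov v p q \<longleftrightarrow> p < q \<and> v p < v q \<and> (\<forall>k. p < k \<and> k < q \<longrightarrow> \<not> (v p < v k \<and> v k < v q))"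

definition rcov :: "(int \<Rightarrow> int) \<Rightarrow> int \<Rightarrow> int set" where
  "rcov v r = {s. cov v r s}"

definition lcov :: "(int \<Rightarrow> int) \<Rightarrow> int \<Rightarrow> int set" where
  "lcov v r = {i. cov v i r}"

lemma finite_rcov: assumes v: "permutation v" shows "finite (rcov v r)"
proof -
  obtain m where m: "0 < m" "\<And>x. m \<le> x \<Longrightarrow> v x = x" "\<And>x. x \<le> - m \<Longrightarrow> v x = x"
    by (rule permutation_bound[OF v]) (rule that)
  \<comment> \<open>A fixed point to the right of \<open>r\<close> with value above
    \<open>v r\<close>. It would lie between \<open>r\<close> and any \<open>s\<close> beyond it,
    both in position and in value.\<close>
  define M where "M = max m (max (r + 1) (v r + 1))"
  have "s \<le> M" if "cov v r s" for s
  proof (rule ccontr)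
    assume "\<not> s \<le> M"
    then have "r < M \<and> M < s" "v r < v M" "v M < v s" using m(2)[of M] m(2)[of s] by (auto simp: M_def)
    then show False using that unfolding cov_def by blast
  qed
  then have "rcov v r \<subseteq> {r..M}" by (auto simp: rcov_def cov_def)
  then show ?thesis by (rule finite_subset) simp
qed

lemma finite_lcov: assumes v: "permutation v" shows "finite (lcov v r)"
proof -
  obtain m where m: "0 < m" "\<And>x. m \<le> x \<Longrightarrow> v x = x" "\<And>x. x \<le> - m \<Longrightarrow> v x = x"
    by (rule permutation_bound[OF v]) (rule that)
  define M where "M = min (- m) (min (r - 1) (v r - 1))"
  have "M \<le> s" if "cov v s r" for s
  proof (rule ccontr)
    assume "\<not> M \<le> s"
    then have "s < M \<and> M < r" "v s < v M" "v M < v r" using m(3)[of M] m(3)[of s] by (auto simp: M_def)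
    then show False using that unfolding cov_def by blast
  qed
  then have "lcov v r \<subseteq> {M..r}" by (auto simp: lcov_def cov_def)
  then show ?thesis by (rule finite_subset) simp
qed

text \<open>The contribution of one word to the difference of the two sides of the transition
  formula at \<open>r\<close>.\<close>

definition Acount :: "(int \<Rightarrow> int) \<Rightarrow> int \<Rightarrow> int list \<Rightarrow> int" where
  "Acount v r c = (\<Sum>s\<in>rcov v r. of_bool (red c (v \<circ> tr r s))) - (\<Sum>i\<in>lcov v r. of_bool (red c (v \<circ> tr i r)))"

definition rem :: "int list \<Rightarrow> nat \<Rightarrow> int list" where
  "rem c t = take t c @ drop (Suc t) c"

text \<open>Reading the word as a wiring diagram, \<open>wprod (take t c) r\<close> is the place of
  wire \<open>r\<close> before letter \<open>t\<close>. Deletions that leave a reduced word of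
  \<open>v\<close> count positively if \<open>r\<close> enters the deleted crossing on the left and
  negatively if on the right.\<close>

definition Bcount :: "(int \<Rightarrow> int) \<Rightarrow> int \<Rightarrow> int list \<Rightarrow> int" where
  "Bcount v r c = (\<Sum>t<length c. of_bool (red (rem c t) v) *
      (of_bool (wprod (take t c) r = c ! t) - of_bool (wprod (take t c) r = c ! t + 1)))"

lemma sr_eq_iff: "sr a x = y \<longleftrightarrow> x = sr a y"
  by auto

lemma tr_sr: "tr p q \<circ> sr a = sr a \<circ> tr (sr a p) (sr a q)"
proof
  fix x
  show "(tr p q \<circ> sr a) x = (sr a \<circ> tr (sr a p) (sr a q)) x"
    by (cases "x = sr a p"; cases "x = sr a q")
      (auto simp: transpose_def sr_eq_iff)
qed

text \<open>An exchange that touches neither \<open>a\<close> nor \<open>a + 1\<close> keeps the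
  ascent. One that touches only one of them keeps it too, or leaves the other strictly between in
  position and value, which a cover forbids.\<close>

lemma cov_ascent:
  assumes v: "permutation v" and a: "v a < v (a + 1)"
  shows "cov v p q \<and> (v \<circ> tr p q) (a + 1) < (v \<circ> tr p q) a \<longleftrightarrow> p = a \<and> q = a + 1"
proof
  assume "p = a \<and> q = a + 1"
  then show "cov v p q \<and> (v \<circ> tr p q) (a + 1) < (v \<circ> tr p q) a"
    using a by (auto simp: cov_def)
next
  assume *: "cov v p q \<and> (v \<circ> tr p q) (a + 1) < (v \<circ> tr p q) a"
  then have pq: "p < q" "v p < v q" and between: "\<And>k. p < k \<Longrightarrow> k < q \<Longrightarrow> \<not> (v p < v k \<and> v k < v q)"
    by (auto simp: cov_def)
  have t: "(v \<circ> tr p q) x = (if x = p then v q else if x = q then v p else v x)" for x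
    by (simp add: transpose_def)
  have d: "(if a + 1 = p then v q else if a + 1 = q then v p else v (a + 1)) <
      (if a = p then v q else if a = q then v p else v a)"
    using * unfolding t by blast
  consider "p = a" "q = a + 1" | "p = a" "q \<noteq> a + 1" | "p = a + 1" | "q = a" | "q = a + 1" "p \<noteq> a"
    | "p \<noteq> a" "p \<noteq> a + 1" "q \<noteq> a" "q \<noteq> a + 1" by blast
  then show "p = a \<and> q = a + 1"
  proof cases
    case 2
    then show ?thesis using d pq a between[of "a + 1"] by simp
  next
    case 3
    then show ?thesis using d pq a by simp
  next
    case 4
    then show ?thesis using d pq a by simp
  next
    case 5
    then show ?thesis using d pq a between[of a] by simp
  next
    case 6
    then show ?thesis using d a by simp
  qed simp
qed

lemma sr_less: "p < q \<Longrightarrow> \<not> (p = a \<and> q = a + 1) \<Longrightarrow> sr a p < sr a q"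
  by (cases "p = a"; cases "p = a + 1"; cases "q = a"; cases "q = a + 1") auto

text \<open>Renaming positions by \<open>sr a\<close> matches covers of \<open>v\<close> with covers
  of \<open>v \<circ> sr a\<close>; the order of \<open>a\<close> and \<open>a + 1\<close> changes,
  and requiring a descent at \<open>a\<close> compensates for it. The pair \<open>a\<close>,
  \<open>a + 1\<close> is excluded because that cover of \<open>v \<circ> sr a\<close> is
  \<open>v\<close> itself.\<close>

lemma cov_descent:
  assumes v: "permutation v" and a: "v (a + 1) < v a"
  shows "cov v p q \<and> (v \<circ> tr p q) (a + 1) < (v \<circ> tr p q) a \<longleftrightarrow>
    cov (v \<circ> sr a) (sr a p) (sr a q) \<and> \<not> (sr a p = a \<and> sr a q = a + 1)"
proof -
  have bt: "cov (v \<circ> sr a) (sr a p) (sr a q) \<longleftrightarrow> sr a p < sr a q \<and> v p < v q \<and>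
    (\<forall>k. sr a p < sr a k \<and> sr a k < sr a q \<longrightarrow> \<not> (v p < v k \<and> v k < v q))"
    unfolding cov_def by (simp, metis sr_sr)
  consider "p = a" "q = a + 1" | "p = a + 1" "q = a" | "\<not> (p = a \<and> q = a + 1)" "\<not> (p = a + 1 \<and> q = a)" by blast
  then show ?thesis
  proof cases
    case 1
    then show ?thesis using a by (auto simp: cov_def)
  next
    case 2
    then show ?thesis using a by (auto simp: cov_def)
  next
    case 3
    have lt: "sr a p < sr a q \<longleftrightarrow> p < q"
      using sr_less[of p q a] sr_less[of "sr a p" "sr a q" a] 3 by (auto simp: sr_eq_iff)
    have ne: "\<not> (sr a p = a \<and> sr a q = a + 1)" using 3 by (auto simp: sr_eq_iff)
    show ?thesis
    proof (cases "p < q \<and> v p < v q")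
      case False
      then show ?thesis using lt bt by (auto simp: cov_def)
    next
      case True
      have k1: "sr a p < sr a k \<and> sr a k < sr a q \<longleftrightarrow> p < k \<and> k < q" if "k \<noteq> a" "k \<noteq> a + 1" for k
      proof -
        have "sr a p < k \<longleftrightarrow> p < k" using that by (cases "p = a"; cases "p = a + 1") auto
        moreover have "k < sr a q \<longleftrightarrow> k < q" using that by (cases "q = a"; cases "q = a + 1") auto
        ultimately show ?thesis using that by simp
      qed
      let ?P = "\<lambda>k. v p < v k \<and> v k < v q"
      have c1: "cov v p q \<longleftrightarrow> (\<forall>k. k \<noteq> a \<and> k \<noteq> a + 1 \<and> p < k \<and> k < q \<longrightarrow> \<not> ?P k) \<and>
         (p < a \<and> a < q \<longrightarrow> \<not> ?P a) \<and> (p < a + 1 \<and> a + 1 < q \<longrightarrow> \<not> ?P (a + 1))"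
      proof -
        have "cov v p q \<longleftrightarrow> (\<forall>k. p < k \<and> k < q \<longrightarrow> \<not> ?P k)" using True by (simp add: cov_def)
        moreover have "(\<forall>k. Q k) \<longleftrightarrow> (\<forall>k. k \<noteq> a \<and> k \<noteq> a + 1 \<longrightarrow> Q k) \<and> Q a \<and> Q (a + 1)"
          for Q :: "int \<Rightarrow> bool" by metis
        note this[of "\<lambda>k. p < k \<and> k < q \<longrightarrow> \<not> ?P k"]
        ultimately show ?thesis by (simp only: imp_conjL)
      qed
      have c2: "cov (v \<circ> sr a) (sr a p) (sr a q) \<longleftrightarrow>
         (\<forall>k. k \<noteq> a \<and> k \<noteq> a + 1 \<and> p < k \<and> k < q \<longrightarrow> \<not> ?P k) \<and>
         (sr a p < a + 1 \<and> a + 1 < sr a q \<longrightarrow> \<not> ?P a) \<and> (sr a p < a \<and> a < sr a q \<longrightarrow> \<not> ?P (a + 1))"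
      proof -
        have "(\<forall>k. Q k) \<longleftrightarrow> (\<forall>k. k \<noteq> a \<and> k \<noteq> a + 1 \<longrightarrow> Q k) \<and> Q a \<and> Q (a + 1)"
          for Q :: "int \<Rightarrow> bool" by metis
        from this[of "\<lambda>k. sr a p < sr a k \<and> sr a k < sr a q \<longrightarrow> \<not> ?P k"]
        have "(\<forall>k. sr a p < sr a k \<and> sr a k < sr a q \<longrightarrow> \<not> ?P k) \<longleftrightarrow>
          (\<forall>k. k \<noteq> a \<and> k \<noteq> a + 1 \<and> sr a p < sr a k \<and> sr a k < sr a q \<longrightarrow> \<not> ?P k) \<and>
          (sr a p < sr a a \<and> sr a a < sr a q \<longrightarrow> \<not> ?P a) \<and>
          (sr a p < sr a (a + 1) \<and> sr a (a + 1) < sr a q \<longrightarrow> \<not> ?P (a + 1))"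
          by (simp only: imp_conjL)
        moreover have "(\<forall>k. k \<noteq> a \<and> k \<noteq> a + 1 \<and> sr a p < sr a k \<and> sr a k < sr a q \<longrightarrow> \<not> ?P k) \<longleftrightarrow>
          (\<forall>k. k \<noteq> a \<and> k \<noteq> a + 1 \<and> p < k \<and> k < q \<longrightarrow> \<not> ?P k)" using k1 by blast
        moreover have "cov (v \<circ> sr a) (sr a p) (sr a q) \<longleftrightarrow>
          (\<forall>k. sr a p < sr a k \<and> sr a k < sr a q \<longrightarrow> \<not> ?P k)"
          unfolding bt using True lt by simp
        ultimately show ?thesis unfolding sr_simps(1,2) by (simp only:)
      qed
      \<comment> \<open>Only \<open>a\<close> and \<open>a + 1\<close> can enter or leave the range
        between \<open>p\<close> and \<open>q\<close>, and the descent condition decides exactly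
        these cases.\<close>
      have "(p < a \<and> a < q \<longrightarrow> \<not> ?P a) \<and> (p < a + 1 \<and> a + 1 < q \<longrightarrow> \<not> ?P (a + 1)) \<and>
          (v \<circ> tr p q) (a + 1) < (v \<circ> tr p q) a \<longleftrightarrow>
         (sr a p < a + 1 \<and> a + 1 < sr a q \<longrightarrow> \<not> ?P a) \<and> (sr a p < a \<and> a < sr a q \<longrightarrow> \<not> ?P (a + 1))"
      proof -
        have t: "(v \<circ> tr p q) x = (if x = p then v q else if x = q then v p else v x)" for x
          by (simp add: transpose_def)
        have n: "v a \<noteq> v q" if "a \<noteq> q" using that permutation_inj_eq[OF v] by simp
        have n': "v (a + 1) \<noteq> v p" if "a + 1 \<noteq> p" using that permutation_inj_eq[OF v] by simp
        have pq: "p < q" "v p < v q" using True by auto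
        consider "p = a" "q \<noteq> a + 1" | "p = a + 1" | "q = a" | "q = a + 1" "p \<noteq> a"
          | "p \<noteq> a" "p \<noteq> a + 1" "q \<noteq> a" "q \<noteq> a + 1" using 3 by blast
        then show ?thesis
        proof cases
          case 1
          then show ?thesis unfolding t using pq a by simp
        next
          case 2
          then show ?thesis unfolding t using pq a n by simp linarith
        next
          case 3
          then show ?thesis unfolding t using pq a n' by simp linarith
        next
          case 4
          then show ?thesis unfolding t using pq a by simp
        next
          case 5
          then have "(p < a + 1) = (p < a)" "(a + 1 < q) = (a < q)" by auto
          with 5 show ?thesis unfolding t using pq a by simp
        qed
      qed
      note R = this
      have conj: "((F \<and> A \<and> B) \<and> E) = ((F \<and> C1 \<and> C2) \<and> N)"
        if "(A \<and> B \<and> E) = (C1 \<and> C2)" N for F A B E C1 C2 N :: bool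
        using that by blast
      show ?thesis unfolding c1 c2 by (rule conj[OF R ne])
    qed
  qed
qed

definition rset :: "(int \<Rightarrow> int) \<Rightarrow> int \<Rightarrow> int list \<Rightarrow> int set" where
  "rset v r c = {s. cov v r s \<and> red c (v \<circ> tr r s)}"

definition lset :: "(int \<Rightarrow> int) \<Rightarrow> int \<Rightarrow> int list \<Rightarrow> int set" where
  "lset v r c = {i. cov v i r \<and> red c (v \<circ> tr i r)}"

lemma finite_rset: "permutation v \<Longrightarrow> finite (rset v r c)"
  by (rule finite_subset[OF _ finite_rcov]) (auto simp: rset_def rcov_def)

lemma finite_lset: "permutation v \<Longrightarrow> finite (lset v r c)"
  by (rule finite_subset[OF _ finite_lcov]) (auto simp: lset_def lcov_def)

lemma Acount_card:
  assumes "permutation v"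
  shows "Acount v r c = int (card (rset v r c)) - int (card (lset v r c))"
proof -
  have "rset v r c = rcov v r \<inter> {s. red c (v \<circ> tr r s)}" "lset v r c = lcov v r \<inter> {i. red c (v \<circ> tr i r)}"
    by (auto simp: rset_def lset_def rcov_def lcov_def)
  then show ?thesis unfolding Acount_def using assms
    by (simp add: sum_of_bool_eq finite_rcov finite_lcov)
qed

lemma tr_adj: "v \<circ> tr a (a + 1) \<circ> sr a = v"
  unfolding sr_def by (simp add: o_assoc[symmetric])

lemma tr_comp_sr: "v \<circ> tr p q \<circ> sr a = v \<circ> sr a \<circ> tr (sr a p) (sr a q)"
  by (simp add: o_assoc[symmetric] tr_sr)

lemma red_tr_Cons: "red (a # c) (v \<circ> tr p q) \<longleftrightarrow>
    (v \<circ> tr p q) (a + 1) < (v \<circ> tr p q) a \<and> red c (v \<circ> sr a \<circ> tr (sr a p) (sr a q))"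
  by (simp only: red.simps tr_comp_sr)

text \<open>At an ascent the only cover that can start with \<open>a\<close> is the exchange of
  \<open>a\<close> and \<open>a + 1\<close>. At a descent the covers become those of
  \<open>v \<circ> sr a\<close>, except for the one leading back to \<open>v\<close>; the correction
  for it is the last summand.\<close>

lemma Acount_Cons:
  assumes v: "permutation v"
  shows "Acount v r (a # c) = (if v (a + 1) < v a then Acount (v \<circ> sr a) (sr a r) c else 0) +
    of_bool (red c v) * (of_bool (r = a) - of_bool (r = a + 1))"
proof (cases "v (a + 1) < v a")
  case False
  then have a: "v a < v (a + 1)" using permutation_inj_eq[OF v, of a "a + 1"] by linarith
  have *: "cov v p q \<and> red (a # c) (v \<circ> tr p q) \<longleftrightarrow> p = a \<and> q = a + 1 \<and> red c v" for p q
  proof -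
    have "cov v p q \<and> red (a # c) (v \<circ> tr p q) \<longleftrightarrow>
      p = a \<and> q = a + 1 \<and> red c (v \<circ> tr p q \<circ> sr a)"
      unfolding red.simps using cov_ascent[OF v a, of p q] by blast
    then show ?thesis using tr_adj by metis
  qed
  have "rset v r (a # c) = (if r = a \<and> red c v then {a + 1} else {})"
    "lset v r (a # c) = (if r = a + 1 \<and> red c v then {a} else {})"
    unfolding rset_def lset_def * by auto
  then show ?thesis unfolding Acount_card[OF v] using False by auto
next
  case True
  let ?u = "v \<circ> sr a"
  have u: "permutation ?u" by (rule permutation_comp_sr[OF v])
  have *: "cov v p q \<and> red (a # c) (v \<circ> tr p q) \<longleftrightarrow> cov ?u (sr a p) (sr a q) \<and>
      \<not> (sr a p = a \<and> sr a q = a + 1) \<and> red c (?u \<circ> tr (sr a p) (sr a q))" for p q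
    unfolding red_tr_Cons using cov_descent[OF v True, of p q] by blast
  have cu: "cov ?u a (a + 1)" using True by (auto simp: cov_def)
  have ut: "?u \<circ> tr a (a + 1) = v" unfolding sr_def by (simp add: o_assoc[symmetric])
  have "sr a ` rset v r (a # c) = rset ?u (sr a r) c - (if sr a r = a then {a + 1} else {})"
  proof (rule set_eqI)
    fix s
    have "s \<in> sr a ` rset v r (a # c) \<longleftrightarrow> sr a s \<in> rset v r (a # c)"
      by (metis image_iff sr_sr)
    then show "s \<in> sr a ` rset v r (a # c) \<longleftrightarrow>
        s \<in> rset ?u (sr a r) c - (if sr a r = a then {a + 1} else {})"
      unfolding rset_def mem_Collect_eq * by auto
  qed
  moreover have "inj_on (sr a) X" for X by (rule inj_onI) (metis sr_sr)
  ultimately have cr: "card (rset v r (a # c)) = card (rset ?u (sr a r) c - (if sr a r = a then {a + 1} else {}))"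
    by (metis card_image)
  have "sr a ` lset v r (a # c) = lset ?u (sr a r) c - (if sr a r = a + 1 then {a} else {})"
  proof (rule set_eqI)
    fix s
    have "s \<in> sr a ` lset v r (a # c) \<longleftrightarrow> sr a s \<in> lset v r (a # c)"
      by (metis image_iff sr_sr)
    then show "s \<in> sr a ` lset v r (a # c) \<longleftrightarrow>
        s \<in> lset ?u (sr a r) c - (if sr a r = a + 1 then {a} else {})"
      unfolding lset_def mem_Collect_eq * by auto
  qed
  moreover have "inj_on (sr a) X" for X by (rule inj_onI) (metis sr_sr)
  ultimately have cl: "card (lset v r (a # c)) = card (lset ?u (sr a r) c - (if sr a r = a + 1 then {a} else {}))"
    by (metis card_image)
  have m1: "a + 1 \<in> rset ?u a c \<longleftrightarrow> red c v" unfolding rset_def mem_Collect_eq ut using cu by simp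
  have m2: "a \<in> lset ?u (a + 1) c \<longleftrightarrow> red c v" unfolding lset_def mem_Collect_eq ut using cu by simp
  have m1': "card (rset ?u a c) > 0" if "red c v"
    using m1 that finite_rset[OF u] by (auto simp: card_gt_0_iff)
  have m2': "card (lset ?u (a + 1) c) > 0" if "red c v"
    using m2 that finite_lset[OF u] by (auto simp: card_gt_0_iff)
  have 1: "int (card (rset v r (a # c))) = int (card (rset ?u (sr a r) c)) - of_bool (red c v) * of_bool (r = a + 1)"
  proof (cases "r = a + 1")
    case True
    then show ?thesis unfolding cr using m1 m1' finite_rset[OF u, of a c]
      by (cases "red c v") (auto simp: card_Diff_singleton of_nat_diff simp del: comp_apply)
  next
    case False
    then have "sr a r \<noteq> a" by (auto simp: sr_eq_iff)
    then show ?thesis unfolding cr using False by simp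
  qed
  have 2: "int (card (lset v r (a # c))) = int (card (lset ?u (sr a r) c)) - of_bool (red c v) * of_bool (r = a)"
  proof (cases "r = a")
    case True
    then show ?thesis unfolding cl using m2 m2' finite_lset[OF u, of "a + 1" c]
      by (cases "red c v") (auto simp: card_Diff_singleton of_nat_diff simp del: comp_apply)
  next
    case False
    then have "sr a r \<noteq> a + 1" by (auto simp: sr_eq_iff)
    then show ?thesis unfolding cl using False by simp
  qed
  show ?thesis unfolding Acount_card[OF v] Acount_card[OF u] 1 2 using True
    by (auto simp: algebra_simps)
qed

lemma Acount_Nil: "permutation v \<Longrightarrow> Acount v r [] = 0"
proof -
  assume v: "permutation v"
  have "\<not> (cov v p q \<and> red [] (v \<circ> tr p q))" for p q
  proof
    assume *: "cov v p q \<and> red [] (v \<circ> tr p q)"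
    then have "v = tr p q" by (metis comp_id o_assoc red.simps(1) transpose_comp_involutory)
    then show False using * by (auto simp: cov_def)
  qed
  then have "rset v r [] = {}" "lset v r [] = {}" unfolding rset_def lset_def by blast+
  then show ?thesis unfolding Acount_card[OF v] by simp
qed

text \<open>Deleting the first letter gives the last summand. Deleting a later one keeps
  \<open>a\<close>, which then has to be a descent of \<open>v\<close> and carries wire
  \<open>r\<close> to \<open>sr a r\<close>.\<close>

lemma Bcount_Cons:
  "Bcount v r (a # c) = (if v (a + 1) < v a then Bcount (v \<circ> sr a) (sr a r) c else 0) +
    of_bool (red c v) * (of_bool (r = a) - of_bool (r = a + 1))"
proof -
  have "Bcount v r (a # c) = of_bool (red c v) * (of_bool (r = a) - of_bool (r = a + 1)) +
    (\<Sum>t<length c. of_bool (v (a + 1) < v a \<and> red (rem c t) (v \<circ> sr a)) *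
      (of_bool (wprod (take t c) (sr a r) = c ! t) - of_bool (wprod (take t c) (sr a r) = c ! t + 1)))"
    unfolding Bcount_def rem_def by (simp add: sum.lessThan_Suc_shift del: sum.lessThan_Suc)
  then show ?thesis by (simp add: Bcount_def)
qed

text \<open>Both sides obey the same recursion on the first letter. The identity holds for each
  single word, reduced or not, and can therefore be summed over any family of objects with
  words.\<close>

lemma Acount_eq_Bcount: "permutation v \<Longrightarrow> Acount v r c = Bcount v r c"
proof (induction c arbitrary: v r)
  case (Cons a c)
  then show ?case using permutation_comp_sr by (simp only: Acount_Cons Bcount_Cons)
qed (simp add: Acount_Nil Bcount_def)

lemma Bcount_card:
  "Bcount v r c =
    int (card {t. t < length c \<and> red (rem c t) v \<and> wprod (take t c) r = c ! t}) -
    int (card {t. t < length c \<and> red (rem c t) v \<and> wprod (take t c) r = c ! t + 1})"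
proof -
  have "Bcount v r c = (\<Sum>t<length c. of_bool (red (rem c t) v \<and> wprod (take t c) r = c ! t)) -
    (\<Sum>t<length c. of_bool (red (rem c t) v \<and> wprod (take t c) r = c ! t + 1))"
    unfolding Bcount_def sum_subtractf[symmetric] by (intro sum.cong) auto
  also have "\<dots> = int (card ({..<length c} \<inter> {t. red (rem c t) v \<and> wprod (take t c) r = c ! t})) -
     int (card ({..<length c} \<inter> {t. red (rem c t) v \<and> wprod (take t c) r = c ! t + 1}))"
    by (simp add: sum_of_bool_eq)
  also have "{..<length c} \<inter> {t. red (rem c t) v \<and> wprod (take t c) r = c ! t} =
     {t. t < length c \<and> red (rem c t) v \<and> wprod (take t c) r = c ! t}" by auto
  also have "{..<length c} \<inter> {t. red (rem c t) v \<and> wprod (take t c) r = c ! t + 1} =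
     {t. t < length c \<and> red (rem c t) v \<and> wprod (take t c) r = c ! t + 1}" by auto
  finally show ?thesis .
qed

text \<open>
  Marked words are words with a position whose deletion leaves a reduced word of \<open>v\<close>; the sign
  says which of the two wires crossing there is \<open>r\<close>.
\<close>

definition marked :: "'o set \<Rightarrow> ('o \<Rightarrow> int list) \<Rightarrow> (int \<Rightarrow> int) \<Rightarrow> int \<Rightarrow> int \<Rightarrow> ('o \<times> nat) set" where
  "marked T wd v r e = {(x, t). x \<in> T \<and> t < length (wd x) \<and> red (rem (wd x) t) v \<and>
      wprod (take t (wd x)) r = wd x ! t + e}"

lemma take_rem: "t < length c \<Longrightarrow> take t (rem c t) = take t c"
  by (simp add: rem_def)

lemma rem_restore: "t < length c \<Longrightarrow> c = take t (rem c t) @ (c ! t) # drop t (rem c t)"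
  by (simp add: rem_def id_take_nth_drop[symmetric])

text \<open>The deleted letter is recovered from the position of the mark and the place of wire
  \<open>r\<close> there, so a marked word is determined by its shortened word and its mark.\<close>

lemma finite_marked_words:
  assumes "permutation v"
  shows "finite (marked UNIV id v r e)"
proof -
  let ?f = "\<lambda>(c, t). (take t c @ (wprod (take t c) r - e) # drop t c, t)"
  have "marked UNIV id v r e \<subseteq> ?f ` ({c. red c v} \<times> {.. card (dg v)})"
  proof
    fix b assume "b \<in> marked UNIV id v r e"
    then obtain c t where b: "b = (c, t)" "t < length c" "red (rem c t) v" "wprod (take t c) r = c ! t + e"
      by (auto simp: marked_def)
    have "length (rem c t) = card (dg v)" using red_imp[OF assms b(3)] by simp
    then have "t \<le> card (dg v)" using b(2) by (simp add: rem_def)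
    moreover have "?f (rem c t, t) = b" using b rem_restore[OF b(2)] take_rem[OF b(2)] by simp
    ultimately show "b \<in> ?f ` ({c. red c v} \<times> {.. card (dg v)})"
      using b(3) by (intro image_eqI[of _ _ "(rem c t, t)"]) auto
  qed
  then show ?thesis by (rule finite_subset) (simp add: finite_red[OF assms])
qed

lemma finite_marked:
  assumes "permutation v" "\<And>c. finite {x \<in> T. wd x = c}"
  shows "finite (marked T wd v r e)"
proof -
  have "marked T wd v r e \<subseteq> (\<Union>(c, t)\<in>marked UNIV id v r e. {x \<in> T. wd x = c} \<times> {t})"
    by (auto simp: marked_def)
  then show ?thesis
    by (rule finite_subset) (use finite_marked_words[OF assms(1)] assms(2) in auto)
qed

text \<open>Summing the identity for single words over the family turns its right-hand side into the
  difference of the numbers of positive and negative marks. A transition formula is thus reduced to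
  a matching of these marks.\<close>

theorem transition_marked:
  assumes v: "permutation v" and fin: "\<And>c. finite {x \<in> T. wd x = c}"
    and eq: "card (marked T wd v r 0) = card (marked T wd v r 1)"
  shows "(\<Sum>s\<in>rcov v r. card {x \<in> T. red (wd x) (v \<circ> tr r s)}) =
    (\<Sum>i\<in>lcov v r. card {x \<in> T. red (wd x) (v \<circ> tr i r)})"
proof -
  have finz: "finite {x \<in> T. red (wd x) z}" if "permutation z" for z
  proof -
    have "{x \<in> T. red (wd x) z} \<subseteq> (\<Union>c\<in>{c. red c z}. {x \<in> T. wd x = c})" by auto
    then show ?thesis by (rule finite_subset) (use fin finite_red[OF that] in auto)
  qed
  \<comment> \<open>The family may be infinite; only these finitely many members contribute to one
    of the counts.\<close>
  define T' where "T' = fst ` marked T wd v r 0 \<union> fst ` marked T wd v r 1 \<union>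
    (\<Union>s\<in>rcov v r. {x \<in> T. red (wd x) (v \<circ> tr r s)}) \<union> (\<Union>i\<in>lcov v r. {x \<in> T. red (wd x) (v \<circ> tr i r)})"
  have fT: "finite T'" unfolding T'_def
    using finite_marked[OF v, of T wd] fin finite_rcov[OF v] finite_lcov[OF v] finz permutation_comp_tr[OF v]
    by auto
  have sT: "T' \<subseteq> T" by (auto simp: T'_def marked_def)
  have c1: "(\<Sum>x\<in>T'. of_bool (red (wd x) (v \<circ> tr r s))) = int (card {x \<in> T. red (wd x) (v \<circ> tr r s)})"
    if "s \<in> rcov v r" for s
  proof -
    have "T' \<inter> {x. red (wd x) (v \<circ> tr r s)} = {x \<in> T. red (wd x) (v \<circ> tr r s)}"
      using sT that unfolding T'_def by blast
    then show ?thesis using fT by (simp add: sum_of_bool_eq)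
  qed
  have c2: "(\<Sum>x\<in>T'. of_bool (red (wd x) (v \<circ> tr i r))) = int (card {x \<in> T. red (wd x) (v \<circ> tr i r)})"
    if "i \<in> lcov v r" for i
  proof -
    have "T' \<inter> {x. red (wd x) (v \<circ> tr i r)} = {x \<in> T. red (wd x) (v \<circ> tr i r)}"
      using sT that unfolding T'_def by blast
    then show ?thesis using fT by (simp add: sum_of_bool_eq)
  qed
  have mk: "(\<Sum>x\<in>T'. int (card {t. t < length (wd x) \<and> red (rem (wd x) t) v \<and> wprod (take t (wd x)) r = wd x ! t + e}))
      = int (card (marked T wd v r e))" if "e = 0 \<or> e = 1" for e
  proof -
    let ?X = "\<lambda>x. {t. t < length (wd x) \<and> red (rem (wd x) t) v \<and>
        wprod (take t (wd x)) r = wd x ! t + e}"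
    have "marked T wd v r e = (SIGMA x:T'. ?X x)"
    proof
      show "marked T wd v r e \<subseteq> (SIGMA x:T'. ?X x)"
      proof
        fix b assume b: "b \<in> marked T wd v r e"
        have "fst b \<in> fst ` marked T wd v r e" using b by (rule imageI)
        then have "fst b \<in> T'" using that unfolding T'_def by (elim disjE) simp_all
        then show "b \<in> (SIGMA x:T'. ?X x)" using b by (auto simp: marked_def)
      qed
      show "(SIGMA x:T'. ?X x) \<subseteq> marked T wd v r e" using sT by (auto simp: marked_def)
    qed
    moreover have "finite (?X x)" for x by (rule finite_subset[of _ "{..<length (wd x)}"]) auto
    ultimately show ?thesis using fT by (simp add: card_SigmaI)
  qed
  have "int (\<Sum>s\<in>rcov v r. card {x \<in> T. red (wd x) (v \<circ> tr r s)}) -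
      int (\<Sum>i\<in>lcov v r. card {x \<in> T. red (wd x) (v \<circ> tr i r)}) = (\<Sum>x\<in>T'. Acount v r (wd x))"
    unfolding Acount_def sum_subtractf sum.swap[of _ _ T'] using c1 c2 by simp
  also have "\<dots> = (\<Sum>x\<in>T'. Bcount v r (wd x))" using Acount_eq_Bcount[OF v] by simp
  also have "\<dots> = 0"
    unfolding Bcount_card sum_subtractf using mk[of 0] mk[of 1] eq by simp
  finally show ?thesis by (simp only: right_minus_eq of_nat_eq_iff)
qed

text \<open>For words the matching lowers the marked letter by one: the shortened word is unchanged,
  and wire \<open>r\<close> passes from the left to the right place of the crossing.\<close>

theorem transition_words:
  assumes v: "permutation v"
  shows "(\<Sum>s\<in>rcov v r. card {c. red c (v \<circ> tr r s)}) = (\<Sum>i\<in>lcov v r. card {c. red c (v \<circ> tr i r)})"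
proof -
  let ?f = "\<lambda>e (c, t). (c[t := c ! t + e], t :: nat) :: int list \<times> nat"
  have "bij_betw (?f (- 1)) (marked UNIV id v r 0) (marked UNIV id v r 1)"
    by (rule bij_betw_byWitness[where f' = "?f 1"])
      (auto simp: marked_def rem_def)
  then have "card (marked UNIV id v r 0) = card (marked UNIV id v r 1)" by (rule bij_betw_same_card)
  from transition_marked[OF v _ this] show ?thesis by simp
qed

section \<open>The transition formula for tableaux\<close>

text \<open>A tableau is the list of its columns, each read from top to bottom.\<close>

definition cw :: "int list list \<Rightarrow> int list" where
  "cw Ks = concat (map rev Ks)"

definition rowle :: "int list \<Rightarrow> int list \<Rightarrow> bool" where
  "rowle K K' \<longleftrightarrow> length K' \<le> length K \<and> (\<forall>i<length K'. K ! i \<le> K' ! i)"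

definition tab :: "int list list \<Rightarrow> bool" where
  "tab Ks \<longleftrightarrow> (\<forall>K\<in>set Ks. K \<noteq> [] \<and> sorted_wrt (<) K) \<and> successively rowle Ks"

definition EGi :: "(int \<Rightarrow> int) \<Rightarrow> nat" where
  "EGi z = card {Ks. tab Ks \<and> red (cw Ks) z}"

lemma cw_simps [simp]: "cw [] = []" "cw (K # Ks) = rev K @ cw Ks" "cw (As @ Bs) = cw As @ cw Bs"
  by (simp_all add: cw_def)

lemma tab_split:
  "tab (As @ K # Bs) \<longleftrightarrow> tab As \<and> tab Bs \<and> K \<noteq> [] \<and> sorted_wrt (<) K \<and>
    (As \<noteq> [] \<longrightarrow> rowle (last As) K) \<and> (Bs \<noteq> [] \<longrightarrow> rowle K (hd Bs))"
  by (auto simp: tab_def successively_append_iff successively_Cons)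

lemma sorted_gap:
  fixes L :: "int list"
  assumes "sorted_wrt (<) L" "k \<le> n" "n < length L"
  shows "L ! k + int (n - k) \<le> L ! n"
  using assms(2,3)
proof (induction n rule: dec_induct)
  case (step n)
  have "L ! n < L ! Suc n" using sorted_wrt_nth_less[OF assms(1), of n "Suc n"] step by simp
  then show ?case using step by (simp add: Suc_diff_le)
qed simp

lemma finite_cw: "finite {Ks. tab Ks \<and> cw Ks = c}"
proof -
  have len: "(\<forall>K\<in>set Ks. K \<noteq> []) \<Longrightarrow> length Ks \<le> length (cw Ks) \<and>
    (\<forall>K\<in>set Ks. set K \<subseteq> set (cw Ks) \<and> length K \<le> length (cw Ks))" for Ks
    by (induction Ks) (auto simp: Suc_le_eq add_strict_increasing)
  let ?A = "{K. set K \<subseteq> set c \<and> length K \<le> length c}"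
  have "finite ?A" by (rule finite_lists_length_le) simp
  then have "finite {Ks. set Ks \<subseteq> ?A \<and> length Ks \<le> length c}" by (rule finite_lists_length_le)
  moreover have "{Ks. tab Ks \<and> cw Ks = c} \<subseteq> {Ks. set Ks \<subseteq> ?A \<and> length Ks \<le> length c}"
    using len by (auto simp: tab_def)
  ultimately show ?thesis by (rule rev_finite_subset)
qed

lemma wprod_run: "b \<le> c + 1 \<Longrightarrow>
    wprod (rev [b..c]) x = (if x = c + 1 then b else if b \<le> x \<and> x \<le> c then x + 1 else x)"
proof -
  assume "b \<le> c + 1"
  then have "b - 1 \<le> c" by simp
  then show ?thesis
  proof (induction c arbitrary: x rule: int_ge_induct)
  case (step c)
  have "[b..c + 1] = [b..c] @ [c + 1]" using step(1) by (simp add: upto_rec2)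
  then have "wprod (rev [b..c + 1]) x = wprod (rev [b..c]) (sr (c + 1) x)" by simp
  then show ?case using step by (cases "x = c + 1"; cases "x = c + 2") (auto simp: sr_def transpose_def)
  qed auto
qed

lemma wprod_far: "(\<And>m. m \<in> set M \<Longrightarrow> x \<noteq> m \<and> x \<noteq> m + 1) \<Longrightarrow> wprod M x = x"
  by (induction M arbitrary: x) auto

lemma sr_commute: "m \<noteq> y - 1 \<Longrightarrow> m \<noteq> y \<Longrightarrow> m \<noteq> y + 1 \<Longrightarrow> sr m (sr y x) = sr y (sr m x)"
  by (cases "x = y"; cases "x = y + 1"; cases "x = m"; cases "x = m + 1") auto

lemma sr_wprod_far:
  assumes "\<And>m. m \<in> set M \<Longrightarrow> m \<noteq> y - 1 \<and> m \<noteq> y \<and> m \<noteq> y + 1"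
  shows "wprod M (sr y x) = sr y (wprod M x)"
  using assms
proof (induction M arbitrary: x)
  case (Cons m M)
  then show ?case using sr_commute[of m y x] by simp
qed simp

lemma sr_run_far:
  assumes "m \<le> b - 2 \<or> m \<ge> c + 2" "b \<le> c + 1"
  shows "sr m (wprod (rev [b..c]) x) = wprod (rev [b..c]) (sr m x)"
  by (rule sr_wprod_far[symmetric]) (use assms in auto)

lemma wprod_run_far:
  assumes "\<And>m. m \<in> set M \<Longrightarrow> m \<le> b - 2 \<or> m \<ge> c + 2" "b \<le> c + 1"
  shows "wprod M (wprod (rev [b..c]) x) = wprod (rev [b..c]) (wprod M x)"
  using assms(1)
proof (induction M arbitrary: x)
  case (Cons m M)
  then show ?case using sr_run_far[of m b c, OF _ assms(2)] by simp
qed simp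

lemma sr_run:
  assumes "b < y" "y \<le> c"
  shows "sr y (wprod (rev [b..c]) x) = wprod (rev [b..c]) (sr (y - 1) x)"
  using assms by (cases "x = y - 1"; cases "x = y")
    (auto simp: wprod_run sr_def transpose_def)

text \<open>The run \<open>c, c - 1, ..., b\<close> is a cycle; conjugation by it shifts the letters \<open>b + 1, ..., c\<close>.\<close>

lemma wprod_run_shift:
  assumes M: "\<And>m. m \<in> set M \<Longrightarrow> m \<le> b - 2 \<or> m \<ge> c + 2" and "b \<le> c + 1"
    and ys: "set ys \<subseteq> {b<..c}"
  shows "wprod (rev [b..c] @ M @ ys) = wprod (map (\<lambda>y. y - 1) ys @ M @ rev [b..c])"
proof
  fix x
  show "wprod (rev [b..c] @ M @ ys) x = wprod (map (\<lambda>y. y - 1) ys @ M @ rev [b..c]) x"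
    using ys
  proof (induction ys arbitrary: x)
    case Nil
    then show ?case using wprod_run_far[OF M assms(2)] by (simp add: wprod_append)
  next
    case (Cons y ys)
    have f: "m \<noteq> y - 1 \<and> m \<noteq> y \<and> m \<noteq> y + 1" if "m \<in> set M" for m
      using M[OF that] Cons.prems by auto
    have "wprod (rev [b..c] @ M @ y # ys) x = wprod ys (sr y (wprod M (wprod (rev [b..c]) x)))"
      by (simp add: wprod_append)
    also have "\<dots> = wprod ys (wprod M (wprod (rev [b..c]) (sr (y - 1) x)))"
    proof -
      have "sr y (wprod M (wprod (rev [b..c]) x)) = wprod M (sr y (wprod (rev [b..c]) x))"
        by (rule sr_wprod_far[symmetric]) (rule f)
      then show ?thesis using sr_run[of b y c] Cons.prems by simp
    qed
    also have "\<dots> = wprod (rev [b..c] @ M @ ys) (sr (y - 1) x)" by (simp add: wprod_append)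
    also have "\<dots> = wprod (map (\<lambda>y. y - 1) (y # ys) @ M @ rev [b..c]) x"
      using Cons by simp
    finally show ?case .
  qed
qed

lemma red_wprod_cong:
  assumes "permutation z" "wprod c = wprod c'" "length c = length c'"
  shows "red (x @ c @ y) z \<longleftrightarrow> red (x @ c' @ y) z"
  unfolding red_iff[OF assms(1)] using assms(2,3) by (simp add: wprod_append)

lemma not_red_shorter:
  assumes "permutation z" "wprod c = wprod c'" "length c' < length c"
  shows "\<not> red (x @ c @ y) z"
proof
  assume "red (x @ c @ y) z"
  then have *: "wprod (x @ c @ y) = z" "length (x @ c @ y) = card (dg z)"
    using red_iff[OF assms(1)] by auto
  have "wprod (x @ c' @ y) = z" using * assms(2) by (simp add: wprod_append)
  then show False using card_dg_wprod[of "x @ c' @ y"] * assms(3) by simp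
qed

lemma upto_snoc: "b \<le> c \<Longrightarrow> [b..c] = [b..c - 1] @ [c]"
  by (simp add: upto_rec2)

lemma upto_Cons: "b \<le> c \<Longrightarrow> [b..c] = b # [b + 1..c]"
  by (simp add: upto_rec1)

lemma upto_app: "b \<le> m \<Longrightarrow> m \<le> c + 1 \<Longrightarrow> [b..c] = [b..m - 1] @ [m..c]"
  by (cases "m = c + 1") (simp_all add: upto_split1)

lemma map_minus_upto: "map (\<lambda>y. y - 1) (rev [b + 1..c]) = rev [b..c - 1]"
proof -
  have "map (\<lambda>y. y - 1) [b + 1..c] = [b..c - 1]"
    by (rule nth_equalityI) auto
  then show ?thesis unfolding rev_map[symmetric] by simp
qed

text \<open>Moving the run past \<open>M\<close> and \<open>ys\<close> brings its last letter
  \<open>b\<close> next to the final \<open>b\<close>, and the two cancel. This excludes a common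
  run of two columns that could be extended upwards.\<close>

lemma not_red_run1:
  assumes z: "permutation z" and M: "\<And>m. m \<in> set M \<Longrightarrow> m \<le> b - 2 \<or> m \<ge> c + 2" and "b \<le> c"
    and ys: "set ys \<subseteq> {b<..c}"
  shows "\<not> red (x @ (rev [b..c] @ M @ ys @ [b]) @ y) z"
proof (rule not_red_shorter[OF z])
  let ?ys = "map (\<lambda>y. y - 1) ys"
  have "wprod (rev [b..c] @ M @ ys @ [b]) = sr b \<circ> wprod (rev [b..c] @ M @ ys)"
    by (simp add: wprod_append o_assoc)
  also have "\<dots> = sr b \<circ> wprod (?ys @ M @ rev [b..c])"
    using wprod_run_shift[OF M _ ys] assms(3) by simp
  also have "\<dots> = wprod (?ys @ M @ rev [b + 1..c])"
    using upto_Cons[OF assms(3)] by (auto simp: wprod_append fun_eq_iff)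
  finally show "wprod (rev [b..c] @ M @ ys @ [b]) = wprod (?ys @ M @ rev [b + 1..c])" .
  show "length (?ys @ M @ rev [b + 1..c]) < length (rev [b..c] @ M @ ys @ [b])" by simp
qed

text \<open>The mirror image: the first letter \<open>c\<close> of the run meets the leading
  \<open>c\<close> and cancels. This excludes a common run that could be extended downwards.\<close>

lemma not_red_run2:
  assumes z: "permutation z" and M: "\<And>m. m \<in> set M \<Longrightarrow> m \<le> b - 2 \<or> m \<ge> c + 2" and "b \<le> c"
    and ys: "set ys \<subseteq> {b..<c}"
  shows "\<not> red (x @ ([c] @ ys @ M @ rev [b..c]) @ y) z"
proof (rule not_red_shorter[OF z])
  let ?ys = "map (\<lambda>y. y + 1) ys"
  have s: "set ?ys \<subseteq> {b<..c}" using ys by auto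
  have m: "map (\<lambda>y. y - 1) ?ys = ys" by (simp add: o_def)
  have "wprod ([c] @ ys @ M @ rev [b..c]) = wprod (rev [b..c] @ M @ ?ys) \<circ> sr c"
    using wprod_run_shift[OF M _ s] assms(3) m by simp
  also have "\<dots> = wprod (rev [b..c - 1] @ M @ ?ys)"
    using upto_snoc[OF assms(3)] by (auto simp: wprod_append fun_eq_iff)
  finally show "wprod ([c] @ ys @ M @ rev [b..c]) = wprod (rev [b..c - 1] @ M @ ?ys)" .
  show "length (rev [b..c - 1] @ M @ ?ys) < length ([c] @ ys @ M @ rev [b..c])" by simp
qed

section \<open>Marked tableaux\<close>

type_synonym cell = "int list list \<times> int list \<times> int \<times> int list \<times> int list list"

text \<open>A tableau with a marked entry \<open>a\<close>: \<open>As\<close> and \<open>Bs\<close>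
  are the columns before and after, \<open>U\<close> and \<open>W\<close> the entries above and
  below the mark. Columns are read upwards, so the letters before the mark are those of
  \<open>As\<close> and then of \<open>W\<close>.\<close>

definition cells :: "(int \<Rightarrow> int) \<Rightarrow> int \<Rightarrow> int \<Rightarrow> cell set" where
  "cells v r e = {(As, U, a, W, Bs). tab (As @ (U @ a # W) # Bs) \<and>
     red (cw As @ rev W @ rev U @ cw Bs) v \<and> wprod (cw As @ rev W) r = a + e}"

lemma cell_ex: "t < length (cw Ks) \<Longrightarrow>
    \<exists>As U a W Bs. Ks = As @ (U @ a # W) # Bs \<and> t = length (cw As @ rev W)"
proof (induction Ks arbitrary: t)
  case (Cons K Ks)
  show ?case
  proof (cases "t < length K")
    case True
    let ?i = "length K - Suc t"
    have "K = take ?i K @ K ! ?i # drop (Suc ?i) K" using True by (intro id_take_nth_drop) simp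
    moreover have "length (drop (Suc ?i) K) = t" using True by simp
    ultimately show ?thesis
      by (intro exI[of _ "[]"] exI[of _ "take ?i K"] exI[of _ "K ! ?i"]
          exI[of _ "drop (Suc ?i) K"] exI[of _ Ks]) simp
  next
    case False
    then have "t - length K < length (cw Ks)" using Cons.prems by simp
    from Cons.IH[OF this] obtain As U a W Bs where
      "Ks = As @ (U @ a # W) # Bs" "t - length K = length (cw As @ rev W)" by blast
    then show ?thesis using False
      by (intro exI[of _ "K # As"] exI[of _ U] exI[of _ a] exI[of _ W] exI[of _ Bs]) simp
  qed
qed simp

lemma cell_uniq:
  assumes "As @ (U @ a # W) # Bs = As' @ (U' @ a' # W') # Bs'"
    "length (cw As @ rev W) = length (cw As' @ rev W')"
  shows "(As, U, a, W, Bs) = (As', U', a', W', Bs')"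
  using assms
proof (induction As arbitrary: As')
  case Nil
  then show ?case by (cases As') auto
next
  case (Cons K As)
  then show ?case by (cases As') auto
qed

lemma card_marked_cells:
  "card (marked {Ks. tab Ks} cw v r e) = card (cells v r e)"
proof -
  let ?g = "\<lambda>(As, U, a, W, Bs). (As @ (U @ a # W) # Bs, length (cw As @ rev W)) :: int list list \<times> nat"
  have "bij_betw ?g (cells v r e) (marked {Ks. tab Ks} cw v r e)"
    unfolding bij_betw_def
  proof
    show "inj_on ?g (cells v r e)"
    proof (rule inj_onI)
      fix x y assume "?g x = ?g y"
      moreover obtain As U a W Bs where "x = (As, U, a, W, Bs)" by (cases x)
      moreover obtain As' U' a' W' Bs' where "y = (As', U', a', W', Bs')" by (cases y)
      ultimately show "x = y" using cell_uniq[of As U a W Bs As' U' a' W' Bs'] by simp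
    qed
    show "?g ` cells v r e = marked {Ks. tab Ks} cw v r e"
    proof
      show "?g ` cells v r e \<subseteq> marked {Ks. tab Ks} cw v r e"
        by (auto simp: cells_def marked_def rem_def nth_append)
      show "marked {Ks. tab Ks} cw v r e \<subseteq> ?g ` cells v r e"
      proof
        fix b assume "b \<in> marked {Ks. tab Ks} cw v r e"
        then obtain Ks t where b: "b = (Ks, t)" "tab Ks" "t < length (cw Ks)" "red (rem (cw Ks) t) v"
          "wprod (take t (cw Ks)) r = cw Ks ! t + e" by (auto simp: marked_def)
        obtain As U a W Bs where K: "Ks = As @ (U @ a # W) # Bs" "t = length (cw As @ rev W)"
          using cell_ex[OF b(3)] by blast
        have "(As, U, a, W, Bs) \<in> cells v r e"
          using b K by (auto simp: cells_def rem_def nth_append)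
        then show "b \<in> ?g ` cells v r e" using K b(1) by (intro image_eqI) auto
      qed
    qed
  qed
  then show ?thesis by (rule bij_betw_same_card[symmetric])
qed

text \<open>The matchings below are given as relations between decompositions of columns, which
  spares explicit formulas for the maps and their inverses.\<close>

lemma card_eq_rel:
  assumes "\<And>x. x \<in> A \<Longrightarrow> \<exists>y\<in>B. R x y" "\<And>y. y \<in> B \<Longrightarrow> \<exists>x\<in>A. R x y"
    "\<And>x y y'. R x y \<Longrightarrow> R x y' \<Longrightarrow> y = y'" "\<And>x x' y. R x y \<Longrightarrow> R x' y \<Longrightarrow> x = x'"
  shows "card A = card B"
proof -
  have "\<forall>x\<in>A. \<exists>y. y \<in> B \<and> R x y" using assms(1) by blast
  from bchoice[OF this] obtain f where f: "\<And>x. x \<in> A \<Longrightarrow> f x \<in> B \<and> R x (f x)" by blast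
  have "inj_on f A"
  proof (rule inj_onI)
    fix x x' assume "x \<in> A" "x' \<in> A" "f x = f x'"
    then show "x = x'" using assms(4)[of x "f x" x'] f[of x] f[of x'] by simp
  qed
  moreover have "f ` A = B"
  proof
    show "f ` A \<subseteq> B" using f by blast
    show "B \<subseteq> f ` A"
    proof
      fix y assume "y \<in> B"
      then obtain x where x: "x \<in> A" "R x y" using assms(2) by blast
      then have "y = f x" using f assms(3) by blast
      then show "y \<in> f ` A" using x(1) by blast
    qed
  qed
  ultimately show ?thesis by (metis card_image)
qed

text \<open>A gap in front of the run makes it maximal; if one run were longer, the other
  decomposition would have the missing letter exactly where the gap must be.\<close>

lemma up_uniq:
  assumes "U @ [b..c] = U' @ [b'..c]" "b \<le> c + 1" "b' \<le> c + 1"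
    "U \<noteq> [] \<longrightarrow> last U < b - 1" "U' \<noteq> [] \<longrightarrow> last U' < b' - 1"
  shows "U = U' \<and> b = b'"
proof -
  have no: "\<not> b < b'" if "U @ [b..c] = U' @ [b'..c]" "b' \<le> c + 1" "U' \<noteq> [] \<longrightarrow> last U' < b' - 1"
    for U U' b b'
  proof
    assume "b < b'"
    then have "U' @ [b'..c] = U @ [b..b' - 1] @ [b'..c]" using that upto_app[of b b' c] by simp
    then have "U' = U @ [b..b' - 1]" by (simp flip: append_assoc)
    moreover have "[b..b' - 1] = [b..b' - 1 - 1] @ [b' - 1]" using \<open>b < b'\<close> by (intro upto_snoc) simp
    ultimately show False using that(3) by simp
  qed
  have "b = b'" using no[of U b U' b'] no[of U' b' U b] assms by fastforce
  then show ?thesis using assms(1) by simp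
qed

lemma down_uniq:
  assumes "[b..c] @ W = [b..c'] @ W'" "b \<le> c + 1" "b \<le> c' + 1"
    "W \<noteq> [] \<longrightarrow> c + 1 < hd W" "W' \<noteq> [] \<longrightarrow> c' + 1 < hd W'"
  shows "W = W' \<and> c = c'"
proof -
  have no: "\<not> c < c'" if "[b..c] @ W = [b..c'] @ W'" "b \<le> c + 1" "W \<noteq> [] \<longrightarrow> c + 1 < hd W"
    for c c' W W'
  proof
    assume "c < c'"
    then have "[b..c] @ W = [b..c] @ [c + 1..c'] @ W'" using that upto_app[of b "c + 1" c'] by simp
    then have "W = (c + 1) # [c + 1 + 1..c'] @ W'" using upto_Cons[of "c + 1" c'] \<open>c < c'\<close> by simp
    then show False using that(3) by simp
  qed
  have "c = c'" using no[of c W c' W'] no[of c' W' c W] assms by fastforce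
  then show ?thesis using assms(1) by simp
qed

text \<open>Splits off the maximal block of consecutive entries directly above \<open>a\<close> in a
  column.\<close>

lemma up_run:
  assumes "sorted_wrt (<) (U @ [a])"
  shows "\<exists>U0 b. U = U0 @ [b..a - 1] \<and> b \<le> a \<and> (U0 \<noteq> [] \<longrightarrow> last U0 < b - (1::int))"
  using assms
proof (induction U arbitrary: a rule: rev_induct)
  case Nil
  then show ?case by (intro exI[of _ "[]"] exI[of _ a]) simp
next
  case (snoc u U)
  have u: "u < a" using snoc.prems by (simp add: sorted_wrt_append)
  show ?case
  proof (cases "u = a - 1")
    case True
    have "sorted_wrt (<) (U @ [u])" using snoc.prems by (simp add: sorted_wrt_append)
    from snoc.IH[OF this] obtain U0 b where *: "U = U0 @ [b..u - 1]" "b \<le> u" "U0 \<noteq> [] \<longrightarrow> last U0 < b - 1"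
      by blast
    then have "U @ [u] = U0 @ [b..a - 1]" using upto_snoc[of b u] True by simp
    then show ?thesis using * True by (intro exI[of _ U0] exI[of _ b]) simp
  next
    case False
    then show ?thesis using u by (intro exI[of _ "U @ [u]"] exI[of _ a]) simp
  qed
qed

lemma down_run:
  assumes "sorted_wrt (<) (a # W)"
  shows "\<exists>c W0. W = [a + 1..c] @ W0 \<and> a \<le> c \<and> (W0 \<noteq> [] \<longrightarrow> c + (1::int) < hd W0)"
  using assms
proof (induction W arbitrary: a)
  case Nil
  then show ?case by (intro exI[of _ a]) simp
next
  case (Cons u W)
  show ?case
  proof (cases "u = a + 1")
    case True
    have "sorted_wrt (<) (u # W)" using Cons.prems by simp
    from Cons.IH[OF this] obtain c W0 where *: "W = [u + 1..c] @ W0" "u \<le> c" "W0 \<noteq> [] \<longrightarrow> c + 1 < hd W0"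
      by blast
    then have "u # W = [a + 1..c] @ W0" using upto_Cons[of u c] True by simp
    then show ?thesis using * True by (intro exI[of _ c] exI[of _ W0]) simp
  next
    case False
    then have "a + 1 < u" using Cons.prems by simp
    then show ?thesis by (intro exI[of _ a] exI[of _ "u # W"]) simp
  qed
qed

text \<open>The left neighbour equals the marked entry. Such a mark cannot slide up: the entry next
  to that neighbour would decrease by one and violate the row condition.\<close>

definition rb0 :: "cell \<Rightarrow> bool" where
  "rb0 = (\<lambda>(As, U, a, W, Bs). As \<noteq> [] \<and> last As ! length U = a)"

text \<open>The right neighbour equals the marked entry, which blocks the reverse slide, as that
  would increase the entry in this row by one.\<close>

definition rb1 :: "cell \<Rightarrow> bool" where
  "rb1 = (\<lambda>(As, U, a, W, Bs). Bs \<noteq> [] \<and> length U < length (hd Bs) \<and> hd Bs ! length U = a)"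

text \<open>Both marked columns become \<open>U @ [b..a - 1] @ W\<close> when the mark is deleted.
  The gap conditions make the run maximal and keep both columns strictly increasing at its
  ends.\<close>

definition shift_rel :: "cell \<Rightarrow> cell \<Rightarrow> bool" where
  "shift_rel x y \<longleftrightarrow> (\<exists>As U b a W Bs. x = (As, U @ [b..a - 1], a, W, Bs) \<and>
     y = (As, U, b - 1, [b..a - 1] @ W, Bs) \<and> b \<le> a \<and>
     (U \<noteq> [] \<longrightarrow> last U < b - 1) \<and> (W \<noteq> [] \<longrightarrow> a < hd W))"

lemma nth_run:
  assumes "i < length (U @ [b..c] @ W)"
  shows "(U @ [b..c] @ W) ! i = (if i < length U then U ! i else
    if i < length U + nat (c - b + 1) then b + int (i - length U) else W ! (i - length U - nat (c - b + 1)))"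
  by (auto simp: nth_append)

lemma sorted_shift:
  fixes a b :: int
  assumes "b \<le> a" "U \<noteq> [] \<longrightarrow> last U < b - 1" "W \<noteq> [] \<longrightarrow> a < hd W"
  shows "sorted_wrt (<) (U @ [b..a] @ W) \<longleftrightarrow> sorted_wrt (<) (U @ [b - 1..a - 1] @ W)"
proof (cases "sorted_wrt (<) U \<and> sorted_wrt (<) W")
  case True
  have l: "x < b - 1" if xU: "x \<in> set U" for x
  proof -
    obtain U' u where U: "U = U' @ [u]" using xU by (cases U rule: rev_cases) auto
    then show ?thesis using True assms(2) xU by (auto simp: sorted_wrt_append)
  qed
  have h: "a < x" if "x \<in> set W" for x
    using that True assms(3) by (cases W) auto
  have s: "sorted_wrt (<) [c..d]" for c d :: int
    using sorted_wrt_upto by blast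
  have f1: "x < y" if "x \<in> set U" "y \<in> set W" for x y
    using l[OF that(1)] h[OF that(2)] assms(1) by simp
  have f2: "x < y" if "x \<in> set U" "b - 1 \<le> y" for x y using l[OF that(1)] that(2) by simp
  have f3: "x < y" if "y \<in> set W" "x \<le> a" for x y using h[OF that(1)] that(2) by simp
  have "sorted_wrt (<) (U @ [b..a] @ W)" "sorted_wrt (<) (U @ [b - 1..a - 1] @ W)"
    unfolding sorted_wrt_append using True s by (auto intro: f1 f2 f3)
  then show ?thesis by blast
next
  case False
  then show ?thesis by (auto simp: sorted_wrt_append)
qed

lemma rowle_trans: "rowle K L \<Longrightarrow> rowle L R \<Longrightarrow> rowle K R"
  unfolding rowle_def by (meson dual_order.strict_trans1 order.trans)

lemma run_decr: "rowle (U @ [b - 1..a - 1] @ W) (U @ [b..a] @ W)"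
  by (auto simp: rowle_def nth_append)

text \<open>Only the bottom row of the run matters: if the left column is below \<open>a\<close>
  there, strict increase puts its entries above at least one step further down, row by row.\<close>

lemma rowle_left_shift:
  fixes a b :: int
  assumes L: "sorted_wrt (<) L" and le: "rowle L (U @ [b..a] @ W)" and "b \<le> a"
    and ne: "L ! (length U + nat (a - b)) \<noteq> a"
  shows "rowle L (U @ [b - 1..a - 1] @ W)"
proof -
  let ?K = "U @ [b..a] @ W" and ?n = "length U + nat (a - b)"
  have n: "?n < length ?K" using assms(3) by simp
  have "L ! ?n \<le> ?K ! ?n" using le n unfolding rowle_def by blast
  moreover have "?K ! ?n = a" using nth_run[OF n] assms(3) by simp
  ultimately have lt: "L ! ?n < a" using ne by simp
  have "L ! i \<le> (U @ [b - 1..a - 1] @ W) ! i" if i: "i < length ?K" for i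
  proof (cases "length U \<le> i \<and> i \<le> ?n")
    case True
    have "L ! i + int (?n - i) \<le> L ! ?n"
      using True n le by (intro sorted_gap[OF L]) (auto simp: rowle_def)
    then have "L ! i \<le> a - 1 - int (?n - i)" using lt by simp
    moreover have "(U @ [b - 1..a - 1] @ W) ! i = a - 1 - int (?n - i)"
      using True assms(3) i by (subst nth_run) (auto simp: of_nat_diff)
    ultimately show ?thesis by simp
  next
    case False
    then have "(U @ [b - 1..a - 1] @ W) ! i = ?K ! i"
      using i assms(3) by (subst nth_run, simp, subst nth_run) auto
    then show ?thesis using le i by (simp add: rowle_def)
  qed
  then show ?thesis using le by (auto simp: rowle_def)
qed

text \<open>Dually, only the top row of the run matters: from there downwards the right column grows
  by at least one per row.\<close>

lemma rowle_right_shift: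
  fixes a b :: int
  assumes R: "sorted_wrt (<) R" and le: "rowle (U @ [b - 1..a - 1] @ W) R" and "b \<le> a"
    and ne: "length U < length R \<longrightarrow> R ! length U \<noteq> b - 1"
  shows "rowle (U @ [b..a] @ W) R"
proof -
  let ?K = "U @ [b - 1..a - 1] @ W" and ?n = "length U + nat (a - b)"
  have "(U @ [b..a] @ W) ! i \<le> R ! i" if i: "i < length R" for i
  proof (cases "length U \<le> i \<and> i \<le> ?n")
    case True
    have iK: "length R \<le> length ?K" using le by (simp add: rowle_def)
    have "?K ! length U = b - 1" using assms(3) by (subst nth_run) auto
    moreover have "?K ! length U \<le> R ! length U" using le True i unfolding rowle_def by simp
    ultimately have "b - 1 \<le> R ! length U" by simp
    then have "b \<le> R ! length U" using ne True i by auto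
    moreover have "R ! length U + int (i - length U) \<le> R ! i"
      using True i by (intro sorted_gap[OF R]) auto
    moreover have "(U @ [b..a] @ W) ! i = b + int (i - length U)"
      using True assms(3) i iK by (subst nth_run) auto
    ultimately show ?thesis by simp
  next
    case False
    then have "(U @ [b..a] @ W) ! i = ?K ! i"
      using i assms(3) le by (subst nth_run, simp add: rowle_def, subst nth_run) (auto simp: rowle_def)
    then show ?thesis using le i by (simp add: rowle_def)
  qed
  then show ?thesis using le by (auto simp: rowle_def)
qed

lemma permutation_wprod_eq: "wprod c x = wprod c y \<longleftrightarrow> x = y"
  by (rule permutation_inj_eq[OF permutation_wprod])

text \<open>A mark whose left neighbour is smaller moves up to the top of its run.\<close>

lemma shift_cells:
  fixes a b :: int and As Bs :: "int list list"
  assumes "b \<le> a" "U \<noteq> [] \<longrightarrow> last U < b - 1" "W \<noteq> [] \<longrightarrow> a < hd W"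
  defines "x \<equiv> (As, U @ [b..a - 1], a, W, Bs)" and "y \<equiv> (As, U, b - 1, [b..a - 1] @ W, Bs)"
  shows "x \<in> cells v r 0 \<and> \<not> rb0 x \<longleftrightarrow> y \<in> cells v r 1 \<and> \<not> rb1 y"
proof -
  have K: "(U @ [b..a - 1]) @ a # W = U @ [b..a] @ W" using upto_snoc[OF assms(1)] by simp
  have K': "U @ (b - 1) # [b..a - 1] @ W = U @ [b - 1..a - 1] @ W"
    using upto_Cons[of "b - 1" "a - 1"] assms(1) by simp
  have w: "wprod (rev [b..a - 1]) p = b \<longleftrightarrow> p = a" for p
    using permutation_wprod_eq[of "rev [b..a - 1]" p a] wprod_run[of b "a - 1" a] assms(1) by simp
  have c1: "x \<in> cells v r 0 \<longleftrightarrow> tab (As @ (U @ [b..a] @ W) # Bs) \<and>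
      red (cw As @ rev W @ rev [b..a - 1] @ rev U @ cw Bs) v \<and> wprod (cw As @ rev W) r = a"
    unfolding x_def cells_def by (simp only: mem_Collect_eq prod.case K) simp
  have c2: "y \<in> cells v r 1 \<longleftrightarrow> tab (As @ (U @ [b - 1..a - 1] @ W) # Bs) \<and>
      red (cw As @ rev W @ rev [b..a - 1] @ rev U @ cw Bs) v \<and> wprod (cw As @ rev W) r = a"
    unfolding y_def cells_def by (simp only: mem_Collect_eq prod.case K') (simp add: wprod_append w)
  have r0: "rb0 x \<longleftrightarrow> As \<noteq> [] \<and> last As ! (length U + nat (a - b)) = a"
    unfolding rb0_def x_def by simp
  have r1: "rb1 y \<longleftrightarrow> Bs \<noteq> [] \<and> length U < length (hd Bs) \<and> hd Bs ! length U = b - 1"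
    unfolding rb1_def y_def by simp
  have sL: "sorted_wrt (<) (last As)" if "tab As" "As \<noteq> []" using that by (simp add: tab_def)
  have sR: "sorted_wrt (<) (hd Bs)" if "tab Bs" "Bs \<noteq> []" using that by (simp add: tab_def)
  have "tab (As @ (U @ [b..a] @ W) # Bs) \<and> \<not> rb0 x \<longleftrightarrow>
      tab (As @ (U @ [b - 1..a - 1] @ W) # Bs) \<and> \<not> rb1 y"
  proof
    assume *: "tab (As @ (U @ [b..a] @ W) # Bs) \<and> \<not> rb0 x"
    have "\<not> rb1 y"
    proof
      assume "rb1 y"
      then have "Bs \<noteq> []" "length U < length (hd Bs)" "hd Bs ! length U = b - 1" unfolding r1 by auto
      moreover from this have "rowle (U @ [b..a] @ W) (hd Bs)" using * by (simp add: tab_split)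
      moreover have "(U @ [b..a] @ W) ! length U = b" using assms(1) by (subst nth_run) auto
      ultimately show False unfolding rowle_def by force
    qed
    moreover have "tab (As @ (U @ [b - 1..a - 1] @ W) # Bs)"
      using * rowle_left_shift[OF sL, of U b a W] assms(1) sorted_shift[OF assms(1-3)]
        rowle_trans[OF run_decr, of U b a W] unfolding tab_split r0 by auto
    ultimately show "tab (As @ (U @ [b - 1..a - 1] @ W) # Bs) \<and> \<not> rb1 y" by blast
  next
    assume *: "tab (As @ (U @ [b - 1..a - 1] @ W) # Bs) \<and> \<not> rb1 y"
    have "\<not> rb0 x"
    proof
      assume "rb0 x"
      then have "As \<noteq> []" "last As ! (length U + nat (a - b)) = a" unfolding r0 by auto
      moreover from this have "rowle (last As) (U @ [b - 1..a - 1] @ W)" using * by (simp add: tab_split)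
      moreover have "length U + nat (a - b) < length (U @ [b - 1..a - 1] @ W)" using assms(1) by simp
      ultimately have "last As ! (length U + nat (a - b)) = a" "last As ! (length U + nat (a - b)) \<le>
          (U @ [b - 1..a - 1] @ W) ! (length U + nat (a - b))"
        unfolding rowle_def by blast+
      moreover have "(U @ [b - 1..a - 1] @ W) ! (length U + nat (a - b)) = a - 1"
        using assms(1) by (subst nth_run) auto
      ultimately show False by linarith
    qed
    moreover have "tab (As @ (U @ [b..a] @ W) # Bs)"
      using * rowle_right_shift[OF sR, of U b a W] assms(1) sorted_shift[OF assms(1-3)]
        rowle_trans[OF _ run_decr, of _ U b a W] unfolding tab_split r1 by auto
    ultimately show "tab (As @ (U @ [b..a] @ W) # Bs) \<and> \<not> rb0 x" by blast
  qed
  then show ?thesis unfolding c1 c2 by blast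
qed

lemma card_shift: "card {x\<in>cells v r 0. \<not> rb0 x} = card {y\<in>cells v r 1. \<not> rb1 y}"
proof (rule card_eq_rel[where R = shift_rel])
  fix x assume x: "x \<in> {x\<in>cells v r 0. \<not> rb0 x}"
  obtain As U' a W Bs where xe: "x = (As, U', a, W, Bs)" by (cases x)
  have "sorted_wrt (<) (U' @ a # W)" using x by (simp add: xe cells_def tab_split)
  then have s: "sorted_wrt (<) (U' @ [a])" and W: "W \<noteq> [] \<longrightarrow> a < hd W"
    by (auto simp: sorted_wrt_append)
  obtain U b where U: "U' = U @ [b..a - 1]" "b \<le> a" "U \<noteq> [] \<longrightarrow> last U < b - 1"
    using up_run[OF s] by blast
  show "\<exists>y\<in>{y\<in>cells v r 1. \<not> rb1 y}. shift_rel x y"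
    using shift_cells[OF U(2,3) W] x U W unfolding xe shift_rel_def by blast
next
  fix y assume y: "y \<in> {y\<in>cells v r 1. \<not> rb1 y}"
  obtain As U b' W' Bs where ye: "y = (As, U, b', W', Bs)" by (cases y)
  have "sorted_wrt (<) (U @ b' # W')" using y by (simp add: ye cells_def tab_split)
  then have s: "sorted_wrt (<) (b' # W')" and U: "U \<noteq> [] \<longrightarrow> last U < b'"
    by (auto simp: sorted_wrt_append)
  obtain c W where W: "W' = [b' + 1..c] @ W" "b' \<le> c" "W \<noteq> [] \<longrightarrow> c + 1 < hd W"
    using down_run[OF s] by blast
  show "\<exists>x\<in>{x\<in>cells v r 0. \<not> rb0 x}. shift_rel x y"
  proof (rule bexI[of _ "(As, U @ [b' + 1..c + 1 - 1], c + 1, W, Bs)"])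
    show "shift_rel (As, U @ [b' + 1..c + 1 - 1], c + 1, W, Bs) y"
      unfolding shift_rel_def ye using W U
      by (intro exI[of _ As] exI[of _ U] exI[of _ "b' + 1"] exI[of _ "c + 1"] exI[of _ W] exI[of _ Bs]) simp
    show "(As, U @ [b' + 1..c + 1 - 1], c + 1, W, Bs) \<in> {x\<in>cells v r 0. \<not> rb0 x}"
      using shift_cells[of "b' + 1" "c + 1" U W As Bs v r] W U y unfolding ye by simp
  qed
next
  fix x y y' assume "shift_rel x y" "shift_rel x y'"
  then obtain As U b a W Bs As' U' b' a' W' Bs' where
    *: "x = (As, U @ [b..a - 1], a, W, Bs)" "y = (As, U, b - 1, [b..a - 1] @ W, Bs)" "b \<le> a"
      "U \<noteq> [] \<longrightarrow> last U < b - 1"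
    and **: "x = (As', U' @ [b'..a' - 1], a', W', Bs')" "y' = (As', U', b' - 1, [b'..a' - 1] @ W', Bs')"
      "b' \<le> a'" "U' \<noteq> [] \<longrightarrow> last U' < b' - 1"
    unfolding shift_rel_def by blast
  have e: "U @ [b..a - 1] = U' @ [b'..a - 1]" "a = a'" using *(1) **(1) by auto
  have "U = U' \<and> b = b'" by (rule up_uniq[OF e(1)]) (use * ** e in auto)
  then show "y = y'" using * ** by auto
next
  fix x x' y assume "shift_rel x y" "shift_rel x' y"
  then obtain As U b a W Bs As' U' b' a' W' Bs' where
    *: "x = (As, U @ [b..a - 1], a, W, Bs)" "y = (As, U, b - 1, [b..a - 1] @ W, Bs)" "b \<le> a"
      "W \<noteq> [] \<longrightarrow> a < hd W"
    and **: "x' = (As', U' @ [b'..a' - 1], a', W', Bs')" "y = (As', U', b' - 1, [b'..a' - 1] @ W', Bs')"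
      "b' \<le> a'" "W' \<noteq> [] \<longrightarrow> a' < hd W'"
    unfolding shift_rel_def by blast
  have e: "[b..a - 1] @ W = [b..a' - 1] @ W'" "b = b'" using *(2) **(2) by auto
  have "W = W' \<and> a - 1 = a' - 1" by (rule down_uniq[OF e(1)]) (use * ** e in auto)
  then show "x = x'" using * ** by auto
qed

text \<open>The tableau stays the same. Its two adjacent columns contain the run from
  \<open>a\<close> to \<open>c\<close> in the same rows, and the mark jumps from the top of the run
  in the right column to its bottom in the left one.\<close>

definition row_rel :: "cell \<Rightarrow> cell \<Rightarrow> bool" where
  "row_rel x y \<longleftrightarrow> (\<exists>As P P2 a c Q1 Q2 Bs. length P = length P2 \<and> a \<le> c \<and>
     x = (As @ [P @ [a..c] @ Q1], P2, a, [a + 1..c] @ Q2, Bs) \<and>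
     y = (As, P @ [a..c - 1], c, Q1, (P2 @ [a..c] @ Q2) # Bs) \<and>
     (P \<noteq> [] \<longrightarrow> last P < a - 1) \<and> (Q2 \<noteq> [] \<longrightarrow> c + 1 < hd Q2))"

text \<open>
  If the left neighbour is equal, the two columns share a run, whose word has a second position
  that can be deleted with the same effect.
\<close>

lemma row_cells:
  fixes a c :: int and As Bs :: "int list list" and Q1 :: "int list"
  assumes v: "permutation v" and len: "length P = length P2" and "a \<le> c"
    and P: "P \<noteq> [] \<longrightarrow> last P < a - 1" and Q: "Q2 \<noteq> [] \<longrightarrow> c + 1 < hd Q2"
  defines "x \<equiv> (As @ [P @ [a..c] @ Q1], P2, a, [a + 1..c] @ Q2, Bs)"
    and "y \<equiv> (As, P @ [a..c - 1], c, Q1, (P2 @ [a..c] @ Q2) # Bs)"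
  shows "x \<in> cells v r 0 \<longleftrightarrow> y \<in> cells v r 1" and "rb0 x" and "rb1 y"
proof -
  have K: "P2 @ a # [a + 1..c] @ Q2 = P2 @ [a..c] @ Q2" using upto_Cons[OF assms(3)] by simp
  have K': "(P @ [a..c - 1]) @ c # Q1 = P @ [a..c] @ Q1" using upto_snoc[OF assms(3)] by simp
  let ?M = "rev P @ rev Q2" and ?T = "tab (As @ [P @ [a..c] @ Q1, P2 @ [a..c] @ Q2] @ Bs)"
  have c1: "x \<in> cells v r 0 \<longleftrightarrow> ?T \<and>
      red ((cw As @ rev Q1) @ (rev [a..c] @ ?M @ rev [a + 1..c]) @ (rev P2 @ cw Bs)) v \<and>
      wprod (rev [a..c] @ ?M @ rev [a + 1..c]) (wprod (cw As @ rev Q1) r) = a"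
    unfolding x_def cells_def by (simp only: mem_Collect_eq prod.case K) (simp add: wprod_append)
  have c2: "y \<in> cells v r 1 \<longleftrightarrow> ?T \<and>
      red ((cw As @ rev Q1) @ (rev [a..c - 1] @ ?M @ rev [a..c]) @ (rev P2 @ cw Bs)) v \<and>
      wprod (cw As @ rev Q1) r = c + 1"
    unfolding y_def cells_def by (simp only: mem_Collect_eq prod.case K') simp
  have "x \<in> cells v r 0 \<longleftrightarrow> y \<in> cells v r 1" if T: ?T
  proof -
    have sP: "sorted_wrt (<) P" and sQ: "sorted_wrt (<) Q2"
      using T by (auto simp: tab_def sorted_wrt_append)
    have M: "m \<le> a - 2 \<or> m \<ge> c + 2" if "m \<in> set ?M" for m
    proof -
      have "m \<le> a - 2" if "m \<in> set P"
      proof -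
        obtain P' p where "P = P' @ [p]" using \<open>m \<in> set P\<close> by (cases P rule: rev_cases) auto
        then show ?thesis using sP P \<open>m \<in> set P\<close> by (auto simp: sorted_wrt_append)
      qed
      moreover have "m \<ge> c + 2" if "m \<in> set Q2" using that sQ Q by (cases Q2) auto
      ultimately show ?thesis using that by auto
    qed
    \<comment> \<open>Deleting \<open>a\<close> from the right copy of the run or \<open>c\<close>
      from the left copy gives the same product, by moving the left run past the right one.\<close>
    have sh: "wprod (rev [a..c] @ ?M @ rev [a + 1..c]) = wprod (rev [a..c - 1] @ ?M @ rev [a..c])"
      using wprod_run_shift[where M = ?M and b = a and c = c and ys = "rev [a + 1..c]", OF M] assms(3)
      unfolding map_minus_upto by (auto simp: subset_iff)
    have "red ((cw As @ rev Q1) @ (rev [a..c] @ ?M @ rev [a + 1..c]) @ (rev P2 @ cw Bs)) v \<longleftrightarrow>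
      red ((cw As @ rev Q1) @ (rev [a..c - 1] @ ?M @ rev [a..c]) @ (rev P2 @ cw Bs)) v"
      by (rule red_wprod_cong[OF v sh]) simp
    \<comment> \<open>The same wire is marked in both cases: it enters the left run at
      \<open>c + 1\<close>, leaves it at \<open>a\<close>, and is not touched again before the mark
      in the right column.\<close>
    moreover have "wprod (rev [a..c] @ ?M @ rev [a + 1..c]) (c + 1) = a"
    proof -
      have "wprod (rev [a..c]) (c + 1) = a" using wprod_run[of a c "c + 1"] assms(3) by simp
      moreover have "wprod ?M a = a" by (rule wprod_far) (use M assms(3) in force)
      moreover have "wprod (rev [a + 1..c]) a = a" by (rule wprod_far) auto
      ultimately show ?thesis by (simp only: wprod_append o_apply)
    qed
    then have "wprod (rev [a..c] @ ?M @ rev [a + 1..c]) p = a \<longleftrightarrow> p = c + 1" for p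
      using permutation_wprod_eq[of "rev [a..c] @ ?M @ rev [a + 1..c]" p "c + 1"] by simp
    ultimately show ?thesis unfolding c1 c2 by blast
  qed
  then show "x \<in> cells v r 0 \<longleftrightarrow> y \<in> cells v r 1" using c1 c2 by blast
  show "rb0 x" unfolding rb0_def x_def using nth_run[of "length P" P a c Q1] len assms(3) by auto
  have "(P2 @ [a..c] @ Q2) ! (length P + nat (c - a)) = c"
    using len assms(3) by (subst nth_run) auto
  then show "rb1 y" unfolding rb1_def y_def using len assms(3) by auto
qed

text \<open>The longest common block of consecutive entries, starting at the common first entry; it
  ends where not both lists continue with the next integer.\<close>

lemma common_down_run:
  assumes "sorted_wrt (<) (X :: int list)" "sorted_wrt (<) Y" "X \<noteq> []" "Y \<noteq> []" "hd X = a" "hd Y = a"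
  shows "\<exists>c Q1 Q2. X = [a..c] @ Q1 \<and> Y = [a..c] @ Q2 \<and> a \<le> c \<and>
    \<not> (Q1 \<noteq> [] \<and> Q2 \<noteq> [] \<and> hd Q1 = c + 1 \<and> hd Q2 = c + 1)"
  using assms
proof (induction X arbitrary: Y a)
  case (Cons x X)
  obtain Y' where Y: "Y = a # Y'" using Cons.prems by (cases Y) auto
  have x: "x = a" using Cons.prems by simp
  show ?case
  proof (cases "X \<noteq> [] \<and> Y' \<noteq> [] \<and> hd X = a + 1 \<and> hd Y' = a + 1")
    case True
    then obtain c Q1 Q2 where *: "X = [a + 1..c] @ Q1" "Y' = [a + 1..c] @ Q2" "a + 1 \<le> c"
      "\<not> (Q1 \<noteq> [] \<and> Q2 \<noteq> [] \<and> hd Q1 = c + 1 \<and> hd Q2 = c + 1)"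
    proof -
      have "sorted_wrt (<) X" "sorted_wrt (<) Y'" using Cons.prems Y by auto
      from Cons.IH[OF this, of "a + 1"] True show ?thesis using that by blast
    qed
    then have "x # X = [a..c] @ Q1" "Y = [a..c] @ Q2" using Y x upto_Cons[of a c] by auto
    then show ?thesis using * by (intro exI[of _ c] exI[of _ Q1] exI[of _ Q2]) auto
  next
    case False
    then show ?thesis using Y x by (intro exI[of _ a] exI[of _ X] exI[of _ Y']) auto
  qed
qed simp

lemma common_up_run:
  assumes "sorted_wrt (<) (X :: int list)" "sorted_wrt (<) Y" "X \<noteq> []" "Y \<noteq> []" "last X = c" "last Y = c"
  shows "\<exists>a P1 P2. X = P1 @ [a..c] \<and> Y = P2 @ [a..c] \<and> a \<le> c \<and>
    \<not> (P1 \<noteq> [] \<and> P2 \<noteq> [] \<and> last P1 = a - 1 \<and> last P2 = a - 1)"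
  using assms
proof (induction X arbitrary: Y c rule: rev_induct)
  case (snoc x X)
  obtain Y' where Y: "Y = Y' @ [c]" using snoc.prems by (cases Y rule: rev_cases) auto
  have x: "x = c" using snoc.prems by simp
  show ?case
  proof (cases "X \<noteq> [] \<and> Y' \<noteq> [] \<and> last X = c - 1 \<and> last Y' = c - 1")
    case True
    then obtain a P1 P2 where *: "X = P1 @ [a..c - 1]" "Y' = P2 @ [a..c - 1]" "a \<le> c - 1"
      "\<not> (P1 \<noteq> [] \<and> P2 \<noteq> [] \<and> last P1 = a - 1 \<and> last P2 = a - 1)"
    proof -
      have "sorted_wrt (<) X" "sorted_wrt (<) Y'" using snoc.prems Y by (auto simp: sorted_wrt_append)
      from snoc.IH[OF this, of "c - 1"] True show ?thesis using that by blast
    qed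
    then have "X @ [x] = P1 @ [a..c]" "Y = P2 @ [a..c]" using Y x upto_snoc[of a c] by auto
    then show ?thesis using * by (intro exI[of _ a] exI[of _ P1] exI[of _ P2]) auto
  next
    case False
    then show ?thesis using Y x by (intro exI[of _ c] exI[of _ X] exI[of _ Y']) auto
  qed
qed simp

lemma sorted_last_less: "sorted_wrt (<) (X @ Y) \<Longrightarrow> X \<noteq> [] \<Longrightarrow> Y \<noteq> [] \<Longrightarrow> last X < (hd Y :: int)"
  by (auto simp: sorted_wrt_append)

lemma sorted_far:
  assumes "sorted_wrt (<) (P :: int list)" "P \<noteq> [] \<longrightarrow> last P < b - 1" "m \<in> set P"
  shows "m \<le> b - 2"
proof -
  obtain P' p where "P = P' @ [p]" using assms(3) by (cases P rule: rev_cases) auto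
  then show ?thesis using assms by (auto simp: sorted_wrt_append)
qed

lemma sorted_far':
  assumes "sorted_wrt (<) (P :: int list)" "P \<noteq> [] \<longrightarrow> b + 1 < hd P" "m \<in> set P"
  shows "m \<ge> b + 2"
  using assms by (cases P) auto

lemma rowle_last:
  assumes "rowle (P @ X) (P2 @ Y)" "length P = length P2" "P \<noteq> []"
  shows "last P \<le> last P2"
proof -
  have "P2 \<noteq> []" using assms by auto
  then have "length P - 1 < length (P2 @ Y)" using assms(2) by (cases P2) auto
  then have "(P @ X) ! (length P - 1) \<le> (P2 @ Y) ! (length P - 1)"
    using assms(1) unfolding rowle_def by blast
  moreover have "length P - 1 < length P" "length P - 1 < length P2" using assms(2,3) by (cases P; simp)+
  ultimately show ?thesis using assms(2,3) \<open>P2 \<noteq> []\<close> by (simp add: last_conv_nth nth_append)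
qed

lemma rowle_hd:
  assumes "rowle (X @ Q) (Y @ Q2)" "length X = length Y" "Q2 \<noteq> []"
  shows "Q \<noteq> [] \<and> hd Q \<le> hd Q2"
proof -
  have l: "length Q2 \<le> length Q" using assms by (simp add: rowle_def)
  then have Q: "Q \<noteq> []" using assms(3) by auto
  have "(X @ Q) ! length X \<le> (Y @ Q2) ! length X"
    using assms l unfolding rowle_def by auto
  then show ?thesis using Q assms by (simp add: nth_append hd_conv_nth)
qed

text \<open>The common run is followed downwards from the marked row. It then needs gaps at both
  ends: the lower one comes from the row condition, the upper one from reducedness.\<close>

lemma row_ex0:
  assumes v: "permutation v" and x: "x \<in> cells v r 0" "rb0 x"
  shows "\<exists>y. y \<in> cells v r 1 \<and> rb1 y \<and> row_rel x y"
proof -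
  obtain As' P2 a W Bs where xe: "x = (As', P2, a, W, Bs)" by (cases x)
  have "As' \<noteq> []" using x(2) by (simp add: xe rb0_def)
  then obtain As K1 where As: "As' = As @ [K1]" by (cases As' rule: rev_cases) auto
  have K1a: "K1 ! length P2 = a" using x(2) by (simp add: xe rb0_def As)
  have tabx: "tab (As @ K1 # (P2 @ a # W) # Bs)"
    and redx: "red (cw (As @ [K1]) @ rev W @ rev P2 @ cw Bs) v"
    using x(1) by (auto simp: xe cells_def As)
  have s1: "sorted_wrt (<) K1" and s2: "sorted_wrt (<) (P2 @ a # W)"
    and le: "rowle K1 (P2 @ a # W)"
    using tabx by (auto simp: tab_def successively_append_iff)
  define P where "P = take (length P2) K1"
  have l1: "length P2 < length K1" using le by (simp add: rowle_def)
  have K1: "K1 = P @ drop (length P2) K1" and lP: "length P = length P2"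
    using l1 by (auto simp: P_def)
  have d1: "drop (length P2) K1 \<noteq> []" "hd (drop (length P2) K1) = a"
    using l1 K1a by (auto simp: hd_drop_conv_nth)
  have sd: "sorted_wrt (<) (drop (length P2) K1)" "sorted_wrt (<) (a # W)"
    using s1 s2 K1 by (metis sorted_wrt_append)+
  obtain c Q1 Q2 where run: "drop (length P2) K1 = [a..c] @ Q1" "a # W = [a..c] @ Q2" "a \<le> c"
    and max: "\<not> (Q1 \<noteq> [] \<and> Q2 \<noteq> [] \<and> hd Q1 = c + 1 \<and> hd Q2 = c + 1)"
    using common_down_run[OF sd d1(1) _ d1(2), of] by auto
  have K1': "K1 = P @ [a..c] @ Q1" using K1 run(1) by simp
  have W: "W = [a + 1..c] @ Q2" using run(2) upto_Cons[OF run(3)] by simp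
  have le': "rowle ((P @ [a..c]) @ Q1) ((P2 @ [a..c]) @ Q2)" using le K1' run(2) by simp
  \<comment> \<open>If the right column continued with \<open>c + 1\<close>, the left one would have
    to do so as well, since its next entry exceeds \<open>c\<close> and is at most the right one.
    The run would then not be maximal.\<close>
  have Q2: "Q2 \<noteq> [] \<longrightarrow> c + 1 < hd Q2"
  proof
    assume q: "Q2 \<noteq> []"
    have 1: "Q1 \<noteq> []" "hd Q1 \<le> hd Q2" using rowle_hd[OF le' _ q] lP by auto
    have "c < hd Q1" using sorted_last_less[of "[a..c]" Q1] sd(1) run(1,3) 1(1) upto_snoc[OF run(3)] by simp
    then show "c + 1 < hd Q2" using max q 1 by force
  qed
  \<comment> \<open>Otherwise the row condition forces \<open>a - 1\<close> above the run in both
    columns. Extending upwards to a maximal start \<open>b\<close> exhibits the pattern of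
    \<open>not_red_run1\<close> in the shortened word.\<close>
  have P: "P \<noteq> [] \<longrightarrow> last P < a - 1"
  proof (rule ccontr)
    assume "\<not> ?thesis"
    then have p: "P \<noteq> []" "\<not> last P < a - 1" by auto
    then have p2: "P2 \<noteq> []" using lP by auto
    have "last P < a" using sorted_last_less[of P "[a..c] @ Q1"] s1 K1' p(1) run(3) upto_Cons[OF run(3)] by simp
    then have lp: "last P = a - 1" using p(2) by simp
    have "last P2 < a" using sorted_last_less[of P2 "a # W"] s2 p2 by simp
    moreover have "last P \<le> last P2" using rowle_last[OF le[unfolded K1'] lP p(1)] .
    ultimately have lp2: "last P2 = a - 1" using lp by simp
    have sP: "sorted_wrt (<) P" "sorted_wrt (<) P2" using s1 K1' s2 by (simp_all add: sorted_wrt_append)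
    obtain b P' P2' where u: "P = P' @ [b..a - 1]" "P2 = P2' @ [b..a - 1]" "b \<le> a - 1"
      "\<not> (P' \<noteq> [] \<and> P2' \<noteq> [] \<and> last P' = b - 1 \<and> last P2' = b - 1)"
      using common_up_run[OF sP p(1) p2 lp lp2] by blast
    have lP': "length P' = length P2'" using lP u by simp
    have P': "P' \<noteq> [] \<longrightarrow> last P' < b - 1"
    proof
      assume q: "P' \<noteq> []"
      then have q2: "P2' \<noteq> []" using lP' by auto
      have "last P' < b" using sorted_last_less[of P' "[b..a - 1]"] sP(1) u(1,3) q upto_Cons[OF u(3)] by simp
      moreover have "last P2' < b" using sorted_last_less[of P2' "[b..a - 1]"] sP(2) u(2,3) q2 upto_Cons[OF u(3)] by simp
      moreover have "last P' \<le> last P2'"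
        by (rule rowle_last[of _ "[b..a - 1] @ [a..c] @ Q1" _ "[b..a - 1] @ a # W"])
          (use le K1' u lP' q in simp_all)
      ultimately show "last P' < b - 1" using u(4) q q2 by force
    qed
    let ?M = "rev P' @ rev Q2" and ?ys = "rev [a + 1..c] @ rev [b + 1..a - 1]"
    have M: "m \<le> b - 2 \<or> m \<ge> c + 2" if "m \<in> set ?M" for m
    proof -
      have "m \<le> b - 2" if "m \<in> set P'"
        using sorted_far[OF _ P' that] sP(1) u(1) by (simp add: sorted_wrt_append)
      moreover have "m \<ge> c + 2" if "m \<in> set Q2"
        using sorted_far'[OF _ Q2 that] sd(2) run(2) by (simp add: sorted_wrt_append)
      ultimately show ?thesis using that by auto
    qed
    have bc: "[b..c] = [b..a - 1] @ [a..c]" using upto_app[of b a c] u(3) run(3) by simp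
    have ba: "rev [b..a - 1] = rev [b + 1..a - 1] @ [b]" using upto_Cons[OF u(3)] by simp
    have E: "cw (As @ [K1]) @ rev W @ rev P2 @ cw Bs =
      (cw As @ rev Q1) @ (rev [b..c] @ ?M @ ?ys @ [b]) @ (rev P2' @ cw Bs)"
      unfolding K1' W u(1,2) bc by (simp add: ba del: upto.simps)
    have N: "\<not> red ((cw As @ rev Q1) @ (rev [b..c] @ ?M @ ?ys @ [b]) @ (rev P2' @ cw Bs)) v"
      by (rule not_red_run1[OF v M]) (use u(3) run(3) in auto)
    show False using N redx unfolding E by blast
  qed
  let ?y = "(As, P @ [a..c - 1], c, Q1, (P2 @ [a..c] @ Q2) # Bs)"
  have xe': "x = (As @ [P @ [a..c] @ Q1], P2, a, [a + 1..c] @ Q2, Bs)" unfolding xe As K1' W by simp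
  have "row_rel x ?y" unfolding row_rel_def xe' using lP run(3) P Q2 by blast
  moreover have "?y \<in> cells v r 1" "rb1 ?y"
    using row_cells(1)[OF v lP run(3) P Q2, where As = As and ?Q1.0 = Q1 and Bs = Bs and r = r]
      row_cells(2,3)[OF v lP run(3) P Q2, where As = As and ?Q1.0 = Q1 and Bs = Bs] x(1) unfolding xe' by blast+
  ultimately show ?thesis by blast
qed

text \<open>Here the run is followed upwards from the mark in the left column, so the roles of the
  two ends are exchanged.\<close>

lemma row_ex1:
  assumes v: "permutation v" and y: "y \<in> cells v r 1" "rb1 y"
  shows "\<exists>x. x \<in> cells v r 0 \<and> rb0 x \<and> row_rel x y"
proof -
  obtain As U c Q1 Bs' where ye: "y = (As, U, c, Q1, Bs')" by (cases y)
  have "Bs' \<noteq> []" using y(2) by (simp add: ye rb1_def)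
  then obtain K2 Bs where Bs: "Bs' = K2 # Bs" by (cases Bs') auto
  have l2: "length U < length K2" and K2c: "K2 ! length U = c" using y(2) by (auto simp: ye rb1_def Bs)
  have taby: "tab (As @ (U @ c # Q1) # K2 # Bs)"
    and redy: "red (cw As @ rev Q1 @ rev U @ cw (K2 # Bs)) v"
    using y(1) by (auto simp: ye cells_def Bs)
  have s1: "sorted_wrt (<) (U @ c # Q1)" and s2: "sorted_wrt (<) K2"
    and le: "rowle (U @ c # Q1) K2"
    using taby by (auto simp: tab_def successively_append_iff)
  define R where "R = take (length U) K2"
  define Q2 where "Q2 = drop (Suc (length U)) K2"
  have K2: "K2 = (R @ [c]) @ Q2" using id_take_nth_drop[OF l2] K2c by (simp add: R_def Q2_def)
  have lR: "length R = length U" using l2 by (simp add: R_def)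
  have su: "sorted_wrt (<) (U @ [c])" "sorted_wrt (<) (R @ [c])"
    using s1 s2 K2 by (auto simp: sorted_wrt_append)
  obtain a P P2 where run: "U @ [c] = P @ [a..c]" "R @ [c] = P2 @ [a..c]" "a \<le> c"
    and max: "\<not> (P \<noteq> [] \<and> P2 \<noteq> [] \<and> last P = a - 1 \<and> last P2 = a - 1)"
    using common_up_run[OF su] by auto
  have U: "U = P @ [a..c - 1]" and R: "R = P2 @ [a..c - 1]" using run upto_snoc[OF run(3)] by simp_all
  have lP: "length P = length P2" using lR U R by simp
  have le': "rowle (P @ [a..c] @ Q1) (P2 @ [a..c] @ Q2)" using le K2 run by (metis append.assoc append_Cons append_Nil)
  have P: "P \<noteq> [] \<longrightarrow> last P < a - 1"
  proof
    assume q: "P \<noteq> []"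
    then have q2: "P2 \<noteq> []" using lP by auto
    have "last P < a" using sorted_last_less[of P "[a..c]"] su(1) run(1,3) q upto_Cons[OF run(3)] by simp
    moreover have "last P2 < a" using sorted_last_less[of P2 "[a..c]"] su(2) run(2,3) q2 upto_Cons[OF run(3)] by simp
    moreover have "last P \<le> last P2" by (rule rowle_last[OF le' lP q])
    ultimately show "last P < a - 1" using max q q2 by force
  qed
  \<comment> \<open>Otherwise both columns continue with \<open>c + 1\<close>. Extending downwards
    to a maximal end \<open>d\<close> exhibits the pattern of \<open>not_red_run2\<close> in the
    shortened word.\<close>
  have Q2: "Q2 \<noteq> [] \<longrightarrow> c + 1 < hd Q2"
  proof (rule ccontr)
    assume "\<not> ?thesis"
    then have q: "Q2 \<noteq> []" "\<not> c + 1 < hd Q2" by auto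
    have le'': "rowle ((P @ [a..c]) @ Q1) ((P2 @ [a..c]) @ Q2)" using le' by simp
    have q1: "Q1 \<noteq> []" "hd Q1 \<le> hd Q2" using rowle_hd[OF le'' _ q(1)] lP by auto
    have sQ: "sorted_wrt (<) Q1" "sorted_wrt (<) Q2" using s1 s2 K2 by (auto simp: sorted_wrt_append)
    have "c < hd Q1" using s1 q1(1) by (auto simp: sorted_wrt_append)
    then have h: "hd Q1 = c + 1" "hd Q2 = c + 1" using q q1 by auto
    obtain d Q1' Q2' where w: "Q1 = [c + 1..d] @ Q1'" "Q2 = [c + 1..d] @ Q2'" "c + 1 \<le> d"
      "\<not> (Q1' \<noteq> [] \<and> Q2' \<noteq> [] \<and> hd Q1' = d + 1 \<and> hd Q2' = d + 1)"
      using common_down_run[OF sQ q1(1) q(1) h] by blast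
    have le3: "rowle ((P @ [a..c] @ [c + 1..d]) @ Q1') ((P2 @ [a..c] @ [c + 1..d]) @ Q2')"
      using le' w by simp
    have Q2': "Q2' \<noteq> [] \<longrightarrow> d + 1 < hd Q2'"
    proof
      assume z: "Q2' \<noteq> []"
      have 1: "Q1' \<noteq> []" "hd Q1' \<le> hd Q2'" using rowle_hd[OF le3 _ z] lP by auto
      have "d < hd Q1'" using sorted_last_less[of "[c + 1..d]" Q1'] sQ(1) w(1,3) 1(1) upto_snoc[OF w(3)] by simp
      then show "d + 1 < hd Q2'" using w(4) z 1 by force
    qed
    let ?M = "rev P @ rev Q2'" and ?ys = "rev [c + 1..d - 1] @ rev [a..c - 1]"
    have M: "m \<le> a - 2 \<or> m \<ge> d + 2" if "m \<in> set ?M" for m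
    proof -
      have "m \<le> a - 2" if "m \<in> set P"
        using sorted_far[OF _ P that] su(1) run(1) by (simp add: sorted_wrt_append)
      moreover have "m \<ge> d + 2" if "m \<in> set Q2'"
        using sorted_far'[OF _ Q2' that] sQ(2) w(2) by (simp add: sorted_wrt_append)
      ultimately show ?thesis using that by auto
    qed
    have ad: "[a..d] = [a..c] @ [c + 1..d]" using upto_app[of a "c + 1" d] w(3) run(3) by simp
    have cd: "rev [c + 1..d] = d # rev [c + 1..d - 1]" using upto_snoc[OF w(3)] by simp
    have K2': "K2 = P2 @ [a..c] @ Q2" using K2 run(2) by simp
    have E: "cw As @ rev Q1 @ rev U @ cw (K2 # Bs) =
      (cw As @ rev Q1') @ ([d] @ ?ys @ ?M @ rev [a..d]) @ (rev P2 @ cw Bs)"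
      unfolding K2' U w(1,2) ad by (simp add: cd del: upto.simps)
    have N: "\<not> red ((cw As @ rev Q1') @ ([d] @ ?ys @ ?M @ rev [a..d]) @ (rev P2 @ cw Bs)) v"
      by (rule not_red_run2[OF v M]) (use w(3) run(3) in auto)
    show False using N redy unfolding E by blast
  qed
  have K2': "K2 = P2 @ [a..c] @ Q2" using K2 run(2) by simp
  let ?x = "(As @ [P @ [a..c] @ Q1], P2, a, [a + 1..c] @ Q2, Bs)"
  have ye': "y = (As, P @ [a..c - 1], c, Q1, (P2 @ [a..c] @ Q2) # Bs)" unfolding ye Bs K2' U by simp
  have "row_rel ?x y" unfolding row_rel_def ye' using lP run(3) P Q2 by blast
  moreover have "?x \<in> cells v r 0" "rb0 ?x"
    using row_cells(1)[OF v lP run(3) P Q2, where As = As and ?Q1.0 = Q1 and Bs = Bs and r = r]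
      row_cells(2,3)[OF v lP run(3) P Q2, where As = As and ?Q1.0 = Q1 and Bs = Bs] y(1) unfolding ye' by blast+
  ultimately show ?thesis by blast
qed

lemma card_row:
  assumes "permutation v"
  shows "card {x\<in>cells v r 0. rb0 x} = card {y\<in>cells v r 1. rb1 y}"
proof (rule card_eq_rel[where R = row_rel])
  fix x y y' assume "row_rel x y" "row_rel x y'"
  then obtain As P P2 a c Q1 Q2 Bs As' P' P2' a' c' Q1' Q2' Bs' where
    *: "length P = length P2" "a \<le> c" "x = (As @ [P @ [a..c] @ Q1], P2, a, [a + 1..c] @ Q2, Bs)"
     "y = (As, P @ [a..c - 1], c, Q1, (P2 @ [a..c] @ Q2) # Bs)" "Q2 \<noteq> [] \<longrightarrow> c + 1 < hd Q2"
    and **: "length P' = length P2'" "a' \<le> c'" "x = (As' @ [P' @ [a'..c'] @ Q1'], P2', a', [a' + 1..c'] @ Q2', Bs')"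
     "y' = (As', P' @ [a'..c' - 1], c', Q1', (P2' @ [a'..c'] @ Q2') # Bs')" "Q2' \<noteq> [] \<longrightarrow> c' + 1 < hd Q2'"
    unfolding row_rel_def by blast
  have e: "[a + 1..c] @ Q2 = [a + 1..c'] @ Q2'" "a = a'" using *(3) **(3) by auto
  have "Q2 = Q2' \<and> c = c'" by (rule down_uniq[OF e(1)]) (use * ** e in auto)
  then show "y = y'" using * ** by auto
next
  fix x x' y assume "row_rel x y" "row_rel x' y"
  then obtain As P P2 a c Q1 Q2 Bs As' P' P2' a' c' Q1' Q2' Bs' where
    *: "length P = length P2" "a \<le> c" "x = (As @ [P @ [a..c] @ Q1], P2, a, [a + 1..c] @ Q2, Bs)"
     "y = (As, P @ [a..c - 1], c, Q1, (P2 @ [a..c] @ Q2) # Bs)" "P \<noteq> [] \<longrightarrow> last P < a - 1"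
    and **: "length P' = length P2'" "a' \<le> c'" "x' = (As' @ [P' @ [a'..c'] @ Q1'], P2', a', [a' + 1..c'] @ Q2', Bs')"
     "y = (As', P' @ [a'..c' - 1], c', Q1', (P2' @ [a'..c'] @ Q2') # Bs')" "P' \<noteq> [] \<longrightarrow> last P' < a' - 1"
    unfolding row_rel_def by blast
  have e: "P @ [a..c - 1] = P' @ [a'..c - 1]" "c = c'" using *(4) **(4) by auto
  have "P = P' \<and> a = a'" by (rule up_uniq[OF e(1)]) (use * ** e in auto)
  then show "x = x'" using * ** by auto
qed (use row_ex0[OF assms] row_ex1[OF assms] in blast)+

text \<open>Positive and negative marks are matched in two classes: unblocked marks by sliding
  within their column, blocked ones by jumping to the neighbouring column.\<close>

theorem transition_EGi:
  assumes v: "permutation v"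
  shows "(\<Sum>s\<in>rcov v r. EGi (v \<circ> tr r s)) = (\<Sum>i\<in>lcov v r. EGi (v \<circ> tr i r))"
proof -
  have fin: "finite {x \<in> {Ks. tab Ks}. cw x = c}" for c using finite_cw[of c] by simp
  have fc: "finite (cells v r e)" for e
  proof -
    let ?g = "\<lambda>(As, U, a, W, Bs). (As @ (U @ a # W) # Bs, length (cw As @ rev W)) :: int list list \<times> nat"
    have "?g ` cells v r e \<subseteq> marked {Ks. tab Ks} cw v r e"
      by (auto simp: cells_def marked_def rem_def nth_append)
    then have "finite (?g ` cells v r e)" using finite_marked[OF v fin] finite_subset by blast
    moreover have "inj_on ?g (cells v r e)"
    proof (rule inj_onI)
      fix x y assume "?g x = ?g y"
      moreover obtain As U a W Bs where "x = (As, U, a, W, Bs)" by (cases x)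
      moreover obtain As' U' a' W' Bs' where "y = (As', U', a', W', Bs')" by (cases y)
      ultimately show "x = y" using cell_uniq[of As U a W Bs As' U' a' W' Bs'] by simp
    qed
    ultimately show ?thesis by (rule finite_imageD)
  qed
  have "card (cells v r 0) = card {x\<in>cells v r 0. rb0 x} + card {x\<in>cells v r 0. \<not> rb0 x}"
    using fc by (subst card_Un_disjoint[symmetric]) (auto intro!: arg_cong[of _ _ card])
  moreover have "card (cells v r 1) = card {x\<in>cells v r 1. rb1 x} + card {x\<in>cells v r 1. \<not> rb1 x}"
    using fc by (subst card_Un_disjoint[symmetric]) (auto intro!: arg_cong[of _ _ card])
  ultimately have "card (marked {Ks. tab Ks} cw v r 0) = card (marked {Ks. tab Ks} cw v r 1)"
    unfolding card_marked_cells using card_row[OF v] card_shift by simp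
  from transition_marked[OF v fin this] show ?thesis by (simp add: EGi_def)
qed

section \<open>The dimension of the module of a Rothe diagram\<close>

text \<open>The coefficient of \<open>i\<close> in the last tensor factor. Since it distinguishes a
  position, it is used with the empty set of operators only, for dimensions.\<close>

definition lastc :: "'r \<Rightarrow> ('r list \<Rightarrow> real) \<Rightarrow> 'r list \<Rightarrow> real" where
  "lastc i f xs = f (xs @ [i])"

lemma lin_lastc: "lin (lastc i)"
  by (auto simp: lin_def lastc_def fun_eq_iff)

lemma equivar_lastc: "equivar {} (lastc i)"
  by (rule equivar_empty[OF lin_lastc])

lemma Fop_snoc: "Fop a b f (xs @ [i]) = Fop a b (lastc i f) xs + of_bool (i = b) * f (xs @ [a])"
proof -
  have "{p. p < length (xs @ [i]) \<and> (xs @ [i]) ! p = b} =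
      {p. p < length xs \<and> xs ! p = b} \<union> (if i = b then {length xs} else {})"
    by (auto simp: nth_append less_Suc_eq)
  then have "Fop a b f (xs @ [i]) = (\<Sum>p\<in>{p. p < length xs \<and> xs ! p = b}. f ((xs @ [i])[p := a])) +
      (\<Sum>p\<in>(if i = b then {length xs} else {}). f ((xs @ [i])[p := a]))"
    unfolding Fop_def by (simp only:) (rule sum.union_disjoint, auto)
  then show ?thesis by (auto simp: Fop_def lastc_def list_update_append intro!: sum.cong)
qed

lemma lastc_Fop: "lastc i (Fop a b f) = (\<lambda>xs. Fop a b (lastc i f) xs + of_bool (i = b) * lastc a f xs)"
  by (rule ext) (simp add: lastc_def[of i "Fop a b f"] Fop_snoc lastc_def[of a f])

lemma lastc_Fop_other: "i \<noteq> b \<Longrightarrow> lastc i (Fop a b f) = Fop a b (lastc i f)"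
  by (simp add: lastc_Fop)

lemma lastc_Fop_funpow_other: "i \<noteq> b \<Longrightarrow> lastc i ((Fop a b ^^ n) f) = (Fop a b ^^ n) (lastc i f)"
  by (induction n) (auto simp: lastc_Fop_other)

text \<open>Leibniz rule: one of the applications may turn the last letter from \<open>a\<close>
  into \<open>b\<close>, and since \<open>a \<noteq> b\<close> this happens at most once.\<close>

lemma lastc_Fop_funpow:
  assumes "a \<noteq> b"
  shows "lastc b ((Fop a b ^^ Suc n) f) =
    (\<lambda>xs. (Fop a b ^^ Suc n) (lastc b f) xs + real (Suc n) * (Fop a b ^^ n) (lastc a f) xs)"
proof (induction n)
  case 0
  then show ?case by (simp add: lastc_Fop)
next
  case (Suc n)
  have "lastc b ((Fop a b ^^ Suc (Suc n)) f) =
      (\<lambda>xs. Fop a b (lastc b ((Fop a b ^^ Suc n) f)) xs + lastc a ((Fop a b ^^ Suc n) f) xs)"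
    by (simp add: lastc_Fop)
  also have "lastc a ((Fop a b ^^ Suc n) f) = (Fop a b ^^ Suc n) (lastc a f)"
    by (rule lastc_Fop_funpow_other[OF assms])
  also have "Fop a b (lastc b ((Fop a b ^^ Suc n) f)) =
      (\<lambda>xs. (Fop a b ^^ Suc (Suc n)) (lastc b f) xs + real (Suc n) * (Fop a b ^^ Suc n) (lastc a f) xs)"
    unfolding Suc.IH using lin_comb[OF lin_Fop] by simp
  finally show ?case by (simp add: algebra_simps)
qed

lemma Fop_Nil: "Fop a b f [] = 0"
  by (simp add: Fop_def)

text \<open>The commutation relations of the matrix units of gl, verified by splitting off the last
  tensor factor.\<close>

lemma Fop_commutator:
  "Fop a b (Fop c d f) xs = Fop c d (Fop a b f) xs + of_bool (d = a) * Fop c b f xs -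
    of_bool (b = c) * Fop a d f xs"
proof (induction xs arbitrary: f rule: rev_induct)
  case Nil
  then show ?case by (simp add: Fop_Nil)
next
  case (snoc i xs)
  have s: "Fop a b (\<lambda>xs. g xs + of_bool P * h xs) xs = Fop a b g xs + of_bool P * Fop a b h xs"
    for a b :: 'a and g h P by (simp only: lin_comb[OF lin_Fop])
  have h1: "Fop a b (Fop c d f) (xs @ [i]) = Fop a b (Fop c d (lastc i f)) xs +
      of_bool (i = d) * Fop a b (lastc c f) xs +
      of_bool (i = b) * (Fop c d (lastc a f) xs + of_bool (a = d) * f (xs @ [c]))"
    by (simp only: Fop_snoc lastc_Fop s) ((simp add: lastc_def)?)
  have h2: "Fop c d (Fop a b f) (xs @ [i]) = Fop c d (Fop a b (lastc i f)) xs +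
      of_bool (i = b) * Fop c d (lastc a f) xs +
      of_bool (i = d) * (Fop a b (lastc c f) xs + of_bool (c = b) * f (xs @ [a]))"
    by (simp only: Fop_snoc lastc_Fop s) ((simp add: lastc_def)?)
  have e: "of_bool (a = d) = (of_bool (d = a) :: real)" "of_bool (c = b) = (of_bool (b = c) :: real)"
    by (simp_all add: eq_commute)
  have comb: "L = R + p * s1 - q * s2" if "L = A1 + \<delta> * B + \<beta> * (C + p' * E)" "R = A2 + \<beta> * C + \<delta> * (B + q' * G)"
      "A1 = A2 + p * H - q * J" "s1 = H + \<beta> * E" "s2 = J + \<delta> * G" "p' = p" "q' = q"
    for L R p s1 q s2 A1 A2 B C E G H J \<beta> \<delta> p' q' :: real
    unfolding that by (simp add: algebra_simps)
  show ?case
    by (rule comb[OF h1 h2 snoc.IH[of "lastc i f"] Fop_snoc[of c b f xs i] Fop_snoc[of a d f xs i] e])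
qed

lemma Fop_commute: "d \<noteq> a \<Longrightarrow> b \<noteq> c \<Longrightarrow> Fop a b (Fop c d f) = Fop c d (Fop a b f)"
  by (rule ext) (subst Fop_commutator, simp)

text \<open>\<open>Fop a i\<close> is the commutator of \<open>Fop e i\<close> and
  \<open>Fop a e\<close> and commutes with both. As \<open>Fop e i\<close> kills \<open>u\<close>,
  applying first the \<open>m\<close>-th power of \<open>Fop a e\<close> and then that of
  \<open>Fop e i\<close> gives \<open>m!\<close> times the \<open>m\<close>-th power of
  \<open>Fop a i\<close> on \<open>u\<close>.\<close>

lemma Fop_raise:
  assumes u: "Fop e i u = (\<lambda>_. 0)" and "a \<noteq> i" "a \<noteq> e" "e \<noteq> i" and z: "(Fop a e ^^ m) u = (\<lambda>_. 0)"
  shows "(Fop a i ^^ m) u = (\<lambda>_. 0)"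
proof -
  have cFX: "Fop a i (Fop a e f) = Fop a e (Fop a i f)" for f using assms by (intro Fop_commute) auto
  have cEF: "Fop e i (Fop a i f) = Fop a i (Fop e i f)" for f using assms by (intro Fop_commute) auto
  have cFXn: "Fop a i ((Fop a e ^^ n) f) = (Fop a e ^^ n) (Fop a i f)" for n f
    by (induction n) (auto simp: cFX)
  have cEnF: "(Fop e i ^^ n) (Fop a i f) = Fop a i ((Fop e i ^^ n) f)" for n f
    by (induction n) (auto simp: cEF)
  have 1: "Fop e i ((Fop a e ^^ Suc n) u) = (\<lambda>xs. real (Suc n) * Fop a i ((Fop a e ^^ n) u) xs)" for n
  proof (induction n)
    case 0
    have "Fop a e (Fop e i u) = (\<lambda>_. 0)" unfolding u by (rule lin_zero[OF lin_Fop])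
    then show ?case using Fop_commutator[of e i a e u] assms(2-4) by (simp add: fun_eq_iff)
  next
    case (Suc n)
    have "Fop e i (Fop a e ((Fop a e ^^ Suc n) u)) = (\<lambda>xs. Fop a e (Fop e i ((Fop a e ^^ Suc n) u)) xs +
        Fop a i ((Fop a e ^^ Suc n) u) xs)"
      using Fop_commutator[of e i a e "(Fop a e ^^ Suc n) u"] assms by (auto simp: fun_eq_iff)
    also have "Fop a e (Fop e i ((Fop a e ^^ Suc n) u)) =
        (\<lambda>xs. real (Suc n) * Fop a i ((Fop a e ^^ Suc n) u) xs)"
      unfolding Suc.IH lin_scale[OF lin_Fop] by (simp add: cFX)
    finally show ?case by (simp add: algebra_simps)
  qed
  have 2: "(Fop e i ^^ n) ((Fop a e ^^ n) u) = (\<lambda>xs. fact n * (Fop a i ^^ n) u xs)" for n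
  proof (induction n)
    case (Suc n)
    have "(Fop e i ^^ Suc n) ((Fop a e ^^ Suc n) u) = (Fop e i ^^ n) (Fop e i ((Fop a e ^^ Suc n) u))"
      by (simp only: funpow_Suc_right o_apply)
    also have "\<dots> = (\<lambda>xs. real (Suc n) * Fop a i ((Fop e i ^^ n) ((Fop a e ^^ n) u)) xs)"
      unfolding 1 lin_scale[OF lin_funpow[OF lin_Fop]] cEnF ..
    also have "\<dots> = (\<lambda>xs. fact (Suc n) * (Fop a i ^^ Suc n) u xs)"
      unfolding Suc.IH lin_scale[OF lin_Fop] by (simp add: algebra_simps)
    finally show ?case .
  qed simp
  have "(\<lambda>xs. fact m * (Fop a i ^^ m) u xs) = (\<lambda>_. 0)"
    unfolding 2[symmetric] z by (rule lin_zero[OF lin_funpow[OF lin_Fop]])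
  then have "fact m * (Fop a i ^^ m) u xs = 0" for xs by metis
  then show ?thesis by (auto simp: fun_eq_iff)
qed

text \<open>Renames rows. It accounts for the exchange of two rows when a descent is removed from a
  permutation.\<close>

definition rl :: "('r \<Rightarrow> 'r) \<Rightarrow> ('r list \<Rightarrow> real) \<Rightarrow> 'r list \<Rightarrow> real" where
  "rl h f xs = f (map h xs)"

lemma lin_rl: "lin (rl h)"
  by (auto simp: lin_def rl_def fun_eq_iff)

lemma Fop_rl:
  assumes "\<And>x. h (h x) = x"
  shows "Fop a b (rl h f) = rl h (Fop (h a) (h b) f)"
proof
  fix ys
  have "map h ys ! p = h b \<longleftrightarrow> ys ! p = b" if "p < length ys" for p
    using that assms by (metis nth_map)
  then have "{p. p < length (map h ys) \<and> map h ys ! p = h b} = {p. p < length ys \<and> ys ! p = b}" by auto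
  then show "Fop a b (rl h f) ys = rl h (Fop (h a) (h b) f) ys"
    unfolding Fop_def rl_def by (auto simp: map_update intro!: sum.cong)
qed

lemma Fop_funpow_rl:
  assumes "\<And>x. h (h x) = x"
  shows "(Fop a b ^^ n) (rl h f) = rl h ((Fop (h a) (h b) ^^ n) f)"
  by (induction n) (auto simp: Fop_rl[OF assms])

lemma rl_gn:
  assumes "\<And>x. h (h x) = x"
  shows "rl h (gn d \<rho> \<kappa>) = gn d (h \<circ> \<rho>) \<kappa>"
proof
  fix xs
  have "h x = y \<longleftrightarrow> x = h y" for x y using assms by metis
  then show "rl h (gn d \<rho> \<kappa>) xs = gn d (h \<circ> \<rho>) \<kappa> xs"
    unfolding rl_def gn_def by (intro sum.cong) auto
qed

lemma len_rl_le: "subsp M \<Longrightarrow> len {} (rl h ` M) \<le> len {} M"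
  using len_exact[OF equivar_empty[OF lin_rl, of h], of M] by (simp add: submod_empty_iff)

lemma len_rl:
  assumes "\<And>x. h (h x) = x" "subsp M"
  shows "len {} (rl h ` M) = len {} M"
proof (rule antisym[OF len_rl_le[OF assms(2)]])
  have "subsp (rl h ` M)"
    using submod_image[OF equivar_empty[OF lin_rl, of h], of M] assms(2) by (simp add: submod_empty_iff)
  then have "len {} (rl h ` rl h ` M) \<le> len {} (rl h ` M)" by (rule len_rl_le)
  moreover have "rl h (rl h f) = f" for f using assms(1) by (simp add: rl_def fun_eq_iff o_def)
  then have "rl h ` rl h ` M = M" by (simp add: image_image)
  ultimately show "len {} M \<le> len {} (rl h ` M)" by simp
qed

lemma subsp_Mod: "subsp (Mod D)"
  by (rule submod_subsp[OF submod_Mod])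

lemma rl_Mod:
  assumes h: "\<And>x. h (h x) = x"
  shows "rl h ` Mod D = Mod ((\<lambda>(x, c). (h x, c)) ` D)"
proof -
  let ?k = "\<lambda>(x, c). (h x, c)"
  have inj: "inj_on ?k D" by (rule inj_onI) (metis (mono_tags, lifting) case_prod_conv h prod.collapse prod.inject)
  have "rl h ` gens D = gens (?k ` D)"
  proof
    show "rl h ` gens D \<subseteq> gens (?k ` D)"
    proof
      fix s assume "s \<in> rl h ` gens D"
      then obtain \<rho> \<kappa> where f: "fill D \<rho> \<kappa>" "s = gn (card D) (h \<circ> \<rho>) \<kappa>"
        by (auto simp: gens_def rl_gn[OF h])
      have "fill (?k ` D) (h \<circ> \<rho>) \<kappa>"
        unfolding fill_image[OF inj] using f(1) by (intro exI[of _ \<rho>] exI[of _ \<kappa>]) simp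
      then show "s \<in> gens (?k ` D)" unfolding gens_def f(2) using card_image[OF inj] by force
    qed
    show "gens (?k ` D) \<subseteq> rl h ` gens D"
    proof
      fix s assume "s \<in> gens (?k ` D)"
      then obtain \<rho>' \<kappa>' where f: "fill (?k ` D) \<rho>' \<kappa>'" "s = gn (card D) \<rho>' \<kappa>'"
        using card_image[OF inj] by (auto simp: gens_def)
      then obtain \<rho> \<kappa> where r: "fill D \<rho> \<kappa>" "\<And>p. p < card D \<Longrightarrow> (\<rho>' p, \<kappa>' p) = ?k (\<rho> p, \<kappa> p)"
        unfolding fill_image[OF inj] by blast
      have "s = gn (card D) (h \<circ> \<rho>) \<kappa>" unfolding f(2) by (rule gn_cong; drule r(2)) auto
      then have "s = rl h (gn (card D) \<rho> \<kappa>)" by (simp only: rl_gn[OF h])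
      then show "s \<in> rl h ` gens D" using r(1) unfolding gens_def by blast
    qed
  qed
  then show ?thesis unfolding Mod_def using lspan_image[OF lin_rl] by metis
qed

text \<open>A column permutation that moves the last position puts there the row of another box in
  that column, which is not \<open>i\<close>. Only permutations fixing the last position
  contribute.\<close>

lemma gn_last:
  assumes "\<And>p. p < d \<Longrightarrow> \<kappa> p = \<kappa> d \<Longrightarrow> \<rho> p \<noteq> i"
  shows "lastc i (gn (Suc d) \<rho> \<kappa>) = (if \<rho> d = i then gn d \<rho> \<kappa> else (\<lambda>_. 0))"
proof
  fix xs
  let ?t = "\<lambda>\<sigma>. of_int (sign \<sigma>) * of_bool (length (xs @ [i]) = Suc d \<and> (\<forall>p<Suc d. (xs @ [i]) ! p = \<rho> (\<sigma> p))) :: real"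
  have z: "?t \<sigma> = 0" if s: "\<sigma> \<in> colperms (Suc d) \<kappa> - colperms d \<kappa>" for \<sigma>
  proof -
    have sp: "\<sigma> permutes {..<Suc d}" and k: "\<kappa> (\<sigma> d) = \<kappa> d" using s by (auto simp: colperms_def)
    have "\<sigma> d \<noteq> d"
    proof
      assume "\<sigma> d = d"
      then have "\<sigma> permutes {..<d}"
        by (intro permutes_superset[OF sp]) (auto simp: less_Suc_eq)
      then show False using s by (auto simp: colperms_def)
    qed
    then have "\<sigma> d < d" using permutes_less[OF sp, of d] by simp
    then have "\<rho> (\<sigma> d) \<noteq> i" using assms k by blast
    then have "\<not> (length (xs @ [i]) = Suc d \<and> (\<forall>p<Suc d. (xs @ [i]) ! p = \<rho> (\<sigma> p)))"
      by (auto simp: nth_append intro!: exI[of _ d])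
    then show ?thesis by simp
  qed
  have sub: "colperms d \<kappa> \<subseteq> colperms (Suc d) \<kappa>"
  proof
    fix \<sigma> assume s: "\<sigma> \<in> colperms d \<kappa>"
    then have "\<sigma> permutes {..<Suc d}" by (auto simp: colperms_def intro: permutes_subset)
    moreover have "\<sigma> d = d" using s permutes_not_in[of \<sigma> "{..<d}" d] by (auto simp: colperms_def)
    ultimately show "\<sigma> \<in> colperms (Suc d) \<kappa>" using s by (auto simp: colperms_def less_Suc_eq)
  qed
  have "lastc i (gn (Suc d) \<rho> \<kappa>) xs = (\<Sum>\<sigma>\<in>colperms (Suc d) \<kappa>. ?t \<sigma>)"
    by (simp only: lastc_def gn_def)
  also have "\<dots> = (\<Sum>\<sigma>\<in>colperms d \<kappa>. ?t \<sigma>)"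
    by (rule sum.mono_neutral_right) (use z sub in \<open>auto simp: finite_colperms\<close>)
  also have "\<dots> = (if \<rho> d = i then gn d \<rho> \<kappa> else (\<lambda>_. 0)) xs"
  proof -
    have "?t \<sigma> = (if \<rho> d = i then of_int (sign \<sigma>) * of_bool (length xs = d \<and> (\<forall>p<d. xs ! p = \<rho> (\<sigma> p))) else 0)"
      if "\<sigma> \<in> colperms d \<kappa>" for \<sigma>
    proof -
      have "\<sigma> d = d" using that permutes_not_in[of \<sigma> "{..<d}" d] by (auto simp: colperms_def)
      then show ?thesis by (auto simp: nth_append less_Suc_eq)
    qed
    then show ?thesis by (simp add: gn_def)
  qed
  finally show "lastc i (gn (Suc d) \<rho> \<kappa>) xs = (if \<rho> d = i then gn d \<rho> \<kappa> else (\<lambda>_. 0)) xs" .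
qed

lemma len_simple:
  assumes "\<And>U. submod G U \<Longrightarrow> U \<subseteq> M \<Longrightarrow> U = {\<lambda>_. 0} \<or> U = M"
  shows "len G M \<le> 1"
proof (rule len_least)
  fix U n assume U: "chain_to G U n" "U \<subseteq> M"
  show "enat n \<le> 1"
  proof (rule ccontr)
    assume "\<not> ?thesis"
    then have "2 \<le> n" by (simp add: one_enat_def)
    then have "chain_to G U (Suc (Suc 0))" using chain_to_le[OF U(1)] by simp
    then obtain V W where "V \<subset> U" "W \<subset> V" "submod G W" "submod G V"
      by (metis Suc_inject chain_to.cases chain_to_submod nat.distinct(1))
    moreover from this have "(\<lambda>_. 0) \<in> W" "V \<noteq> M" "V \<subseteq> M" using U(2) by (auto simp: submod_def subsp_def)
    ultimately show False using assms[of V] by blast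
  qed
qed

lemma len_Mod_pos:
  fixes D :: "('a \<times> 'b) set"
  assumes "finite D"
  shows "1 \<le> len (PG (card D)) (Mod D)"
proof -
  obtain \<rho> \<kappa> where f: "fill D \<rho> \<kappa>" using fill_ex[OF assms] by blast
  have "gn (card D) \<rho> \<kappa> \<noteq> (\<lambda>_. 0)" using gn_self_fill[OF f] by auto
  then have sub: "{\<lambda>_. 0} \<subset> Mod D" using gn_in_Mod[OF f] subspD(1)[OF subsp_Mod, of D] by auto
  have zero: "submod (PG (card D)) {\<lambda>_ :: 'a list. 0}" by (rule submod_zero) (rule lin_PG)
  have "len (PG (card D)) {\<lambda>_ :: 'a list. 0} + 1 \<le> len (PG (card D)) (Mod D)"
    using len_strict[OF zero submod_Mod sub] .
  then show ?thesis by (simp add: len_zero)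
qed

lemma card_red_id: "card {c. red c id} = 1"
proof -
  have "red c id \<longleftrightarrow> c = []" for c by (cases c) auto
  then show ?thesis by simp
qed

lemma enat_sum: "finite A \<Longrightarrow> (\<Sum>a\<in>A. enat (g a)) = enat (\<Sum>a\<in>A. g a)"
  by (induction A rule: finite_induct) (auto simp: zero_enat_def)

text \<open>For each descent \<open>a\<close> the generators with box \<open>(a, z (a + 1))\<close>
  in the last position span \<open>N a\<close>. Its coefficient at \<open>a\<close> is the module of
  the diagram without that box, which up to a row exchange belongs to \<open>z \<circ> sr a\<close>,
  and its coefficients at larger letters vanish. This is triangular and mirrors the recursion for
  reduced words.\<close>

theorem len_Mod_dg_ge: "permutation z \<Longrightarrow> enat (card {c. red c z}) \<le> len {} (Mod (dg z))"
proof (induction "card (dg z)" arbitrary: z)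
  case 0
  then have "z = id" using dg_empty_iff finite_dg by auto
  obtain \<rho> \<kappa> where f: "fill (dg z) \<rho> \<kappa>" using fill_ex[OF finite_dg[OF 0(2)]] by blast
  have "gn (card (dg z)) \<rho> \<kappa> \<noteq> (\<lambda>_. 0)" using gn_self_fill[OF f] by auto
  then have "{\<lambda>_. 0} \<subset> Mod (dg z)" using gn_in_Mod[OF f] subspD(1)[OF subsp_Mod, of "dg z"] by auto
  then have "len {} {\<lambda>_ :: int list. 0} + 1 \<le> len {} (Mod (dg z))"
    using len_strict[of "{}" "{\<lambda>_. 0}" "Mod (dg z)"] submod_zero[of "{}"] subsp_Mod[of "dg z"]
    by (simp add: submod_empty_iff)
  then have "1 \<le> len {} (Mod (dg z))" by (simp add: len_zero)
  moreover have "card {c. red c z} = 1" unfolding \<open>z = id\<close> by (rule card_red_id)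
  ultimately show ?case by (simp add: one_enat_def)
next
  case (Suc d z)
  note z = Suc.prems
  let ?D = "dg z" and ?b = "\<lambda>a. (a, z (a + 1))"
  have ne: "z \<noteq> id" using Suc.hyps(2) by (auto simp: dg_id simp del: id_apply)
  define N where "N a = lspan {gn (Suc d) \<rho> \<kappa> |\<rho> \<kappa>. fill ?D \<rho> \<kappa> \<and> (\<rho> d, \<kappa> d) = ?b a}" for a
  define Ts where "Ts = map (\<lambda>a. (N a, lastc a, Mod (?D - {?b a}))) (rev (sorted_list_of_set (descents z)))"
  have g: "lastc i (gn (Suc d) \<rho> \<kappa>) = (if i = a then gn d \<rho> \<kappa> else (\<lambda>_. 0))"
    if f: "fill ?D \<rho> \<kappa>" "(\<rho> d, \<kappa> d) = ?b a" and i: "a \<le> i" for a i \<rho> \<kappa>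
  proof -
    have "\<rho> p \<noteq> i" if p: "p < d" "\<kappa> p = \<kappa> d" for p
    proof
      assume r: "\<rho> p = i"
      have "(\<rho> p, \<kappa> p) \<in> ?D"
        unfolding fill_mem[OF f(1)] using p(1) Suc.hyps(2) by (intro exI[of _ p]) simp
      \<comment> \<open>The box is the lowest one of its column: a box in column
        \<open>z (a + 1)\<close> lies in a row before \<open>a + 1\<close>.\<close>
      then have "i < a + 1" using mem_dg[OF z, of i "a + 1"] p(2) f(2) r by simp
      then have "\<rho> p = \<rho> d" using i r f(2) by simp
      then have "p = d"
        using f(1) p Suc.hyps(2) unfolding fill_def bij_betw_def inj_on_def by (metis lessI lessThan_iff less_SucI)
      then show False using p(1) by simp
    qed
    then show ?thesis using gn_last[of d \<kappa> \<rho> i] f(2) by auto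
  qed
  have LN: "lastc a ` N a = Mod (?D - {?b a})" if a: "a \<in> descents z" for a
  proof -
    have bD: "?b a \<in> ?D" using a mem_dg[OF z, of a "a + 1"] by (simp add: descents_def)
    have cD: "card (?D - {?b a}) = d" using bD Suc.hyps(2) by (simp add: card_Diff_singleton)
    have "lastc a ` {gn (Suc d) \<rho> \<kappa> |\<rho> \<kappa>. fill ?D \<rho> \<kappa> \<and> (\<rho> d, \<kappa> d) = ?b a} = gens (?D - {?b a})"
    proof
      show "lastc a ` {gn (Suc d) \<rho> \<kappa> |\<rho> \<kappa>. fill ?D \<rho> \<kappa> \<and> (\<rho> d, \<kappa> d) = ?b a} \<subseteq> gens (?D - {?b a})"
      proof
        fix s assume "s \<in> lastc a ` {gn (Suc d) \<rho> \<kappa> |\<rho> \<kappa>. fill ?D \<rho> \<kappa> \<and> (\<rho> d, \<kappa> d) = ?b a}"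
        then obtain \<rho> \<kappa> where f: "fill ?D \<rho> \<kappa>" "(\<rho> d, \<kappa> d) = ?b a" "s = lastc a (gn (Suc d) \<rho> \<kappa>)" by auto
        have b: "bij_betw (\<lambda>p. (\<rho> p, \<kappa> p)) {..<Suc d} ?D" using f(1) Suc.hyps(2) by (simp add: fill_def)
        have "bij_betw (\<lambda>p. (\<rho> p, \<kappa> p)) ({..<Suc d} - {d}) (?D - {(\<rho> d, \<kappa> d)})"
          by (rule bij_betw_DiffI[OF b]) (use bij_betwE[OF b] in auto)
        moreover have "{..<Suc d} - {d} = {..<d}" by auto
        ultimately have "fill (?D - {?b a}) \<rho> \<kappa>" using f(2) cD by (simp add: fill_def)
        moreover have "s = gn d \<rho> \<kappa>" using g[OF f(1,2), of a] f(3) by simp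
        ultimately show "s \<in> gens (?D - {?b a})" using cD unfolding gens_def by blast
      qed
      show "gens (?D - {?b a}) \<subseteq> lastc a ` {gn (Suc d) \<rho> \<kappa> |\<rho> \<kappa>. fill ?D \<rho> \<kappa> \<and> (\<rho> d, \<kappa> d) = ?b a}"
      proof
        fix s assume "s \<in> gens (?D - {?b a})"
        then obtain \<rho> \<kappa> where f: "fill (?D - {?b a}) \<rho> \<kappa>" "s = gn d \<rho> \<kappa>" using cD by (auto simp: gens_def)
        let ?r = "\<rho>(d := a)" and ?k = "\<kappa>(d := z (a + 1))"
        have b: "bij_betw (\<lambda>p. (?r p, ?k p)) {..<d} (?D - {?b a})"
          using f(1) cD unfolding fill_def by (subst bij_betw_cong[where g = "\<lambda>p. (\<rho> p, \<kappa> p)"]) auto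
        have "bij_betw (\<lambda>p. (?r p, ?k p)) ({..<d} \<union> {d}) ((?D - {?b a}) \<union> {?b a})"
          by (rule bij_betw_combine[OF b]) (auto simp: bij_betw_def)
        moreover have "{..<d} \<union> {d} = {..<Suc d}" "(?D - {?b a}) \<union> {?b a} = ?D" using bD by auto
        ultimately have F: "fill ?D ?r ?k" using Suc.hyps(2) unfolding fill_def by metis
        have "lastc a (gn (Suc d) ?r ?k) = gn d ?r ?k" using g[OF F, of a a] by simp
        also have "gn d ?r ?k = s" unfolding f(2) by (rule gn_cong) auto
        finally have "s = lastc a (gn (Suc d) ?r ?k)" ..
        moreover have "(?r d, ?k d) = ?b a" by simp
        ultimately show "s \<in> lastc a ` {gn (Suc d) \<rho> \<kappa> |\<rho> \<kappa>. fill ?D \<rho> \<kappa> \<and> (\<rho> d, \<kappa> d) = ?b a}"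
          using F by blast
      qed
    qed
    then show ?thesis unfolding N_def Mod_def using lspan_image[OF lin_lastc] by metis
  qed
  have NM: "N a \<subseteq> Mod ?D" for a
    unfolding N_def using Suc.hyps(2) by (intro lspan_least[OF subsp_Mod]) (auto intro!: gn_in_Mod simp: )
  have K: "N a \<subseteq> kernel (lastc i)" if "a < i" for a i
  proof -
    have "subsp (kernel (lastc i))" by (auto simp: subsp_def lin_zero[OF lin_lastc] lin_comb[OF lin_lastc])
    then show ?thesis unfolding N_def using g that by (intro lspan_least) auto
  qed
  have T: "triangular {} Ts"
    unfolding triangular_def
  proof
    show "\<forall>(N, L, Q)\<in>set Ts. submod {} N \<and> equivar {} L \<and> L ` N = Q"
      using LN finite_descents[OF z] by (auto simp: Ts_def submod_empty_iff equivar_lastc N_def subsp_lspan)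
    \<comment> \<open>Larger descents come first, since the coefficient at a larger letter kills the
      spaces of the smaller ones.\<close>
    have "sorted_wrt (\<lambda>x y. y < x) (rev (sorted_list_of_set (descents z)))"
      using strict_sorted_list_of_set[of "descents z"] by (simp add: sorted_wrt_rev)
    then show "sorted_wrt (\<lambda>(_, L, _) (N, _, _). N \<subseteq> kernel L) Ts"
      unfolding Ts_def sorted_wrt_map by (rule sorted_wrt_mono_rel[rotated]) (use K in auto)
  qed
  have "(\<Sum>(N, L, Q)\<leftarrow>Ts. len {} Q) \<le> len {} (Mod ?D)"
    by (intro len_triangular_ge[OF T]) (auto simp: submod_empty_iff subsp_Mod Ts_def dest: subsetD[OF NM])
  also have "(\<Sum>(N, L, Q)\<leftarrow>Ts. len {} Q) = (\<Sum>a\<in>descents z. len {} (Mod (?D - {?b a})))"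
  proof -
    have "(\<Sum>(N, L, Q)\<leftarrow>Ts. len {} Q) = (\<Sum>a\<leftarrow>rev (sorted_list_of_set (descents z)). len {} (Mod (?D - {?b a})))"
      by (simp add: Ts_def o_def)
    also have "\<dots> = (\<Sum>a\<in>set (rev (sorted_list_of_set (descents z))). len {} (Mod (?D - {?b a})))"
      by (rule sum_list_distinct_conv_sum_set) simp
    finally show ?thesis using finite_descents[OF z] by simp
  qed
  finally have le: "(\<Sum>a\<in>descents z. len {} (Mod (?D - {?b a}))) \<le> len {} (Mod ?D)" .
  have ih: "enat (card {c. red c (z \<circ> sr a)}) \<le> len {} (Mod (?D - {?b a}))" if a: "a \<in> descents z" for a
  proof -
    have d: "z (a + 1) < z a" using a by (simp add: descents_def)
    have "enat (card {c. red c (z \<circ> sr a)}) \<le> len {} (Mod (dg (z \<circ> sr a)))"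
      using Suc.hyps(1)[OF _ permutation_comp_sr[OF z]] card_dg_comp_sr[OF z d] Suc.hyps(2) by simp
    also have "Mod (dg (z \<circ> sr a)) = rl (sr a) ` Mod (?D - {?b a})"
      unfolding dg_comp_sr[OF z d] by (rule rl_Mod[symmetric]) simp
    also have "len {} \<dots> = len {} (Mod (?D - {?b a}))" by (rule len_rl) (simp_all add: subsp_Mod)
    finally show ?thesis .
  qed
  have "enat (card {c. red c z}) = (\<Sum>a\<in>descents z. enat (card {c. red c (z \<circ> sr a)}))"
    unfolding card_red_descents[OF z ne] by (rule enat_sum[symmetric, OF finite_descents[OF z]])
  also have "\<dots> \<le> (\<Sum>a\<in>descents z. len {} (Mod (?D - {?b a})))" by (rule sum_mono[OF ih])
  finally show ?case using le by (rule order.trans)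
qed

text \<open>
  Relations satisfied by the module of a Rothe diagram. They cut out a space whose dimension is
  bounded by peeling off the last letter, and which therefore equals the module.
\<close>

definition Yset :: "int \<Rightarrow> (int \<Rightarrow> int) \<Rightarrow> (int list \<Rightarrow> real) set" where
  "Yset m z = {f. (\<forall>xs. length xs = card (dg z) \<and> set xs \<subseteq> {- m<..<m} \<or> f xs = 0) \<and>
     (\<forall>a b. a < b \<longrightarrow> (Fop a b ^^ Suc (card (elig a b (dg z)))) f = (\<lambda>_. 0)) \<and>
     (\<forall>a b. b < a \<and> z a < z b \<longrightarrow> Fop a b f = (\<lambda>_. 0))}"

lemma subsp_Yset: "subsp (Yset m z)"
  unfolding subsp_def
proof (intro conjI ballI allI)
  show "(\<lambda>_. 0) \<in> Yset m z"
    by (simp add: Yset_def lin_zero[OF lin_funpow[OF lin_Fop]] lin_zero[OF lin_Fop] del: funpow.simps)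
  fix f g c assume f: "f \<in> Yset m z" and g: "g \<in> Yset m z"
  show "(\<lambda>x. f x + c * g x) \<in> Yset m z"
    unfolding Yset_def
  proof (intro CollectI conjI allI impI)
    fix xs show "length xs = card (dg z) \<and> set xs \<subseteq> {- m<..<m} \<or> f xs + c * g xs = 0"
    proof (cases "length xs = card (dg z) \<and> set xs \<subseteq> {- m<..<m}")
      case False
      then have "f xs = 0" "g xs = 0" using f g unfolding Yset_def by blast+
      then show ?thesis by simp
    qed blast
  next
    fix a b :: int assume "a < b"
    then show "(Fop a b ^^ Suc (card (elig a b (dg z)))) (\<lambda>x. f x + c * g x) = (\<lambda>_. 0)"
      using f g unfolding lin_comb[OF lin_funpow[OF lin_Fop]] Yset_def by (simp del: funpow.simps)
  next
    fix a b :: int assume "b < a \<and> z a < z b"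
    then show "Fop a b (\<lambda>x. f x + c * g x) = (\<lambda>_. 0)"
      using f g unfolding lin_comb[OF lin_Fop] Yset_def by simp
  qed
qed

text \<open>The powers vanish as soon as they exceed the number of eligible columns. If
  \<open>b < a\<close> and \<open>z a < z b\<close>, row \<open>a\<close> is contained in row
  \<open>b\<close>, so no column is eligible.\<close>

lemma Mod_dg_Yset:
  assumes z: "permutation z" and m: "\<And>x. m \<le> x \<Longrightarrow> z x = x" "\<And>x. x \<le> - m \<Longrightarrow> z x = x"
  shows "Mod (dg z) \<subseteq> Yset m z"
proof
  fix f assume f: "f \<in> Mod (dg z)"
  have supp: "set xs \<subseteq> {- m<..<m} \<or> f xs = 0" for xs
    using f unfolding Mod_def
  proof (induction rule: lspan.induct)
    case (add f s c)
    then obtain \<rho> \<kappa> where s: "s = gn (card (dg z)) \<rho> \<kappa>" "fill (dg z) \<rho> \<kappa>" by (auto simp: gens_def)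
    have "s xs = 0" if "\<not> set xs \<subseteq> {- m<..<m}"
    proof (rule ccontr)
      assume "s xs \<noteq> 0"
      then obtain \<sigma> where \<sigma>: "\<sigma> \<in> colperms (card (dg z)) \<kappa>" "length xs = card (dg z)"
        "\<And>p. p < card (dg z) \<Longrightarrow> xs ! p = \<rho> (\<sigma> p)"
        unfolding s(1) gn_def by (auto elim!: sum.not_neutral_contains_not_neutral)
      have "x \<in> {- m<..<m}" if xx: "x \<in> set xs" for x
      proof -
        obtain p where p: "p < card (dg z)" "x = xs ! p" using xx \<sigma>(2) by (auto simp: in_set_conv_nth)
        have "(\<rho> (\<sigma> p), \<kappa> (\<sigma> p)) \<in> dg z" using fill_mem[OF s(2)] colperms_less[OF \<sigma>(1) p(1)] by blast
        then have "(\<rho> (\<sigma> p), \<kappa> (\<sigma> p)) \<in> {- m<..<m} \<times> {- m<..<m}" using dg_bound[OF z m] by blast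
        then show ?thesis using \<sigma>(3)[OF p(1)] p(2) by simp
      qed
      then show False using that by blast
    qed
    then show ?case using add.IH by (cases "set xs \<subseteq> {- m<..<m}") simp_all
  qed simp
  have rev: "Fop a b f = (\<lambda>_. 0)" if ab: "b < a" "z a < z b" for a b
  proof -
    have "elig a b (dg z) = {}" unfolding elig_def dg_def using ab by auto
    then have "(Fop a b ^^ 1) f = (\<lambda>_. 0)"
      by (intro Fop_funpow_Mod_zero[OF finite_dg[OF z] _ _ f]) (use ab in auto)
    then show ?thesis by simp
  qed
  show "f \<in> Yset m z"
    unfolding Yset_def
  proof (intro CollectI conjI allI impI)
    fix xs show "length xs = card (dg z) \<and> set xs \<subseteq> {- m<..<m} \<or> f xs = 0"
      using supp[of xs] Mod_supp[OF f, of xs] by blast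
  next
    fix a b :: int assume "a < b"
    then show "(Fop a b ^^ Suc (card (elig a b (dg z)))) f = (\<lambda>_. 0)"
      by (intro Fop_funpow_Mod_zero[OF finite_dg[OF z] _ _ f]) auto
  qed (use rev in blast)
qed

lemma YsetD:
  assumes "f \<in> Yset m z"
  shows "\<not> (length xs = card (dg z) \<and> set xs \<subseteq> {- m<..<m}) \<Longrightarrow> f xs = 0"
    and "a < b \<Longrightarrow> (Fop a b ^^ Suc (card (elig a b (dg z)))) f = (\<lambda>_. 0)"
    and "b < a \<Longrightarrow> z a < z b \<Longrightarrow> Fop a b f = (\<lambda>_. 0)"
  using assms unfolding Yset_def by blast+

lemma lastc_zero: "lastc i (\<lambda>_. 0) = (\<lambda>_. 0)"
  by (rule lin_zero[OF lin_lastc])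

lemma Fop_funpow_zero: "(Fop a b ^^ n) (\<lambda>_. 0) = (\<lambda>_. 0)"
  by (rule lin_zero[OF lin_funpow[OF lin_Fop]])

text \<open>At an ascent row \<open>i\<close> is contained in row \<open>i + 1\<close>, so
  \<open>Fop i (i + 1)\<close> kills \<open>f\<close>. Its coefficient at \<open>i + 1\<close> is
  the coefficient of \<open>f\<close> at \<open>i\<close> plus a term that vanishes by
  assumption.\<close>

lemma lastc_ascent:
  assumes z: "permutation z" and f: "f \<in> Yset m z" and "lastc (i + 1) f = (\<lambda>_. 0)" "z i < z (i + 1)"
  shows "lastc i f = (\<lambda>_. 0)"
proof -
  have "elig i (i + 1) (dg z) = {}"
  proof -
    have "(i + 1, c) \<in> dg z" if "(i, c) \<in> dg z" for c
    proof -
      have c: "i < inv z c" "c < z i" using that by (auto simp: dg_def)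
      have "inv z c \<noteq> i + 1" using c(2) assms(4) permutation_f_inv[OF z, of c] by auto
      then show ?thesis using c assms(4) by (auto simp: dg_def)
    qed
    then show ?thesis by (auto simp: elig_def)
  qed
  then have "Fop i (i + 1) f = (\<lambda>_. 0)" using YsetD(2)[OF f, of i "i + 1"] by simp
  then have "lastc (i + 1) (Fop i (i + 1) f) = (\<lambda>_. 0)" by (simp add: lastc_zero)
  then show ?thesis
    unfolding lastc_Fop assms(3) using lin_zero[OF lin_Fop, of i "i + 1"] by (simp add: fun_eq_iff)
qed

text \<open>The leading coefficient inherits the relations for \<open>z \<circ> sr i\<close>. They
  are read off from the last-letter coefficients of the relations for \<open>f\<close>, where all
  coefficients beyond \<open>i\<close> vanish; the work lies in row pairs whose number of eligible
  columns changes with the removed box.\<close>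

lemma lastc_descent:
  assumes z: "permutation z" and m: "\<And>x. m \<le> x \<Longrightarrow> z x = x" "\<And>x. x \<le> - m \<Longrightarrow> z x = x"
    and f: "f \<in> Yset m z" and top: "\<And>j. i < j \<Longrightarrow> lastc j f = (\<lambda>_. 0)" and d: "z (i + 1) < z i"
  shows "rl (sr i) (lastc i f) \<in> Yset m (z \<circ> sr i)"
proof -
  let ?g = "lastc i f" and ?y = "z \<circ> sr i" and ?c = "z (i + 1)"
  let ?D = "dg z" and ?D' = "dg z - {(i, z (i + 1))}"
  have cy: "card ?D = Suc (card (dg ?y))" by (rule card_dg_comp_sr[OF z d])
  have dy: "dg ?y = (\<lambda>(x, c). (sr i x, c)) ` ?D'" by (rule dg_comp_sr[OF z d])
  have memy: "(x, c) \<in> dg ?y \<longleftrightarrow> (sr i x, c) \<in> ?D'" for x c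
  proof
    assume "(x, c) \<in> dg ?y"
    then obtain b where b: "b \<in> ?D'" "(x, c) = (\<lambda>(x, c). (sr i x, c)) b" unfolding dy by blast
    then have "b = (sr i x, c)" by (cases b) simp
    then show "(sr i x, c) \<in> ?D'" using b(1) by (simp only:)
  next
    assume "(sr i x, c) \<in> ?D'"
    then show "(x, c) \<in> dg ?y" unfolding dy by (rule image_eqI[rotated]) simp
  qed
  have el: "elig a b (dg ?y) = elig (sr i a) (sr i b) ?D'" for a b
    unfolding elig_def memy ..
  have memD: "(x, ?c) \<in> ?D \<longleftrightarrow> x < i + 1 \<and> ?c < z x" for x by (rule mem_dg[OF z])
  have fin: "finite (elig a b ?D)" for a b by (rule finite_elig[OF finite_dg[OF z]])
  have box: "(i, i + 1) \<in> {- m<..<m} \<times> {- m<..<m}"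
  proof -
    have "red (i # c) z \<Longrightarrow> set (i # c) \<subseteq> {- m<..<m}" for c using red_letters[OF z _ m] by blast
    have 1: "i + 1 < m"
    proof (rule ccontr)
      assume "\<not> i + 1 < m"
      then have e: "z (i + 1) = i + 1" using m(1) by simp
      then have "m \<le> z i" using d \<open>\<not> i + 1 < m\<close> by simp
      then have "z (z i) = z i" using m(1) by blast
      then have "z i = i" using permutation_inj_eq[OF z] by blast
      then show False using e d by simp
    qed
    have 2: "- m < i"
    proof (rule ccontr)
      assume "\<not> - m < i"
      then have e: "z i = i" using m(2) by simp
      then have "z (i + 1) \<le> - m" using d \<open>\<not> - m < i\<close> by simp
      then have "z (z (i + 1)) = z (i + 1)" using m(2) by blast
      then have "z (i + 1) = i + 1" using permutation_inj_eq[OF z] by blast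
      then show False using e d by simp
    qed
    show ?thesis using 1 2 by simp
  qed
  have fwd: "(Fop a b ^^ Suc (card (elig a b ?D))) f = (\<lambda>_. 0)" if "a < b" for a b
    using YsetD(2)[OF f that] .
  \<comment> \<open>The coefficient at \<open>b\<close> of a vanishing power ties the last-letter
    coefficients of \<open>f\<close> at \<open>a\<close> and \<open>b\<close> together.\<close>
  have rel: "(\<lambda>xs. (Fop a b ^^ Suc n) (lastc b f) xs + real (Suc n) * (Fop a b ^^ n) (lastc a f) xs) = (\<lambda>_. 0)"
    if "a < b" "card (elig a b ?D) \<le> n" for a b n
  proof -
    have "(Fop a b ^^ Suc n) f = (\<lambda>_. 0)"
      by (rule funpow_lin_zero[OF lin_Fop fwd[OF that(1)]]) (use that in simp)
    then have "lastc b ((Fop a b ^^ Suc n) f) = (\<lambda>_. 0)" using lastc_zero[of b] by (simp only:)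
    then show ?thesis unfolding lastc_Fop_funpow[OF less_imp_neq[OF that(1)]] .
  qed
  have Ei: "Fop (i + 1) i f = (\<lambda>_. 0)" using YsetD(3)[OF f, of i "i + 1"] d by simp
  have G1: "(Fop a b ^^ Suc (card (elig a b ?D'))) ?g = (\<lambda>_. 0)" if ab: "sr i a < sr i b" for a b
  proof -
    consider "a = i + 1" "b = i" | "a = i" "i + 1 < b" | "b = i" "a < i" | "a < b" "a \<noteq> i" "b \<noteq> i"
      using ab by (cases "a = i"; cases "a = i + 1"; cases "b = i"; cases "b = i + 1") auto
    then show ?thesis
    proof cases
      case 1
      have "lastc i (Fop (i + 1) i f) = (\<lambda>_. 0)" unfolding Ei by (rule lastc_zero)
      then have "Fop (i + 1) i ?g = (\<lambda>_. 0)" unfolding lastc_Fop using top[of "i + 1"] by (simp add: fun_eq_iff)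
      then have "(Fop (i + 1) i ^^ Suc 0) ?g = (\<lambda>_. 0)" by simp
      then show ?thesis unfolding 1 by (rule funpow_lin_zero[OF lin_Fop]) simp
    next
      case 2
      \<comment> \<open>The removed box was eligible from row \<open>i\<close> to row
        \<open>b\<close>, so one power less has to suffice. It does, because the coefficient at
        \<open>b\<close> is zero.\<close>
      have cb: "(b, ?c) \<notin> ?D" using memD 2 by simp
      have "(i, ?c) \<in> ?D" using memD d by simp
      then have "?c \<in> elig i b ?D" using cb by (simp add: elig_def)
      moreover have "elig i b ?D' = elig i b ?D - {?c}" using 2 by (auto simp: elig_def)
      ultimately have "Suc (card (elig i b ?D')) = card (elig i b ?D)" using fin by (metis card.remove)
      moreover have "(Fop i b ^^ card (elig i b ?D)) ?g = (\<lambda>_. 0)"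
        using rel[of i b "card (elig i b ?D)"] top[of b] 2 Fop_funpow_zero[where a = i and b = b and n = "Suc (card (elig i b ?D))"]
        by (simp add: fun_eq_iff del: funpow.simps of_nat_Suc)
      ultimately show ?thesis unfolding 2(1) by simp
    next
      case 3
      let ?F = "Fop a i" and ?m = "card (elig a i ?D)"
      show ?thesis
      proof (cases "(a, ?c) \<in> ?D")
        case True
        \<comment> \<open>One more column becomes eligible. The relations for two consecutive
          exponents contain the same two terms with different coefficients, so both terms
          vanish.\<close>
        have "elig a i ?D' = insert ?c (elig a i ?D)" using 3 True by (auto simp: elig_def)
        moreover have "?c \<notin> elig a i ?D" using memD d by (simp add: elig_def)
        ultimately have c: "card (elig a i ?D') = Suc ?m" using fin by simp
        have 1: "(\<lambda>xs. (?F ^^ Suc ?m) ?g xs + real (Suc ?m) * (?F ^^ ?m) (lastc a f) xs) = (\<lambda>_. 0)"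
          using rel[of a i ?m] 3 by simp
        have 2: "(\<lambda>xs. (?F ^^ Suc (Suc ?m)) ?g xs + real (Suc (Suc ?m)) * (?F ^^ Suc ?m) (lastc a f) xs) = (\<lambda>_. 0)"
          using rel[of a i "Suc ?m"] 3 by simp
        have "?F (\<lambda>xs. (?F ^^ Suc ?m) ?g xs + real (Suc ?m) * (?F ^^ ?m) (lastc a f) xs) = (\<lambda>_. 0)"
          unfolding 1 by (rule lin_zero[OF lin_Fop])
        then have 3: "(\<lambda>xs. (?F ^^ Suc (Suc ?m)) ?g xs + real (Suc ?m) * (?F ^^ Suc ?m) (lastc a f) xs) = (\<lambda>_. 0)"
          unfolding lin_comb[OF lin_Fop] by simp
        have "(?F ^^ Suc (Suc ?m)) ?g xs = 0" for xs
        proof -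
          have "(?F ^^ Suc (Suc ?m)) ?g xs + real (Suc (Suc ?m)) * (?F ^^ Suc ?m) (lastc a f) xs = 0"
            using 2 by metis
          moreover have "(?F ^^ Suc (Suc ?m)) ?g xs + real (Suc ?m) * (?F ^^ Suc ?m) (lastc a f) xs = 0"
            using 3 by metis
          moreover have "x = 0" if 1: "x + real (Suc (Suc k)) * y = 0" and 2: "x + real (Suc k) * y = 0" for x y k
          proof -
            have "x + real (Suc (Suc k)) * y - (x + real (Suc k) * y) = y" by (simp add: algebra_simps)
            then have "y = 0" using 1 2 by simp
            then show ?thesis using 1 by simp
          qed
          ultimately show ?thesis by blast
        qed
        then show ?thesis unfolding c \<open>b = i\<close> by (auto simp del: funpow.simps)
      next
        case False
        \<comment> \<open>Here the exponent must not grow, so the contribution of the coefficient at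
          \<open>a\<close> has to vanish by itself. Rows \<open>i\<close> and \<open>i + 1\<close>
          agree in the columns of row \<open>a\<close>, and \<open>Fop_raise\<close> passes the
          relation from row \<open>i + 1\<close> to row \<open>i\<close>.\<close>
        have za: "z a < ?c" using memD[of a] False 3 permutation_inj_eq[OF z, of a "i + 1"] by force
        have e1: "elig a i ?D' = elig a i ?D" using False 3 by (auto simp: elig_def)
        have e2: "elig a (i + 1) ?D = elig a i ?D"
        proof -
          have "(i + 1, c) \<in> ?D \<longleftrightarrow> (i, c) \<in> ?D" if "(a, c) \<in> ?D" for c
          proof -
            have "c < z a" using that by (simp add: dg_def)
            then have c: "c < ?c" "c < z i" using za d by simp_all
            then have "inv z c \<noteq> i + 1" using permutation_f_inv[OF z, of c] by auto
            then show ?thesis using c by (auto simp: dg_def)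
          qed
          then show ?thesis unfolding elig_def by blast
        qed
        have X: "(Fop a (i + 1) ^^ ?m) (lastc a f) = (\<lambda>_. 0)"
          using rel[of a "i + 1" ?m] e2 3 top[of "i + 1"] Fop_funpow_zero[where a = a and b = "i + 1" and n = "Suc ?m"]
          by (simp add: fun_eq_iff del: funpow.simps of_nat_Suc)
        have "lastc a (Fop (i + 1) i f) = (\<lambda>_. 0)" unfolding Ei by (rule lastc_zero)
        then have E: "Fop (i + 1) i (lastc a f) = (\<lambda>_. 0)" using lastc_Fop_other[of a i] 3 by simp
        have F0: "(?F ^^ ?m) (lastc a f) = (\<lambda>_. 0)"
          by (rule Fop_raise[OF E _ _ _ X]) (use 3 in auto)
        show ?thesis unfolding e1 \<open>b = i\<close>
          using rel[of a i ?m] 3 unfolding F0 by (simp del: funpow.simps)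
      qed
    next
      case 4
      have e: "elig a b ?D' = elig a b ?D" using 4 by (auto simp: elig_def)
      have "lastc i ((Fop a b ^^ Suc (card (elig a b ?D))) f) = (\<lambda>_. 0)"
        unfolding fwd[OF 4(1)] by (rule lastc_zero)
      then show ?thesis unfolding e using lastc_Fop_funpow_other[of i b] 4 by (simp del: funpow.simps)
    qed
  qed
  have G2: "Fop a b ?g = (\<lambda>_. 0)" if ab: "sr i b < sr i a" "z a < z b" for a b
  proof -
    have ba: "b < a"
    proof (rule ccontr)
      assume "\<not> b < a"
      then have "b = i + 1 \<and> a = i"
        using ab(1) by (cases "a = i"; cases "a = i + 1"; cases "b = i"; cases "b = i + 1") auto
      then show False using ab(2) d by simp
    qed
    have "lastc i (Fop a b f) = (\<lambda>_. 0)" using YsetD(3)[OF f ba ab(2)] by (simp add: lastc_zero)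
    then show ?thesis unfolding lastc_Fop using top[of a] ba by (cases "b = i") (auto simp: fun_eq_iff)
  qed
  show ?thesis
    unfolding Yset_def
  proof (intro CollectI conjI allI impI)
    fix xs
    have st: "set (map (sr i) xs) \<subseteq> {- m<..<m} \<Longrightarrow> set xs \<subseteq> {- m<..<m}"
    proof
      fix x assume "set (map (sr i) xs) \<subseteq> {- m<..<m}" "x \<in> set xs"
      then have "sr i x \<in> {- m<..<m}" by auto
      then show "x \<in> {- m<..<m}" using box by (cases "x = i"; cases "x = i + 1") auto
    qed
    show "length xs = card (dg ?y) \<and> set xs \<subseteq> {- m<..<m} \<or> rl (sr i) ?g xs = 0"
      using YsetD(1)[OF f, of "map (sr i) xs @ [i]"] st cy unfolding rl_def lastc_def by auto
  next
    fix a b :: int assume "a < b"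
    then have "(Fop (sr i a) (sr i b) ^^ Suc (card (elig (sr i a) (sr i b) ?D'))) ?g = (\<lambda>_. 0)"
      using G1[of "sr i a" "sr i b"] by simp
    then show "(Fop a b ^^ Suc (card (elig a b (dg ?y)))) (rl (sr i) ?g) = (\<lambda>_. 0)"
      unfolding el using Fop_funpow_rl[of "sr i"] lin_zero[OF lin_rl] by (simp del: funpow.simps)
  next
    fix a b :: int assume "b < a \<and> ?y a < ?y b"
    then have "Fop (sr i a) (sr i b) ?g = (\<lambda>_. 0)" using G2[of "sr i b" "sr i a"] by simp
    then show "Fop a b (rl (sr i) ?g) = (\<lambda>_. 0)"
      using Fop_rl[of "sr i"] lin_zero[OF lin_rl] by simp
  qed
qed

text \<open>Filtering by the largest last letter with nonzero coefficient, an ascent contributes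
  nothing and a descent at most the space of the shorter permutation. This is the recursion for
  reduced words again, now as an upper bound.\<close>

theorem len_Yset_le:
  assumes "permutation z" "\<And>x. m \<le> x \<Longrightarrow> z x = x" "\<And>x. x \<le> - m \<Longrightarrow> z x = x"
  shows "len {} (Yset m z) \<le> enat (card {c. red c z})"
  using assms
proof (induction "card (dg z)" arbitrary: z)
  case 0
  then have zi: "z = id" using dg_empty_iff finite_dg by auto
  have "len {} (Yset m z) \<le> 1"
  proof (rule len_simple)
    fix U assume U: "submod {} U" "U \<subseteq> Yset m z"
    have supp: "f xs = 0" if "f \<in> Yset m z" "xs \<noteq> []" for f xs
      using YsetD(1)[OF that(1), of xs] that(2) 0(1) by auto
    show "U = {\<lambda>_. 0} \<or> U = Yset m z"
    proof (cases "\<exists>u\<in>U. u [] \<noteq> 0")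
      case False
      have "u = (\<lambda>_. 0)" if u: "u \<in> U" for u
      proof
        fix xs
        have 1: "u [] = 0" and 2: "u \<in> Yset m z" using False u U(2) by blast+
        show "u xs = 0"
        proof (cases "xs = []")
          case False
          then show ?thesis using supp[OF 2] by blast
        qed (simp add: 1)
      qed
      moreover have "(\<lambda>_. 0) \<in> U" using subspD(1)[of U] U(1) submod_empty_iff by blast
      ultimately show ?thesis by blast
    next
      case True
      then obtain u where u: "u \<in> U" "u [] \<noteq> 0" by blast
      have "f \<in> U" if f: "f \<in> Yset m z" for f
      proof -
        have "f xs = f [] / u [] * u xs" for xs
        proof (cases "xs = []")
          case False
          have "u \<in> Yset m z" using u(1) U(2) by blast
          then show ?thesis using supp[OF f False] supp[of u xs] False by simp
        qed (simp add: u(2))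
        then have e: "(\<lambda>xs. f [] / u [] * u xs) = f" by (intro ext) (rule sym)
        have "(\<lambda>xs. f [] / u [] * u xs) \<in> U"
          using subsp_scale[OF _ u(1)] U(1) by (simp only: submod_empty_iff)
        then show ?thesis unfolding e .
      qed
      then show ?thesis using U(2) by blast
    qed
  qed
  then show ?case unfolding zi card_red_id by (simp only: one_enat_def)
next
  case (Suc d z)
  note z = Suc.prems(1) and m = Suc.prems(2,3)
  have ne: "z \<noteq> id" using Suc.hyps(2) by (auto simp: dg_id simp del: id_apply)
  let ?R = "\<lambda>a. enat (card {c. red c (z \<circ> sr a)})"
  \<comment> \<open>The kernel of \<open>lastc (i + 1)\<close> on \<open>V (i + 1)\<close> is
    \<open>V i\<close>, so each step of the filtration is measured by one coefficient.\<close>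
  define V where "V i = {f \<in> Yset m z. \<forall>j>i. lastc j f = (\<lambda>_. 0)}" for i
  have subV: "subsp (V i)" for i
    using subspD[OF subsp_Yset[of m z]]
    unfolding subsp_def V_def by (auto simp: lastc_zero lin_comb[OF lin_lastc])
  have end0: "f xs = 0" if f: "f \<in> Yset m z" and i: "\<And>j. - m < j \<Longrightarrow> j < m \<Longrightarrow> lastc j f = (\<lambda>_. 0)" for f xs
  proof (cases xs rule: rev_cases)
    case Nil
    then show ?thesis using YsetD(1)[OF f, of xs] Suc.hyps(2) by auto
  next
    case (snoc ys y)
    show ?thesis
    proof (cases "- m < y \<and> y < m")
      case True
      then have "lastc y f ys = 0" using i by simp
      then show ?thesis by (simp add: lastc_def snoc)
    next
      case False
      then show ?thesis using YsetD(1)[OF f, of xs] snoc by auto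
    qed
  qed
  have bound: "len {} (V i) \<le> (\<Sum>a\<in>descents z \<inter> {..i}. ?R a)" if "- m \<le> i" for i
    using that
  proof (induction i rule: int_ge_induct)
    case base
    have "V (- m) = {\<lambda>_. 0}"
    proof
      show "V (- m) \<subseteq> {\<lambda>_. 0}" using end0 by (auto simp: V_def)
      show "{\<lambda>_. 0} \<subseteq> V (- m)" using subspD(1)[OF subV] by simp
    qed
    then show ?case by (simp add: len_zero)
  next
    case (step i)
    let ?i = "i + 1"
    have "len {} (V ?i) = len {} (V ?i \<inter> kernel (lastc ?i)) + len {} (lastc ?i ` V ?i)"
      by (rule len_exact[OF equivar_lastc]) (auto simp: submod_empty_iff subV)
    also have "V ?i \<inter> kernel (lastc ?i) = V i"
      unfolding V_def by (auto simp: le_less) (metis zless_imp_add1_zle le_less)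
    finally have e: "len {} (V ?i) = len {} (V i) + len {} (lastc ?i ` V ?i)" .
    show ?case
    proof (cases "?i \<in> descents z")
      case True
      then have d: "z (?i + 1) < z ?i" by (simp add: descents_def)
      have sI: "subsp (lastc ?i ` V ?i)"
        using submod_image[OF equivar_lastc, of "V ?i" ?i] subV by (simp add: submod_empty_iff)
      have "rl (sr ?i) ` lastc ?i ` V ?i \<subseteq> Yset m (z \<circ> sr ?i)"
        using lastc_descent[OF z m _ _ d] by (auto simp: V_def)
      then have "len {} (rl (sr ?i) ` lastc ?i ` V ?i) \<le> len {} (Yset m (z \<circ> sr ?i))" by (rule len_mono)
      then have "len {} (lastc ?i ` V ?i) \<le> len {} (Yset m (z \<circ> sr ?i))"
        using len_rl[OF _ sI, of "sr ?i"] by simp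
      also have "\<dots> \<le> ?R ?i"
      proof (rule Suc.hyps(1))
        show "d = card (dg (z \<circ> sr ?i))" using card_dg_comp_sr[OF z d] Suc.hyps(2) by simp
        show "permutation (z \<circ> sr ?i)" by (rule permutation_comp_sr[OF z])
        have 1: "?i + 1 < m"
        proof (rule ccontr)
          assume "\<not> ?i + 1 < m"
          then have e: "z (?i + 1) = ?i + 1" using m(1) by simp
          then have "m \<le> z ?i" using d \<open>\<not> ?i + 1 < m\<close> by simp
          then have "z (z ?i) = z ?i" using m(1) by blast
          then have "z ?i = ?i" using permutation_inj_eq[OF z] by blast
          then show False using e d by simp
        qed
        show "(z \<circ> sr ?i) x = x" if "m \<le> x" for x using m(1)[OF that] 1 that by simp
        show "(z \<circ> sr ?i) x = x" if "x \<le> - m" for x using m(2)[OF that] step.hyps that by simp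
      qed
      finally have "len {} (V ?i) \<le> (\<Sum>a\<in>descents z \<inter> {..i}. ?R a) + ?R ?i"
        unfolding e using step.IH by (intro add_mono)
      also have "\<dots> = (\<Sum>a\<in>descents z \<inter> {..?i}. ?R a)"
      proof -
        have "descents z \<inter> {..?i} = insert ?i (descents z \<inter> {..i})" using True by auto
        then show ?thesis using finite_descents[OF z] by (simp add: add.commute)
      qed
      finally show ?thesis .
    next
      case False
      then have a: "z ?i < z (?i + 1)"
        using permutation_inj_eq[OF z, of ?i "?i + 1"] by (auto simp: descents_def)
      have "lastc ?i ` V ?i \<subseteq> {\<lambda>_. 0}" using lastc_ascent[OF z _ _ a] by (auto simp: V_def)
      then have "len {} (lastc ?i ` V ?i) \<le> 0" using len_mono[of _ "{\<lambda>_. 0}" "{}"] by (simp add: len_zero)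
      moreover have "descents z \<inter> {..?i} = descents z \<inter> {..i}" using False by (auto simp: le_less)
      ultimately show ?thesis using step.IH e by simp
    qed
  qed
  have mm: "- m \<le> m"
  proof (rule ccontr)
    assume "\<not> - m \<le> m"
    then have "z x = x" for x using m(1)[of x] m(2)[of x] by linarith
    then show False using ne by auto
  qed
  have "Yset m z = V m"
    unfolding V_def using YsetD(1)[of _ m z] by (auto simp: lastc_def fun_eq_iff)
  then have "len {} (Yset m z) \<le> (\<Sum>a\<in>descents z \<inter> {..m}. ?R a)" using bound[OF mm] by simp
  also have "\<dots> \<le> (\<Sum>a\<in>descents z. ?R a)"
    using finite_descents[OF z] by (intro sum_mono2) auto
  also have "\<dots> = enat (card {c. red c z})"
    unfolding card_red_descents[OF z ne] by (rule enat_sum[OF finite_descents[OF z]])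
  finally show ?case .
qed

theorem len_Mod_dg: "permutation z \<Longrightarrow> len {} (Mod (dg z)) = enat (card {c. red c z})"
proof -
  assume z: "permutation z"
  obtain m where m0: "0 < m" and m: "\<And>x. m \<le> x \<Longrightarrow> z x = x" "\<And>x. x \<le> - m \<Longrightarrow> z x = x"
    by (rule permutation_bound[OF z]) (rule that)
  have "len {} (Mod (dg z)) \<le> len {} (Yset m z)" by (rule len_mono[OF Mod_dg_Yset[OF z m]])
  also have "\<dots> \<le> enat (card {c. red c z})" by (rule len_Yset_le[OF z m])
  finally show ?thesis using len_Mod_dg_ge[OF z] by (rule antisym)
qed

section \<open>Trees of row and column moves\<close>

text \<open>
  A branching node is witnessed by row \<open>r\<close>, column \<open>B\<close> and a list of pairs \<open>(i, a)\<close>; child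
  \<open>(i, a)\<close> moves column \<open>B\<close> to column \<open>a\<close> and row \<open>r\<close> to row \<open>i\<close>. The conditions make the
  corresponding subquotients of the module of \<open>D\<close> triangular. Only rows in \<open>X\<close> and columns in
  \<open>Y\<close> are involved.
\<close>

inductive jtree :: "'r set \<Rightarrow> 'c set \<Rightarrow> ('r \<times> 'c) set \<Rightarrow> nat \<Rightarrow> bool"
  and jforest :: "'r set \<Rightarrow> 'c set \<Rightarrow> ('r \<times> 'c) set \<Rightarrow> 'r \<Rightarrow> 'c \<Rightarrow> ('r \<times> 'c) list \<Rightarrow> nat \<Rightarrow> bool"
where
  leaf: "jtree X Y D (Suc 0)"
| branch: "jforest X Y D r B L n \<Longrightarrow> 2 \<le> length L \<Longrightarrow> r \<in> X \<Longrightarrow> B \<in> Y \<Longrightarrow> (r, B) \<in> D \<Longrightarrow> jtree X Y D n"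
| fnil: "jforest X Y D r B [] 0"
| fcons: "jtree X Y (Rm r i (Cm B a D)) n \<Longrightarrow> jforest X Y D r B L n' \<Longrightarrow> i \<in> X \<Longrightarrow> a \<in> Y \<Longrightarrow>
    i \<noteq> r \<Longrightarrow> a \<noteq> B \<Longrightarrow> (i, B) \<notin> D \<Longrightarrow> (r, a) \<notin> D \<Longrightarrow> (i, a) \<notin> D \<Longrightarrow>
    (\<forall>b\<in>set L. (i, snd b) \<in> D) \<Longrightarrow> jforest X Y D r B ((i, a) # L) (n + n')"

text \<open>Every condition of a tree and the effect of its moves depend only on which boxes of
  \<open>X\<close> times \<open>Y\<close> are present. Injections that preserve and reflect this
  carry the tree along, whatever the diagrams look like elsewhere.\<close>

lemma jtree_transfer:
  "jtree (X :: 'a set) (Y :: 'b set) D n \<Longrightarrow> (\<And>(\<alpha> :: 'a \<Rightarrow> 'c) (\<beta> :: 'b \<Rightarrow> 'd) X' Y' D'. inj_on \<alpha> X \<Longrightarrow> inj_on \<beta> Y \<Longrightarrow> \<alpha> ` X \<subseteq> X' \<Longrightarrow> \<beta> ` Y \<subseteq> Y' \<Longrightarrow>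
      (\<And>x c. x \<in> X \<Longrightarrow> c \<in> Y \<Longrightarrow> (x, c) \<in> D \<longleftrightarrow> (\<alpha> x, \<beta> c) \<in> D') \<Longrightarrow> jtree X' Y' D' n)"
  "jforest (X :: 'a set) (Y :: 'b set) D r B L n \<Longrightarrow> (\<And>(\<alpha> :: 'a \<Rightarrow> 'c) (\<beta> :: 'b \<Rightarrow> 'd) X' Y' D'. inj_on \<alpha> X \<Longrightarrow> inj_on \<beta> Y \<Longrightarrow> \<alpha> ` X \<subseteq> X' \<Longrightarrow> \<beta> ` Y \<subseteq> Y' \<Longrightarrow>
      (\<And>x c. x \<in> X \<Longrightarrow> c \<in> Y \<Longrightarrow> (x, c) \<in> D \<longleftrightarrow> (\<alpha> x, \<beta> c) \<in> D') \<Longrightarrow> r \<in> X \<Longrightarrow> B \<in> Y \<Longrightarrow>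
      jforest X' Y' D' (\<alpha> r) (\<beta> B) (map (\<lambda>b. (\<alpha> (fst b), \<beta> (snd b))) L) n \<and> set L \<subseteq> X \<times> Y)"
proof (induction rule: jtree_jforest.inducts)
  case (leaf X Y D)
  show ?case by (rule jtree_jforest.leaf)
next
  case (branch X Y D r B L n)
  have "jforest X' Y' D' (\<alpha> r) (\<beta> B) (map (\<lambda>b. (\<alpha> (fst b), \<beta> (snd b))) L) n"
    by (rule conjunct1[OF branch.IH[of \<alpha> \<beta> X' Y' D']]) (rule branch.prems branch.hyps | assumption)+
  then show ?case
    by (rule jtree_jforest.branch) (use branch in auto)
next
  case (fnil X Y D r B)
  show ?case by (auto intro: jtree_jforest.fnil)
next
  case (fcons X Y r i B a D n L n')
  note inj = inj_on_eq_iff[OF fcons.prems(1)] inj_on_eq_iff[OF fcons.prems(2)]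
  note D = fcons.prems(5) and r = fcons.prems(6,7) and ia = fcons.hyps(3,4)
  have ne: "\<alpha> i \<noteq> \<alpha> r" "\<beta> a \<noteq> \<beta> B" using fcons.hyps r inj by auto
  have F: "jforest X' Y' D' (\<alpha> r) (\<beta> B) (map (\<lambda>b. (\<alpha> (fst b), \<beta> (snd b))) L) n' \<and> set L \<subseteq> X \<times> Y"
    by (rule fcons.IH(2)[of \<alpha> \<beta> X' Y' D']) (rule fcons.prems | assumption)+
  \<comment> \<open>Injectivity ensures that the moved rows and columns are recognised after
    renaming, so agreement on the selected rows and columns persists in the child.\<close>
  have ch: "(x, c) \<in> Rm r i (Cm B a D) \<longleftrightarrow> (\<alpha> x, \<beta> c) \<in> Rm (\<alpha> r) (\<alpha> i) (Cm (\<beta> B) (\<beta> a) D')"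
    if "x \<in> X" "c \<in> Y" for x c
    using that fcons.hyps r ia ne
    by (simp add: mem_Rm[OF ne(1)[symmetric]] mem_Rm[OF fcons.hyps(5)[symmetric]]
        mem_Cm[OF ne(2)[symmetric]] mem_Cm[OF fcons.hyps(6)[symmetric]] inj D)
  have T: "jtree X' Y' (Rm (\<alpha> r) (\<alpha> i) (Cm (\<beta> B) (\<beta> a) D')) n"
    by (rule fcons.IH(1)[of \<alpha> \<beta> X' Y']) (rule fcons.prems(1-4) ch | assumption)+
  have "jforest X' Y' D' (\<alpha> r) (\<beta> B) ((\<alpha> i, \<beta> a) # map (\<lambda>b. (\<alpha> (fst b), \<beta> (snd b))) L) (n + n')"
  proof (rule jtree_jforest.fcons[OF T])
    show "\<forall>b\<in>set (map (\<lambda>b. (\<alpha> (fst b), \<beta> (snd b))) L). (\<alpha> i, snd b) \<in> D'"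
    proof
      fix b assume "b \<in> set (map (\<lambda>b. (\<alpha> (fst b), \<beta> (snd b))) L)"
      then obtain b' where b': "b' \<in> set L" "b = (\<alpha> (fst b'), \<beta> (snd b'))" by auto
      then have "snd b' \<in> Y" using F by auto
      then show "(\<alpha> i, snd b) \<in> D'" using D[OF ia(1), of "snd b'"] fcons.hyps(10) b' by auto
    qed
  qed (use F fcons.prems(3,4) ia r ne D fcons.hyps in auto)
  then show ?case using F ia by simp
qed

lemma jtree_mono:
  assumes "jtree X Y D n" "X \<subseteq> X'" "Y \<subseteq> Y'"
  shows "jtree X' Y' D n"
  using jtree_transfer(1)[OF assms(1), of id id X' Y' D] assms(2,3) by simp

lemma jforest_mono:
  assumes "jforest X Y D r B L n" "X \<subseteq> X'" "Y \<subseteq> Y'"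
  shows "jforest X' Y' D r B L n"
  using assms
proof (induction L arbitrary: n)
  case Nil
  then show ?case by (cases rule: jforest.cases) (auto intro: fnil)
next
  case (Cons b L)
  from Cons.prems(1) show ?case
  proof (cases rule: jforest.cases)
    case (fcons i a n1 n')
    then show ?thesis using Cons.IH[of n'] Cons.prems(2,3) jtree_mono[OF fcons(3) Cons.prems(2,3)]
      by (auto intro!: jtree_jforest.fcons)
  qed
qed

lemma jtree_pos: "jtree X Y D n \<Longrightarrow> 0 < n" "jforest X Y D r B L n \<Longrightarrow> length L \<le> n"
  by (induction rule: jtree_jforest.inducts) auto

text \<open>Pruning a tree to \<open>k\<close> leaves leaves less than \<open>k\<close> branchings.\<close>

lemma jtree_prune:
  "jtree X Y D n \<Longrightarrow> (\<And>k. 0 < k \<Longrightarrow> k \<le> n \<Longrightarrow>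
     \<exists>X' Y'. X' \<subseteq> X \<and> Y' \<subseteq> Y \<and> finite X' \<and> finite Y' \<and> card X' + 3 \<le> 3 * k \<and> card Y' + 3 \<le> 3 * k \<and> jtree X' Y' D k)"
  "jforest X Y D r B L n \<Longrightarrow> (\<And>k. 0 < k \<Longrightarrow> k \<le> n \<Longrightarrow>
     \<exists>X' Y' L'. X' \<subseteq> X \<and> Y' \<subseteq> Y \<and> finite X' \<and> finite Y' \<and> card X' + 2 * length L' \<le> 3 * k \<and>
       card Y' + 2 * length L' \<le> 3 * k \<and> jforest X' Y' D r B L' k \<and> set L' \<subseteq> set L \<and> L' \<noteq> [] \<and>
       (2 \<le> length L \<and> 2 \<le> k \<longrightarrow> 2 \<le> length L'))"
proof (induction rule: jtree_jforest.inducts)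
  case (leaf X Y D)
  then have "k = Suc 0" by simp
  then show ?case by (intro exI[of _ "{}"]) (auto intro: jtree_jforest.leaf)
next
  case (branch X Y D r B L n)
  show ?case
  proof (cases "k = Suc 0")
    case True
    then show ?thesis by (intro exI[of _ "{}"]) (auto intro: jtree_jforest.leaf)
  next
    case False
    then obtain X' Y' L' where *: "X' \<subseteq> X" "Y' \<subseteq> Y" "finite X'" "finite Y'" "card X' + 2 * length L' \<le> 3 * k"
       "card Y' + 2 * length L' \<le> 3 * k" "jforest X' Y' D r B L' k" "2 \<le> length L'"
      using branch.IH[OF branch.prems] branch.hyps(2) branch.prems by auto
    have "jtree (insert r X') (insert B Y') D k"
      by (rule jtree_jforest.branch[OF jforest_mono[OF *(7)] *(8)]) (use branch.hyps in auto)
    \<comment> \<open>At least two children leave a slack of four in the forest bound: one is spent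
      on \<open>r\<close> or \<open>B\<close>, and three remain as the tree bound demands.\<close>
    moreover have "card (insert r X') + 3 \<le> 3 * k" "card (insert B Y') + 3 \<le> 3 * k"
      using *(5,6,8) card_insert_le_m1[of "card X' + 1" X' r] card_insert_le_m1[of "card Y' + 1" Y' B] by simp_all
    ultimately show ?thesis using * branch.hyps
      by (intro exI[of _ "insert r X'"] exI[of _ "insert B Y'"]) auto
  qed
next
  case (fnil X Y D r B)
  then show ?case by simp
next
  case (fcons X Y r i B a D n L n')
  \<comment> \<open>The first child keeps as many leaves as it can while one is left for the others,
    so two children survive whenever \<open>k \<ge> 2\<close>. For \<open>k = 1\<close> the others
    are dropped.\<close>
  define k1 where "k1 = (if L = [] then k else min n (if k = 1 then 1 else k - 1))"
  have n0: "L \<noteq> [] \<Longrightarrow> 0 < n'" and n1: "0 < n"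
    using jtree_pos(2)[OF fcons.hyps(2)] jtree_pos(1)[OF fcons.hyps(1)] by (cases L; simp)+
  have nL: "n' = 0" if "L = []" using fcons.hyps(2) that by (cases rule: jforest.cases) auto
  have k1: "0 < k1" "k1 \<le> n" "k - k1 \<le> n'" "k1 \<le> k"
    using fcons.prems n0 n1 nL unfolding k1_def by (auto split: if_splits)
  obtain X1 Y1 where 1: "X1 \<subseteq> X" "Y1 \<subseteq> Y" "finite X1" "finite Y1" "card X1 + 3 \<le> 3 * k1"
     "card Y1 + 3 \<le> 3 * k1" "jtree X1 Y1 (Rm r i (Cm B a D)) k1"
    using fcons.IH(1)[OF k1(1,2)] by blast
  show ?case
  proof (cases "k1 = k")
    case True
    have "jforest (insert i X1) (insert a Y1) D r B [(i, a)] (k1 + 0)"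
      by (rule jtree_jforest.fcons[OF jtree_mono[OF 1(7)] jtree_jforest.fnil]) (use fcons.hyps in auto)
    moreover have "card (insert i X1) + 2 \<le> 3 * k" "card (insert a Y1) + 2 \<le> 3 * k"
      using True 1(5,6) card_insert_le_m1[of "card X1 + 1" X1 i] card_insert_le_m1[of "card Y1 + 1" Y1 a] by simp_all
    moreover have "\<not> (2 \<le> length ((i, a) # L) \<and> 2 \<le> k)"
      using True fcons.prems unfolding k1_def by (auto split: if_splits)
    ultimately show ?thesis using True 1 fcons.hyps
      by (intro exI[of _ "insert i X1"] exI[of _ "insert a Y1"] exI[of _ "[(i, a)]"]) auto
  next
    case False
    then have "0 < k - k1" using k1 by simp
    then obtain X2 Y2 L2 where 2: "X2 \<subseteq> X" "Y2 \<subseteq> Y" "finite X2" "finite Y2" "card X2 + 2 * length L2 \<le> 3 * (k - k1)"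
       "card Y2 + 2 * length L2 \<le> 3 * (k - k1)" "jforest X2 Y2 D r B L2 (k - k1)" "set L2 \<subseteq> set L" "L2 \<noteq> []"
      using fcons.IH(2)[OF _ k1(3)] by blast
    let ?X = "insert i (X1 \<union> X2)" and ?Y = "insert a (Y1 \<union> Y2)"
    have "jforest ?X ?Y D r B ((i, a) # L2) (k1 + (k - k1))"
      by (rule jtree_jforest.fcons[OF jtree_mono[OF 1(7)] jforest_mono[OF 2(7)]])
        (use fcons.hyps 2(8) in auto)
    moreover have "card ?X + 2 * length ((i, a) # L2) \<le> 3 * k"
    proof -
      have "card ?X \<le> Suc (card X1 + card X2)"
        using card_insert_le_m1[of "card (X1 \<union> X2) + 1" "X1 \<union> X2" i] card_Un_le[of X1 X2] by simp
      then show ?thesis using 1(5) 2(5) k1 by simp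
    qed
    moreover have "card ?Y + 2 * length ((i, a) # L2) \<le> 3 * k"
    proof -
      have "card ?Y \<le> Suc (card Y1 + card Y2)"
        using card_insert_le_m1[of "card (Y1 \<union> Y2) + 1" "Y1 \<union> Y2" a] card_Un_le[of Y1 Y2] by simp
      then show ?thesis using 1(6) 2(6) k1 by simp
    qed
    moreover have "2 \<le> length ((i, a) # L2)" using 2(9) by (cases L2) auto
    ultimately show ?thesis using 1 2 fcons.hyps k1
      by (intro exI[of _ ?X] exI[of _ ?Y] exI[of _ "(i, a) # L2"]) auto
  qed
qed

section \<open>Branching and lengths\<close>

definition child :: "('r \<times> 'c) set \<Rightarrow> 'r \<Rightarrow> 'c \<Rightarrow> 'r \<times> 'c \<Rightarrow> ('r \<times> 'c) set" where
  "child D r B = (\<lambda>(i, a). Rm r i (Cm B a D))"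

definition node :: "('r \<times> 'c) set \<Rightarrow> 'r \<Rightarrow> 'c \<Rightarrow> ('r \<times> 'c) list \<Rightarrow> bool" where
  "node D r B L \<longleftrightarrow> (r, B) \<in> D \<and>
     (\<forall>(i, a)\<in>set L. i \<noteq> r \<and> a \<noteq> B \<and> (i, B) \<notin> D \<and> (r, a) \<notin> D \<and> (i, a) \<notin> D) \<and>
     sorted_wrt (\<lambda>b b'. (fst b, snd b') \<in> D) L"

text \<open>The triples required by \<open>triangular\<close>: the column move gives the submodule,
  the row move the map. The exponent is taken from \<open>D\<close> itself, not from the diagram
  after the column move.\<close>

definition node_list :: "('r \<times> 'c) set \<Rightarrow> 'r \<Rightarrow> 'c \<Rightarrow> ('r \<times> 'c) list \<Rightarrow>
    (('r list \<Rightarrow> real) set \<times> (('r list \<Rightarrow> real) \<Rightarrow> ('r list \<Rightarrow> real)) \<times> ('r list \<Rightarrow> real) set) list" where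
  "node_list D r B L =
     map (\<lambda>(i, a). (Mod (Cm B a D), Rop r i (card (elig r i D)), Mod (child D r B (i, a)))) L"

lemma submod_Mod_card: "card E = d \<Longrightarrow> submod (PG d) (Mod E)"
  using submod_Mod[of E] by simp

text \<open>For its own child the column move replaces \<open>B\<close> by \<open>a\<close> among
  the eligible columns, so the row operator has exactly the right exponent. For a later child the
  replacement column already has a box in row \<open>i\<close>, one eligible column is lost, and the
  operator vanishes.\<close>

lemma node_triangular:
  assumes fin: "finite D" and node: "node D r B L"
  shows "triangular (PG (card D)) (node_list D r B L)"
  unfolding triangular_def
proof
  have own: "Rop r i (card (elig r i D)) ` Mod (Cm B a D) = Mod (child D r B (i, a))"
    if ia: "(i, a) \<in> set L" for i a
  proof -
    have c: "i \<noteq> r" "a \<noteq> B" "(i, B) \<notin> D" "(r, a) \<notin> D" "(i, a) \<notin> D" "(r, B) \<in> D"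
      using node ia by (auto simp: node_def)
    \<comment> \<open>The box \<open>(r, B)\<close> moves to column \<open>a\<close>, while row
      \<open>i\<close> has no box in either column.\<close>
    have "elig r i (Cm B a D) = insert a (elig r i D - {B})"
      unfolding elig_def mem_Cm[OF c(2)[symmetric]] using c by auto
    moreover have "a \<notin> elig r i D" "B \<in> elig r i D" using c by (auto simp: elig_def)
    ultimately have "card (elig r i (Cm B a D)) = card (elig r i D)"
      using finite_elig[OF fin, of r i] card.remove[OF finite_elig[OF fin, of r i], of B] by simp
    then show ?thesis
      using Rop_Mod[OF finite_Cm[OF fin, of B a] c(1)[symmetric]] by (simp add: child_def)
  qed
  show "\<forall>(N, L', Q)\<in>set (node_list D r B L). submod (PG (card D)) N \<and> equivar (PG (card D)) L' \<and> L' ` N = Q"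
    unfolding node_list_def using own equivar_Rop submod_Mod_card[OF card_Cm] by fastforce
  have kill: "Mod (Cm B a' D) \<subseteq> kernel (Rop r i (card (elig r i D)))"
    if ia: "(i, a) \<in> set L" "(i', a') \<in> set L" "(i, a') \<in> D" for i a i' a'
  proof -
    have c: "i \<noteq> r" "a' \<noteq> B" "(i, B) \<notin> D" "(r, a') \<notin> D" "(r, B) \<in> D"
      using node ia by (auto simp: node_def)
    \<comment> \<open>After the move column \<open>a'\<close> has boxes in both rows, so
      \<open>B\<close> is lost without replacement.\<close>
    have "elig r i (Cm B a' D) = elig r i D - {B}"
      unfolding elig_def mem_Cm[OF c(2)[symmetric]] using c ia(3) by auto
    moreover have "B \<in> elig r i D" using c by (auto simp: elig_def)
    ultimately have "card (elig r i (Cm B a' D)) < card (elig r i D)"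
      using card_Diff1_less[OF finite_elig[OF fin, of r i], of B] by simp
    then show ?thesis by (intro Rop_Mod_zero[OF finite_Cm[OF fin]]) (use c in auto)
  qed
  have kill': "Mod (Cm B (snd b') D) \<subseteq> kernel (Rop r (fst b) (card (elig r (fst b) D)))"
    if "b \<in> set L" "b' \<in> set L" "(fst b, snd b') \<in> D" for b b'
    using kill[of "fst b" "snd b" "fst b'" "snd b'"] that by simp
  have "sorted_wrt (\<lambda>b b'. (fst b, snd b') \<in> D) L" using node by (simp add: node_def)
  then show "sorted_wrt (\<lambda>(_, L, _) (N, _, _). N \<subseteq> kernel L) (node_list D r B L)"
    unfolding node_list_def sorted_wrt_map
    by (rule sorted_wrt_mono_rel[rotated]) (simp add: case_prod_beta kill')
qed

lemma node_sub:
  assumes "finite D" "node D r B L" "N \<in> fst ` set (node_list D r B L)"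
  shows "N \<subseteq> Mod D"
proof -
  obtain i a where "(i, a) \<in> set L" "N = Mod (Cm B a D)"
    using assms(3) by (auto simp: node_list_def)
  moreover from this have "B \<noteq> a" using assms(2) by (auto simp: node_def)
  ultimately show ?thesis using Mod_Cm[OF assms(1)] by blast
qed

lemma node_list_sum:
  "(\<Sum>(N, L', Q)\<leftarrow>node_list D r B L. len G Q) = (\<Sum>b\<leftarrow>L. len G (Mod (child D r B b)))"
  by (simp add: node_list_def o_def case_prod_beta)

lemma node_len_ge:
  assumes "finite D" "node D r B L"
  shows "(\<Sum>b\<leftarrow>L. len (PG (card D)) (Mod (child D r B b))) \<le> len (PG (card D)) (Mod D)"
  by (rule len_triangular_ge[OF node_triangular[OF assms] _ submod_Mod node_sub[OF assms], unfolded node_list_sum])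
    (auto intro: lin_PG)

lemma node_len_eq:
  assumes "finite D" "node D r B L"
    and "len {} (Mod D) \<le> (\<Sum>b\<leftarrow>L. len {} (Mod (child D r B b)))"
    and "(\<Sum>b\<leftarrow>L. len {} (Mod (child D r B b))) \<noteq> \<infinity>"
  shows "len (PG (card D)) (Mod D) = (\<Sum>b\<leftarrow>L. len (PG (card D)) (Mod (child D r B b)))"
  by (rule len_triangular_eq[OF node_triangular[OF assms(1,2)] _ submod_Mod node_sub[OF assms(1,2)],
        unfolded node_list_sum])
    (use assms(3,4) in \<open>auto intro: lin_PG\<close>)

lemma card_child: "card (child D r B b) = card D"
  by (cases b) (simp add: child_def card_Rm card_Cm)

text \<open>A leaf counts once because the module of a finite diagram is nonzero; at a branching the
  lengths of the children add up below that of the parent. No permutation is involved.\<close>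

lemma jtree_len:
  "jtree X Y D n \<Longrightarrow> finite D \<Longrightarrow> enat n \<le> len (PG (card D)) (Mod D)"
  "jforest X Y D r B L n \<Longrightarrow> finite D \<Longrightarrow>
    enat n \<le> (\<Sum>b\<leftarrow>L. len (PG (card D)) (Mod (child D r B b))) \<and> ((r, B) \<in> D \<longrightarrow> node D r B L)"
proof (induction rule: jtree_jforest.inducts)
  case (leaf X Y D)
  then show ?case using len_Mod_pos[of D] by (simp add: one_enat_def)
next
  case (branch X Y D r B L n)
  then show ?case using node_len_ge[of D r B L] order.trans by blast
next
  case (fnil X Y D r B)
  then show ?case by (simp add: node_def zero_enat_def)
next
  case (fcons X Y r i B a D n L n')
  have "enat n \<le> len (PG (card D)) (Mod (child D r B (i, a)))"
    using fcons.IH(1) fcons.prems by (simp add: child_def card_Rm card_Cm finite_Rm finite_Cm)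
  moreover have "enat n' \<le> (\<Sum>b\<leftarrow>L. len (PG (card D)) (Mod (child D r B b)))" using fcons by blast
  ultimately have "enat n + enat n' \<le>
      len (PG (card D)) (Mod (child D r B (i, a))) + (\<Sum>b\<leftarrow>L. len (PG (card D)) (Mod (child D r B b)))"
    by (rule add_mono)
  moreover have "node D r B ((i, a) # L)" if "(r, B) \<in> D"
    using that fcons.IH(2) fcons.prems fcons.hyps by (auto simp: node_def)
  ultimately show ?case by simp
qed

section \<open>Diagrams whose columns form a chain\<close>

definition colset :: "('r \<times> 'c) set \<Rightarrow> 'c \<Rightarrow> 'r set" where
  "colset D c = {x. (x, c) \<in> D}"

definition rowset :: "('r \<times> 'c) set \<Rightarrow> 'r \<Rightarrow> 'c set" where
  "rowset D x = {c. (x, c) \<in> D}"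

definition colchain :: "('r \<times> 'c) set \<Rightarrow> bool" where
  "colchain D \<longleftrightarrow> (\<forall>c c'. colset D c \<subseteq> colset D c' \<or> colset D c' \<subseteq> colset D c)"

lemma finite_colset: "finite D \<Longrightarrow> finite (colset D c)"
  by (rule finite_subset[of _ "fst ` D"]) (force simp: colset_def)+

lemma finite_rowset: "finite D \<Longrightarrow> finite (rowset D x)"
  by (rule finite_subset[of _ "snd ` D"]) (force simp: rowset_def)+

lemma card_rows_cols:
  assumes D: "finite D" and C: "finite C" "snd ` D \<subseteq> C" and K: "finite K"
  shows "(\<Sum>c\<in>C. card (colset D c \<inter> K)) = (\<Sum>x\<in>K. card (rowset D x))"
proof -
  have "(\<Sum>c\<in>C. card (colset D c \<inter> K)) = card (SIGMA c:C. colset D c \<inter> K)"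
    using C K by (simp add: card_SigmaI)
  also have "(SIGMA c:C. colset D c \<inter> K) = prod.swap ` (SIGMA x:K. rowset D x)"
    using C(2) by (force simp: colset_def rowset_def image_iff)
  also have "card \<dots> = card (SIGMA x:K. rowset D x)" by (rule card_image) simp
  also have "\<dots> = (\<Sum>x\<in>K. card (rowset D x))"
    using K finite_rowset[OF D] by (simp add: card_SigmaI)
  finally show ?thesis .
qed

text \<open>Nested columns make the row and column sizes extremal: fixing a column of
  \<open>D\<close> as a set of rows, no diagram with the same column sizes has more boxes in these
  rows, and equal row sizes force equality in every column.\<close>

lemma chain_margins:
  assumes D: "finite D" and E: "finite E" and chain: "colchain D"
    and cols: "\<And>c. card (colset E c) = card (colset D c)"
    and rows: "\<And>x. card (rowset E x) = card (rowset D x)"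
  shows "E = D"
proof -
  have "colset E c0 = colset D c0" for c0
  proof -
    let ?K = "colset D c0" and ?C = "insert c0 (snd ` D \<union> snd ` E)"
    have fK: "finite ?K" by (rule finite_colset[OF D])
    have C: "finite ?C" "snd ` E \<subseteq> ?C" "snd ` D \<subseteq> ?C" using D E by auto
    have "(\<Sum>c\<in>?C. card (colset E c \<inter> ?K)) = (\<Sum>c\<in>?C. card (colset D c \<inter> ?K))"
      unfolding card_rows_cols[OF E C(1,2) fK] card_rows_cols[OF D C(1,3) fK] rows ..
    \<comment> \<open>The intersection is bounded by the sizes of both sets, and in \<open>D\<close>
      the smaller bound is attained because columns are comparable.\<close>
    moreover have "card (colset E c \<inter> ?K) \<le> card (colset D c \<inter> ?K)" for c
    proof (cases "colset D c \<subseteq> ?K")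
      case True
      then have "card (colset D c \<inter> ?K) = card (colset E c)" using cols by (simp add: Int_absorb2)
      then show ?thesis using card_mono[OF finite_colset[OF E], of "colset E c \<inter> ?K" c] by simp
    next
      case False
      then have "colset D c \<inter> ?K = ?K" using chain by (auto simp: colchain_def)
      then show ?thesis using card_mono[OF fK, of "colset E c \<inter> ?K"] by simp
    qed
    ultimately have "card (colset E c0 \<inter> ?K) = card (colset D c0 \<inter> ?K)"
      by (rule sum_mono_inv) (use D E in auto)
    then have "colset E c0 \<inter> ?K = ?K" using fK by (intro card_subset_eq) auto
    then have "?K \<subseteq> colset E c0" by blast
    then show ?thesis using cols finite_colset[OF E] by (metis card_subset_eq)
  qed
  then show ?thesis by (auto simp: colset_def set_eq_iff)
qed

lemma fill_perm:
  assumes "fill D \<rho> \<kappa>" "fill D \<rho>' \<kappa>'"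
  shows "\<exists>\<tau>. \<tau> permutes {..<card D} \<and> (\<forall>p<card D. \<rho>' p = \<rho> (\<tau> p) \<and> \<kappa>' p = \<kappa> (\<tau> p))"
proof -
  let ?d = "card D" and ?f = "\<lambda>p. (\<rho> p, \<kappa> p)" and ?f' = "\<lambda>p. (\<rho>' p, \<kappa>' p)"
  have b: "bij_betw ?f {..<?d} D" and b': "bij_betw ?f' {..<?d} D" using assms by (auto simp: fill_def)
  define \<tau> where "\<tau> p = (if p < ?d then inv_into {..<?d} ?f (?f' p) else p)" for p
  have "bij_betw (inv_into {..<?d} ?f \<circ> ?f') {..<?d} {..<?d}"
    using b' bij_betw_inv_into[OF b] by (rule bij_betw_trans)
  then have "bij_betw \<tau> {..<?d} {..<?d}" by (subst bij_betw_cong[where g = "inv_into {..<?d} ?f \<circ> ?f'"]) (auto simp: \<tau>_def)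
  then have "\<tau> permutes {..<?d}" by (rule bij_imp_permutes) (simp add: \<tau>_def)
  moreover have "?f (\<tau> p) = ?f' p" if "p < ?d" for p
    using f_inv_into_f[of "?f' p" ?f "{..<?d}"] bij_betw_imp_surj_on[OF b] bij_betwE[OF b'] that
    by (simp add: \<tau>_def)
  ultimately show ?thesis by auto
qed

lemma card_colset_fill: "fill D \<rho> \<kappa> \<Longrightarrow> card (colset D c) = card {p. p < card D \<and> \<kappa> p = c}"
proof -
  assume f: "fill D \<rho> \<kappa>"
  have "\<rho> ` {p. p < card D \<and> \<kappa> p = c} = colset D c"
    unfolding colset_def fill_mem[OF f] by auto
  moreover have "inj_on \<rho> {p. p < card D \<and> \<kappa> p = c}"
    using f unfolding fill_def bij_betw_def inj_on_def by auto
  ultimately show ?thesis by (metis card_image)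
qed

lemma card_rowset_fill: "fill D \<rho> \<kappa> \<Longrightarrow> card (rowset D x) = card {p. p < card D \<and> \<rho> p = x}"
proof -
  assume f: "fill D \<rho> \<kappa>"
  have "\<kappa> ` {p. p < card D \<and> \<rho> p = x} = rowset D x"
    unfolding rowset_def fill_mem[OF f] by auto
  moreover have "inj_on \<kappa> {p. p < card D \<and> \<rho> p = x}"
    using f unfolding fill_def bij_betw_def inj_on_def by auto
  ultimately show ?thesis by (metis card_image)
qed

text \<open>The rows of one filling combined with the columns of another either repeat a box and
  give zero, or enumerate a diagram with the same margins. That diagram is \<open>D\<close>, so the
  result is the given generator up to sign.\<close>

lemma gn_chain:
  assumes fin: "finite D" and chain: "colchain D" and f: "fill D \<rho> \<kappa>" and f2: "fill D \<rho>2 \<kappa>2"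
    and s: "\<sigma> permutes {..<card D}"
  shows "\<exists>c. gn (card D) (\<rho>2 \<circ> \<sigma>) \<kappa> = (\<lambda>xs. c * gn (card D) \<rho> \<kappa> xs)"
proof (cases "inj_on (\<lambda>p. ((\<rho>2 \<circ> \<sigma>) p, \<kappa> p)) {..<card D}")
  case False
  then obtain p q where "p < card D" "q < card D" "p \<noteq> q" "(\<rho>2 \<circ> \<sigma>) p = (\<rho>2 \<circ> \<sigma>) q" "\<kappa> p = \<kappa> q"
    unfolding inj_on_def by auto
  then have "gn (card D) (\<rho>2 \<circ> \<sigma>) \<kappa> = (\<lambda>_. 0)" by (rule gn_zero)
  then show ?thesis by (intro exI[of _ 0]) simp
next
  case True
  let ?d = "card D"
  define E where "E = (\<lambda>p. ((\<rho>2 \<circ> \<sigma>) p, \<kappa> p)) ` {..<?d}"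
  have cE: "card E = ?d" unfolding E_def using card_image[OF True] by simp
  have fE: "fill E (\<rho>2 \<circ> \<sigma>) \<kappa>" unfolding fill_def cE using True by (simp add: E_def bij_betw_def)
  have "E = D"
  proof (rule chain_margins[OF fin _ chain])
    show "finite E" by (simp add: E_def)
    show "card (colset E c) = card (colset D c)" for c
      unfolding card_colset_fill[OF fE] card_colset_fill[OF f] cE ..
    show "card (rowset E x) = card (rowset D x)" for x
    proof -
      have "\<sigma> ` {p. p < ?d \<and> (\<rho>2 \<circ> \<sigma>) p = x} = {p. p < ?d \<and> \<rho>2 p = x}"
      proof
        show "\<sigma> ` {p. p < ?d \<and> (\<rho>2 \<circ> \<sigma>) p = x} \<subseteq> {p. p < ?d \<and> \<rho>2 p = x}"
          using permutes_less[OF s] by auto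
        show "{p. p < ?d \<and> \<rho>2 p = x} \<subseteq> \<sigma> ` {p. p < ?d \<and> (\<rho>2 \<circ> \<sigma>) p = x}"
        proof
          fix p assume "p \<in> {p. p < ?d \<and> \<rho>2 p = x}"
          then show "p \<in> \<sigma> ` {p. p < ?d \<and> (\<rho>2 \<circ> \<sigma>) p = x}"
            using permutes_less[OF permutes_inv[OF s], of p]
            by (intro image_eqI[of _ _ "inv \<sigma> p"]) (auto simp: permutes_inverses[OF s])
        qed
      qed
      moreover have "card (\<sigma> ` {p. p < ?d \<and> (\<rho>2 \<circ> \<sigma>) p = x}) = card {p. p < ?d \<and> (\<rho>2 \<circ> \<sigma>) p = x}"
        by (rule card_image[OF permutes_inj_on[OF s]])
      ultimately have "card {p. p < ?d \<and> (\<rho>2 \<circ> \<sigma>) p = x} = card {p. p < ?d \<and> \<rho>2 p = x}"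
        by simp
      then show ?thesis unfolding card_rowset_fill[OF fE] card_rowset_fill[OF f2] cE .
    qed
  qed
  then have "fill D (\<rho>2 \<circ> \<sigma>) \<kappa>" using fE by simp
  from fill_perm[OF f this] obtain \<tau> where t: "\<tau> permutes {..<?d}"
    "\<And>p. p < ?d \<Longrightarrow> (\<rho>2 \<circ> \<sigma>) p = \<rho> (\<tau> p) \<and> \<kappa> p = \<kappa> (\<tau> p)" by blast
  have tc: "\<tau> \<in> colperms ?d \<kappa>" using t by (auto simp: colperms_def)
  have "gn ?d (\<rho>2 \<circ> \<sigma>) \<kappa> = gn ?d (\<rho> \<circ> \<tau>) \<kappa>"
    by (rule gn_cong) (simp only: comp_apply conjunct1[OF t(2)[unfolded comp_apply]], rule refl)
  then have "gn ?d (\<rho>2 \<circ> \<sigma>) \<kappa> = (\<lambda>xs. of_int (sign \<tau>) * gn ?d \<rho> \<kappa> xs)"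
    using gn_comp[OF tc, of \<rho>] by auto
  then show ?thesis by blast
qed

lemma alt_chain:
  assumes fin: "finite D" and chain: "colchain D" and f: "fill D \<rho> \<kappa>" and u: "u \<in> Mod D"
  shows "\<exists>c. alt (card D) \<kappa> u = (\<lambda>xs. c * gn (card D) \<rho> \<kappa> xs)"
  using u unfolding Mod_def
proof (induction rule: lspan.induct)
  case zero
  show ?case by (intro exI[of _ 0]) (simp add: lin_zero[OF lin_alt])
next
  case (add u s a)
  obtain c where c: "alt (card D) \<kappa> u = (\<lambda>xs. c * gn (card D) \<rho> \<kappa> xs)" using add.IH by blast
  obtain \<rho>2 \<kappa>2 where s: "s = gn (card D) \<rho>2 \<kappa>2" "fill D \<rho>2 \<kappa>2" using add.hyps by (auto simp: gens_def)
  have "\<forall>\<sigma>\<in>colperms (card D) \<kappa>2. \<exists>c. gn (card D) (\<rho>2 \<circ> \<sigma>) \<kappa> = (\<lambda>xs. c * gn (card D) \<rho> \<kappa> xs)"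
    using gn_chain[OF fin chain f s(2)] by (auto simp: colperms_def)
  from bchoice[OF this] obtain e where e: "\<And>\<sigma>. \<sigma> \<in> colperms (card D) \<kappa>2 \<Longrightarrow>
      gn (card D) (\<rho>2 \<circ> \<sigma>) \<kappa> = (\<lambda>xs. e \<sigma> * gn (card D) \<rho> \<kappa> xs)" by blast
  define b where "b = (\<Sum>\<sigma>\<in>colperms (card D) \<kappa>2. of_int (sign \<sigma>) * e \<sigma>)"
  have "alt (card D) \<kappa> s = (\<lambda>xs. b * gn (card D) \<rho> \<kappa> xs)"
    unfolding s(1) alt_gn b_def by (auto simp: sum_distrib_right e mult.assoc intro!: sum.cong ext)
  then have "alt (card D) \<kappa> (\<lambda>x. u x + a * s x) = (\<lambda>xs. (c + a * b) * gn (card D) \<rho> \<kappa> xs)"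
    unfolding lin_comb[OF lin_alt] c by (simp add: algebra_simps)
  then show ?case by blast
qed

text \<open>The right-hand side is the inner product of \<open>u\<close> with the generator of
  \<open>\<rho>\<close> and \<open>\<kappa>\<close>; an antisymmetrisation that vanishes therefore
  means orthogonality.\<close>

lemma alt_at:
  "alt d \<kappa> u (map \<rho> [0..<d]) = (\<Sum>\<tau>\<in>colperms d \<kappa>. of_int (sign \<tau>) * u (map (\<rho> \<circ> \<tau>) [0..<d]))"
proof -
  have "act d (inv \<tau>) u (map \<rho> [0..<d]) = u (map (\<rho> \<circ> inv \<tau>) [0..<d])" if "\<tau> \<in> colperms d \<kappa>" for \<tau>
  proof -
    have "map (\<lambda>p. map \<rho> [0..<d] ! inv \<tau> p) [0..<d] = map (\<rho> \<circ> inv \<tau>) [0..<d]"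
      using colperms_less[OF colperms_inv[OF that]] by simp
    then show ?thesis by (simp add: act_def del: map_eq_conv)
  qed
  then have "alt d \<kappa> u (map \<rho> [0..<d]) =
      (\<Sum>\<tau>\<in>colperms d \<kappa>. of_int (sign \<tau>) * u (map (\<rho> \<circ> inv \<tau>) [0..<d]))"
    by (simp add: alt_def)
  also have "\<dots> = (\<Sum>\<tau>\<in>colperms d \<kappa>. of_int (sign \<tau>) * u (map (\<rho> \<circ> \<tau>) [0..<d]))"
  proof (rule sum.reindex_bij_witness[of _ inv inv])
    fix \<tau> assume "\<tau> \<in> colperms d \<kappa>"
    then have t: "\<tau> permutes {..<d}" by (simp add: colperms_def)
    show "inv (inv \<tau>) = \<tau>" using permutes_bij[OF t] by (rule inv_inv_eq)
    then show "inv (inv \<tau>) = \<tau>" .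
    show "of_int (sign (inv \<tau>)) * u (map (\<rho> \<circ> inv \<tau>) [0..<d]) = of_int (sign \<tau>) * u (map (\<rho> \<circ> inv \<tau>) [0..<d])"
      by (simp add: sign_inverse[OF permutation_lessThan[OF t]])
  qed (auto intro: colperms_inv)
  finally show ?thesis .
qed

text \<open>The submodule theorem of James. Either some antisymmetrisation of an element of
  \<open>U\<close> is nonzero; it is then a multiple of a generator, which generates everything. Or
  \<open>U\<close> is orthogonal to all generators, hence to itself, and vanishes over the
  reals.\<close>

theorem len_chain_le:
  assumes fin: "finite D" and chain: "colchain D"
  shows "len (PG (card D)) (Mod D) \<le> 1"
proof (rule len_simple)
  let ?d = "card D"
  fix U assume U: "submod (PG ?d) U" "U \<subseteq> Mod D"
  show "U = {\<lambda>_. 0} \<or> U = Mod D"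
  proof (cases "\<exists>u\<in>U. \<exists>\<rho> \<kappa>. fill D \<rho> \<kappa> \<and> alt ?d \<kappa> u \<noteq> (\<lambda>_. 0)")
    case True
    then obtain u \<rho> \<kappa> where u: "u \<in> U" "fill D \<rho> \<kappa>" "alt ?d \<kappa> u \<noteq> (\<lambda>_. 0)" by blast
    obtain c where c: "alt ?d \<kappa> u = (\<lambda>xs. c * gn ?d \<rho> \<kappa> xs)" using alt_chain[OF fin chain u(2)] u(1) U(2) by blast
    then have c0: "c \<noteq> 0" using u(3) by auto
    have "(\<lambda>xs. c * gn ?d \<rho> \<kappa> xs) \<in> U" using alt_submod[OF U(1) u(1)] c by metis
    then have "(\<lambda>xs. 1 / c * (c * gn ?d \<rho> \<kappa> xs)) \<in> U" by (rule subsp_scale[OF submod_subsp[OF U(1)]])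
    then have g: "gn ?d \<rho> \<kappa> \<in> U" using c0 by simp
    have "gens D \<subseteq> U"
    proof
      fix s assume "s \<in> gens D"
      then obtain \<rho>' \<kappa>' where s: "s = gn ?d \<rho>' \<kappa>'" "fill D \<rho>' \<kappa>'" by (auto simp: gens_def)
      obtain \<tau> where t: "\<tau> permutes {..<?d}" "\<And>p. p < ?d \<Longrightarrow> \<rho>' p = \<rho> (\<tau> p) \<and> \<kappa>' p = \<kappa> (\<tau> p)"
        using fill_perm[OF u(2) s(2)] by blast
      have "act ?d (inv \<tau>) (gn ?d \<rho> \<kappa>) = gn ?d (\<rho> \<circ> inv (inv \<tau>)) (\<kappa> \<circ> inv (inv \<tau>))"
        by (rule act_gn[OF permutes_inv[OF t(1)]])
      also have "\<dots> = s" unfolding s(1) inv_inv_eq[OF permutes_bij[OF t(1)]] by (rule gn_cong) (use t(2) in auto)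
      finally have "s = act ?d (inv \<tau>) (gn ?d \<rho> \<kappa>)" ..
      moreover have "act ?d (inv \<tau>) \<in> PG ?d" using permutes_inv[OF t(1)] by (auto simp: PG_def)
      ultimately show "s \<in> U" using submodD[OF U(1)] g by blast
    qed
    then have "Mod D \<subseteq> U" unfolding Mod_def by (rule lspan_least[OF submod_subsp[OF U(1)]])
    then show ?thesis using U(2) by blast
  next
    case False
    \<comment> \<open>A finite set of words supporting the whole module, so that the inner product
      is a finite sum.\<close>
    define W where "W = {xs. set xs \<subseteq> fst ` D \<and> length xs = ?d}"
    have fW: "finite W" unfolding W_def using fin by (intro finite_lists_length_eq) simp
    have supp: "f xs = 0" if "f \<in> Mod D" "xs \<notin> W" for f xs
      using that(1) unfolding Mod_def
    proof (induction rule: lspan.induct)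
      case (add f s c)
      then obtain \<rho> \<kappa> where s: "s = gn ?d \<rho> \<kappa>" "fill D \<rho> \<kappa>" by (auto simp: gens_def)
      have "s xs = 0"
      proof (rule ccontr)
        assume "s xs \<noteq> 0"
        then obtain \<sigma> where \<sigma>: "\<sigma> \<in> colperms ?d \<kappa>" "length xs = ?d" "\<And>p. p < ?d \<Longrightarrow> xs ! p = \<rho> (\<sigma> p)"
          unfolding s(1) gn_def by (auto elim!: sum.not_neutral_contains_not_neutral)
        have "(\<rho> (\<sigma> p), \<kappa> (\<sigma> p)) \<in> D" if "p < ?d" for p
          using fill_mem[OF s(2)] colperms_less[OF \<sigma>(1) that] by blast
        then have "xs \<in> W" unfolding W_def using \<sigma>(2,3) by (force simp: in_set_conv_nth)
        then show False using that(2) by blast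
      qed
      then show ?case using add.IH by simp
    qed simp
    have ip0: "(\<Sum>xs\<in>W. u xs * gn ?d \<rho> \<kappa> xs) = 0" if u: "u \<in> U" and f: "fill D \<rho> \<kappa>" for u \<rho> \<kappa>
    proof -
      have uM: "u \<in> Mod D" using u U(2) by blast
      have "(\<Sum>xs\<in>W. u xs * gn ?d \<rho> \<kappa> xs) = (\<Sum>\<sigma>\<in>colperms ?d \<kappa>. \<Sum>xs\<in>W. of_int (sign \<sigma>) *
          (if xs = map (\<rho> \<circ> \<sigma>) [0..<?d] then u xs else 0))"
        unfolding gn_def sum_distrib_left
        by (subst sum.swap, intro sum.cong refl) (auto simp: list_eq_iff_nth_eq)
      also have "\<dots> = (\<Sum>\<sigma>\<in>colperms ?d \<kappa>. of_int (sign \<sigma>) * u (map (\<rho> \<circ> \<sigma>) [0..<?d]))"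
        unfolding sum_distrib_left[symmetric]
        by (intro sum.cong refl arg_cong2[of _ _ _ _ times])
          (use fW supp[OF uM] in \<open>auto simp: sum.delta\<close>)
      also have "\<dots> = alt ?d \<kappa> u (map \<rho> [0..<?d])" by (rule alt_at[symmetric])
      also have "\<dots> = 0"
      proof -
        have "alt ?d \<kappa> u = (\<lambda>_. 0)" using False u f by blast
        then show ?thesis by metis
      qed
      finally show ?thesis .
    qed
    have ip: "(\<Sum>xs\<in>W. u xs * w xs) = 0" if u: "u \<in> U" and w: "w \<in> Mod D" for u w
      using w unfolding Mod_def
    proof (induction rule: lspan.induct)
      case (add f s c)
      then obtain \<rho> \<kappa> where s: "s = gn ?d \<rho> \<kappa>" "fill D \<rho> \<kappa>" by (auto simp: gens_def)
      have "(\<Sum>xs\<in>W. u xs * (f xs + c * s xs)) = (\<Sum>xs\<in>W. u xs * f xs) + c * (\<Sum>xs\<in>W. u xs * s xs)"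
        by (simp add: sum.distrib sum_distrib_left algebra_simps)
      then show ?case using add.IH ip0[OF u s(2)] s(1) by simp
    qed simp
    have "u = (\<lambda>_. 0)" if u: "u \<in> U" for u
    proof
      fix xs
      have uM: "u \<in> Mod D" using u U(2) by blast
      have "(\<Sum>xs\<in>W. u xs * u xs) = 0" by (rule ip[OF u uM])
      then have "\<forall>xs\<in>W. u xs * u xs = 0" using fW by (subst (asm) sum_nonneg_eq_0_iff) auto
      then show "u xs = 0" using supp[OF uM] by (cases "xs \<in> W") auto
    qed
    moreover have "(\<lambda>_. 0) \<in> U" by (rule subspD(1)[OF submod_subsp[OF U(1)]])
    ultimately show ?thesis by blast
  qed
qed

section \<open>Grassmannian permutations\<close>

text \<open>No descent except possibly at \<open>d\<close>. The identity qualifies for every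
  \<open>d\<close>, which ends the induction that raises \<open>d\<close>.\<close>

definition grass :: "int \<Rightarrow> (int \<Rightarrow> int) \<Rightarrow> bool" where
  "grass d z \<longleftrightarrow> (\<forall>x y. x < y \<and> (y \<le> d \<or> d < x) \<longrightarrow> z x < z y)"

lemma grass_less: "grass d z \<Longrightarrow> x < y \<Longrightarrow> y \<le> d \<or> d < x \<Longrightarrow> z x < z y"
  by (simp add: grass_def)

lemma wprod_up:
  assumes "b \<le> d + 1"
  shows "wprod [b..d] x = (if x = b then d + 1 else if b < x \<and> x \<le> d + 1 then x - 1 else x)"
proof -
  have "b - 1 \<le> d" using assms by simp
  then show ?thesis
  proof (induction d arbitrary: x rule: int_ge_induct)
    case (step d)
    have "[b..d + 1] = [b..d] @ [d + 1]" using step(1) by (simp add: upto_rec2)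
    then have "wprod [b..d + 1] x = sr (d + 1) (wprod [b..d] x)" by (simp add: wprod_append)
    then show ?case using step by (auto simp: sr_def transpose_def)
  qed auto
qed

lemma wprod_up_extend: "b \<le> d + 1 \<Longrightarrow> wprod [b - 1..d] = wprod [b..d] \<circ> sr (b - 1)"
  using upto_rec1[of "b - 1" d] by simp

lemma wprod_up_self: "wprod [d + 1..d] = id"
  by simp

lemma red_run:
  assumes z: "permutation z" and g: "grass d z" and b: "b \<le> d + 1" "b \<le> d \<Longrightarrow> z (d + 1) < z b"
  shows "(red (rev [b..d] @ e) z \<longleftrightarrow> red e (z \<circ> wprod [b..d])) \<and>
    int (card (dg (z \<circ> wprod [b..d]))) + (d + 1 - b) = int (card (dg z))"
  using b
proof (induction b arbitrary: e rule: int_le_induct)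
  case base
  show ?case by (simp del: comp_apply id_apply)
next
  case (step b)
  have lt: "z (d + 1) < z (b - 1)" using step by simp
  have zb: "z (d + 1) < z b" if "b \<le> d"
    using grass_less[OF g, of "b - 1" b] that lt by simp
  note IH = step.IH[OF zb]
  let ?v = "z \<circ> wprod [b..d]"
  have v: "permutation ?v" by (rule permutation_compose[OF z permutation_wprod])
  have dsc: "?v (b - 1 + 1) < ?v (b - 1)" using lt step(1) by (simp add: wprod_up)
  have ext: "z \<circ> wprod [b - 1..d] = ?v \<circ> sr (b - 1)"
    unfolding wprod_up_extend[OF step(1)] by (rule o_assoc)
  have "rev [b - 1..d] @ e = rev [b..d] @ (b - 1) # e" using upto_rec1[of "b - 1" d] step(1) by simp
  then have "red (rev [b - 1..d] @ e) z \<longleftrightarrow> red ((b - 1) # e) ?v" using IH[of "(b - 1) # e"] by (simp del: comp_apply red.simps)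
  also have "\<dots> \<longleftrightarrow> red e (z \<circ> wprod [b - 1..d])" unfolding ext using dsc by (simp del: comp_apply)
  finally show ?case
    using IH[of e] card_dg_comp_sr[OF v dsc] unfolding ext by (simp del: comp_apply)
qed

text \<open>After the run down to \<open>b\<close> has been removed, a descent below
  \<open>b\<close> can only be at \<open>b - 1\<close>. A decreasing continuation therefore consists
  of consecutive letters.\<close>

lemma run_red:
  assumes z: "permutation z" and g: "grass d z"
    and "b \<le> d" "z (d + 1) < z b" "sorted_wrt (>) L" "\<And>a. a \<in> set L \<Longrightarrow> a < b"
    "red (L @ e) (z \<circ> wprod [b..d])"
  shows "\<exists>b'\<le>b. L = rev [b'..b - 1] \<and> z (d + 1) < z b' \<and> red e (z \<circ> wprod [b'..d])"
  using assms(3-)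
proof (induction L arbitrary: b)
  case Nil
  then show ?case by (intro exI[of _ b]) (simp del: comp_apply)
next
  case (Cons a L)
  let ?v = "z \<circ> wprod [b..d]"
  have dsc: "?v (a + 1) < ?v a" and rd: "red (L @ e) (?v \<circ> sr a)" using Cons.prems(5) by (simp_all del: comp_apply)
  have ab: "a < b" using Cons.prems(4) by simp
  have a: "a = b - 1"
  proof (rule ccontr)
    assume "a \<noteq> b - 1"
    then have "a + 1 < b" using ab by simp
    then show False using dsc Cons.prems(1) grass_less[OF g, of a "a + 1"] by (simp add: wprod_up)
  qed
  have lt: "z (d + 1) < z (b - 1)" using dsc Cons.prems(1) by (simp add: a wprod_up)
  have "z \<circ> wprod [b - 1..d] = ?v \<circ> sr a"
    unfolding a using wprod_up_extend[of b d] Cons.prems(1) by (simp add: o_assoc)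
  then have rd': "red (L @ e) (z \<circ> wprod [b - 1..d])" using rd by metis
  obtain b' where b': "b' \<le> b - 1" "L = rev [b'..b - 1 - 1]" "z (d + 1) < z b'" "red e (z \<circ> wprod [b'..d])"
    using Cons.IH[OF _ lt _ _ rd'] Cons.prems(1,3) a by (auto simp del: comp_apply)
  moreover have "[b'..b - 1] = [b'..b - 1 - 1] @ [b - 1]" using b'(1) by (simp add: upto_rec2)
  ultimately show ?case using a by (intro exI[of _ b']) (simp del: comp_apply)
qed

lemma wprod_ge:
  assumes "\<And>a. a \<in> set c \<Longrightarrow> b \<le> a"
  shows "x < b \<Longrightarrow> wprod c x = x" "b \<le> x \<Longrightarrow> b \<le> wprod c x"
proof -
  show fx: "wprod c x = x" if "x < b" for x
    by (rule wprod_far) (use assms that in force)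
  show "b \<le> wprod c x" if "b \<le> x"
  proof (rule ccontr)
    assume "\<not> b \<le> wprod c x"
    then have "wprod c (wprod c x) = wprod c x" by (intro fx) simp
    then have "wprod c x = x" using permutation_inj_eq[OF permutation_wprod, of c "wprod c x" x] by simp
    then show False using that \<open>\<not> b \<le> wprod c x\<close> by simp
  qed
qed

lemma tab_ge_hd:
  assumes "tab Ks" "Ks \<noteq> []" "K \<in> set Ks" "a \<in> set K"
  shows "hd (hd Ks) \<le> a"
  using assms
proof (induction Ks arbitrary: K a)
  case (Cons K0 Ks)
  have s: "K0 \<noteq> []" "sorted_wrt (<) K0" using Cons.prems(1) by (auto simp: tab_def)
  show ?case
  proof (cases "K = K0")
    case True
    then have "a = hd K0 \<or> a \<in> set (tl K0)" using Cons.prems(4) s by (cases K0) auto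
    then show ?thesis using s by (cases K0) auto
  next
    case False
    then have K: "K \<in> set Ks" "Ks \<noteq> []" using Cons.prems(3) by auto
    have t: "tab Ks" "rowle K0 (hd Ks)" using Cons.prems(1) K(2) tab_split[of "[]" K0 Ks] by auto
    have "hd Ks \<noteq> []" using t(1) K(2) by (auto simp: tab_def)
    then have "hd K0 \<le> hd (hd Ks)" using t(2) s(1) by (auto simp: rowle_def hd_conv_nth)
    then show ?thesis using Cons.IH[OF t(1) K(2,1) Cons.prems(4)] by simp
  qed
qed simp

text \<open>The first letter is the bottom of the first column and must be the only descent
  \<open>d\<close>; the rest of the column continues the run. Its top \<open>b\<close> is the
  insertion point of the value \<open>z (d + 1)\<close> among the values up to
  \<open>d\<close>.\<close>

lemma grass_first_column:
  assumes z: "permutation z" and g: "grass d z" and T: "tab (K # Rs)" "red (cw (K # Rs)) z"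
  shows "\<exists>b\<le>d. K = [b..d] \<and> z (b - 1) < z (d + 1) \<and> z (d + 1) < z b \<and> red (cw Rs) (z \<circ> wprod [b..d])"
proof -
  have K: "K \<noteq> []" "sorted_wrt (<) K" using T(1) by (auto simp: tab_def)
  define a L where "a = last K" and "L = rev (butlast K)"
  have KL: "K = rev L @ [a]" using K(1) by (simp add: a_def L_def)
  have dsc: "z (a + 1) < z a" and rd: "red (L @ cw Rs) (z \<circ> sr a)" using T(2) by (simp_all add: KL)
  have ad: "a = d"
  proof (rule ccontr)
    assume "a \<noteq> d"
    then have "z a < z (a + 1)" by (intro grass_less[OF g]) auto
    then show False using dsc by simp
  qed
  have sL: "sorted_wrt (>) L" "\<And>x. x \<in> set L \<Longrightarrow> x < d"
    using K(2) by (auto simp: KL ad sorted_wrt_append sorted_wrt_rev)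
  have "red (L @ cw Rs) (z \<circ> wprod [d..d])" using rd by (simp add: ad del: comp_apply)
  then obtain b where b: "b \<le> d" "L = rev [b..d - 1]" "z (d + 1) < z b" "red (cw Rs) (z \<circ> wprod [b..d])"
    using run_red[OF z g _ _ sL, where e = "cw Rs"] dsc ad by auto
  have Kb: "K = [b..d]" using b(1,2) by (simp add: KL ad upto_rec2)
  \<comment> \<open>All later entries are at least the corner \<open>b\<close>, so the remaining
    product fixes \<open>b - 1\<close> and maps \<open>b\<close> to something not below
    \<open>b\<close>. A run stopped too early would contradict this.\<close>
  have "z (b - 1) < z (d + 1)"
  proof (rule ccontr)
    assume "\<not> z (b - 1) < z (d + 1)"
    then have gt: "z (d + 1) < z (b - 1)" using permutation_inj_eq[OF z, of "b - 1" "d + 1"] b(1) by linarith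
    have "hd K = b" using b(1) by (simp add: Kb upto_rec1)
    then have ge: "b \<le> x" if "x \<in> set (cw Rs)" for x
      using that tab_ge_hd[OF T(1), where a = x] by (auto simp: cw_def)
    have v: "permutation (z \<circ> wprod [b..d])" by (rule permutation_compose[OF z permutation_wprod])
    then have w: "wprod (cw Rs) = z \<circ> wprod [b..d]" using red_imp[OF _ b(4)] by blast
    have "b \<le> wprod (cw Rs) b" "wprod (cw Rs) (b - 1) = b - 1"
      by (rule wprod_ge, erule ge, simp)+
    then have "b \<le> z (d + 1)" "z (b - 1) = b - 1" using b(1) unfolding w by (simp_all add: wprod_up)
    then show False using gt by simp
  qed
  then show ?thesis using b Kb by blast
qed

text \<open>Without a descent at \<open>d\<close> there would be no inversion at all. The values up
  to \<open>d\<close> then cross the value at \<open>d + 1\<close> somewhere, starting from a fixed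
  point far to the left.\<close>

lemma grass_not_id:
  assumes z: "permutation z" and g: "grass d z" and "z \<noteq> id"
  obtains b where "b \<le> d" "z (b - 1) < z (d + 1)" "z (d + 1) < z b"
proof -
  have "z (d + 1) < z d"
  proof (rule ccontr)
    assume "\<not> z (d + 1) < z d"
    then have dd: "z d < z (d + 1)" using permutation_inj_eq[OF z, of d "d + 1"] by linarith
    have mono: "z x < z y" if "x < y" for x y
    proof (cases "y \<le> d \<or> d < x")
      case True then show ?thesis using grass_less[OF g that] by simp
    next
      case False
      have "z x \<le> z d" using False grass_less[OF g, of x d] by (cases "x = d") auto
      moreover have "z (d + 1) \<le> z y" using False grass_less[OF g, of "d + 1" y] by (cases "y = d + 1") auto
      ultimately show ?thesis using dd by simp
    qed
    have "b \<notin> dg z" for b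
    proof
      assume "b \<in> dg z"
      moreover obtain x c where "b = (x, c)" by fastforce
      moreover have "c = z (inv z c)" using permutation_f_inv[OF z] by simp
      ultimately have "x < inv z c" "z (inv z c) < z x" by (auto simp: dg_def)
      then show False using mono[of x "inv z c"] by simp
    qed
    then have "dg z = {}" by blast
    then show False using dg_empty_iff[OF z] assms(3) by blast
  qed
  note ds = this
  obtain m where m0: "0 < m" and m: "\<And>x. m \<le> x \<Longrightarrow> z x = x" "\<And>x. x \<le> - m \<Longrightarrow> z x = x"
    by (rule permutation_bound[OF z]) (rule that)
  define x0 where "x0 = min (- m) (min d (z (d + 1) - 1))"
  have x0: "x0 \<le> d" "z x0 < z (d + 1)" using m(2)[of x0] by (auto simp: x0_def)
  have "\<exists>b\<le>d. z (b - 1) < z (d + 1) \<and> z (d + 1) < z b"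
  proof (rule ccontr)
    assume no: "\<not> (\<exists>b\<le>d. z (b - 1) < z (d + 1) \<and> z (d + 1) < z b)"
    have "y \<le> d \<Longrightarrow> z y < z (d + 1)" if "x0 \<le> y" for y
      using that
    proof (induction y rule: int_ge_induct)
      case base then show ?case using x0 by simp
    next
      case (step y)
      then have "\<not> z (d + 1) < z (y + 1)" using no[simplified, rule_format, of "y + 1"] by auto
      then show ?case using permutation_inj_eq[OF z, of "y + 1" "d + 1"] step.prems by linarith
    qed
    then show False using ds x0(1) by force
  qed
  then show thesis using that by blast
qed

text \<open>The run moves the value at \<open>d + 1\<close> to its sorted place among the first
  positions, so the possible descent shifts to \<open>d + 1\<close>.\<close>

lemma grass_next:
  assumes g: "grass d z" and b: "b \<le> d" "z (b - 1) < z (d + 1)" "z (d + 1) < z b"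
  shows "grass (d + 1) (z \<circ> wprod [b..d])"
  unfolding grass_def
proof (intro allI impI)
  fix x y :: int assume xy: "x < y \<and> (y \<le> d + 1 \<or> d + 1 < x)"
  have le: "z x \<le> z (b - 1)" if "x < b" for x
    using grass_less[OF g, of x "b - 1"] b(1) that by (cases "x = b - 1") auto
  have ge: "z b \<le> z x" if "b \<le> x" "x \<le> d" for x
    using grass_less[OF g, of b x] that by (cases "x = b") auto
  have w: "wprod [b..d] x = (if x = b then d + 1 else if b < x \<and> x \<le> d + 1 then x - 1 else x)" for x
    by (rule wprod_up) (use b in simp)
  consider "d + 1 < x" | "y \<le> d + 1" "x = b" | "y \<le> d + 1" "y = b" | "y \<le> d + 1" "x < b" "b < y"
    | "y < b" | "b < x" "y \<le> d + 1" using xy by linarith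
  then show "(z \<circ> wprod [b..d]) x < (z \<circ> wprod [b..d]) y"
  proof cases
    case 1 then show ?thesis using xy grass_less[OF g, of x y] b by (simp add: w)
  next
    case 2 then show ?thesis using xy ge[of "y - 1"] b by (simp add: w)
  next
    case 3 then show ?thesis using xy le[of x] b by (simp add: w)
  next
    case 4 then show ?thesis using xy le[of x] ge[of "y - 1"] b by (simp add: w)
  next
    case 5 then show ?thesis using xy grass_less[OF g, of x y] b by (simp add: w)
  next
    case 6 then show ?thesis using xy grass_less[OF g, of "x - 1" "y - 1"] b by (simp add: w)
  qed
qed

text \<open>The first column is forced, and what remains is a tableau for a Grassmannian permutation
  with fewer inversions.\<close>

theorem EGi_grass:
  assumes "permutation z" "grass d z"
  shows "EGi z = 1"
proof -
  have "\<exists>!Ks. tab Ks \<and> red (cw Ks) z"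
    using assms
  proof (induction "card (dg z)" arbitrary: d z rule: less_induct)
    case less
    note z = less.prems(1) and g = less.prems(2)
    show ?case
    proof (cases "z = id")
      case True
      have "Ks = []" if "tab Ks" "red (cw Ks) z" for Ks
      proof -
        have "cw Ks = []" using red_imp[OF z that(2)] by (simp add: True dg_id)
        then show ?thesis using that(1) by (auto simp: cw_def tab_def)
      qed
      moreover have "tab []" "red (cw []) z" by (simp_all add: tab_def True)
      ultimately show ?thesis by blast
    next
      case False
      then obtain b where b: "b \<le> d" "z (b - 1) < z (d + 1)" "z (d + 1) < z b"
        by (rule grass_not_id[OF z g])
      let ?v = "z \<circ> wprod [b..d]"
      have v: "permutation ?v" by (rule permutation_compose[OF z permutation_wprod])
      have g': "grass (d + 1) ?v" by (rule grass_next[OF g b])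
      have R: "red (rev [b..d] @ e) z \<longleftrightarrow> red e ?v" for e using red_run[OF z g, of b e] b by simp
      have "card (dg ?v) < card (dg z)" using red_run[OF z g, of b "[]"] b by simp
      from less.hyps[OF this v g'] obtain Rs where
        Rs: "tab Rs" "red (cw Rs) ?v" "\<And>Rs'. tab Rs' \<Longrightarrow> red (cw Rs') ?v \<Longrightarrow> Rs' = Rs" by blast
      \<comment> \<open>The next column ends at \<open>d + 1\<close> and starts after
        \<open>b\<close>, because position \<open>b\<close> now holds \<open>z (d + 1)\<close>,
        which is below \<open>z (d + 2)\<close>.\<close>
      have "rowle [b..d] (hd Rs)" if ne: "Rs \<noteq> []"
      proof -
        obtain K Rs' where K: "Rs = K # Rs'" using ne by (cases Rs) auto
        obtain b' where b': "b' \<le> d + 1" "K = [b'..d + 1]" "?v (d + 1 + 1) < ?v b'"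
          using grass_first_column[OF v g', of K Rs'] Rs(1,2) unfolding K by blast
        have "?v b < ?v (d + 1 + 1)" using b grass_less[OF g, of "d + 1" "d + 1 + 1"] by (simp add: wprod_up)
        then have "?v b < ?v b'" using b'(3) by simp
        then have "b < b'" using grass_less[OF g', of b' b] b(1) b'(1) by (cases "b' = b") force+
        then show ?thesis using b(1) by (auto simp: K b'(2) rowle_def)
      qed
      then have "tab ([b..d] # Rs)"
        using tab_split[of "[]" "[b..d]" Rs] Rs(1) b(1) by (simp add: tab_def)
      moreover have "red (cw ([b..d] # Rs)) z" using R Rs(2) by simp
      moreover have "Ks = [b..d] # Rs" if K: "tab Ks" "red (cw Ks) z" for Ks
      proof -
        have "Ks \<noteq> []" using K(2) False by auto
        then obtain K0 Rs0 where Ks: "Ks = K0 # Rs0" by (cases Ks) auto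
        obtain b1 where b1: "b1 \<le> d" "K0 = [b1..d]" "z (b1 - 1) < z (d + 1)" "z (d + 1) < z b1"
          "red (cw Rs0) (z \<circ> wprod [b1..d])"
          using grass_first_column[OF z g, of K0 Rs0] K unfolding Ks by blast
        have "b1 = b"
        proof (rule linorder_cases[of b1 b])
          assume "b1 < b"
          then have "z b1 \<le> z (b - 1)" using grass_less[OF g, of b1 "b - 1"] b(1) by (cases "b1 = b - 1") auto
          then show ?thesis using b b1 by simp
        next
          assume "b < b1"
          then have "z b \<le> z (b1 - 1)" using grass_less[OF g, of b "b1 - 1"] b1(1) by (cases "b = b1 - 1") auto
          then show ?thesis using b b1 by simp
        qed
        moreover have "tab Rs0" using K(1) tab_split[of "[]" K0 Rs0] unfolding Ks by simp
        ultimately show ?thesis using Rs(3) b1 Ks by blast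
      qed
      ultimately show ?thesis by blast
    qed
  qed
  then obtain Ks where "tab Ks \<and> red (cw Ks) z" "\<And>Ks'. tab Ks' \<and> red (cw Ks') z \<Longrightarrow> Ks' = Ks" by blast
  then have "{Ks. tab Ks \<and> red (cw Ks) z} = {Ks}" by blast
  then show ?thesis by (simp add: EGi_def)
qed

text \<open>A nonempty column belongs to a position after \<open>d\<close> and consists of all rows
  up to \<open>d\<close> with a larger value; these sets shrink as the value grows.\<close>

lemma colchain_grass:
  assumes z: "permutation z" and g: "grass d z"
  shows "colchain (dg z)"
proof -
  have cs: "colset (dg z) c = (if inv z c \<le> d then {} else {x. x \<le> d \<and> c < z x})" for c
  proof -
    define j where "j = inv z c"
    then have c: "c = z j" using permutation_f_inv[OF z] by simp
    have "x \<in> colset (dg z) c \<longleftrightarrow> x \<in> (if inv z c \<le> d then {} else {x. x \<le> d \<and> c < z x})" for x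
      using grass_less[OF g, of x j] unfolding colset_def dg_def j_def[symmetric] c
      by (cases "x < j"; cases "j \<le> d"; cases "x \<le> d") (simp_all add: c[symmetric] j_def[symmetric])
    then show ?thesis by (rule set_eqI)
  qed
  have "colset (dg z) c \<subseteq> colset (dg z) c' \<or> colset (dg z) c' \<subseteq> colset (dg z) c" if "c' \<le> c" for c c'
    unfolding cs using that by auto
  note sub = this
  show ?thesis unfolding colchain_def
  proof (intro allI)
    fix c c' :: int
    show "colset (dg z) c \<subseteq> colset (dg z) c' \<or> colset (dg z) c' \<subseteq> colset (dg z) c"
      using sub[of c c'] sub[of c' c] by (cases "c \<le> c'") auto
  qed
qed

section \<open>The Lascoux-Schuetzenberger tree\<close>

text \<open>The maximal transition: \<open>r\<close> is the last descent and \<open>s\<close> the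
  last position whose value is below \<open>z r\<close>.\<close>

locale ls_step =
  fixes z :: "int \<Rightarrow> int" and r s :: int
  assumes z: "permutation z" and rs: "r < s" and desc: "z s < z r"
    and inc: "\<And>x y. r < x \<Longrightarrow> x < y \<Longrightarrow> z x < z y"
    and gt: "\<And>x. s < x \<Longrightarrow> z r < z x"
begin

definition v where "v = z \<circ> tr r s"
definition I where "I = lcov v r"
definition next_perm where "next_perm i = v \<circ> tr i r"

lemma zeq: "z x = z y \<longleftrightarrow> x = y"
  by (rule permutation_inj_eq[OF z])

lemma perm_v: "permutation v"
  unfolding v_def by (rule permutation_comp_tr[OF z])

lemma permutation_next: "permutation (next_perm i)"
  unfolding next_perm_def by (rule permutation_comp_tr[OF perm_v])

lemma v_simps: "v r = z s" "v s = z r" "x \<noteq> r \<Longrightarrow> x \<noteq> s \<Longrightarrow> v x = z x"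
  by (auto simp: v_def transpose_def)

text \<open>Between \<open>r\<close> and \<open>s\<close> the values are smaller than
  \<open>z s\<close>, and beyond \<open>s\<close> every candidate is blocked by \<open>s\<close>.
  One side of the transition formula thus consists of \<open>z\<close> alone.\<close>

lemma rcov_v: "rcov v r = {s}"
proof -
  have "cov v r t \<longleftrightarrow> t = s" for t
  proof
    assume c: "cov v r t"
    then have t: "r < t" "v r < v t" "\<And>k. r < k \<Longrightarrow> k < t \<Longrightarrow> \<not> (v r < v k \<and> v k < v t)"
      by (auto simp: cov_def)
    show "t = s"
    proof (rule linorder_cases[of t s])
      assume "t < s"
      then show ?thesis using t(1,2) inc[of t s] by (simp add: v_simps)
    next
      assume "s < t"
      then show ?thesis using t(3)[of s] rs desc gt[of t] by (simp add: v_simps)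
    qed
  next
    have "\<not> (v r < v k)" if "r < k" "k < s" for k using that inc[of k s] by (simp add: v_simps)
    then show "cov v r t" if "t = s" using that rs desc by (auto simp: cov_def v_simps)
  qed
  then show ?thesis by (auto simp: rcov_def)
qed

lemma mem_I: "i \<in> I \<longleftrightarrow> i < r \<and> z i < z s \<and> (\<forall>k. i < k \<and> k < r \<longrightarrow> z k < z i \<or> z s < z k)"
proof -
  have "v k = z k" if "k < r" for k using that rs by (simp add: v_simps)
  then have "cov v i r \<longleftrightarrow> i < r \<and> z i < z s \<and> (\<forall>k. i < k \<and> k < r \<longrightarrow> \<not> (z i < z k \<and> z k < z s))"
    by (auto simp: cov_def v_simps)
  moreover have "\<not> (z i < z k \<and> z k < z s) \<longleftrightarrow> z k < z i \<or> z s < z k" if "i < k" "k < r" for k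
    using that zeq[of i k] zeq[of k s] rs by linarith
  ultimately show ?thesis unfolding I_def lcov_def mem_Collect_eq by metis
qed

lemma I_D:
  assumes "i \<in> I"
  shows "i < r" "z i < z s" "\<And>k. i < k \<Longrightarrow> k < r \<Longrightarrow> z k < z i \<or> z s < z k"
  using assms by (auto simp: mem_I)

lemma finite_I: "finite I"
  unfolding I_def by (rule finite_lcov[OF perm_v])

text \<open>The rightmost admissible position works: a position that violates the cover condition
  would be admissible itself and lie further right.\<close>

lemma max_in_I:
  assumes k: "k0 < r" "z k0 < z s"
    and P: "P k0" "\<And>i k. i < k \<Longrightarrow> k < r \<Longrightarrow> P i \<Longrightarrow> z i < z k \<Longrightarrow> z k < z s \<Longrightarrow> P k"
  obtains i where "i \<in> I" "P i" "k0 \<le> i"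
proof -
  define A where "A = {i. k0 \<le> i \<and> i < r \<and> z i < z s \<and> P i}"
  have "finite A" by (rule finite_subset[of _ "{k0..r}"]) (auto simp: A_def)
  then have A: "finite A" "k0 \<in> A" using k P(1) by (simp_all add: A_def)
  define i where "i = Max A"
  have i: "i \<in> A" unfolding i_def using A by (intro Max_in) auto
  have "z k < z i \<or> z s < z k" if "i < k" "k < r" for k
  proof (rule ccontr)
    assume "\<not> (z k < z i \<or> z s < z k)"
    then have "z i < z k" "z k < z s" using that zeq[of i k] zeq[of k s] rs by linarith+
    moreover have "P k" by (rule P(2)[of i k]) (use that i calculation in \<open>auto simp: A_def\<close>)
    ultimately have "k \<in> A" using that i by (auto simp: A_def)
    then have "k \<le> i" unfolding i_def using A by (intro Max_ge) auto
    then show False using that by simp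
  qed
  then have "i \<in> I" using i by (simp add: mem_I A_def)
  then show thesis using that i by (simp add: A_def)
qed

text \<open>Far to the left there is a fixed point with small value; this is where permutations of
  all integers are needed.\<close>

lemma I_nonempty: "I \<noteq> {}"
proof -
  obtain m where m0: "0 < m" and m: "\<And>x. m \<le> x \<Longrightarrow> z x = x" "\<And>x. x \<le> - m \<Longrightarrow> z x = x"
    by (rule permutation_bound[OF z]) (rule that)
  define k where "k = min (- m) (min (r - 1) (z s - 1))"
  have "k < r" "z k < z s" using m(2)[of k] by (auto simp: k_def)
  then show ?thesis using max_in_I[of k "\<lambda>_. True"] by blast
qed

lemma next_simps:
  assumes "i \<in> I"
  shows "next_perm i i = z s" "next_perm i r = z i" "next_perm i s = z r"
    "x \<noteq> i \<Longrightarrow> x \<noteq> r \<Longrightarrow> x \<noteq> s \<Longrightarrow> next_perm i x = z x"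
  using I_D(1)[OF assms] rs by (auto simp: next_perm_def v_def transpose_def)

lemma mem_dg_next:
  assumes i: "i \<in> I"
  shows "(x, z j) \<in> dg (next_perm i) \<longleftrightarrow>
    x < (if j = i then r else if j = r then s else if j = s then i else j) \<and>
    z j < (if x = i then z s else if x = r then z i else if x = s then z r else z x)"
proof -
  let ?j = "if j = i then r else if j = r then s else if j = s then i else j"
  have "z j = next_perm i ?j" using next_simps[OF i] I_D(1)[OF i] rs by auto
  moreover have "next_perm i x = (if x = i then z s else if x = r then z i else if x = s then z r else z x)"
    using next_simps[OF i] by auto
  ultimately show ?thesis using mem_dg[OF permutation_next, of x i ?j] by simp
qed

lemma position:
  assumes i: "i \<in> I"
  shows "x < i \<or> x = i \<or> (i < x \<and> x < r \<and> (z x < z i \<or> z s < z x)) \<or> x = r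
    \<or> (r < x \<and> x < s \<and> z x < z s) \<or> x = s \<or> (s < x \<and> z r < z x)"
  using I_D(1)[OF i] I_D(3)[OF i, of x] inc[of x s] gt[of x] by linarith

text \<open>The positions fall into the classes of \<open>position\<close>, each with known bounds
  on its value, and the equality is checked class against class.\<close>

lemma dg_next:
  assumes i: "i \<in> I"
  shows "dg (next_perm i) = child (dg z) r (z s) (i, z i)"
proof -
  note c = I_D(1,2)[OF i] rs desc
  have ne: "r \<noteq> i" "z s \<noteq> z i" using c by auto
  have "(x, z j) \<in> dg (next_perm i) \<longleftrightarrow> (x, z j) \<in> child (dg z) r (z s) (i, z i)" for x j
    unfolding child_def prod.case mem_Rm[OF ne(1)] mem_Cm[OF ne(2)] mem_dg[OF z] zeq mem_dg_next[OF i]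
    using position[OF i, of x] position[OF i, of j] c zeq[of x j] by smt
  then have "(x, c) \<in> dg (next_perm i) \<longleftrightarrow> (x, c) \<in> child (dg z) r (z s) (i, z i)" for x c
    using permutation_f_inv[OF z, of c] by metis
  then show ?thesis by (intro set_eqI) auto
qed

text \<open>If there is only one child, \<open>max_in_I\<close> forbids values that would produce
  another one, and the moves become plain exchanges of rows and columns. Such a step does not
  branch.\<close>

lemma dg_next_single:
  assumes I: "I = {i}"
  shows "(x, c) \<in> dg (next_perm i) \<longleftrightarrow> (tr r i x, Transposition.transpose (z s) (z i) c) \<in> dg z"
proof -
  have i: "i \<in> I" by (simp add: I)
  note c = I_D(1,2)[OF i] rs desc
  have lo: "z k < z i \<or> z s < z k" if ki: "k < i" for k
  proof (rule ccontr)
    assume "\<not> (z k < z i \<or> z s < z k)"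
    then have k: "z i < z k" "z k < z s" using ki zeq[of i k] zeq[of k s] c by linarith+
    obtain i' where "i' \<in> I" "z i < z i'" "k \<le> i'"
      by (rule max_in_I[of k "\<lambda>j. z i < z j"]) (use ki c k in auto)
    then show False using I by simp
  qed
  have mid: "z s < z k" if ki: "i < k" "k < r" for k
  proof (rule ccontr)
    assume "\<not> z s < z k"
    then have k: "z k < z s" using ki zeq[of k s] c by linarith
    obtain i' where "i' \<in> I" "k \<le> i'"
      by (rule max_in_I[of k "\<lambda>_. True"]) (use ki k in auto)
    then show False using I ki by simp
  qed
  have "x < i \<and> z x < z i \<or> x < i \<and> z s < z x \<or> x = i \<or> (i < x \<and> x < r \<and> z s < z x) \<or> x = r
    \<or> (r < x \<and> x < s \<and> z x < z s) \<or> x = s \<or> (s < x \<and> z r < z x)" for x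
  proof -
    consider "x < i" | "x = i" | "i < x" "x < r" | "x = r" | "r < x" "x < s" | "x = s" | "s < x"
      by linarith
    then show ?thesis by cases (use lo[of x] mid[of x] in \<open>auto simp: inc gt\<close>)
  qed
  note pos = this
  define j where "j = inv z c"
  have cj: "c = z j" using permutation_f_inv[OF z] by (simp add: j_def)
  have "Transposition.transpose (z s) (z i) c = z (tr s i j)"
    unfolding cj transpose_def by (simp add: zeq)
  moreover have "(x, z j) \<in> dg (next_perm i) \<longleftrightarrow> tr r i x < tr s i j \<and> z (tr s i j) < z (tr r i x)"
  proof -
    have e: "z (tr s i j) = (if j = s then z i else if j = i then z s else z j)"
      "z (tr r i x) = (if x = r then z i else if x = i then z r else z x)"
      "tr s i j = (if j = s then i else if j = i then s else j)"
      "tr r i x = (if x = r then i else if x = i then r else x)"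
      by (simp_all add: transpose_def)
    show ?thesis
      unfolding mem_dg_next[OF i] e using pos[of x] pos[of j] c zeq[of x j] by smt
  qed
  ultimately show ?thesis unfolding cj by (simp add: mem_dg[OF z])
qed

definition branches :: "(int \<times> int) list" where
  "branches = map (\<lambda>i. (i, z i)) (sorted_list_of_set I)"

text \<open>Among the positions in \<open>I\<close> the values decrease from left to right, since a
  larger value further right, still below \<open>z s\<close>, would block the cover. This gives the
  boxes that triangularity asks for.\<close>

lemma node_branches: "node (dg z) r (z s) branches"
proof -
  have "sorted_wrt (\<lambda>i j. (i, z j) \<in> dg z) (sorted_list_of_set I)"
  proof (rule sorted_wrt_mono_rel[OF _ strict_sorted_list_of_set])
    fix i j assume "i \<in> set (sorted_list_of_set I)" "j \<in> set (sorted_list_of_set I)" "i < j"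
    then have "i \<in> I" "j \<in> I" "i < j" using finite_I by auto
    then show "(i, z j) \<in> dg z" using I_D(3)[of i j] I_D(1,2)[of j] by (auto simp: mem_dg[OF z])
  qed
  moreover have "(r, z s) \<in> dg z" using rs desc by (simp add: mem_dg[OF z])
  moreover have "i \<noteq> r \<and> z i \<noteq> z s \<and> (i, z s) \<notin> dg z \<and> (r, z i) \<notin> dg z \<and> (i, z i) \<notin> dg z" if "i \<in> I" for i
    using I_D(1,2)[OF that] by (auto simp: mem_dg[OF z])
  ultimately show ?thesis using finite_I by (auto simp: node_def branches_def sorted_wrt_map)
qed

lemma sum_branches:
  fixes f :: "(int \<times> int) set \<Rightarrow> 'a::comm_monoid_add"
  shows "(\<Sum>b\<leftarrow>branches. f (child (dg z) r (z s) b)) = (\<Sum>i\<in>I. f (dg (next_perm i)))"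
proof -
  have "(\<Sum>b\<leftarrow>branches. f (child (dg z) r (z s) b)) = (\<Sum>i\<leftarrow>sorted_list_of_set I. f (dg (next_perm i)))"
    unfolding branches_def map_map comp_def
    by (intro arg_cong[of _ _ sum_list] map_cong refl) (use dg_next finite_I in auto)
  then show ?thesis using finite_I by (simp add: sum_list_distinct_conv_sum_set)
qed

lemma v_tr: "v \<circ> tr r s = z"
  by (auto simp: v_def o_assoc[symmetric])

lemma EGi_step: "EGi z = (\<Sum>i\<in>I. EGi (next_perm i))"
  using transition_EGi[OF perm_v, of r] unfolding rcov_v I_def next_perm_def by (simp add: v_tr)

text \<open>The dimensions add up because they count reduced words and
  \<open>transition_words\<close> applies; \<open>node_len_eq\<close> turns this into additivity of
  composition length.\<close>

lemma len_step: "len (PG (card (dg z))) (Mod (dg z)) =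
    (\<Sum>i\<in>I. len (PG (card (dg (next_perm i)))) (Mod (dg (next_perm i))))"
proof -
  have s: "(\<Sum>b\<leftarrow>branches. len {} (Mod (child (dg z) r (z s) b))) = len {} (Mod (dg z))"
    unfolding sum_branches[of "\<lambda>D. len {} (Mod D)"] len_Mod_dg[OF permutation_next] len_Mod_dg[OF z]
    using transition_words[OF perm_v, of r] finite_I
    unfolding rcov_v I_def[symmetric] next_perm_def[symmetric] by (simp add: v_tr enat_sum)
  have "len (PG (card (dg z))) (Mod (dg z)) =
      (\<Sum>b\<leftarrow>branches. len (PG (card (dg z))) (Mod (child (dg z) r (z s) b)))"
    by (rule node_len_eq[OF finite_dg[OF z] node_branches]) (simp_all add: s len_Mod_dg[OF z])
  also have "\<dots> = (\<Sum>i\<in>I. len (PG (card (dg z))) (Mod (dg (next_perm i))))"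
    by (rule sum_branches[of "\<lambda>D. len (PG (card (dg z))) (Mod D)"])
  also have "\<dots> = (\<Sum>i\<in>I. len (PG (card (dg (next_perm i)))) (Mod (dg (next_perm i))))"
    by (rule sum.cong) (simp_all add: dg_next card_child)
  finally show ?thesis .
qed

text \<open>A branching needs at least two children. With a single child, its tree is renamed along
  the exchange of rows and columns instead.\<close>

lemma jtree_step:
  assumes T: "\<And>i. i \<in> I \<Longrightarrow> jtree UNIV UNIV (dg (next_perm i)) (f i)"
  shows "jtree UNIV UNIV (dg z) (\<Sum>i\<in>I. f i)"
proof (cases "card I = 1")
  case True
  then obtain i where i: "I = {i}" by (rule card_1_singletonE)
  have "jtree UNIV UNIV (dg z) (f i)"
    by (rule jtree_transfer(1)[OF T, of i "tr r i" "Transposition.transpose (z s) (z i)" UNIV UNIV])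
      (use i dg_next_single[OF i] in simp_all)
  then show ?thesis by (simp add: i)
next
  case False
  have "card I \<noteq> 0" using I_nonempty finite_I by simp
  then have L: "2 \<le> length branches" using False by (simp add: branches_def)
  have F: "jforest UNIV UNIV (dg z) r (z s) (map (\<lambda>i. (i, z i)) js) (\<Sum>i\<leftarrow>js. f i)"
    if "set js \<subseteq> I" "sorted_wrt (\<lambda>i j. (i, z j) \<in> dg z) js" for js
    using that
  proof (induction js)
    case Nil
    then show ?case by (simp add: fnil)
  next
    case (Cons i js)
    then have i: "i \<in> I" by simp
    have "jtree UNIV UNIV (Rm r i (Cm (z s) (z i) (dg z))) (f i)"
      using T[OF i] unfolding dg_next[OF i] child_def by simp
    from fcons[OF this Cons.IH] show ?case
      using Cons.prems I_D(1,2)[OF i] by (auto simp: mem_dg[OF z])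
  qed
  have "sorted_wrt (\<lambda>i j. (i, z j) \<in> dg z) (sorted_list_of_set I)"
    using node_branches by (simp add: node_def branches_def sorted_wrt_map)
  then have "jforest UNIV UNIV (dg z) r (z s) branches (\<Sum>i\<in>I. f i)"
    using F[of "sorted_list_of_set I"] finite_I
    by (simp add: branches_def sum_list_distinct_conv_sum_set)
  then show ?thesis by (rule branch[OF _ L]) (use rs desc in \<open>auto simp: mem_dg[OF z]\<close>)
qed

end

text \<open>An upper bound on the length together with a tree that attains it. By
  \<open>jtree_len\<close> both are equalities, and \<open>EGi z\<close> bounds the leaves of every
  tree in the diagram.\<close>

definition good :: "(int \<Rightarrow> int) \<Rightarrow> bool" where
  "good z \<longleftrightarrow> len (PG (card (dg z))) (Mod (dg z)) \<le> enat (EGi z) \<and> jtree UNIV UNIV (dg z) (EGi z)"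

lemma good_grass:
  assumes "permutation z" "grass d z"
  shows "good z"
  using len_chain_le[OF finite_dg[OF assms(1)] colchain_grass[OF assms]] EGi_grass[OF assms]
  by (simp add: good_def one_enat_def leaf)

lemma (in ls_step) good_step:
  assumes "\<And>i. i \<in> I \<Longrightarrow> good (next_perm i)"
  shows "good z"
  unfolding good_def
proof
  have "(\<Sum>i\<in>I. len (PG (card (dg (next_perm i)))) (Mod (dg (next_perm i)))) \<le> (\<Sum>i\<in>I. enat (EGi (next_perm i)))"
    by (rule sum_mono) (use assms in \<open>auto simp: good_def\<close>)
  then show "len (PG (card (dg z))) (Mod (dg z)) \<le> enat (EGi z)"
    unfolding len_step EGi_step enat_sum[OF finite_I] .
  show "jtree UNIV UNIV (dg z) (EGi z)"
    unfolding EGi_step by (rule jtree_step) (use assms in \<open>auto simp: good_def\<close>)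
qed

text \<open>
  The descents of \<open>z\<close> lie between \<open>d\<close> and \<open>d + n\<close>. A step removes the last descent \<open>r = d + n\<close> or
  decreases the last position \<open>r + m\<close> whose value is below \<open>z r\<close>.
\<close>

lemma good_aux:
  assumes "permutation z" "\<And>x y. x < y \<Longrightarrow> y \<le> d \<Longrightarrow> z x < z y" "\<And>x y. d + int n < x \<Longrightarrow> x < y \<Longrightarrow> z x < z y"
  shows "good z"
  using assms
proof (induction n arbitrary: z)
  case 0
  show ?case by (rule good_grass[OF 0(1), of d]) (use 0(2,3) in \<open>auto simp: grass_def\<close>)
next
  case (Suc n)
  define r where "r = d + int (Suc n)"
  \<comment> \<open>The inner induction lowers the distance \<open>m\<close> of the last value below
    \<open>z r\<close> until \<open>r\<close> is no descent any more; then the outer hypothesis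
    applies.\<close>
  have A: "good z" if z: "permutation z" "\<And>x y. x < y \<Longrightarrow> y \<le> d \<Longrightarrow> z x < z y"
     "\<And>x y. r < x \<Longrightarrow> x < y \<Longrightarrow> z x < z y" "\<And>x. r + int m < x \<Longrightarrow> z r < z x" for z m
    using that
  proof (induction m arbitrary: z)
    case 0
    have "z x < z y" if "d + int n < x" "x < y" for x y
      using 0(3)[of x y] 0(4)[of y] that by (cases "x = r") (auto simp: r_def)
    note inc = this
    show ?case by (rule Suc.IH) (rule 0(1,2) inc | assumption)+
  next
    case (Suc m)
    note p = Suc.prems
    define s where "s = r + int (Suc m)"
    show ?case
    proof (cases "z r < z s")
      case True
      have "z r < z x" if "r + int m < x" for x
        using p(4)[of x] that True by (cases "x = s") (auto simp: s_def)
      note gt = this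
      show ?thesis by (rule Suc.IH) (rule p(1-3) gt | assumption)+
    next
      case False
      \<comment> \<open>Now \<open>s\<close> is the last position with value below
        \<open>z r\<close>, so the transition at \<open>r\<close> and \<open>s\<close> is available.
        In a child the value at \<open>r\<close> is \<open>z i\<close>, below \<open>z s\<close>,
        and every value from \<open>s\<close> on exceeds it.\<close>
      then have "z s < z r" using permutation_inj_eq[OF p(1), of r s] by (auto simp: s_def)
      then interpret ls_step z r s
        by unfold_locales (use p in \<open>auto simp: s_def\<close>)
      show ?thesis
      proof (rule good_step)
        fix i assume i: "i \<in> I"
        note n = next_simps[OF i] and c = I_D(1,2)[OF i] rs desc
        show "good (next_perm i)"
        proof (rule Suc.IH[OF permutation_next])
          show "next_perm i x < next_perm i y" if xy: "x < y" "y \<le> d" for x y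
          proof -
            have "x < r" "y < r" "x \<noteq> s" "y \<noteq> s" using xy rs by (auto simp: r_def)
            then show ?thesis
              using p(2)[OF xy] c I_D(3)[OF i, of y] n(1) n(4)[of x] n(4)[of y] xy
              by (cases "x = i"; cases "y = i") force+
          qed
          show "next_perm i x < next_perm i y" if xy: "r < x" "x < y" for x y
          proof -
            have "x \<noteq> i" "y \<noteq> i" "x \<noteq> r" "y \<noteq> r" using xy c by auto
            then show ?thesis
              using p(3)[OF xy] p(3)[of x s] c gt[of y] n(3) n(4)[of x] n(4)[of y] xy
              by (cases "x = s"; cases "y = s") force+
          qed
          show "next_perm i r < next_perm i x" if x: "r + int m < x" for x
          proof -
            have "x = s \<or> s < x" using x by (auto simp: s_def)
            then show ?thesis using c gt[of x] n(2,3) n(4)[of x] by auto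
          qed
        qed
      qed
    qed
  qed
  obtain b where b0: "0 < b" and b: "\<And>x. b \<le> x \<Longrightarrow> z x = x" "\<And>x. x \<le> - b \<Longrightarrow> z x = x"
    by (rule permutation_bound[OF Suc.prems(1)]) (rule that)
  \<comment> \<open>Beyond \<open>r + int m\<close> all positions are fixed and their values exceed
    \<open>z r\<close>, so the inner induction can start.\<close>
  define m where "m = nat (max b (z r + 1) - r)"
  have "max b (z r + 1) \<le> r + int m" unfolding m_def by linarith
  then have "z r < z x" if "r + int m < x" for x using b(1)[of x] that by simp
  then show ?case using A[OF Suc.prems(1,2)] Suc.prems(3) unfolding r_def by blast
qed

theorem good: "permutation z \<Longrightarrow> good z"
proof -
  assume z: "permutation z"
  obtain m where m0: "0 < m" and m: "\<And>x. m \<le> x \<Longrightarrow> z x = x" "\<And>x. x \<le> - m \<Longrightarrow> z x = x"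
    by (rule permutation_bound[OF z]) (rule that)
  show ?thesis
    by (rule good_aux[OF z, of "- m" "nat (2 * m)"]) (use m m0 in auto)
qed

lemma jtree_le_EGi:
  assumes "permutation z" "jtree X Y (dg z) n"
  shows "n \<le> EGi z"
proof -
  have "enat n \<le> enat (EGi z)"
    using jtree_len(1)[OF assms(2) finite_dg[OF assms(1)]] good[OF assms(1)]
    unfolding good_def by (meson order.trans)
  then show ?thesis by simp
qed

section \<open>Permutations and tableaux of natural numbers\<close>

text \<open>The identity on negative integers supplies the room to the left that transitions
  need.\<close>

definition ext :: "(nat \<Rightarrow> nat) \<Rightarrow> int \<Rightarrow> int" where
  "ext w x = (if 0 \<le> x then int (w (nat x)) else x)"

lemma ext_id: "ext id = id"
  by (auto simp: ext_def)

lemma ext_comp: "ext (f \<circ> g) = ext f \<circ> ext g"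
  by (auto simp: ext_def)

lemma ext_simple_refl: "ext (simple_refl a) = sr (int a)"
proof
  fix x show "ext (simple_refl a) x = sr (int a) x"
    by (cases x rule: int_cases) (auto simp: ext_def simple_refl_def sr_def transpose_def)
qed

lemma ext_inject: "ext f = ext g \<longleftrightarrow> f = g"
proof
  assume "ext f = ext g"
  then have "ext f (int x) = ext g (int x)" for x by simp
  then show "f = g" by (auto simp: ext_def)
qed simp

lemma S_D:
  assumes "w \<in> S n"
  shows "w permutes {1..n}" "w 0 = 0" "n < x \<Longrightarrow> w x = x"
  using assms by (auto simp: S_def permutes_def)

lemma ext_fixed:
  assumes "w \<in> S n" "x \<le> 0 \<or> int n < x"
  shows "ext w x = x"
proof -
  have "w (nat x) = nat x" if "int n < x" using S_D(3)[OF assms(1), of "nat x"] that by simp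
  then show ?thesis using assms(2) S_D(2)[OF assms(1)] by (auto simp: ext_def)
qed

lemma ext_range:
  assumes "w \<in> S n" "0 < x" "x \<le> int n"
  shows "0 < ext w x" "ext w x \<le> int n"
proof -
  have "nat x \<in> {1..n}" using assms by auto
  then have "w (nat x) \<in> {1..n}" using permutes_in_image[OF S_D(1)[OF assms(1)]] by blast
  then show "0 < ext w x" "ext w x \<le> int n" using assms(2) by (auto simp: ext_def)
qed

lemma permutation_ext:
  assumes "w \<in> S n"
  shows "permutation (ext w)"
proof -
  note p = S_D(1)[OF assms]
  have "ext w \<circ> ext (inv w) = id" "ext (inv w) \<circ> ext w = id"
    unfolding ext_comp[symmetric] using permutes_inv_o[OF p] ext_id by simp_all
  then have "bij (ext w)" by (rule o_bij[rotated])
  moreover have "{x. ext w x \<noteq> x} \<subseteq> {0..int n}"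
  proof
    fix x assume "x \<in> {x. ext w x \<noteq> x}"
    then have "\<not> (x \<le> 0 \<or> int n < x)" using ext_fixed[OF assms, of x] by blast
    then show "x \<in> {0..int n}" by simp
  qed
  then have "finite {x. ext w x \<noteq> x}" by (rule finite_subset) simp
  ultimately show ?thesis unfolding permutation by blast
qed

lemma permutation_inv: "permutation f \<Longrightarrow> permutation (inv f)"
  by (rule permutation_inverse)

lemma inv_inv_perm: "permutation f \<Longrightarrow> inv (inv f) = f"
  by (simp add: inv_inv_eq permutation_bijective)

text \<open>\<open>word_prod\<close> lets the last letter act first and \<open>wprod\<close> the
  first one, so the same word yields mutually inverse permutations. This is the origin of every
  \<open>inv\<close> below.\<close>

lemma wprod_int: "wprod (map int as) = inv (ext (word_prod as))"
proof -
  have "wprod (map int as) \<circ> ext (word_prod as) = id \<and> ext (word_prod as) \<circ> wprod (map int as) = id"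
  proof (induction as)
    case (Cons a as)
    let ?e = "ext (word_prod as)" and ?w = "wprod (map int as)"
    have "wprod (map int (a # as)) \<circ> ext (word_prod (a # as)) = ?w \<circ> (sr (int a) \<circ> sr (int a)) \<circ> ?e"
      "ext (word_prod (a # as)) \<circ> wprod (map int (a # as)) = sr (int a) \<circ> (?e \<circ> ?w) \<circ> sr (int a)"
      by (simp_all add: ext_comp ext_simple_refl o_assoc del: sr_sr_comp)
    note e = this
    show ?case unfolding e using Cons.IH by (simp del: comp_apply id_apply)
  qed (simp only: word_prod.simps wprod.simps list.map ext_id id_comp simp_thms)
  then show ?thesis by (metis inv_unique_comp)
qed

lemma word_prod_iff:
  assumes "w \<in> S n"
  shows "word_prod as = w \<longleftrightarrow> wprod (map int as) = inv (ext w)"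
proof
  assume "wprod (map int as) = inv (ext w)"
  then have e: "inv (wprod (map int as)) = ext w" using inv_inv_perm[OF permutation_ext[OF assms]] by simp
  have "bij (ext (word_prod as))"
  proof (induction as)
    case (Cons a as)
    then show ?case
      unfolding word_prod.simps ext_comp ext_simple_refl
      by (rule bij_comp[OF _ permutation_bijective[OF permutation_sr]])
  qed (simp only: word_prod.simps ext_id bij_id)
  then have "inv (wprod (map int as)) = ext (word_prod as)" unfolding wprod_int by (rule inv_inv_eq)
  then show "word_prod as = w" using e by (simp add: ext_inject)
qed (simp add: wprod_int)

text \<open>The tree consisting of one leaf shows that \<open>EGi\<close> is positive, so there is a
  tableau and with it a reduced word.\<close>

lemma red_exists: "permutation z \<Longrightarrow> \<exists>c. red c z"
proof -
  assume z: "permutation z"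
  have "jtree UNIV UNIV (dg z) (Suc 0)" by (rule leaf)
  then have "0 < EGi z" using jtree_le_EGi[OF z, of UNIV UNIV "Suc 0"] by simp
  then have "{Ks. tab Ks \<and> red (cw Ks) z} \<noteq> {}" unfolding EGi_def by (metis card.empty less_irrefl)
  then show ?thesis by blast
qed

text \<open>The minimum in \<open>Red\<close> equals the number of inversions because a word of that
  length exists. Its letters are positive since all positions up to 0 are fixed.\<close>

lemma Red_iff:
  assumes w: "w \<in> S n"
  shows "as \<in> Red w \<longleftrightarrow> red (map int as) (inv (ext w))"
proof -
  let ?z = "inv (ext w)"
  have z: "permutation ?z" by (rule permutation_inv[OF permutation_ext[OF w]])
  have fixed: "?z x = x" if "x \<le> 0 \<or> int n < x" for x
    using permutation_inv_f[OF permutation_ext[OF w], of x] ext_fixed[OF w that] by simp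
  have letters: "set c \<subseteq> {0<..<int n + 1}" if "red c ?z" for c
    by (rule red_letters[OF z that]) (use fixed in auto)
  have words: "as \<in> words w" if "red (map int as) ?z" for as
    using letters[OF that] red_imp[OF z that] word_prod_iff[OF w] by (force simp: words_def)
  have long: "card (dg ?z) \<le> length bs" if "bs \<in> words w" for bs
    using card_dg_wprod[of "map int bs"] that word_prod_iff[OF w, of bs] by (auto simp: words_def)
  show ?thesis
  proof
    assume as: "as \<in> Red w"
    obtain c where c: "red c ?z" using red_exists[OF z] by blast
    have "map int (map nat c) = c" unfolding map_map by (rule map_idI) (use letters[OF c] in force)
    then have "length as \<le> length c" using as words[of "map nat c"] c by (fastforce simp: Red_def)
    then have "length as = card (dg ?z)" using red_imp[OF z c] long[of as] as by (simp add: Red_def)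
    then show "red (map int as) ?z"
      unfolding red_iff[OF z] using as word_prod_iff[OF w, of as] by (simp add: Red_def words_def)
  next
    assume r: "red (map int as) ?z"
    have "length as = card (dg ?z)" using red_imp[OF z r] by simp
    then show "as \<in> Red w" using words[OF r] long by (simp add: Red_def)
  qed
qed

section \<open>Tableaux by rows and by columns\<close>

definition shape :: "'a list list \<Rightarrow> bool" where
  "shape X \<longleftrightarrow> (\<forall>r\<in>set X. r \<noteq> []) \<and> (\<forall>i. Suc i < length X \<longrightarrow> length (X ! Suc i) \<le> length (X ! i))"

lemma shape_sorted: "shape X \<Longrightarrow> sorted (rev (map length X))"
proof -
  assume "shape X"
  then have "successively (\<ge>) (map length X)" by (auto simp: shape_def successively_conv_nth)
  then have "sorted_wrt (\<ge>) (map length X)"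
    by (subst (asm) successively_iff_sorted_wrt_strong) auto
  then show ?thesis by (simp add: sorted_wrt_rev)
qed

text \<open>Weakly decreasing row lengths and nonempty rows make transposition an involution that
  exchanges the two indices of a cell.\<close>

lemma shape_transpose:
  assumes "shape X"
  shows "shape (List.transpose X)" "List.transpose (List.transpose X) = X"
    "j < length (List.transpose X) \<and> i < length (List.transpose X ! j) \<longleftrightarrow> i < length X \<and> j < length (X ! i)"
    "i < length X \<Longrightarrow> j < length (X ! i) \<Longrightarrow> List.transpose X ! j ! i = X ! i ! j"
proof -
  let ?Y = "List.transpose X"
  note s = shape_sorted[OF assms]
  have ne: "\<forall>r\<in>set X. r \<noteq> []" using assms by (simp add: shape_def)
  have mono: "length (X ! i') \<le> length (X ! i)" if "i \<le> i'" "i' < length X" for i i'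
    using sorted_rev_nth_mono[OF s, of i i'] that by simp
  show TT: "List.transpose ?Y = X"
    using transpose_transpose[OF s] ne by (simp add: takeWhile_eq_all_conv)
  show iff: "j < length ?Y \<and> i < length (?Y ! j) \<longleftrightarrow> i < length X \<and> j < length (X ! i)" for i j
  proof -
    have J: "j < length ?Y" if "i < length X" "j < length (X ! i)"
      using length_transpose_sorted[OF s] mono[of 0 i] that by (cases X) auto
    have "filter (\<lambda>ys. j < length ys) X = takeWhile (\<lambda>ys. j < length ys) X"
      by (rule filter_equals_takeWhile_sorted_rev[OF s])
    moreover have "i < length (takeWhile (\<lambda>ys. j < length ys) X) \<longleftrightarrow> i < length X \<and> j < length (X ! i)"
    proof
      assume l: "i < length (takeWhile (\<lambda>ys. j < length ys) X)"
      then have "takeWhile (\<lambda>ys. j < length ys) X ! i \<in> set (takeWhile (\<lambda>ys. j < length ys) X)" by (rule nth_mem)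
      then show "i < length X \<and> j < length (X ! i)"
        using l set_takeWhileD[of _ "\<lambda>ys. j < length ys" X] length_takeWhile_le[of "\<lambda>ys. j < length ys" X]
        by (auto simp: takeWhile_nth)
    next
      assume l: "i < length X \<and> j < length (X ! i)"
      show "i < length (takeWhile (\<lambda>ys. j < length ys) X)"
      proof (rule ccontr)
        assume "\<not> ?thesis"
        then have le: "length (takeWhile (\<lambda>ys. j < length ys) X) \<le> i" by simp
        then have "length (takeWhile (\<lambda>ys. j < length ys) X) < length X" using l by simp
        from nth_length_takeWhile[OF this] show False using mono[OF le] l by simp
      qed
    qed
    ultimately show ?thesis using J by (auto simp: nth_transpose)
  qed
  show "?Y ! j ! i = X ! i ! j" if "i < length X" "j < length (X ! i)" for i j
  proof -
    have ij: "j < length ?Y" "i < length (?Y ! j)" using iff that by blast+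
    show ?thesis by (rule nth_nth_transpose_sorted[OF s ij(1)]) (use ij in \<open>simp add: nth_transpose\<close>)
  qed
  show "shape ?Y"
    unfolding shape_def
  proof (intro conjI ballI allI impI)
    fix r assume "r \<in> set ?Y"
    then obtain j where j: "j < length ?Y" "r = ?Y ! j" by (auto simp: in_set_conv_nth)
    have "X \<noteq> []" using j(1) by auto
    then have "j < length (X ! 0)" using j(1) length_transpose_sorted[OF s] by simp
    then have "0 < length (?Y ! j)" using iff[of j 0] \<open>X \<noteq> []\<close> by simp
    then show "r \<noteq> []" using j by simp
  next
    fix j assume j: "Suc j < length ?Y"
    show "length (?Y ! Suc j) \<le> length (?Y ! j)"
    proof (rule ccontr)
      assume "\<not> ?thesis"
      then have l: "length (?Y ! j) < length (?Y ! Suc j)" by simp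
      then have "length (?Y ! j) < length X \<and> Suc j < length (X ! length (?Y ! j))" using iff j by blast
      then have "length (?Y ! j) < length (?Y ! j)" using iff[of j "length (?Y ! j)"] by simp
      then show False by simp
    qed
  qed
qed

lemma sorted_wrt_Suc:
  assumes "transp P"
  shows "sorted_wrt P xs \<longleftrightarrow> (\<forall>i. Suc i < length xs \<longrightarrow> P (xs ! i) (xs ! Suc i))"
  using successively_iff_sorted_wrt_strong[of xs P] transpD[OF assms] successively_conv_nth[of P xs] by blast

lemma semistandard_iff:
  "semistandard T \<longleftrightarrow> shape T \<and> (\<forall>r\<in>set T. \<forall>a\<in>set r. 1 \<le> a) \<and>
    (\<forall>i j. Suc i < length T \<and> j < length (T ! Suc i) \<longrightarrow> T ! i ! j < T ! Suc i ! j) \<and>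
    (\<forall>i j. i < length T \<and> Suc j < length (T ! i) \<longrightarrow> T ! i ! j \<le> T ! i ! Suc j)"
proof -
  have "(\<forall>r\<in>set T. sorted r) \<longleftrightarrow> (\<forall>i j. i < length T \<and> Suc j < length (T ! i) \<longrightarrow> T ! i ! j \<le> T ! i ! Suc j)"
    unfolding all_set_conv_all_nth sorted_iff_nth_Suc by blast
  note sorted = this
  have "(\<forall>i. Suc i < length T \<longrightarrow> length (T ! Suc i) \<le> length (T ! i) \<and>
        (\<forall>j < length (T ! Suc i). T ! i ! j < T ! Suc i ! j)) \<longleftrightarrow>
      (\<forall>i. Suc i < length T \<longrightarrow> length (T ! Suc i) \<le> length (T ! i)) \<and>
      (\<forall>i j. Suc i < length T \<and> j < length (T ! Suc i) \<longrightarrow> T ! i ! j < T ! Suc i ! j)"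
    by blast
  then show ?thesis unfolding semistandard_def shape_def sorted[symmetric] ball_conj_distrib by (simp only: conj_ac)
qed

lemma tab_int_iff:
  "tab (map (map int) Ks) \<longleftrightarrow> shape Ks \<and>
    (\<forall>j i. j < length Ks \<and> Suc i < length (Ks ! j) \<longrightarrow> Ks ! j ! i < Ks ! j ! Suc i) \<and>
    (\<forall>j i. Suc j < length Ks \<and> i < length (Ks ! Suc j) \<longrightarrow> Ks ! j ! i \<le> Ks ! Suc j ! i)"
proof -
  have "(\<forall>K\<in>set Ks. sorted_wrt (<) (map int K)) \<longleftrightarrow>
      (\<forall>j i. j < length Ks \<and> Suc i < length (Ks ! j) \<longrightarrow> Ks ! j ! i < Ks ! j ! Suc i)"
    unfolding all_set_conv_all_nth sorted_wrt_map by (auto simp: sorted_wrt_Suc transp_def)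
  moreover have "successively rowle (map (map int) Ks) \<longleftrightarrow>
      (\<forall>i. Suc i < length Ks \<longrightarrow> length (Ks ! Suc i) \<le> length (Ks ! i)) \<and>
      (\<forall>j i. Suc j < length Ks \<and> i < length (Ks ! Suc j) \<longrightarrow> Ks ! j ! i \<le> Ks ! Suc j ! i)"
    unfolding successively_conv_nth rowle_def by auto
  ultimately show ?thesis unfolding tab_def shape_def by (auto simp: all_set_conv_all_nth)
qed

lemma semistandard_transpose:
  assumes "shape T"
  shows "semistandard T \<longleftrightarrow> tab (map (map int) (List.transpose T)) \<and> (\<forall>r\<in>set (List.transpose T). \<forall>a\<in>set r. 1 \<le> a)"
proof -
  let ?Y = "List.transpose T"
  note t = shape_transpose[OF assms]
  have cell: "i < length T \<and> j < length (T ! i) \<longleftrightarrow> j < length ?Y \<and> i < length (?Y ! j)" for i j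
    using t(3)[of j i] by blast
  have "(\<forall>r\<in>set T. \<forall>a\<in>set r. 1 \<le> a) \<longleftrightarrow> (\<forall>i j. i < length T \<and> j < length (T ! i) \<longrightarrow> 1 \<le> T ! i ! j)"
    unfolding all_set_conv_all_nth by blast
  also have "\<dots> \<longleftrightarrow> (\<forall>i j. j < length ?Y \<and> i < length (?Y ! j) \<longrightarrow> 1 \<le> ?Y ! j ! i)"
    using cell t(4) by metis
  also have "\<dots> \<longleftrightarrow> (\<forall>r\<in>set ?Y. \<forall>a\<in>set r. 1 \<le> a)" unfolding all_set_conv_all_nth by blast
  finally have 1: "(\<forall>r\<in>set T. \<forall>a\<in>set r. 1 \<le> a) \<longleftrightarrow> (\<forall>r\<in>set ?Y. \<forall>a\<in>set r. 1 \<le> a)" .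
  have up: "i < length T \<and> j < length (T ! i)" if "Suc i < length T" "j < length (T ! Suc i)" for i j
    using assms that unfolding shape_def by (meson Suc_lessD less_le_trans)
  have 2: "(\<forall>i j. Suc i < length T \<and> j < length (T ! Suc i) \<longrightarrow> T ! i ! j < T ! Suc i ! j) \<longleftrightarrow>
      (\<forall>j i. j < length ?Y \<and> Suc i < length (?Y ! j) \<longrightarrow> ?Y ! j ! i < ?Y ! j ! Suc i)"
    using cell t(4) up by metis
  have left: "j < length (T ! i)" if "Suc j < length (T ! i)" for i j using that by simp
  have 3: "(\<forall>i j. i < length T \<and> Suc j < length (T ! i) \<longrightarrow> T ! i ! j \<le> T ! i ! Suc j) \<longleftrightarrow>
      (\<forall>j i. Suc j < length ?Y \<and> i < length (?Y ! Suc j) \<longrightarrow> ?Y ! j ! i \<le> ?Y ! Suc j ! i)"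
    using cell t(4) left by metis
  show ?thesis unfolding semistandard_iff tab_int_iff 1 2 3 using t(1) assms by blast
qed

text \<open>The bijection lists the columns and embeds the entries into the integers. It is onto
  because letters of a reduced word lie between 1 and \<open>n\<close>, so converting back loses
  nothing.\<close>

lemma EG_EGi:
  assumes w: "w \<in> S n"
  shows "EG w = EGi (inv (ext w))"
proof -
  let ?z = "inv (ext w)" and ?f = "\<lambda>T. map (map int) (List.transpose T)"
  have z: "permutation ?z" by (rule permutation_inv[OF permutation_ext[OF w]])
  have cw: "map int (column_word T) = cw (?f T)" for T
    by (simp add: column_word_def cw_def map_concat rev_map comp_def)
  have "bij_betw ?f (EG_tableaux w) {Ks. tab Ks \<and> red (cw Ks) ?z}"
  proof (rule bij_betwI')
    fix T T' assume T: "T \<in> EG_tableaux w" "T' \<in> EG_tableaux w"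
    then have "shape T" "shape T'" by (auto simp: EG_tableaux_def semistandard_iff)
    then have "List.transpose (List.transpose T) = T" "List.transpose (List.transpose T') = T'"
      using shape_transpose(2) by blast+
    moreover have "?f T = ?f T' \<longleftrightarrow> List.transpose T = List.transpose T'"
      by (simp add: inj_map_eq_map[OF inj_mapI[OF inj_of_nat]])
    ultimately show "?f T = ?f T' \<longleftrightarrow> T = T'" by metis
  next
    fix T assume "T \<in> EG_tableaux w"
    then have T: "semistandard T" "column_word T \<in> Red w" by (auto simp: EG_tableaux_def)
    then have "shape T" by (simp add: semistandard_iff)
    then have "tab (?f T)" using semistandard_transpose T(1) by blast
    then show "?f T \<in> {Ks. tab Ks \<and> red (cw Ks) ?z}" using T(2) Red_iff[OF w] by (simp add: cw)
  next
    fix Ks assume "Ks \<in> {Ks. tab Ks \<and> red (cw Ks) ?z}"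
    then have K: "tab Ks" "red (cw Ks) ?z" by auto
    have "?z x = x" if "x \<le> 0 \<or> int n < x" for x
      using permutation_inv_f[OF permutation_ext[OF w], of x] ext_fixed[OF w that] by simp
    then have "set (cw Ks) \<subseteq> {0<..<int n + 1}" by (intro red_letters[OF z K(2)]) auto
    then have pos: "0 < a" if "L \<in> set Ks" "a \<in> set L" for a L using that by (force simp: cw_def)
    define Ks' where "Ks' = map (map nat) Ks"
    have "map (map int) Ks' = map id Ks"
      unfolding Ks'_def map_map
      by (intro map_cong refl, unfold comp_def map_map id_apply, intro map_idI) (use pos in force)
    then have KK: "map (map int) Ks' = Ks" by simp
    have sh: "shape Ks'" using K(1) unfolding KK[symmetric] tab_int_iff by blast
    note t = shape_transpose(1,2)[OF sh]
    have "\<forall>r\<in>set Ks'. \<forall>a\<in>set r. 1 \<le> a" using pos by (force simp: Ks'_def)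
    then have ss: "semistandard (List.transpose Ks')"
      using semistandard_transpose[OF t(1)] K(1) by (simp add: t(2) KK)
    moreover have f: "?f (List.transpose Ks') = Ks" by (simp add: t(2) KK)
    moreover have "column_word (List.transpose Ks') \<in> Red w"
      unfolding Red_iff[OF w] cw f by (rule K(2))
    ultimately show "\<exists>T\<in>EG_tableaux w. Ks = ?f T" by (intro bexI[of _ "List.transpose Ks'"]) (auto simp: EG_tableaux_def)
  qed
  then show ?thesis unfolding EG_def EGi_def by (rule bij_betw_same_card)
qed

section \<open>Patterns\<close>

text \<open>In this diagram rows are values of \<open>f\<close> and columns are positions, which is
  how rows and columns turn into a set of positions.\<close>

lemma mem_dg_inv:
  assumes "permutation f"
  shows "(x, c) \<in> dg (inv f) \<longleftrightarrow> c < inv f x \<and> x < f c"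
  by (auto simp: dg_def inv_inv_perm[OF assms])

text \<open>On the positions in \<open>A\<close> both permutations have the same relative order, so
  the boxes in the selected rows and columns correspond, a row being tracked through the position of
  its value.\<close>

lemma jtree_pattern:
  assumes f: "permutation f" and g: "permutation g"
    and T: "jtree X Y (dg (inv f)) n" and A: "Y \<subseteq> A" "inv f ` X \<subseteq> A"
    and mono: "strict_mono_on A \<beta>"
    and ord: "\<And>p q. p \<in> A \<Longrightarrow> q \<in> A \<Longrightarrow> f p < f q \<longleftrightarrow> g (\<beta> p) < g (\<beta> q)"
  shows "n \<le> EGi (inv g)"
proof -
  let ?\<alpha> = "\<lambda>x. g (\<beta> (inv f x))"
  have inj: "inj_on \<beta> A" by (rule strict_mono_on_imp_inj_on[OF mono])
  have "jtree UNIV UNIV (dg (inv g)) n"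
  proof (rule jtree_transfer(1)[OF T, of ?\<alpha> \<beta>])
    show "inj_on \<beta> Y" by (rule inj_on_subset[OF inj A(1)])
    show "inj_on ?\<alpha> X"
    proof (rule inj_onI)
      fix x y assume xy: "x \<in> X" "y \<in> X" "?\<alpha> x = ?\<alpha> y"
      then have "inv f x = inv f y"
        using permutation_inj_eq[OF g] inj_onD[OF inj, of "inv f x" "inv f y"] A(2) by auto
      then show "x = y" using permutation_inj_eq[OF permutation_inv[OF f]] by simp
    qed
    fix x c assume xc: "x \<in> X" "c \<in> Y"
    then have a: "inv f x \<in> A" "c \<in> A" using A by auto
    have "c < inv f x \<longleftrightarrow> \<beta> c < \<beta> (inv f x)" by (rule strict_mono_on_less[OF mono a(2,1), symmetric])
    moreover have "x < f c \<longleftrightarrow> ?\<alpha> x < g (\<beta> c)" using ord[OF a] permutation_f_inv[OF f, of x] by simp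
    ultimately show "(x, c) \<in> dg (inv f) \<longleftrightarrow> (?\<alpha> x, \<beta> c) \<in> dg (inv g)"
      unfolding mem_dg_inv[OF f] mem_dg_inv[OF g] by (simp add: permutation_inv_f[OF g])
  qed auto
  then show ?thesis by (rule jtree_le_EGi[OF permutation_inv[OF g]])
qed

text \<open>A tree with \<open>EG v\<close> leaves in the diagram of \<open>v\<close> is carried
  over to the diagram of \<open>w\<close>, where the leaves of any tree are bounded by
  \<open>EG w\<close>.\<close>

lemma EG_pattern_le:
  assumes w: "w \<in> S n" and c: "contains_pattern w v"
  shows "EG v \<le> EG w"
proof -
  obtain m i where v: "v \<in> S m" and i: "strict_mono_on {1..m} i" "\<forall>j\<in>{1..m}. 1 \<le> i j"
    and fl: "fl m (\<lambda>j. w (i j)) = v"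
    using c by (auto simp: contains_pattern_def)
  have "inj_on (\<lambda>j. w (i j)) {1..m}"
    using comp_inj_on[OF strict_mono_on_imp_inj_on[OF i(1)] permutes_inj_on[OF S_D(1)[OF w]]]
    by (simp add: comp_def)
  then have ord: "v a < v b \<longleftrightarrow> w (i a) < w (i b)" if "a \<in> {1..m}" "b \<in> {1..m}" for a b
    using fl that by (simp add: fl_eq_iff)
  define N where "N = int (max n (Max (insert 0 (i ` {1..m}))))"
  have N: "int n \<le> N" "\<And>a. a \<in> {1..m} \<Longrightarrow> int (i a) \<le> N" by (auto simp: N_def le_max_iff_disj)
  \<comment> \<open>The tree of \<open>v\<close> may use any integer rows and columns, so the
    occurrence is extended to all positions: nonpositive ones stay, and those beyond
    \<open>m\<close> are shifted past all of \<open>w\<close>, where both permutations are the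
    identity.\<close>
  define \<beta> where "\<beta> p = (if p \<le> 0 then p else if p \<le> int m then int (i (nat p)) else p + N)" for p
  have b1: "\<beta> p = p" if "p \<le> 0" for p using that by (simp add: \<beta>_def)
  have b2: "\<beta> p = int (i (nat p))" "nat p \<in> {1..m}" "0 < \<beta> p" "\<beta> p \<le> N" if "0 < p" "p \<le> int m" for p
  proof -
    show p: "nat p \<in> {1..m}" using that by auto
    show e: "\<beta> p = int (i (nat p))" using that by (simp add: \<beta>_def)
    show "0 < \<beta> p" "\<beta> p \<le> N" unfolding e using i(2) p N(2)[OF p] by fastforce+
  qed
  have b3: "\<beta> p = p + N" if "int m < p" for p using that by (simp add: \<beta>_def)
  have e2: "ext w (\<beta> p) = int (w (i (nat p)))" "0 < ext w (\<beta> p)" "ext w (\<beta> p) \<le> N"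
    "ext v p = int (v (nat p))" "0 < ext v p" "ext v p \<le> int m" if p: "0 < p" "p \<le> int m" for p
  proof -
    show "ext w (\<beta> p) = int (w (i (nat p)))" "ext v p = int (v (nat p))" using b2[OF p] p by (simp_all add: ext_def)
    show "0 < ext v p" "ext v p \<le> int m" by (rule ext_range[OF v p])+
    show "0 < ext w (\<beta> p)" "ext w (\<beta> p) \<le> N"
      using ext_range[OF w, of "\<beta> p"] ext_fixed[OF w, of "\<beta> p"] b2[OF p] N(1) by (cases "\<beta> p \<le> int n"; simp)+
  qed
  have e1: "ext w (\<beta> p) = p" "ext v p = p" if "p \<le> 0" for p
    using that ext_fixed[OF w] ext_fixed[OF v] b1 by simp_all
  have e3: "ext w (\<beta> p) = p + N" "ext v p = p" if "int m < p" for p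
    using that ext_fixed[OF w, of "p + N"] ext_fixed[OF v, of p] b3 N(1) by simp_all
  have N0: "0 \<le> N" by (simp add: N_def)
  have cases: "p \<le> 0 \<or> (0 < p \<and> p \<le> int m) \<or> int m < p" for p by linarith
  have "EGi (inv (ext v)) \<le> EGi (inv (ext w))"
  proof (rule jtree_pattern[OF permutation_ext[OF v] permutation_ext[OF w], of UNIV UNIV _ UNIV \<beta>])
    show "jtree UNIV UNIV (dg (inv (ext v))) (EGi (inv (ext v)))"
      using good[OF permutation_inv[OF permutation_ext[OF v]]] by (simp add: good_def)
    show "strict_mono_on UNIV \<beta>"
    proof (rule strict_mono_onI)
      fix p q :: int assume pq: "p < q"
      show "\<beta> p < \<beta> q"
      proof (cases "0 < p \<and> q \<le> int m")
        case True
        then have "nat p < nat q" "nat p \<in> {1..m}" "nat q \<in> {1..m}" using pq by auto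
        then show ?thesis using strict_mono_onD[OF i(1)] True pq b2(1)[of p] b2(1)[of q] by simp
      next
        case False
        have up: "0 < \<beta> q" if "0 < q" using that b2(3)[of q] b3[of q] N0 by (cases "q \<le> int m") auto
        have lo: "\<beta> p \<le> N" if "p \<le> int m" using that b2(4)[of p] b1[of p] N0 by (cases "p \<le> 0") auto
        consider "q \<le> 0" | "p \<le> 0" "0 < q" | "p \<le> int m" "int m < q" | "int m < p"
          using False pq by linarith
        then show ?thesis
        proof cases
          case 1 then show ?thesis using pq b1[of p] b1[of q] by simp
        next
          case 2 then show ?thesis using b1[of p] up by simp
        next
          case 3 then show ?thesis using lo b3[of q] by simp
        next
          case 4 then show ?thesis using pq b3[of p] b3[of q] by simp
        qed
      qed
    qed
    fix p q :: int
    show "ext v p < ext v q \<longleftrightarrow> ext w (\<beta> p) < ext w (\<beta> q)"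
    proof (cases "(0 < p \<and> p \<le> int m) \<and> 0 < q \<and> q \<le> int m")
      case True
      then show ?thesis using e2(1,4)[of p] e2(1,4)[of q] ord[OF b2(2) b2(2), of p q] by simp
    next
      case False
      then show ?thesis
        using cases[of p] cases[of q] e1[of p] e1[of q] e2(2,3,5,6)[of p] e2(2,3,5,6)[of q] e3[of p] e3[of q] N0
        by smt
    qed
  qed auto
  then show ?thesis using EG_EGi[OF v] EG_EGi[OF w] by simp
qed

text \<open>
  Rows and columns with nonpositive index do not meet the diagram, so they can be replaced by
  large ones.
\<close>

lemma jtree_positive:
  assumes w: "w \<in> S n" and T: "jtree X Y (dg (inv (ext w))) k" and fin: "finite X" "finite Y"
  obtains X' Y' where "jtree X' Y' (dg (inv (ext w))) k" "finite X'" "finite Y'"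
    "card X' \<le> card X" "card Y' \<le> card Y" "X' \<subseteq> {0<..}" "Y' \<subseteq> {0<..}"
proof -
  let ?D = "dg (inv (ext w))"
  note p = permutation_ext[OF w]
  define M where "M = Max (insert (int n) (X \<union> Y)) + 1"
  have M: "int n < M" "\<And>x. x \<in> X \<union> Y \<Longrightarrow> x < M"
    using fin Max_ge[of "insert (int n) (X \<union> Y)"] unfolding M_def by force+
  \<comment> \<open>A nonpositive index \<open>x\<close> becomes \<open>M - x\<close>, which is at
    least \<open>M\<close> and so lies beyond \<open>n\<close> and all given indices.\<close>
  let ?h = "\<lambda>x. if 0 < x then x else M - x"
  have h: "0 < ?h x" for x using M(1) by auto
  have inj: "inj_on ?h A" if "A \<subseteq> X \<union> Y" for A
    using M(2) that by (intro inj_onI) (force split: if_splits)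
  have pos: "x \<in> {0<..int n}" "c \<in> {0<..int n}" if "(x, c) \<in> ?D" for x c
  proof -
    define q where "q = inv (ext w) x"
    have x: "x = ext w q" using permutation_f_inv[OF p] by (simp add: q_def)
    have cq: "c < q" "ext w q < ext w c" using that x unfolding mem_dg_inv[OF p] q_def by auto
    note F = ext_fixed[OF w] and R = ext_range[OF w]
    have "0 < c" using cq F[of c] F[of q] R[of q] by (cases "q \<le> 0 \<or> int n < q"; cases "c \<le> 0") auto
    moreover have "q \<le> int n" using cq F[of q] F[of c] R[of c] \<open>0 < c\<close> by (cases "int n < c"; cases "int n < q") auto
    ultimately show "x \<in> {0<..int n}" "c \<in> {0<..int n}" using cq R[of q] x by auto
  qed
  have iff: "(x, c) \<in> ?D \<longleftrightarrow> (?h x, ?h c) \<in> ?D" for x c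
  proof (cases "0 < x \<and> 0 < c")
    case False
    then have "(?h x, ?h c) \<notin> ?D" using pos[of "?h x" "?h c"] M(1) by auto
    moreover have "(x, c) \<notin> ?D" using pos[of x c] False by auto
    ultimately show ?thesis by blast
  qed simp
  have "jtree (?h ` X) (?h ` Y) ?D k"
    by (rule jtree_transfer(1)[OF T, of ?h ?h]) (use inj iff in auto)
  note J = this
  have hsub: "?h ` A \<subseteq> {0<..}" for A by (intro image_subsetI) (simp only: greaterThan_iff h)
  show thesis by (rule that[OF J]) (simp_all only: finite_imageI fin card_image_le hsub)
qed

text \<open>A pruned tree with \<open>k + 1\<close> leaves survives in the pattern of
  \<open>w\<close> on the positions it involves, and that pattern then has at least
  \<open>k + 1\<close> tableaux.\<close>

lemma pattern_of_large_EG: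
  assumes w: "w \<in> S n" and gt: "k < EG w"
  obtains v where "v \<in> S (6 * k)" "contains_pattern w v" "k < EG v"
proof -
  let ?D = "dg (inv (ext w))" and ?m = "6 * k"
  note p = permutation_ext[OF w]
  have "jtree UNIV UNIV ?D (EG w)"
    using good[OF permutation_inv[OF p]] EG_EGi[OF w] by (simp add: good_def)
  from jtree_prune(1)[OF this, of "Suc k"] gt obtain X0 Y0 where
    0: "finite X0" "finite Y0" "card X0 + 3 \<le> 3 * Suc k" "card Y0 + 3 \<le> 3 * Suc k" "jtree X0 Y0 ?D (Suc k)"
    by auto
  obtain X Y where XY: "jtree X Y ?D (Suc k)" "finite X" "finite Y"
    "card X \<le> card X0" "card Y \<le> card Y0" "X \<subseteq> {0<..}" "Y \<subseteq> {0<..}"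
    by (rule jtree_positive[OF w 0(5,1,2)])
  \<comment> \<open>Columns are positions already; rows are values and enter through the positions
    of these values. Each kind contributes at most \<open>3 * k\<close>.\<close>
  define P0 where "P0 = nat ` (Y \<union> inv (ext w) ` X)"
  have qpos: "0 < inv (ext w) x" if "0 < x" for x
  proof (rule ccontr)
    assume "\<not> 0 < inv (ext w) x"
    then have "ext w (inv (ext w) x) = inv (ext w) x" by (intro ext_fixed[OF w]) simp
    then show False using permutation_f_inv[OF p, of x] that \<open>\<not> 0 < inv (ext w) x\<close> by simp
  qed
  have P0: "finite P0" "card P0 \<le> ?m" "P0 \<subseteq> {1..}"
  proof -
    show "finite P0" using XY by (simp add: P0_def)
    have "card P0 \<le> card (Y \<union> inv (ext w) ` X)" unfolding P0_def by (rule card_image_le) (use XY in simp)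
    also have "\<dots> \<le> card Y + card X"
      using card_Un_le[of Y "inv (ext w) ` X"] card_image_le[OF XY(2), of "inv (ext w)"] by linarith
    finally show "card P0 \<le> ?m" using XY 0 by simp
    show "P0 \<subseteq> {1..}" using XY(6,7) qpos by (force simp: P0_def)
  qed
  \<comment> \<open>Padding with small positions gives exactly \<open>6 * k\<close> of them, so that
    a single symmetric group contains all patterns needed.\<close>
  obtain P where P: "P0 \<subseteq> P" "P \<subseteq> P0 \<union> {1..?m}" "card P = ?m"
    using exists_subset_between[of P0 ?m "P0 \<union> {1..?m}"] P0 card_mono[of "P0 \<union> {1..?m}" "{1..?m}"] by auto
  have fP: "finite P" using P(2) P0(1) finite_subset by blast
  obtain h where h: "bij_betw h {..<card P} P" "strict_mono_on {..<card P} h"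
    using ex_bij_betw_strict_mono_card[OF fP] by blast
  define i where "i j = h (j - 1)" for j
  have mono: "strict_mono_on {1..?m} i"
  proof (rule strict_mono_onI)
    fix a b assume "a \<in> {1..?m}" "b \<in> {1..?m}" "a < b"
    then show "i a < i b" using strict_mono_onD[OF h(2), of "a - 1" "b - 1"] by (auto simp: i_def P(3))
  qed
  have img: "i ` {1..?m} = P"
  proof -
    have "(\<lambda>j. j - 1) ` {1..?m} = {..<?m}"
      by (auto simp: image_iff intro!: bexI[of _ "Suc _"])
    then have "i ` {1..?m} = h ` {..<?m}" unfolding i_def by (metis image_image)
    then show ?thesis using bij_betw_imp_surj_on[OF h(1)] P(3) by simp
  qed
  have inj: "inj_on i {1..?m}" by (rule strict_mono_on_imp_inj_on[OF mono])
  have injw: "inj_on (\<lambda>j. w (i j)) {1..?m}"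
    using comp_inj_on[OF inj permutes_inj_on[OF S_D(1)[OF w]]] by (simp add: comp_def)
  define v where "v = fl ?m (\<lambda>j. w (i j))"
  have v: "v \<in> S ?m" "\<And>a b. a \<in> {1..?m} \<Longrightarrow> b \<in> {1..?m} \<Longrightarrow> v a < v b \<longleftrightarrow> w (i a) < w (i b)"
    using fl_eq_iff[OF injw, of v] v_def by auto
  have "P \<subseteq> {1..}" using P(2) P0(3) by auto
  then have "\<forall>j\<in>{1..?m}. 1 \<le> i j" using img by auto
  then have c: "contains_pattern w v"
    unfolding contains_pattern_def using v(1) mono v_def by blast
  define \<beta> where "\<beta> x = int (inv_into {1..?m} i (nat x))" for x
  have \<beta>: "nat (\<beta> x) \<in> {1..?m}" "i (nat (\<beta> x)) = nat x" "0 < \<beta> x" if "x \<in> int ` P" for x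
  proof -
    have "nat x \<in> i ` {1..?m}" using that img by auto
    then show "nat (\<beta> x) \<in> {1..?m}" "i (nat (\<beta> x)) = nat x" "0 < \<beta> x"
      using inv_into_into[of "nat x" i "{1..?m}"] f_inv_into_f[of "nat x" i "{1..?m}"]
      unfolding \<beta>_def by auto
  qed
  have "Suc k \<le> EGi (inv (ext v))"
  proof (rule jtree_pattern[OF p permutation_ext[OF v(1)] XY(1), of "int ` P" \<beta>])
    show "Y \<subseteq> int ` P"
    proof
      fix y assume "y \<in> Y"
      then have "nat y \<in> P" "y = int (nat y)" using P(1) XY(7) by (auto simp: P0_def)
      then show "y \<in> int ` P" by blast
    qed
    show "inv (ext w) ` X \<subseteq> int ` P"
    proof
      fix y assume y: "y \<in> inv (ext w) ` X"
      then have "0 < y" using XY(6) qpos by auto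
      then have "nat y \<in> P" "y = int (nat y)" using P(1) y by (auto simp: P0_def)
      then show "y \<in> int ` P" by blast
    qed
    show "strict_mono_on (int ` P) \<beta>"
    proof (rule strict_mono_onI)
      fix x y assume xy: "x \<in> int ` P" "y \<in> int ` P" "x < y"
      then have "i (nat (\<beta> x)) < i (nat (\<beta> y))" using \<beta>(2)[of x] \<beta>(2)[of y] by auto
      then have "nat (\<beta> x) < nat (\<beta> y)" using strict_mono_on_less[OF mono \<beta>(1)[OF xy(1)] \<beta>(1)[OF xy(2)]] by simp
      then show "\<beta> x < \<beta> y" by simp
    qed
    fix x y assume xy: "x \<in> int ` P" "y \<in> int ` P"
    have "ext w x = int (w (i (nat (\<beta> x))))" "ext w y = int (w (i (nat (\<beta> y))))"
      using xy \<beta>(2)[of x] \<beta>(2)[of y] by (auto simp: ext_def)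
    moreover have "ext v (\<beta> x) = int (v (nat (\<beta> x)))" "ext v (\<beta> y) = int (v (nat (\<beta> y)))"
      using \<beta>(3)[of x] \<beta>(3)[of y] xy by (auto simp: ext_def)
    ultimately show "ext w x < ext w y \<longleftrightarrow> ext v (\<beta> x) < ext v (\<beta> y)"
      using v(2)[OF \<beta>(1)[OF xy(1)] \<beta>(1)[OF xy(2)]] by simp
  qed
  then show thesis using that[OF v(1) c] EG_EGi[OF v(1)] by simp
qed

theorem theorem1p3:
  fixes k :: nat
  assumes "k \<ge> 1"
  shows "\<exists>V. finite V \<and> V \<subseteq> S_infty \<and>
           (\<forall>w\<in>S_infty. k_vexillary k w \<longleftrightarrow> (\<forall>v\<in>V. avoids_pattern w v))"
proof (intro exI conjI ballI)
  \<comment> \<open>All violations of the bound within one symmetric group; no minimality is sought,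
    and finiteness is immediate.\<close>
  let ?V = "{v \<in> S (6 * k). \<not> k_vexillary k v}"
  show "finite ?V" unfolding S_def by (rule finite_subset[OF _ finite_permutations[of "{1..6 * k}"]]) auto
  show "?V \<subseteq> S_infty" by (auto simp: S_infty_def)
  fix w assume "w \<in> S_infty"
  then obtain n where w: "w \<in> S n" by (auto simp: S_infty_def)
  show "k_vexillary k w \<longleftrightarrow> (\<forall>v\<in>?V. avoids_pattern w v)"
  proof
    assume "k_vexillary k w"
    then show "\<forall>v\<in>?V. avoids_pattern w v"
      using EG_pattern_le[OF w] order.trans unfolding k_vexillary_def avoids_pattern_def by blast
  next
    assume avoid: "\<forall>v\<in>?V. avoids_pattern w v"
    show "k_vexillary k w"
    proof (rule ccontr)
      assume "\<not> k_vexillary k w"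
      then have "k < EG w" by (simp add: k_vexillary_def)
      then obtain v where "v \<in> S (6 * k)" "contains_pattern w v" "k < EG v"
        by (rule pattern_of_large_EG[OF w])
      then show False using avoid by (auto simp: k_vexillary_def avoids_pattern_def)
    qed
  qed
qed

end
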